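(* Let $N\ge2$, $M\ge0$, and let $t\in\mathcal{S}'(\mathbb{R}^N\times\mathbb{R}^M)$ be of the form $t(y,x)=s(y,x)f(x)$ with $s\in\mathcal{S}'(\mathbb{R}^N\times\mathbb{R}^M)$ and $f\in\mathcal{S}(\mathbb{R}^M)$ (for $M=0$ this means $t$ is an arbitrary element of $\mathcal{S}'(\mathbb{R}^N)$). Suppose $\tilde t(q,q')=O^{\mathrm{dist}}(|q|^{d-\varepsilon})$ with $d\in\mathbb{Z}$ and $\varepsilon\in(0,1)$. Then for an arbitrary UV regular splitting function $\Theta$ in $\mathbb{R}^N$ there exist $c_\gamma\in C(\mathbb{R}^M)$, for multi-indices $\gamma\in\mathbb{N}_0^N$ with $|\gamma|<d$, such that $$\widetilde{t_\Theta}(q,q')=O^{\mathrm{dist}}(|q|^{d-\varepsilon})+\sum_{|\gamma|<d}c_\gamma(q')\,q^\gamma,$$ where $t_\Theta(y,x):=\Theta(y)\,t(y,x)$.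
   Context: Fourier transform convention: $\tilde f(k)=\int e^{\mathrm{i}k\cdot y}f(y)\,\mathrm{d}y$ (in all variables, as tempered distributions); $q$ is the variable dual to $y\in\mathbb{R}^N$ and $q'$ dual to $x\in\mathbb{R}^M$. A function $\Theta:\mathbb{R}^N\to\mathbb{R}$ is a UV regular splitting function iff it is smooth, $0\le\Theta\le1$, $\Theta\equiv0$ in a neighborhood of the origin, and there is $\ell>0$ with $\Theta(\lambda y)=\Theta(y)$ for all $\lambda>1$, $|y|>\ell$. For $u\in\mathcal{S}'(\mathbb{R}^N\times\mathbb{R}^M)$ and $\delta\in\mathbb{R}$, $u(q,q')=O^{\mathrm{dist}}(|q|^\delta)$ means: there exist a neighborhood $\mathcal{O}$ of the origin in $\mathbb{R}^N\times\mathbb{R}^M$ and $u_\alpha\in C(\mathcal{O})$ indexed by $\alpha\in\mathbb{N}_0^N$ with finitely many nonzero, $u_\alpha\equiv0$ if $\delta+|\alpha|<0$, $|u_\alpha(q,q')|\le\mathrm{const}\,|q|^{\delta+|\alpha|}$ on $\mathcal{O}$, and $u=\sum_\alpha\partial_q^\alpha u_\alpha$ on $\mathcal{O}$ in the sense of distributions. *)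

theory Defs
  imports "HOL-Analysis.Analysis"
begin

definition dderiv :: "'a::real_normed_vector \<Rightarrow> ('a \<Rightarrow> 'b::real_normed_vector) \<Rightarrow> 'a \<Rightarrow> 'b" where
  "dderiv v f x = frechet_derivative f (at x) v"

fun dderivs :: "'a::real_normed_vector list \<Rightarrow> ('a \<Rightarrow> 'b::real_normed_vector) \<Rightarrow> 'a \<Rightarrow> 'b" where
  "dderivs [] f = f"
| "dderivs (v # vs) f = dderiv v (dderivs vs f)"

definition smooth :: "('a::real_normed_vector \<Rightarrow> 'b::real_normed_vector) \<Rightarrow> bool" where
  "smooth f \<longleftrightarrow> (\<forall>vs x. dderivs vs f differentiable (at x))"

definition schwartz :: "('a::euclidean_space \<Rightarrow> complex) \<Rightarrow> bool" where
  "schwartz f \<longleftrightarrow> smooth f \<and>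
     (\<forall>vs (k::nat). bounded (range (\<lambda>x. ((1 + norm x) ^ k) *\<^sub>R dderivs vs f x)))"

definition schw_seminorm :: "nat \<Rightarrow> nat \<Rightarrow> ('a::euclidean_space \<Rightarrow> complex) \<Rightarrow> real" where
  "schw_seminorm k m f = Sup {(1 + norm x) ^ k * norm (dderivs vs f x) | x vs.
                                 set vs \<subseteq> Basis \<and> length vs \<le> m}"

text \<open>A tempered distribution is a continuous linear functional on the Schwartz space;
  only its values on Schwartz functions are meaningful.\<close>
definition tempered :: "(('a::euclidean_space \<Rightarrow> complex) \<Rightarrow> complex) \<Rightarrow> bool" where
  "tempered T \<longleftrightarrow>
     (\<forall>f g. schwartz f \<longrightarrow> schwartz g \<longrightarrow> T (\<lambda>x. f x + g x) = T f + T g) \<and>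
     (\<forall>a f. schwartz f \<longrightarrow> T (\<lambda>x. a * f x) = a * T f) \<and>
     (\<exists>C k m. \<forall>f. schwartz f \<longrightarrow> norm (T f) \<le> C * schw_seminorm k m f)"

definition fourier :: "('a::euclidean_space \<Rightarrow> complex) \<Rightarrow> 'a \<Rightarrow> complex" where
  "fourier f = (\<lambda>k. LINT y|lborel. cis (k \<bullet> y) * f y)"

definition fourier_dist :: "(('a::euclidean_space \<Rightarrow> complex) \<Rightarrow> complex) \<Rightarrow> ('a \<Rightarrow> complex) \<Rightarrow> complex" where
  "fourier_dist T = (\<lambda>f. T (fourier f))"

definition mi_abs :: "('n::finite \<Rightarrow> nat) \<Rightarrow> nat" where
  "mi_abs \<alpha> = (\<Sum>i\<in>UNIV. \<alpha> i)"

text \<open>A list of indices in which each i occurs exactly alpha i times (order irrelevant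
  for smooth functions).\<close>
definition mi_list :: "('n::finite \<Rightarrow> nat) \<Rightarrow> 'n list" where
  "mi_list \<alpha> = (SOME xs. \<forall>i. count_list xs i = \<alpha> i)"

definition mi_mono :: "('n::finite \<Rightarrow> nat) \<Rightarrow> real^'n \<Rightarrow> real" where
  "mi_mono \<gamma> q = (\<Prod>i\<in>UNIV. (q $ i) ^ \<gamma> i)"

text \<open>|q|^e with the convention |q|^0 = 1 (Isabelle's powr has 0 powr 0 = 0).\<close>
definition pw :: "real \<Rightarrow> real \<Rightarrow> real" where
  "pw r e = (if e = 0 then 1 else r powr e)"

definition test_fun :: "'a::euclidean_space set \<Rightarrow> ('a \<Rightarrow> complex) \<Rightarrow> bool" where
  "test_fun U f \<longleftrightarrow> smooth f \<and> compact (closure {z. f z \<noteq> 0}) \<and> closure {z. f z \<noteq> 0} \<subseteq> U"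

text \<open>Generic O^dist(|q|^delta): e i is the unit vector of the i-th q-coordinate, p the
  projection onto the q-variable.\<close>
definition Odist_gen :: "('n::finite \<Rightarrow> 'a::euclidean_space) \<Rightarrow> ('a \<Rightarrow> real^'n)
     \<Rightarrow> (('a \<Rightarrow> complex) \<Rightarrow> complex) \<Rightarrow> real \<Rightarrow> bool" where
  "Odist_gen e p u \<delta> \<longleftrightarrow>
     (\<exists>U ua. open U \<and> 0 \<in> U \<and>
        finite {\<alpha>. \<exists>z\<in>U. ua \<alpha> z \<noteq> 0} \<and>
        (\<forall>\<alpha>. continuous_on U (ua \<alpha>)) \<and>
        (\<forall>\<alpha>. \<delta> + real (mi_abs \<alpha>) < 0 \<longrightarrow> (\<forall>z\<in>U. ua \<alpha> z = 0)) \<and>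
        (\<forall>\<alpha>. \<exists>C. \<forall>z\<in>U. norm (ua \<alpha> z) \<le> C * pw (norm (p z)) (\<delta> + real (mi_abs \<alpha>))) \<and>
        (\<forall>f. test_fun U f \<longrightarrow>
            u f = (\<Sum>\<alpha>\<in>{\<alpha>. \<exists>z\<in>U. ua \<alpha> z \<noteq> 0}.
                     (-1) ^ mi_abs \<alpha> * (LINT z|lborel. ua \<alpha> z * dderivs (map e (mi_list \<alpha>)) f z))))"

definition Odist :: "(((real^'n::finite) \<times> 'b::euclidean_space \<Rightarrow> complex) \<Rightarrow> complex) \<Rightarrow> real \<Rightarrow> bool" where
  "Odist u \<delta> = Odist_gen (\<lambda>i. (axis i 1, 0)) fst u \<delta>"

definition Odist0 :: "((real^'n::finite \<Rightarrow> complex) \<Rightarrow> complex) \<Rightarrow> real \<Rightarrow> bool" where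
  "Odist0 u \<delta> = Odist_gen (\<lambda>i. axis i 1) id u \<delta>"

definition uv_splitting :: "(real^'n::finite \<Rightarrow> real) \<Rightarrow> bool" where
  "uv_splitting \<Theta> \<longleftrightarrow> smooth \<Theta> \<and> (\<forall>y. 0 \<le> \<Theta> y \<and> \<Theta> y \<le> 1) \<and>
     (\<exists>e>0. \<forall>y. norm y < e \<longrightarrow> \<Theta> y = 0) \<and>
     (\<exists>l>0. \<forall>lam>1. \<forall>y. norm y > l \<longrightarrow> \<Theta> (lam *\<^sub>R y) = \<Theta> y)"

end

theory Submission
  imports Defs
begin

text \<open>The splitting function telescopes into dyadic dilates, \<open>\<Theta> y = \<Sum>j. \<rho> (2 ^ (- j) y)\<close> with
  \<open>\<rho> y = \<Theta> y - \<Theta> (y / 2)\<close> smooth and supported in an annulus. On the Fourier side multiplication by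
  the \<open>j\<close>-th dilate is convolution in \<open>q\<close> with a Schwartz kernel of width \<open>2 ^ (- j)\<close>. Near the
  origin only the local representation \<open>\<Sum>\<partial>u\<close> of the Fourier transform of \<open>t\<close> matters, up to an error
  that is rapidly decreasing in \<open>j\<close> because \<open>t = s f\<close> with \<open>f\<close> rapidly decreasing.

  Writing \<open>\<rho> y = (\<Sum>i. (y $ i) ^ L) \<sigma> y\<close> trades each piece for \<open>L\<close> additional derivatives of smooth
  functions of size \<open>2 ^ (- j L) (|q| + 2 ^ (- j)) powr b\<close>, each derivative in \<open>q\<close> costing a factor
  \<open>2 ^ j\<close>. As the total order \<open>b + L\<close> is positive and not an integer, their Taylor remainders in
  \<open>q\<close> sum to \<open>O(|q| powr (b + L))\<close>, while the Taylor polynomials sum to a polynomial in \<open>q\<close> with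
  continuous coefficients, whose degree the outer derivatives bring below \<open>d\<close>.\<close>

section \<open>Smooth functions and iterated directional derivatives\<close>

text \<open>The Fourier transform of \<open>t\<close> is a sum of derivatives near the origin and
  merely a tempered distribution elsewhere, yet the pieces need pointwise bounds. The far
  contribution is therefore first estimated as a functional, by nothing but the L1 norm of the test
  function; since it is given by a continuous density, testing against bumps turns this into a
  supremum bound. With only the L1 norm at hand, derivatives can be moved from the test function to
  the kernel of the convolution, but this kernel smooths in the \<open>q\<close>-directions alone.
  Decay in \<open>x\<close> must come from elsewhere, and this is where the factor \<open>f\<close>
  enters.

  The noninteger order \<open>A = b + L\<close> lies strictly between two consecutive degrees. Terms
  of the lower degree are summable over the scales with \<open>2 ^ j |q| > 1\<close>, remainders of
  the higher order over those with \<open>2 ^ j |q| \<le> 1\<close>, each with a geometric margin;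
  an integer order would produce a logarithm.\<close>

lemma dderiv_eq: "(f has_derivative D) (at x) \<Longrightarrow> dderiv v f x = D v"
  unfolding dderiv_def by (metis frechet_derivative_at)

lemma differentiable_dderiv:
  "f differentiable (at x) \<Longrightarrow> (f has_derivative (\<lambda>v. dderiv v f x)) (at x)"
  unfolding dderiv_def using frechet_derivative_works by auto

lemma dderivs_append: "dderivs (vs @ ws) f = dderivs vs (dderivs ws f)"
  by (induct vs) auto

lemma smooth_differentiable: "smooth f \<Longrightarrow> f differentiable (at x)"
  unfolding smooth_def by (metis dderivs.simps(1))

lemma smooth_has_derivative: "smooth f \<Longrightarrow> (f has_derivative (\<lambda>v. dderiv v f x)) (at x)"
  by (simp add: differentiable_dderiv smooth_differentiable)

lemma smooth_dderiv: "smooth f \<Longrightarrow> smooth (dderiv v f)"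
  unfolding smooth_def by (metis dderivs.simps dderivs_append)

lemma smooth_dderivs: "smooth f \<Longrightarrow> smooth (dderivs vs f)"
  unfolding smooth_def by (metis dderivs_append)

lemma smooth_continuous_on: "smooth f \<Longrightarrow> continuous_on S f"
  by (meson continuous_at_imp_continuous_on differentiable_imp_continuous_within smooth_differentiable)

lemma linear_dderiv: "smooth f \<Longrightarrow> linear (\<lambda>v. dderiv v f x)"
  using smooth_has_derivative has_derivative_linear by blast

section \<open>Coinduction up to sums, for derivatives of products\<close>

inductive sumcl :: "'i set \<Rightarrow> (('i \<Rightarrow> 'a \<Rightarrow> 'b::real_normed_vector) \<Rightarrow> bool) \<Rightarrow> ('i \<Rightarrow> 'a \<Rightarrow> 'b) \<Rightarrow> bool"
  for I B where
  base: "B f \<Longrightarrow> (\<And>i x. i \<in> I \<Longrightarrow> g i x = f i x) \<Longrightarrow> sumcl I B g"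
| add: "sumcl I B f \<Longrightarrow> sumcl I B g \<Longrightarrow> (\<And>i x. i \<in> I \<Longrightarrow> h i x = f i x + g i x) \<Longrightarrow> sumcl I B h"

lemma sumcl_cong: "sumcl I B f \<Longrightarrow> (\<And>i x. i \<in> I \<Longrightarrow> g i x = f i x) \<Longrightarrow> sumcl I B g"
  by (induct rule: sumcl.induct) (auto intro: sumcl.intros)

lemma sumcl_bases: "B f \<Longrightarrow> B g \<Longrightarrow> (\<And>i x. i \<in> I \<Longrightarrow> h i x = f i x + g i x) \<Longrightarrow> sumcl I B h"
  by (rule sumcl.add[of I B f g]) (auto intro: sumcl.base)

text \<open>The Leibniz and chain rules map a class of products to sums of such products, so plain
  coinduction fails; the sum closure is stable under \<open>dderiv\<close>. Families over an index
  set are used so that \<open>Bd\<close> can express a bound uniform in the index.\<close>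

lemma sumcl_coinduct:
  fixes F :: "'i \<Rightarrow> 'a::real_normed_vector \<Rightarrow> 'b::real_normed_vector"
  assumes B: "\<And>f. B f \<Longrightarrow> (\<forall>i\<in>I. \<forall>x. f i differentiable (at x)) \<and> Bd f \<and> (\<forall>v. sumcl I B (\<lambda>i. dderiv v (f i)))"
    and Bd_add: "\<And>f g h. Bd f \<Longrightarrow> Bd g \<Longrightarrow> (\<And>i x. i \<in> I \<Longrightarrow> h i x = f i x + g i x) \<Longrightarrow> Bd h"
    and Bd_cong: "\<And>f g. Bd f \<Longrightarrow> (\<And>i x. i \<in> I \<Longrightarrow> g i x = f i x) \<Longrightarrow> Bd g"
    and F: "sumcl I B F"
  shows "(\<forall>i\<in>I. \<forall>x. dderivs vs (F i) differentiable (at x)) \<and> Bd (\<lambda>i. dderivs vs (F i))"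
proof -
  have step: "(\<forall>i\<in>I. \<forall>x. f i differentiable (at x)) \<and> Bd f \<and> (\<forall>v. sumcl I B (\<lambda>i. dderiv v (f i)))"
    if "sumcl I B f" for f
    using that
  proof induct
    case (base f g)
    have *: "g i = f i" if "i \<in> I" for i using base(2)[OF that] by auto
    have "Bd g" using B[OF base(1)] base(2) Bd_cong by blast
    moreover have "sumcl I B (\<lambda>i. dderiv v (g i))" for v
      by (rule sumcl_cong[of I B "\<lambda>i. dderiv v (f i)"]) (use B[OF base(1)] * in auto)
    ultimately show ?case using B[OF base(1)] * by auto
  next
    case (add f g h)
    have *: "h i = (\<lambda>x. f i x + g i x)" if "i \<in> I" for i using add(5)[OF that] by auto
    have d: "\<forall>i\<in>I. \<forall>x. h i differentiable (at x)" using add * by auto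
    have s: "dderiv v (h i) x = dderiv v (f i) x + dderiv v (g i) x" if "i \<in> I" for v i x
    proof -
      have "(h i has_derivative (\<lambda>v. dderiv v (f i) x + dderiv v (g i) x)) (at x)"
        unfolding *[OF that] using add that by (intro has_derivative_add differentiable_dderiv) auto
      then show ?thesis by (rule dderiv_eq)
    qed
    have "Bd h" using Bd_add[of f g h] add by blast
    moreover have "sumcl I B (\<lambda>i. dderiv v (h i))" for v
      by (rule sumcl.add[of I B "\<lambda>i. dderiv v (f i)" "\<lambda>i. dderiv v (g i)"]) (use add s in auto)
    ultimately show ?case using d by blast
  qed
  have "sumcl I B (\<lambda>i. dderivs vs (F i))"
  proof (induct vs)
    case Nil then show ?case using F by simp
  next
    case (Cons v vs) then show ?case using step by auto
  qed
  then show ?thesis using step by blast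
qed

lemma smooth_sumcl:
  assumes "\<And>f. B f \<Longrightarrow> (\<forall>i\<in>I. \<forall>x. f i differentiable (at x)) \<and> (\<forall>v. sumcl I B (\<lambda>i. dderiv v (f i)))"
    and "B F" "i \<in> I"
  shows "smooth (F i)"
  unfolding smooth_def using sumcl_coinduct[of B I "\<lambda>_. True" F] assms by (auto intro: sumcl.base)

lemma smooth_coinduct:
  assumes "P f" "\<And>f. P f \<Longrightarrow> (\<forall>x. f differentiable (at x)) \<and> (\<forall>v. P (dderiv v f))"
  shows "smooth f"
proof -
  have "P (dderivs vs f)" for vs by (induct vs) (use assms in auto)
  then show ?thesis unfolding smooth_def using assms by auto
qed

lemma dderiv_add: "smooth f \<Longrightarrow> smooth g \<Longrightarrow> dderiv v (\<lambda>x. f x + g x) = (\<lambda>x. dderiv v f x + dderiv v g x)"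
  by (rule ext, rule dderiv_eq) (auto intro!: has_derivative_add smooth_has_derivative)

lemma smooth_add:
  fixes f g :: "'a::real_normed_vector \<Rightarrow> 'b::real_normed_vector"
  assumes "smooth f" "smooth g" shows "smooth (\<lambda>x. f x + g x)"
proof (rule smooth_coinduct[where P="\<lambda>h. \<exists>f g. smooth f \<and> smooth g \<and> h = (\<lambda>x. f x + g x)"])
  fix h :: "'a \<Rightarrow> 'b" assume "\<exists>f g. smooth f \<and> smooth g \<and> h = (\<lambda>x. f x + g x)"
  then obtain f g where fg: "smooth f" "smooth g" and h: "h = (\<lambda>x. f x + g x)" by blast
  have "\<exists>f g. smooth f \<and> smooth g \<and> dderiv v h = (\<lambda>x. f x + g x)" for v
    unfolding h dderiv_add[OF fg] using fg smooth_dderiv by blast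
  then show "(\<forall>x. h differentiable at x) \<and> (\<forall>v. \<exists>f g. smooth f \<and> smooth g \<and> dderiv v h = (\<lambda>x. f x + g x))"
    unfolding h using differentiable_add[OF smooth_differentiable smooth_differentiable, OF fg] by blast
qed (use assms in blast)

lemma dderiv_blin: "bounded_linear L \<Longrightarrow> smooth f \<Longrightarrow> dderiv v (\<lambda>x. L (f x)) = (\<lambda>x. L (dderiv v f x))"
  by (rule ext, rule dderiv_eq, erule bounded_linear.has_derivative, erule smooth_has_derivative)

lemma smooth_blin: assumes L: "bounded_linear L" and f: "smooth f" shows "smooth (\<lambda>x. L (f x))"
proof (rule smooth_coinduct[where P="\<lambda>h. \<exists>f. smooth f \<and> h = (\<lambda>x. L (f x))"])
  show "\<exists>fa. smooth fa \<and> (\<lambda>x. L (f x)) = (\<lambda>x. L (fa x))" using f by blast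
  fix h assume "\<exists>f. smooth f \<and> h = (\<lambda>x. L (f x))"
  then obtain f where f: "smooth f" and h: "h = (\<lambda>x. L (f x))" by blast
  show "(\<forall>x. h differentiable at x) \<and> (\<forall>v. \<exists>f. smooth f \<and> dderiv v h = (\<lambda>x. L (f x)))"
    unfolding h dderiv_blin[OF L f] using smooth_dderiv[OF f]
    using bounded_linear.has_derivative[OF L smooth_has_derivative[OF f]] by (auto simp: differentiable_def)
qed

lemma dderivs_blin: "bounded_linear L \<Longrightarrow> smooth f \<Longrightarrow> dderivs vs (\<lambda>x. L (f x)) = (\<lambda>x. L (dderivs vs f x))"
  by (induct vs) (simp_all add: dderiv_blin smooth_dderivs)

lemma smooth_const: "smooth (\<lambda>x. c)"
proof (rule smooth_coinduct[where P="\<lambda>h. \<exists>c. h = (\<lambda>x. c)"])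
  fix f :: "'a \<Rightarrow> 'b" assume "\<exists>c. f = (\<lambda>x. c)"
  then obtain c where f: "f = (\<lambda>x. c)" by blast
  have "dderiv v f = (\<lambda>x. 0)" for v unfolding f by (rule ext, rule dderiv_eq) simp
  then show "(\<forall>x. f differentiable at x) \<and> (\<forall>v. \<exists>c. dderiv v f = (\<lambda>x. c))" using f by auto
qed auto

lemma dderiv_const: "dderiv v (\<lambda>x. c) = (\<lambda>x. 0)"
  by (rule ext, rule dderiv_eq) simp

lemma dderiv_linear: "bounded_linear f \<Longrightarrow> dderiv v f = (\<lambda>x. f v)"
  by (rule ext, rule dderiv_eq) (rule bounded_linear_imp_has_derivative)

lemma smooth_linear: assumes "bounded_linear f" shows "smooth f"
proof (rule smooth_coinduct[where P="\<lambda>h. h = f \<or> (\<exists>c. h = (\<lambda>x. c))"])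
  fix h assume "h = f \<or> (\<exists>c. h = (\<lambda>x. c))"
  then show "(\<forall>x. h differentiable at x) \<and> (\<forall>v. dderiv v h = f \<or> (\<exists>c. dderiv v h = (\<lambda>x. c)))"
  proof
    assume "h = f"
    then show ?thesis using dderiv_linear[OF assms] bounded_linear_imp_differentiable[OF assms] by auto
  next
    assume "\<exists>c. h = (\<lambda>x. c)"
    then obtain c where h: "h = (\<lambda>x. c)" by blast
    have "dderiv v h = (\<lambda>x. 0)" for v unfolding h by (rule dderiv_const)
    then show ?thesis using h by auto
  qed
qed auto

lemma dderiv_mult:
  fixes f g :: "'a::real_normed_vector \<Rightarrow> 'b::real_normed_algebra"
  shows "smooth f \<Longrightarrow> smooth g \<Longrightarrow> dderiv v (\<lambda>x. f x * g x) = (\<lambda>x. f x * dderiv v g x + dderiv v f x * g x)"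
  by (rule ext, rule dderiv_eq) (auto intro!: has_derivative_mult smooth_has_derivative)

lemma sumcl_mult:
  fixes f g :: "'a::real_normed_vector \<Rightarrow> 'b::real_normed_algebra"
  assumes fg: "smooth f" "smooth g" and "B (\<lambda>_ x. f x * dderiv v g x)" "B (\<lambda>_ x. dderiv v f x * g x)"
  shows "sumcl I B (\<lambda>i. dderiv v (\<lambda>x. f x * g x))"
  unfolding dderiv_mult[OF fg] using assms by (auto intro: sumcl_bases)

lemma smooth_mult:
  fixes f g :: "'a::real_normed_vector \<Rightarrow> 'b::real_normed_algebra"
  assumes "smooth f" "smooth g" shows "smooth (\<lambda>x. f x * g x)"
proof -
  let ?B = "\<lambda>F. \<exists>f g. smooth f \<and> smooth g \<and> F = (\<lambda>(i::unit) (x::'a). f x * (g x :: 'b))"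
  have "smooth ((\<lambda>(i::unit) x. f x * g x) ())"
  proof (rule smooth_sumcl[where B="?B" and I=UNIV])
    fix F assume "?B F"
    then obtain f g where fg: "smooth f" "smooth g" "F = (\<lambda>(i::unit) (x::'a). f x * (g x :: 'b))" by blast
    have "sumcl UNIV ?B (\<lambda>i. dderiv v (F i))" for v
      unfolding fg(3) by (rule sumcl_mult[OF fg(1,2)]) (use fg smooth_dderiv in blast)+
    then show "(\<forall>i\<in>UNIV. \<forall>x. F i differentiable at x) \<and> (\<forall>v. sumcl UNIV ?B (\<lambda>i. dderiv v (F i)))"
      unfolding fg(3) using differentiable_mult[OF smooth_differentiable smooth_differentiable, OF fg(1,2)] by simp
  qed (use assms in blast)+
  then show ?thesis .
qed

lemma dderiv_cmult:
  fixes f :: "'a::real_normed_vector \<Rightarrow> 'b::real_normed_algebra"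
  shows "smooth f \<Longrightarrow> dderiv v (\<lambda>x. c * f x) = (\<lambda>x. c * dderiv v f x)"
  by (simp add: dderiv_mult smooth_const dderiv_const)

lemma smooth_cmult:
  fixes f :: "'a::real_normed_vector \<Rightarrow> 'b::real_normed_algebra"
  shows "smooth f \<Longrightarrow> smooth (\<lambda>x. c * f x)"
  by (rule smooth_mult[OF smooth_const])

lemma dderivs_cmult:
  fixes f :: "'a::real_normed_vector \<Rightarrow> 'b::real_normed_algebra"
  shows "smooth f \<Longrightarrow> dderivs vs (\<lambda>x. c * f x) = (\<lambda>x. c * dderivs vs f x)"
  by (induct vs) (simp_all add: dderiv_cmult smooth_dderivs)

lemma dderivs_add: "smooth f \<Longrightarrow> smooth g \<Longrightarrow> dderivs vs (\<lambda>x. f x + g x) = (\<lambda>x. dderivs vs f x + dderivs vs g x)"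
  by (induct vs) (simp_all add: dderiv_add smooth_dderivs)

lemma smooth_diff:
  fixes f g :: "'a::real_normed_vector \<Rightarrow> 'b::real_normed_algebra_1"
  assumes "smooth f" "smooth g" shows "smooth (\<lambda>x. f x - g x)"
  using smooth_add[OF assms(1) smooth_cmult[OF assms(2), of "-1"]] by simp

lemma smooth_sum: "(\<And>i. i \<in> A \<Longrightarrow> smooth (f i)) \<Longrightarrow> smooth (\<lambda>x. \<Sum>i\<in>A. f i x)"
  by (induct A rule: infinite_finite_induct) (auto intro: smooth_add smooth_const)

lemma smooth_power:
  fixes f :: "'a::real_normed_vector \<Rightarrow> 'b::real_normed_algebra_1"
  shows "smooth f \<Longrightarrow> smooth (\<lambda>x. f x ^ n)"
  by (induct n) (auto intro: smooth_mult smooth_const)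

lemma dderiv_affine:
  assumes "bounded_linear A" "smooth g"
  shows "dderiv v (\<lambda>x. g (A x + b)) = (\<lambda>x. dderiv (A v) g (A x + b))"
proof (rule ext, rule dderiv_eq)
  fix x
  have "((\<lambda>x. A x + b) has_derivative (\<lambda>v. A v)) (at x)"
    using has_derivative_add[OF bounded_linear_imp_has_derivative[OF assms(1)] has_derivative_const[of b]] by simp
  from has_derivative_compose[OF this smooth_has_derivative[OF assms(2)]]
  show "((\<lambda>x. g (A x + b)) has_derivative (\<lambda>v. dderiv (A v) g (A x + b))) (at x)" .
qed

lemma smooth_affine:
  assumes A: "bounded_linear A" and g: "smooth g"
  shows "smooth (\<lambda>x. g (A x + b))"
proof (rule smooth_coinduct[where P="\<lambda>h. \<exists>g. smooth g \<and> h = (\<lambda>x. g (A x + b))"])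
  show "\<exists>ga. smooth ga \<and> (\<lambda>x. g (A x + b)) = (\<lambda>x. ga (A x + b))" using g by blast
  fix h assume "\<exists>g. smooth g \<and> h = (\<lambda>x. g (A x + b))"
  then obtain g where f: "smooth g" and h: "h = (\<lambda>x. g (A x + b))" by blast
  have "h differentiable at x" for x
  proof -
    have "((\<lambda>x. A x + b) has_derivative (\<lambda>v. A v)) (at x)"
      using has_derivative_add[OF bounded_linear_imp_has_derivative[OF A] has_derivative_const[of b]] by simp
    from has_derivative_compose[OF this smooth_has_derivative[OF f]] show ?thesis
      unfolding h differentiable_def by blast
  qed
  then show "(\<forall>x. h differentiable at x) \<and> (\<forall>v. \<exists>g. smooth g \<and> dderiv v h = (\<lambda>x. g (A x + b)))"
    unfolding h dderiv_affine[OF A f] using smooth_dderiv[OF f] by auto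
qed

lemma dderivs_affine:
  assumes A: "bounded_linear A" and g: "smooth g"
  shows "dderivs vs (\<lambda>x. g (A x + b)) = (\<lambda>x. dderivs (map A vs) g (A x + b))"
  by (induct vs) (simp_all add: dderiv_affine[OF A] smooth_dderivs[OF g])

lemmas smooth_comp_linear = smooth_affine[where b=0, simplified]
lemmas dderivs_comp_linear = dderivs_affine[where b=0, simplified]
lemmas dderiv_comp_linear = dderiv_affine[where b=0, simplified]

lemma dderiv_comp_real:
  fixes b :: "real \<Rightarrow> real"
  assumes "smooth b" "smooth g"
  shows "dderiv v (\<lambda>x. b (g x)) = (\<lambda>x. dderiv 1 b (g x) * dderiv v g x)"
proof (rule ext, rule dderiv_eq)
  fix x
  have "((\<lambda>x. b (g x)) has_derivative (\<lambda>v. dderiv (dderiv v g x) b (g x))) (at x)"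
    by (rule has_derivative_compose[OF smooth_has_derivative[OF assms(2)] smooth_has_derivative[OF assms(1)]])
  moreover have "dderiv c b y = dderiv 1 b y * c" for c y :: real
    using linear_cmul[OF linear_dderiv[OF assms(1), of y], of c 1] by simp
  then have "(\<lambda>v. dderiv (dderiv v g x) b (g x)) = (\<lambda>v. dderiv 1 b (g x) * dderiv v g x)"
    by blast
  ultimately show "((\<lambda>x. b (g x)) has_derivative (\<lambda>v. dderiv 1 b (g x) * dderiv v g x)) (at x)" by argo
qed

text \<open>The products \<open>b (g x) * a x\<close> with smooth \<open>a\<close> and
  \<open>b\<close> are closed under differentiation up to sums, because the inner derivative of
  \<open>g\<close> is absorbed into \<open>a\<close>. The constant factor 1 puts
  \<open>b (g x)\<close> into this class.\<close>

lemma smooth_comp_real: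
  fixes b :: "real \<Rightarrow> real"
  and g :: "'a::real_normed_vector \<Rightarrow> real"
  assumes "smooth b" "smooth g" shows "smooth (\<lambda>x. b (g x))"
proof -
  let ?B = "\<lambda>F. \<exists>b a. smooth b \<and> smooth a \<and> F = (\<lambda>(i::unit) (x::'a). b (g x) * (a x :: real))"
  have "smooth ((\<lambda>(i::unit) x. b (g x) * 1) ())"
  proof (rule smooth_sumcl[where B="?B" and I=UNIV])
    fix F assume "?B F"
    then obtain b a where fg: "smooth b" "smooth a" "F = (\<lambda>(i::unit) (x::'a). b (g x) * (a x :: real))" by blast
    have D: "((\<lambda>x. b (g x)) has_derivative (\<lambda>v. dderiv v (\<lambda>x. b (g x)) x)) (at x)" for x
      by (rule differentiable_dderiv)
        (use has_derivative_compose[OF smooth_has_derivative[OF assms(2)] smooth_has_derivative[OF fg(1)]]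
          in \<open>auto simp: differentiable_def\<close>)
    have M: "((\<lambda>x. b (g x) * a x) has_derivative
        (\<lambda>v. b (g x) * dderiv v a x + dderiv v (\<lambda>x. b (g x)) x * a x)) (at x)" for x
      by (intro has_derivative_mult D smooth_has_derivative fg)
    have S: "sumcl UNIV ?B (\<lambda>i. dderiv v (F i))" for v
    proof (rule sumcl_bases)
      show "?B (\<lambda>(i::unit) x. b (g x) * dderiv v a x)" using fg smooth_dderiv by blast
      have "smooth (\<lambda>x. dderiv v g x * a x)" by (intro smooth_mult smooth_dderiv assms fg)
      then show "?B (\<lambda>(i::unit) x. dderiv 1 b (g x) * (dderiv v g x * a x))" using fg smooth_dderiv by blast
      show "dderiv v (F i) x = b (g x) * dderiv v a x + dderiv 1 b (g x) * (dderiv v g x * a x)" for i x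
        unfolding fg(3) dderiv_eq[OF M] by (simp add: dderiv_comp_real[OF fg(1) assms(2)])
    qed
    have "\<forall>x. F i differentiable at x" for i unfolding fg(3) differentiable_def using M by blast
    then show "(\<forall>i\<in>UNIV. \<forall>x. F i differentiable at x) \<and> (\<forall>v. sumcl UNIV ?B (\<lambda>i. dderiv v (F i)))"
      using S by auto
  qed (use assms smooth_const in blast)+
  then show ?thesis by simp
qed

lemma has_derivative_cis_inner:
  "((\<lambda>x. cis (k \<bullet> x)) has_derivative (\<lambda>v. (\<i> * of_real (k \<bullet> v)) * cis (k \<bullet> x))) (at x)"
proof -
  have "(cis has_vector_derivative \<i> * cis t) (at t)" for t
    unfolding has_vector_derivative_complex_iff
    by (auto intro!: derivative_eq_intros)
  then have "(cis has_derivative (\<lambda>h. h *\<^sub>R (\<i> * cis t))) (at t)" for t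
    unfolding has_vector_derivative_def .
  moreover have "((\<lambda>x. k \<bullet> x) has_derivative (\<lambda>v. k \<bullet> v)) (at x)"
    by (intro bounded_linear_imp_has_derivative bounded_linear_inner_right)
  ultimately show ?thesis
    using has_derivative_compose[of "\<lambda>x. k \<bullet> x" _ x UNIV cis]
    by (auto simp: scaleR_conv_of_real mult_ac)
qed

lemma dderiv_cis: "dderiv v (\<lambda>x. cis (k \<bullet> x)) = (\<lambda>x. (\<i> * of_real (k \<bullet> v)) * cis (k \<bullet> x))"
  by (rule ext, rule dderiv_eq) (rule has_derivative_cis_inner)

lemma smooth_cis: "smooth (\<lambda>x. cis (k \<bullet> x))"
proof (rule smooth_coinduct[where P="\<lambda>h. \<exists>c. h = (\<lambda>x. c * cis (k \<bullet> x))"])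
  fix f :: "'a \<Rightarrow> complex" assume "\<exists>c. f = (\<lambda>x. c * cis (k \<bullet> x))"
  then obtain c where f: "f = (\<lambda>x. c * cis (k \<bullet> x))" by blast
  have D: "(f has_derivative (\<lambda>v. c * ((\<i> * of_real (k \<bullet> v)) * cis (k \<bullet> x)))) (at x)" for x
    unfolding f by (intro has_derivative_mult_right has_derivative_cis_inner)
  have "\<exists>d. dderiv v f = (\<lambda>x. d * cis (k \<bullet> x))" for v
    by (rule exI[of _ "c * (\<i> * of_real (k \<bullet> v))"]) (auto simp: dderiv_eq[OF D] mult.assoc)
  then show "(\<forall>x. f differentiable at x) \<and> (\<forall>v. \<exists>c. dderiv v f = (\<lambda>x. c * cis (k \<bullet> x)))"
    using D by (auto simp: differentiable_def)
qed (rule exI[of _ 1], simp)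

lemma line_derivative:
  assumes "smooth f"
  shows "((\<lambda>t. f (x + t *\<^sub>R v)) has_vector_derivative dderiv v f (x + t *\<^sub>R v)) (at t)"
proof -
  have "((\<lambda>t. x + t *\<^sub>R v) has_derivative (\<lambda>h. h *\<^sub>R v)) (at t)"
    by (auto intro!: derivative_eq_intros)
  from has_derivative_compose[OF this smooth_has_derivative[OF assms]]
  show ?thesis unfolding has_vector_derivative_def
    using linear_cmul[OF linear_dderiv[OF assms]] by simp
qed

section \<open>Symmetry of mixed derivatives\<close>

text \<open>The mean value inequality is used twice, first in direction \<open>w\<close> for
  \<open>dderiv v f\<close>, then in direction \<open>v\<close> for the difference in
  \<open>w\<close>, each time after subtracting the linear term given by the value at
  \<open>x\<close>.\<close>

lemma mixed_difference_bound:
  fixes f :: "'a::real_normed_vector \<Rightarrow> 'b::real_normed_vector"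
  assumes f: "smooth f" and t: "0 < t"
    and e: "\<And>a b. 0 \<le> a \<Longrightarrow> a \<le> t \<Longrightarrow> 0 \<le> b \<Longrightarrow> b \<le> t \<Longrightarrow>
       norm (dderiv w (dderiv v f) (x + a *\<^sub>R v + b *\<^sub>R w) - dderiv w (dderiv v f) x) \<le> e"
  shows "norm (f (x + t *\<^sub>R v + t *\<^sub>R w) - f (x + t *\<^sub>R v) - f (x + t *\<^sub>R w) + f x
            - (t * t) *\<^sub>R dderiv w (dderiv v f) x) \<le> t * t * e"
proof -
  have inner: "norm (dderiv v f (x + a *\<^sub>R v + t *\<^sub>R w) - dderiv v f (x + a *\<^sub>R v) - t *\<^sub>R dderiv w (dderiv v f) x) \<le> t * e"
    if a: "0 \<le> a" "a \<le> t" for a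
  proof -
    have "norm ((dderiv v f (x + a *\<^sub>R v + t *\<^sub>R w) - t *\<^sub>R dderiv w (dderiv v f) x)
        - (dderiv v f (x + a *\<^sub>R v + 0 *\<^sub>R w) - 0 *\<^sub>R dderiv w (dderiv v f) x)) \<le> e * norm (t - 0)"
    proof (rule differentiable_bound[where S="{0..t}" and f="\<lambda>b. dderiv v f (x + a *\<^sub>R v + b *\<^sub>R w) - b *\<^sub>R dderiv w (dderiv v f) x"
          and f'="\<lambda>b h. h *\<^sub>R (dderiv w (dderiv v f) (x + a *\<^sub>R v + b *\<^sub>R w) - dderiv w (dderiv v f) x)"])
      show "((\<lambda>b. dderiv v f (x + a *\<^sub>R v + b *\<^sub>R w) - b *\<^sub>R dderiv w (dderiv v f) x) has_derivative
         (\<lambda>h. h *\<^sub>R (dderiv w (dderiv v f) (x + a *\<^sub>R v + b *\<^sub>R w) - dderiv w (dderiv v f) x))) (at b within {0..t})" for b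
        unfolding has_vector_derivative_def[symmetric]
        by (rule has_vector_derivative_at_within)
          (auto intro!: derivative_eq_intros line_derivative smooth_dderiv f)
      show "onorm (\<lambda>h. h *\<^sub>R (dderiv w (dderiv v f) (x + a *\<^sub>R v + b *\<^sub>R w) - dderiv w (dderiv v f) x)) \<le> e"
        if "b \<in> {0..t}" for b
      proof (rule onorm_le)
        fix h :: real
        show "norm (h *\<^sub>R (dderiv w (dderiv v f) (x + a *\<^sub>R v + b *\<^sub>R w) - dderiv w (dderiv v f) x)) \<le> e * norm h"
          using mult_left_mono[OF e[OF a, of b], of "\<bar>h\<bar>"] that by (simp add: mult.commute)
      qed
    qed (use t in auto)
    then show ?thesis using t by (simp add: algebra_simps)
  qed
  have "norm ((f (x + t *\<^sub>R v + t *\<^sub>R w) - f (x + t *\<^sub>R v) - t *\<^sub>R (t *\<^sub>R dderiv w (dderiv v f) x))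
      - (f (x + 0 *\<^sub>R v + t *\<^sub>R w) - f (x + 0 *\<^sub>R v) - 0 *\<^sub>R (t *\<^sub>R dderiv w (dderiv v f) x))) \<le> (t * e) * norm (t - 0)"
  proof (rule differentiable_bound[where S="{0..t}" and
        f="\<lambda>a. f (x + a *\<^sub>R v + t *\<^sub>R w) - f (x + a *\<^sub>R v) - a *\<^sub>R (t *\<^sub>R dderiv w (dderiv v f) x)"
          and f'="\<lambda>a h. h *\<^sub>R (dderiv v f (x + a *\<^sub>R v + t *\<^sub>R w) - dderiv v f (x + a *\<^sub>R v) - t *\<^sub>R dderiv w (dderiv v f) x)"])
    show "((\<lambda>a. f (x + a *\<^sub>R v + t *\<^sub>R w) - f (x + a *\<^sub>R v) - a *\<^sub>R (t *\<^sub>R dderiv w (dderiv v f) x)) has_derivative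
       (\<lambda>h. h *\<^sub>R (dderiv v f (x + a *\<^sub>R v + t *\<^sub>R w) - dderiv v f (x + a *\<^sub>R v) - t *\<^sub>R dderiv w (dderiv v f) x))) (at a within {0..t})" for a
    proof -
      have "((\<lambda>a. f ((x + t *\<^sub>R w) + a *\<^sub>R v)) has_vector_derivative dderiv v f ((x + t *\<^sub>R w) + a *\<^sub>R v)) (at a)"
        by (rule line_derivative[OF f])
      then have 1: "((\<lambda>a. f (x + a *\<^sub>R v + t *\<^sub>R w)) has_vector_derivative dderiv v f (x + a *\<^sub>R v + t *\<^sub>R w)) (at a)"
        by (simp add: add_ac)
      show ?thesis
        unfolding has_vector_derivative_def[symmetric]
        by (rule has_vector_derivative_at_within)
          (auto intro!: derivative_eq_intros line_derivative f 1)
    qed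
    show "onorm (\<lambda>h. h *\<^sub>R (dderiv v f (x + a *\<^sub>R v + t *\<^sub>R w) - dderiv v f (x + a *\<^sub>R v) - t *\<^sub>R dderiv w (dderiv v f) x)) \<le> t * e"
      if "a \<in> {0..t}" for a
    proof (rule onorm_le)
      fix h :: real
      show "norm (h *\<^sub>R (dderiv v f (x + a *\<^sub>R v + t *\<^sub>R w) - dderiv v f (x + a *\<^sub>R v) - t *\<^sub>R dderiv w (dderiv v f) x)) \<le> t * e * norm h"
        using mult_left_mono[OF inner[of a], of "\<bar>h\<bar>"] that by (simp add: mult_ac)
    qed
  qed (use t in auto)
  then show ?thesis using t by (simp add: algebra_simps)
qed

text \<open>The second difference of \<open>mixed_difference_bound\<close> is symmetric in
  \<open>v\<close> and \<open>w\<close>, so after division by \<open>t * t\<close> both mixed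
  derivatives are within \<open>e\<close> of the same vector.\<close>

lemma dderiv_commute:
  fixes f :: "'a::real_normed_vector \<Rightarrow> 'b::real_normed_vector"
  assumes f: "smooth f"
  shows "dderiv w (dderiv v f) = dderiv v (dderiv w f)"
proof
  fix x
  have "norm (dderiv w (dderiv v f) x - dderiv v (dderiv w f) x) \<le> 2 * e" if e: "e > 0" for e
  proof -
    have near: "\<exists>d>0. \<forall>a b. 0 \<le> a \<and> a \<le> d \<and> 0 \<le> b \<and> b \<le> d \<longrightarrow> norm (g (x + a *\<^sub>R v + b *\<^sub>R w) - g x) \<le> e"
      if "smooth g" for g :: "'a \<Rightarrow> 'b"
    proof -
      have "isCont g x" using smooth_differentiable[OF that] differentiable_imp_continuous_within by blast
      then obtain d where d: "d > 0" "\<And>y. dist y x < d \<Longrightarrow> dist (g y) (g x) < e"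
        unfolding continuous_at_eps_delta using e by blast
      define d' where "d' = d / (2 * (1 + norm v + norm w))"
      have pos: "1 + norm v + norm w > 0" by (smt (verit) norm_ge_zero)
      have d': "d' > 0" unfolding d'_def using d pos by (intro divide_pos_pos mult_pos_pos) auto
      { fix a b assume ab: "0 \<le> a" "a \<le> d'" "0 \<le> b" "b \<le> d'"
        have "norm (a *\<^sub>R v + b *\<^sub>R w) \<le> a * norm v + b * norm w"
          using ab norm_triangle_ineq[of "a *\<^sub>R v" "b *\<^sub>R w"] by simp
        also have "\<dots> \<le> d' * norm v + d' * norm w"
          using ab by (intro add_mono mult_right_mono) auto
        also have "\<dots> \<le> d' * (1 + norm v + norm w)" using d' by (simp add: algebra_simps)
        also have "\<dots> < d" unfolding d'_def using d pos by (simp add: divide_less_eq)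
        finally have "dist (x + a *\<^sub>R v + b *\<^sub>R w) x < d" by (simp add: dist_norm add.assoc)
        then have "norm (g (x + a *\<^sub>R v + b *\<^sub>R w) - g x) \<le> e" using d(2)[of "x + a *\<^sub>R v + b *\<^sub>R w"] by (simp add: dist_norm) }
      then show ?thesis using d' by blast
    qed
    obtain d1 where d1: "d1 > 0" "\<And>a b. 0 \<le> a \<Longrightarrow> a \<le> d1 \<Longrightarrow> 0 \<le> b \<Longrightarrow> b \<le> d1 \<Longrightarrow>
        norm (dderiv w (dderiv v f) (x + a *\<^sub>R v + b *\<^sub>R w) - dderiv w (dderiv v f) x) \<le> e"
      using near[of "dderiv w (dderiv v f)"] f by (metis smooth_dderiv)
    obtain d2 where d2: "d2 > 0" "\<And>a b. 0 \<le> a \<Longrightarrow> a \<le> d2 \<Longrightarrow> 0 \<le> b \<Longrightarrow> b \<le> d2 \<Longrightarrow>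
        norm (dderiv v (dderiv w f) (x + a *\<^sub>R v + b *\<^sub>R w) - dderiv v (dderiv w f) x) \<le> e"
      using near[of "dderiv v (dderiv w f)"] f by (metis smooth_dderiv)
    define t where "t = min d1 d2"
    have t: "t > 0" "t \<le> d1" "t \<le> d2" using d1 d2 by (auto simp: t_def)
    let ?D = "f (x + t *\<^sub>R v + t *\<^sub>R w) - f (x + t *\<^sub>R v) - f (x + t *\<^sub>R w) + f x"
    have 1: "norm (?D - (t * t) *\<^sub>R dderiv w (dderiv v f) x) \<le> t * t * e"
      by (rule mixed_difference_bound[OF f t(1)]) (use d1 t in auto)
    have "norm (f (x + t *\<^sub>R w + t *\<^sub>R v) - f (x + t *\<^sub>R w) - f (x + t *\<^sub>R v) + f x
        - (t * t) *\<^sub>R dderiv v (dderiv w f) x) \<le> t * t * e"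
    proof (rule mixed_difference_bound[OF f t(1)])
      fix a b assume ab: "0 \<le> a" "a \<le> t" "0 \<le> b" "b \<le> t"
      show "norm (dderiv v (dderiv w f) (x + a *\<^sub>R w + b *\<^sub>R v) - dderiv v (dderiv w f) x) \<le> e"
        using d2(2)[of b a] ab t by (simp add: add_ac)
    qed
    then have 2: "norm (?D - (t * t) *\<^sub>R dderiv v (dderiv w f) x) \<le> t * t * e"
      by (simp add: algebra_simps)
    have "norm ((t * t) *\<^sub>R (dderiv w (dderiv v f) x - dderiv v (dderiv w f) x)) \<le> t * t * e + t * t * e"
      using norm_triangle_ineq4[of "?D - (t * t) *\<^sub>R dderiv v (dderiv w f) x" "?D - (t * t) *\<^sub>R dderiv w (dderiv v f) x"] 1 2
      by (simp add: algebra_simps)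
    then show ?thesis using t by (simp add: mult.assoc)
  qed
  then have "norm (dderiv w (dderiv v f) x - dderiv v (dderiv w f) x) \<le> 0"
    by (metis add_0 divide_pos_pos field_le_epsilon nonzero_mult_div_cancel_left times_divide_eq_right zero_less_numeral zero_neq_numeral)
  then show "dderiv w (dderiv v f) x = dderiv v (dderiv w f) x" by simp
qed

lemma dderivs_commute1: "smooth f \<Longrightarrow> dderivs (vs @ [v]) f = dderivs (v # vs) f"
proof (induct vs arbitrary: f)
  case (Cons w vs)
  then have "dderivs (w # vs @ [v]) f = dderiv w (dderiv v (dderivs vs f))" by simp
  also have "\<dots> = dderiv v (dderiv w (dderivs vs f))"
    by (rule dderiv_commute) (simp add: smooth_dderivs Cons)
  finally show ?case by simp
qed simp

text \<open>A multi-index only fixes how often each direction occurs, and \<open>mi_list\<close>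
  picks an unspecified order; iterated derivatives must not depend on it.\<close>

lemma dderivs_perm: "smooth f \<Longrightarrow> mset vs = mset ws \<Longrightarrow> dderivs vs f = dderivs ws f"
proof (induct vs arbitrary: ws)
  case (Cons v vs)
  then obtain as bs where ws: "ws = as @ v # bs" by (metis in_set_conv_decomp list.set_intros(1) set_mset_mset)
  have "dderivs ws f = dderivs (v # as) (dderivs bs f)"
    unfolding ws dderivs_append[symmetric]
    using dderivs_commute1[OF smooth_dderivs[OF Cons(2)], of as v bs] by (simp add: dderivs_append)
  also have "\<dots> = dderiv v (dderivs (as @ bs) f)" by (simp add: dderivs_append)
  also have "dderivs (as @ bs) f = dderivs vs f"
    using Cons ws by (intro Cons(1)[symmetric]) auto
  finally show ?case by simp
qed simp

section \<open>Integration by parts and cutoff functions\<close>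

lemma lborel_integral_shift:
  fixes f :: "'a::euclidean_space \<Rightarrow> 'b::{banach,second_countable_topology}"
  assumes [measurable]: "f \<in> borel_measurable borel"
  shows "integral\<^sup>L lborel (\<lambda>x. f (x + a)) = integral\<^sup>L lborel f"
proof -
  have "integral\<^sup>L (distr lborel borel ((+) a)) f = integral\<^sup>L lborel (\<lambda>x. f (a + x))"
    by (rule integral_distr) auto
  then show ?thesis by (simp add: lborel_distr_plus add.commute)
qed

lemma lborel_integrable_shift:
  fixes f :: "'a::euclidean_space \<Rightarrow> 'b::{banach,second_countable_topology}"
  assumes [measurable]: "f \<in> borel_measurable borel"
  shows "integrable lborel (\<lambda>x. f (x + a)) \<longleftrightarrow> integrable lborel f"
proof -
  have "integrable (distr lborel borel ((+) a)) f \<longleftrightarrow> integrable lborel (\<lambda>x. f (a + x))"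
    by (rule integrable_distr_eq) auto
  then show ?thesis by (simp add: lborel_distr_plus add.commute)
qed

lemma lborel_integral_scale:
  fixes f :: "'a::euclidean_space \<Rightarrow> 'b::{banach,second_countable_topology}"
  assumes [measurable]: "f \<in> borel_measurable borel" and c: "c \<noteq> 0"
  shows "integral\<^sup>L lborel (\<lambda>x. f (c *\<^sub>R x)) = (1 / \<bar>c\<bar> ^ DIM('a)) *\<^sub>R integral\<^sup>L lborel f"
proof -
  have "integral\<^sup>L lborel f = integral\<^sup>L (density (distr lborel borel (\<lambda>x. 0 + c *\<^sub>R x)) (\<lambda>_. \<bar>c\<bar>^DIM('a))) f"
    using lborel_affine[OF c, of "0::'a"] by simp
  also have "\<dots> = integral\<^sup>L (distr lborel borel (\<lambda>x. 0 + c *\<^sub>R x)) (\<lambda>x. \<bar>c\<bar>^DIM('a) *\<^sub>R f x)"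
    by (rule integral_density) auto
  also have "\<dots> = integral\<^sup>L lborel (\<lambda>x. \<bar>c\<bar>^DIM('a) *\<^sub>R f (0 + c *\<^sub>R x))"
    by (rule integral_distr) auto
  also have "\<dots> = \<bar>c\<bar>^DIM('a) *\<^sub>R integral\<^sup>L lborel (\<lambda>x. f (c *\<^sub>R x))" by simp
  finally show ?thesis using c by simp
qed

lemma lborel_integral_uminus:
  fixes f :: "'a::euclidean_space \<Rightarrow> 'b::{banach,second_countable_topology}"
  assumes "f \<in> borel_measurable borel"
  shows "integral\<^sup>L lborel (\<lambda>x. f (- x)) = integral\<^sup>L lborel f"
  using lborel_integral_scale[OF assms, of "-1"] by simp

lemma integrable_inverse_1_sq: "integrable lborel (\<lambda>x::real. inverse (1 + x\<^sup>2))"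
proof (rule integrableI_bounded)
  have pos: "(\<integral>\<^sup>+x. ennreal (inverse (1 + x\<^sup>2)) * indicator {0..} x \<partial>lborel) = ennreal (pi / 2)"
    by (subst nn_integral_FTC_atLeast[where F=arctan and T="pi/2"])
      (auto intro!: tendsto_arctan_at_top DERIV_arctan)
  have "(\<integral>\<^sup>+x. ennreal (inverse (1 + x\<^sup>2)) * indicator {..0} x \<partial>lborel) =
     ennreal \<bar>-1\<bar> * (\<integral>\<^sup>+x. ennreal (inverse (1 + (0 + (-1) * x)\<^sup>2)) * indicator {..0} (0 + (-1) * x) \<partial>lborel)"
    by (rule nn_integral_real_affine) auto
  also have "\<dots> = (\<integral>\<^sup>+x. ennreal (inverse (1 + x\<^sup>2)) * indicator {0..} x \<partial>lborel)"
    by (auto intro!: nn_integral_cong simp: indicator_def)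
  finally have neg: "(\<integral>\<^sup>+x. ennreal (inverse (1 + x\<^sup>2)) * indicator {..0} x \<partial>lborel) = ennreal (pi / 2)"
    using pos by simp
  have "(\<integral>\<^sup>+x. ennreal (norm (inverse (1 + x\<^sup>2))) \<partial>(lborel::real measure)) \<le>
    (\<integral>\<^sup>+x. ennreal (inverse (1 + x\<^sup>2)) * indicator {0..} x + ennreal (inverse (1 + x\<^sup>2)) * indicator {..0} x \<partial>lborel)"
    by (intro nn_integral_mono) (auto simp: indicator_def)
  also have "\<dots> = ennreal (pi/2) + ennreal (pi/2)"
    by (subst nn_integral_add) (auto simp: pos neg)
  finally show "(\<integral>\<^sup>+x. ennreal (norm (inverse (1 + x\<^sup>2))) \<partial>(lborel::real measure)) < \<infinity>"
    by (rule le_less_trans) (simp flip: ennreal_plus)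
qed simp

text \<open>The exponent is generous: each of the \<open>DIM('a)\<close> one-dimensional factors
  \<open>1 + (x \<bullet> b)\<^sup>2\<close> is at most \<open>(1 + norm x)\<^sup>2\<close>, so the
  weight is dominated by an integrable product.\<close>

lemma integrable_decay: "integrable lborel (\<lambda>x::'a::euclidean_space. 1 / (1 + norm x) ^ (2 * DIM('a)))"
proof -
  interpret P: product_sigma_finite "\<lambda>_::'a. lborel :: real measure" by standard
  let ?g = "\<lambda>x::'a. \<Prod>b\<in>Basis. inverse (1 + (x \<bullet> b)\<^sup>2)"
  have "integrable (\<Pi>\<^sub>M b\<in>(Basis::'a set). lborel) (\<lambda>f. \<Prod>b\<in>Basis. inverse (1 + (f b)\<^sup>2 :: real))"
    by (rule P.product_integrable_prod) (auto intro: integrable_inverse_1_sq)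
  also have "(\<lambda>f. \<Prod>b\<in>(Basis::'a set). inverse (1 + (f b)\<^sup>2)) = (\<lambda>f. ?g (\<Sum>b\<in>Basis. f b *\<^sub>R b))"
    by (auto intro!: prod.cong ext)
  finally have "integrable (distr (\<Pi>\<^sub>M b\<in>(Basis::'a set). lborel) borel (\<lambda>f. \<Sum>b\<in>Basis. f b *\<^sub>R b)) ?g"
    by (subst integrable_distr_eq) auto
  then have g: "integrable lborel ?g" by (simp add: lborel_eq[symmetric])
  show ?thesis
  proof (rule Bochner_Integration.integrable_bound[OF g])
    show "AE x in lborel. norm (1 / (1 + norm x) ^ (2 * DIM('a))) \<le> norm (?g x)"
    proof (rule AE_I2)
      fix x :: 'a
      have "(\<Prod>b\<in>(Basis::'a set). 1 + (x \<bullet> b)\<^sup>2) \<le> (\<Prod>b\<in>(Basis::'a set). (1 + norm x)\<^sup>2)"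
      proof (rule prod_mono)
        fix b :: 'a assume b: "b \<in> Basis"
        have "(x \<bullet> b)\<^sup>2 \<le> (norm x)\<^sup>2" using Basis_le_norm[OF b, of x] by (metis abs_le_square_iff abs_norm_cancel)
        moreover have "(1 + norm x)\<^sup>2 = 1 + 2 * norm x + (norm x)\<^sup>2" by (simp add: power2_eq_square algebra_simps)
        ultimately show "0 \<le> 1 + (x \<bullet> b)\<^sup>2 \<and> 1 + (x \<bullet> b)\<^sup>2 \<le> (1 + norm x)\<^sup>2"
          using norm_ge_zero[of x] by (smt (verit) zero_le_power2)
      qed
      also have "\<dots> = (1 + norm x) ^ (2 * DIM('a))" by (simp add: power_mult)
      finally have le: "(\<Prod>b\<in>(Basis::'a set). 1 + (x \<bullet> b)\<^sup>2) \<le> (1 + norm x) ^ (2 * DIM('a))" .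
      have "0 < (\<Prod>b\<in>(Basis::'a set). 1 + (x \<bullet> b)\<^sup>2)"
        by (intro prod_pos) (auto simp: add_pos_nonneg)
      then have "1 / (1 + norm x) ^ (2 * DIM('a)) \<le> 1 / (\<Prod>b\<in>(Basis::'a set). 1 + (x \<bullet> b)\<^sup>2)"
        using le by (intro divide_left_mono) auto
      also have "\<dots> = ?g x" by (simp add: prod_inversef inverse_eq_divide prod_dividef)
      finally show "norm (1 / (1 + norm x) ^ (2 * DIM('a))) \<le> norm (?g x)"
        by (smt (verit) norm_ge_zero real_norm_def zero_le_divide_1_iff zero_le_power)
    qed
  qed simp
qed

lemma integrable_by_decay:
  fixes f :: "'a::euclidean_space \<Rightarrow> 'b::{banach,second_countable_topology}"
  assumes "f \<in> borel_measurable borel" and "\<And>x. norm (f x) \<le> C / (1 + norm x) ^ (2 * DIM('a))"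
  shows "integrable lborel f"
proof (rule Bochner_Integration.integrable_bound[OF integrable_mult_right[OF integrable_decay, of C]])
  show "AE x in lborel. norm (f x) \<le> norm (C * (1 / (1 + norm x) ^ (2 * DIM('a))))"
  proof (rule AE_I2)
    fix x
    have "norm (f x) \<le> C / (1 + norm x) ^ (2 * DIM('a))" by (rule assms(2))
    also have "\<dots> \<le> \<bar>C\<bar> / (1 + norm x) ^ (2 * DIM('a))" by (intro divide_right_mono) auto
    finally show "norm (f x) \<le> norm (C * (1 / (1 + norm x) ^ (2 * DIM('a))))" by simp
  qed
qed (use assms in simp)

lemma continuous_borel: "continuous_on UNIV f \<Longrightarrow> f \<in> borel_measurable borel"
  by (rule borel_measurable_continuous_onI)

lemma smooth_borel [measurable_dest]: "smooth f \<Longrightarrow> f \<in> borel_measurable borel"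
  by (rule continuous_borel) (rule smooth_continuous_on)

section \<open>Derivatives along lines and integration by parts\<close>

lemma onorm_scale_le: "norm y \<le> B \<Longrightarrow> onorm (\<lambda>h::real. h *\<^sub>R y) \<le> B"
proof (rule onorm_le)
  fix h :: real assume "norm y \<le> B"
  then show "norm (h *\<^sub>R y) \<le> B * norm h" using mult_left_mono[of "norm y" B "\<bar>h\<bar>"] by (simp add: mult.commute)
qed

lemma hvd_bound:
  fixes g :: "real \<Rightarrow> 'b::real_normed_vector"
  assumes "\<And>t. 0 \<le> t \<Longrightarrow> t \<le> h \<Longrightarrow> (g has_vector_derivative g' t) (at t)"
    and "\<And>t. 0 \<le> t \<Longrightarrow> t \<le> h \<Longrightarrow> norm (g' t) \<le> B" and "0 \<le> h"
  shows "norm (g h - g 0) \<le> B * h"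
proof -
  have "norm (g h - g 0) \<le> B * norm (h - 0)"
  proof (rule differentiable_bound[where S="{0..h}" and f'="\<lambda>t s. s *\<^sub>R g' t"])
    show "(g has_derivative (\<lambda>s. s *\<^sub>R g' t)) (at t within {0..h})" if "t \<in> {0..h}" for t
      unfolding has_vector_derivative_def[symmetric]
      by (rule has_vector_derivative_at_within) (use assms that in auto)
    show "onorm (\<lambda>s. s *\<^sub>R g' t) \<le> B" if "t \<in> {0..h}" for t
      by (rule onorm_scale_le) (use assms that in auto)
  qed (use assms in auto)
  then show ?thesis using assms by simp
qed

text \<open>Convolution in the \<open>q\<close>-directions makes a merely continuous function
  differentiable in these directions only. \<open>dderiv\<close> is then unspecified, as it is read
  off a Frechet derivative; \<open>hdd\<close> asks for no more than a derivative along every line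
  parallel to \<open>v\<close>.\<close>

definition hdd :: "'a::real_normed_vector \<Rightarrow> ('a \<Rightarrow> 'b::real_normed_vector) \<Rightarrow> ('a \<Rightarrow> 'b) \<Rightarrow> bool" where
  "hdd v f f' \<longleftrightarrow> (\<forall>x. ((\<lambda>t. f (x + t *\<^sub>R v)) has_vector_derivative f' x) (at 0))"

lemma hddD:
  assumes "hdd v f f'"
  shows "((\<lambda>t. f (x + t *\<^sub>R v)) has_vector_derivative f' (x + t *\<^sub>R v)) (at t)"
proof -
  have "((\<lambda>\<tau>. \<tau> - t) has_vector_derivative 1) (at t)"
    by (auto intro!: derivative_eq_intros)
  moreover have "((\<lambda>s. f ((x + t *\<^sub>R v) + s *\<^sub>R v)) has_vector_derivative f' (x + t *\<^sub>R v)) (at (t - t))"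
    using assms unfolding hdd_def by simp
  ultimately have "((\<lambda>s. f ((x + t *\<^sub>R v) + s *\<^sub>R v)) \<circ> (\<lambda>\<tau>. \<tau> - t) has_vector_derivative 1 *\<^sub>R f' (x + t *\<^sub>R v)) (at t)"
    by (rule vector_diff_chain_at)
  then show ?thesis by (simp add: o_def algebra_simps)
qed

lemma hdd_smooth: "smooth f \<Longrightarrow> hdd v f (dderiv v f)"
  unfolding hdd_def using line_derivative[of f _ v 0] by simp

lemma hdd_unique: "hdd v f g \<Longrightarrow> hdd v f h \<Longrightarrow> g = h"
  unfolding hdd_def by (intro ext) (metis vector_derivative_unique_at)

lemma hdd_add: "hdd v f f' \<Longrightarrow> hdd v g g' \<Longrightarrow> hdd v (\<lambda>x. f x + g x) (\<lambda>x. f' x + g' x)"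
  unfolding hdd_def by (auto intro!: derivative_eq_intros)

lemma hdd_const: "hdd v (\<lambda>x. c) (\<lambda>x. 0)"
  unfolding hdd_def by (auto intro!: derivative_eq_intros)

lemma hdd_diff: "hdd v f f' \<Longrightarrow> hdd v g g' \<Longrightarrow> hdd v (\<lambda>x. f x - g x) (\<lambda>x. f' x - g' x)"
  unfolding hdd_def by (auto intro!: derivative_eq_intros)

lemma hdd_sum: "(\<And>i. i \<in> A \<Longrightarrow> hdd v (f i) (f' i)) \<Longrightarrow> hdd v (\<lambda>x. \<Sum>i\<in>A. f i x) (\<lambda>x. \<Sum>i\<in>A. f' i x)"
  by (induct A rule: infinite_finite_induct) (auto intro: hdd_add hdd_const)

lemma hdd_mult:
  fixes f g :: "'a::real_normed_vector \<Rightarrow> 'b::real_normed_algebra"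
  assumes "hdd v f f'" "hdd v g g'" shows "hdd v (\<lambda>x. f x * g x) (\<lambda>x. f x * g' x + f' x * g x)"
proof -
  have "((\<lambda>t. f (x + t *\<^sub>R v) * g (x + t *\<^sub>R v)) has_vector_derivative
     f (x + 0 *\<^sub>R v) * g' x + f' x * g (x + 0 *\<^sub>R v)) (at 0)" for x
    using assms unfolding hdd_def by (intro has_vector_derivative_mult) auto
  then show ?thesis unfolding hdd_def by simp
qed

lemma hdd_cmult:
  fixes f :: "'a::real_normed_vector \<Rightarrow> 'b::real_normed_algebra"
  shows "hdd v f f' \<Longrightarrow> hdd v (\<lambda>x. c * f x) (\<lambda>x. c * f' x)"
  using hdd_mult[OF hdd_const, of v f f' c] by simp

lemma hvd_tendsto:
  assumes "(f has_vector_derivative D) (at x)"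
  shows "((\<lambda>h. (1 / h) *\<^sub>R (f (x + h) - f x)) \<longlongrightarrow> D) (at 0)"
proof -
  have "((\<lambda>h. norm (f (x + h) - f x - h *\<^sub>R D) / norm h) \<longlongrightarrow> 0) (at 0)"
    using assms unfolding has_vector_derivative_def has_derivative_at by simp
  then have "((\<lambda>h. norm ((1 / h) *\<^sub>R (f (x + h) - f x) - D)) \<longlongrightarrow> 0) (at 0)"
  proof (rule Lim_transform_eventually)
    have "\<forall>\<^sub>F h in at 0. h \<noteq> (0::real)" by (simp add: eventually_at_filter)
    then show "\<forall>\<^sub>F h in at 0. norm (f (x + h) - f x - h *\<^sub>R D) / norm h = norm ((1 / h) *\<^sub>R (f (x + h) - f x) - D)"
    proof eventually_elim
      fix h :: real assume h: "h \<noteq> 0"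
      have "(1 / h) *\<^sub>R (f (x + h) - f x) - D = (1 / h) *\<^sub>R (f (x + h) - f x - h *\<^sub>R D)"
        using h by (simp add: algebra_simps)
      then show "norm (f (x + h) - f x - h *\<^sub>R D) / norm h = norm ((1 / h) *\<^sub>R (f (x + h) - f x) - D)"
        by simp
    qed
  qed
  then show ?thesis using LIM_zero_iff tendsto_norm_zero_iff by blast
qed

text \<open>Peetre's inequality: a polynomial weight tolerates a translation at the price of the
  same power of the weight of the shift.\<close>

lemma peetre:
  fixes z w :: "'a::real_normed_vector"
  shows "1 + norm z \<le> (1 + norm w) * (1 + norm (z + w))"
proof -
  have "norm z \<le> norm (z + w) + norm w" using norm_triangle_ineq4[of "z + w" w] by simp
  moreover have "0 \<le> norm w * norm (z + w)" by simp
  moreover have "(1 + norm w) * (1 + norm (z + w)) = 1 + norm w + norm (z + w) + norm w * norm (z + w)"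
    by (simp only: distrib_left distrib_right mult_1 mult_1_right add.assoc)
  ultimately show ?thesis by linarith
qed

lemma peetre_inverse:
  fixes z w :: "'a::real_normed_vector"
  shows "1 / (1 + norm (z + w)) ^ n \<le> (1 + norm w) ^ n / (1 + norm z) ^ n"
proof -
  have "(1 + norm z) ^ n \<le> ((1 + norm w) * (1 + norm (z + w))) ^ n"
    by (intro power_mono peetre) auto
  moreover have "1 + norm (z + w) > 0" "1 + norm z > 0" by (smt (verit) norm_ge_zero)+
  ultimately show ?thesis by (simp add: divide_simps power_mult_distrib)
qed

text \<open>Each difference quotient of \<open>Y\<close> integrates to zero by translation
  invariance. The quotients converge to \<open>Y'\<close> and, by the mean value inequality and
  Peetre's inequality, are dominated through the decay of \<open>Y'\<close>; no slicing into lines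
  and no boundary terms occur.\<close>

lemma integral_hdd_zero:
  fixes Y :: "'a::euclidean_space \<Rightarrow> 'b::{banach,second_countable_topology}"
  assumes Y: "hdd v Y Y'" "integrable lborel Y" "continuous_on UNIV Y" "continuous_on UNIV Y'"
    and C: "\<And>z. norm (Y' z) \<le> C / (1 + norm z) ^ (2 * DIM('a))"
  shows "integral\<^sup>L lborel Y' = 0"
proof -
  have [measurable]: "Y \<in> borel_measurable borel" "Y' \<in> borel_measurable borel"
    using Y continuous_borel by auto
  define h where "h n = 1 / (real n + 1)" for n :: nat
  define s where "s n z = (1 / h n) *\<^sub>R (Y (z + h n *\<^sub>R v) - Y z)" for n z
  have h: "0 < h n" "h n \<le> 1" for n unfolding h_def by (auto simp: field_simps)
  have h0: "h \<longlonglongrightarrow> 0" unfolding h_def using lim_1_over_n LIMSEQ_Suc[OF lim_1_over_n] by (simp add: add.commute)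
  have hf: "filterlim h (at 0) sequentially"
  proof -
    have "h n \<noteq> 0" for n using h(1)[of n] by simp
    then show ?thesis unfolding filterlim_at using h0 by simp
  qed
  have Cpos: "0 \<le> C" using order_trans[OF norm_ge_zero C[of 0]] by simp
  have bnd: "norm (s n z) \<le> C * (1 + norm v) ^ (2 * DIM('a)) * (1 / (1 + norm z) ^ (2 * DIM('a)))" for n z
  proof -
    let ?B = "C * (1 + norm v) ^ (2 * DIM('a)) * (1 / (1 + norm z) ^ (2 * DIM('a)))"
    have "norm (Y (z + h n *\<^sub>R v) - Y (z + 0 *\<^sub>R v)) \<le> ?B * h n"
    proof (rule hvd_bound[where g="\<lambda>t. Y (z + t *\<^sub>R v)"])
      fix t assume t: "0 \<le> t" "t \<le> h n"
      show "((\<lambda>t. Y (z + t *\<^sub>R v)) has_vector_derivative Y' (z + t *\<^sub>R v)) (at t)" by (rule hddD[OF Y(1)])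
      have "norm (Y' (z + t *\<^sub>R v)) \<le> C * (1 / (1 + norm (z + t *\<^sub>R v)) ^ (2 * DIM('a)))" using C by simp
      also have "\<dots> \<le> C * ((1 + norm (t *\<^sub>R v)) ^ (2 * DIM('a)) / (1 + norm z) ^ (2 * DIM('a)))"
        by (intro mult_left_mono peetre_inverse Cpos)
      also have "\<dots> \<le> C * ((1 + norm v) ^ (2 * DIM('a)) / (1 + norm z) ^ (2 * DIM('a)))"
      proof (intro mult_left_mono divide_right_mono power_mono Cpos)
        show "1 + norm (t *\<^sub>R v) \<le> 1 + norm v" using t h[of n] by (simp add: mult_left_le_one_le)
      qed auto
      finally show "norm (Y' (z + t *\<^sub>R v)) \<le> ?B" by simp
    qed (use h[of n] in auto)
    then show ?thesis unfolding s_def using h[of n] by (simp add: divide_le_eq)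
  qed
  have "(\<lambda>n. integral\<^sup>L lborel (s n)) \<longlonglongrightarrow> integral\<^sup>L lborel Y'"
  proof (rule integral_dominated_convergence)
    show "integrable lborel (\<lambda>z::'a. C * (1 + norm v) ^ (2 * DIM('a)) * (1 / (1 + norm z) ^ (2 * DIM('a))))"
      by (rule integrable_mult_right[OF integrable_decay])
    show "AE z in lborel. (\<lambda>n. s n z) \<longlonglongrightarrow> Y' z"
    proof (rule AE_I2)
      fix z
      have "((\<lambda>h. (1 / h) *\<^sub>R (Y (z + (0 + h) *\<^sub>R v) - Y (z + 0 *\<^sub>R v))) \<longlongrightarrow> Y' z) (at 0)"
        using Y(1) unfolding hdd_def by (intro hvd_tendsto) auto
      from filterlim_compose[OF this hf] show "(\<lambda>n. s n z) \<longlonglongrightarrow> Y' z" unfolding s_def by simp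
    qed
    show "\<And>i. AE x in lborel. norm (s i x) \<le> C * (1 + norm v) ^ (2 * DIM('a)) * (1 / (1 + norm x) ^ (2 * DIM('a)))"
      using bnd by blast
    show "\<And>n. s n \<in> borel_measurable lborel" unfolding s_def by measurable
  qed simp
  moreover have "integral\<^sup>L lborel (s n) = 0" for n
  proof -
    have "integrable lborel (\<lambda>z. Y (z + h n *\<^sub>R v))" by (simp add: lborel_integrable_shift Y(2))
    then show ?thesis unfolding s_def using Y(2) lborel_integral_shift[of Y "h n *\<^sub>R v"] by simp
  qed
  ultimately show ?thesis by (simp add: LIMSEQ_const_iff)
qed

lemma integration_by_parts:
  fixes X \<phi> :: "'a::euclidean_space \<Rightarrow> complex"
  assumes X: "hdd v X X'" and phi: "hdd v \<phi> \<phi>'"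
    and c: "continuous_on UNIV X" "continuous_on UNIV X'" "continuous_on UNIV \<phi>" "continuous_on UNIV \<phi>'"
    and b: "\<And>z. norm (X z * \<phi> z) \<le> C / (1 + norm z) ^ (2 * DIM('a))"
           "\<And>z. norm (X' z * \<phi> z) \<le> C / (1 + norm z) ^ (2 * DIM('a))"
           "\<And>z. norm (X z * \<phi>' z) \<le> C / (1 + norm z) ^ (2 * DIM('a))"
  shows "(LINT z|lborel. X z * \<phi>' z) = - (LINT z|lborel. X' z * \<phi> z)"
proof -
  have i: "integrable lborel (\<lambda>z. X z * \<phi> z)" "integrable lborel (\<lambda>z. X' z * \<phi> z)" "integrable lborel (\<lambda>z. X z * \<phi>' z)"
    by (rule integrable_by_decay[OF _ b(1)] integrable_by_decay[OF _ b(2)] integrable_by_decay[OF _ b(3)],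
        intro continuous_borel continuous_intros c)+
  have "(LINT z|lborel. X z * \<phi>' z + X' z * \<phi> z) = 0"
  proof (rule integral_hdd_zero[OF hdd_mult[OF X phi] i(1)])
    show "norm (X z * \<phi>' z + X' z * \<phi> z) \<le> (C + C) / (1 + norm z) ^ (2 * DIM('a))" for z
      unfolding add_divide_distrib by (rule norm_triangle_mono[OF b(3) b(2)])
  qed (intro continuous_intros c)+
  then show ?thesis using i by (simp add: eq_neg_iff_add_eq_0)
qed

section \<open>Smooth cutoff functions\<close>

definition bump :: "real \<Rightarrow> real" where "bump x = (if x > 0 then exp (- 1 / x) else 0)"

lemma bump_poly_tendsto: "((\<lambda>x. if x > 0 then poly p (1 / x) * exp (- 1 / x) else 0) \<longlongrightarrow> (0::real)) (at 0)"
proof -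
  have "((\<lambda>u. poly p u / exp u) \<longlongrightarrow> 0) at_top"
  proof -
    have "((\<lambda>u. \<Sum>i\<le>degree p. coeff p i * (u ^ i / exp u)) \<longlongrightarrow> (\<Sum>i\<le>degree p. coeff p i * 0)) at_top"
      by (intro tendsto_intros tendsto_power_div_exp_0)
    then show ?thesis by (simp add: poly_altdef sum_divide_distrib)
  qed
  from filterlim_compose[OF this filterlim_inverse_at_top_right]
  have R: "((\<lambda>x. poly p (inverse x) / exp (inverse x)) \<longlongrightarrow> 0) (at_right 0)" .
  have "((\<lambda>x. if x > 0 then poly p (1 / x) * exp (- 1 / x) else 0) \<longlongrightarrow> (0::real)) (at_right 0)"
  proof (rule Lim_transform_eventually[OF R])
    show "\<forall>\<^sub>F x in at_right 0. poly p (inverse x) / exp (inverse x) = (if x > 0 then poly p (1 / x) * exp (- 1 / x) else 0)"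
      unfolding eventually_at_filter by (rule always_eventually) (auto simp: inverse_eq_divide exp_minus)
  qed
  moreover have "((\<lambda>x. if x > 0 then poly p (1 / x) * exp (- 1 / x) else 0) \<longlongrightarrow> (0::real)) (at_left 0)"
    by (rule Lim_transform_eventually[OF tendsto_const]) (auto simp: eventually_at_filter)
  ultimately show ?thesis by (simp add: filterlim_split_at)
qed

text \<open>The functions \<open>poly p (1 / x) * exp (- 1 / x)\<close>, extended by zero to the
  left, are closed under differentiation. Only the origin needs a limit, and there the difference
  quotient is again of this form, with \<open>p\<close> multiplied by the variable.\<close>

lemma smooth_bump: "smooth bump"
proof (rule smooth_coinduct[where P="\<lambda>h. \<exists>p::real poly. h = (\<lambda>x. if x > 0 then poly p (1 / x) * exp (- 1 / x) else 0)"])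
  show "\<exists>p::real poly. bump = (\<lambda>x. if x > 0 then poly p (1 / x) * exp (- 1 / x) else 0)"
    by (rule exI[of _ "1"]) (auto simp: bump_def)
  fix f assume "\<exists>p::real poly. f = (\<lambda>x. if x > 0 then poly p (1 / x) * exp (- 1 / x) else 0)"
  then obtain p :: "real poly" where f: "f = (\<lambda>x. if x > 0 then poly p (1 / x) * exp (- 1 / x) else 0)" by blast
  \<comment> \<open>With \<open>u = 1 / x\<close>, the derivative of
    \<open>poly p u * exp (- u)\<close> with respect to \<open>x\<close> is
    \<open>poly (p - pderiv p) u * u\<^sup>2 * exp (- u)\<close>.\<close>
  define q where "q = (p - pderiv p) * monom 1 2"
  define g where "g x = (if x > 0 then poly q (1 / x) * exp (- 1 / x) else 0)" for x :: real
  have D: "DERIV f x :> g x" for x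
  proof -
    consider "x > 0" | "x = 0" | "x < 0" by linarith
    then show ?thesis
    proof cases
      case 1
      have "((\<lambda>x. poly p (1 / x) * exp (- 1 / x)) has_real_derivative g x) (at x)"
        using 1 unfolding g_def q_def
        by (auto intro!: derivative_eq_intros DERIV_chain2[OF poly_DERIV] simp: poly_monom field_simps power2_eq_square)
      moreover have "\<forall>\<^sub>F y in nhds x. y > 0" using 1 by (simp add: eventually_nhds_in_open[of "{0<..}", simplified])
      ultimately show ?thesis unfolding f
        by (subst DERIV_cong_ev[OF refl _ refl, where g="\<lambda>x. poly p (1 / x) * exp (- 1 / x)"]) (auto elim: eventually_mono)
    next
      case 2
      have "((\<lambda>h. if h > 0 then poly (p * monom 1 1) (1 / h) * exp (- 1 / h) else 0) \<longlongrightarrow> 0) (at 0)"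
        by (rule bump_poly_tendsto)
      also have "(\<lambda>h. if h > 0 then poly (p * monom 1 1) (1 / h) * exp (- 1 / h) else 0) = (\<lambda>h. (f (0 + h) - f 0) / h)"
        by (auto simp: f poly_monom)
      finally show ?thesis using 2 unfolding DERIV_def g_def by simp
    next
      case 3
      have "((\<lambda>x. 0) has_real_derivative g x) (at x)" using 3 unfolding g_def by simp
      moreover have "\<forall>\<^sub>F y in nhds x. y < 0" using 3 by (simp add: eventually_nhds_in_open[of "{..<0}", simplified])
      ultimately show ?thesis unfolding f
        by (subst DERIV_cong_ev[OF refl _ refl, where g="\<lambda>x. 0"]) (auto elim: eventually_mono)
    qed
  qed
  then have D': "(f has_derivative (\<lambda>v. g x * v)) (at x)" for x by (simp add: has_field_derivative_def)
  have "\<exists>p::real poly. dderiv v f = (\<lambda>x. if x > 0 then poly p (1 / x) * exp (- 1 / x) else 0)" for v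
    by (rule exI[of _ "smult v q"]) (auto simp: dderiv_eq[OF D'] g_def)
  then show "(\<forall>x. f differentiable at x) \<and>
     (\<forall>v. \<exists>p::real poly. dderiv v f = (\<lambda>x. if x > 0 then poly p (1 / x) * exp (- 1 / x) else 0))"
    using D' by (auto simp: differentiable_def)
qed

text \<open>Nesting \<open>bump\<close> avoids a quotient of two functions:
  \<open>bump 1 - bump x\<close> equals \<open>bump 1\<close> for \<open>x \<le> 0\<close> and is at
  most 0 for \<open>x \<ge> 1\<close>, so smoothness reduces to that of a composition.\<close>

definition step :: "real \<Rightarrow> real" where "step x = bump (bump 1 - bump x) / bump (bump 1)"

lemma bump_mono: "x \<le> y \<Longrightarrow> bump x \<le> bump y"
  by (auto simp: bump_def divide_simps)

lemma bump_pos: "x > 0 \<Longrightarrow> bump x > 0"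
  by (auto simp: bump_def)

lemma step_props: "0 \<le> step x" "step x \<le> 1" "x \<le> 0 \<Longrightarrow> step x = 1" "x \<ge> 1 \<Longrightarrow> step x = 0"
proof -
  have p: "bump (bump 1) > 0" by (intro bump_pos) simp
  have n: "bump y \<ge> 0" for y by (simp add: bump_def)
  show "0 \<le> step x" unfolding step_def using p n by (simp add: divide_simps)
  show "step x \<le> 1" unfolding step_def using p bump_mono[of "bump 1 - bump x" "bump 1"] n[of x] by simp
  show "x \<le> 0 \<Longrightarrow> step x = 1" unfolding step_def using p by (simp add: bump_def)
  show "x \<ge> 1 \<Longrightarrow> step x = 0" unfolding step_def using bump_mono[of 1 x] by (simp add: bump_def)
qed

lemma smooth_step: "smooth step"
proof -
  have "smooth (\<lambda>x. (1 / bump (bump 1)) * bump (bump 1 - bump x))"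
    by (rule smooth_cmult, rule smooth_comp_real[OF smooth_bump], rule smooth_diff[OF smooth_const smooth_bump])
  then show ?thesis by (simp add: step_def[abs_def])
qed

lemma smooth_norm_sq: "smooth (\<lambda>x::'a::euclidean_space. (norm x)\<^sup>2)"
proof -
  have "smooth (\<lambda>x::'a. \<Sum>b\<in>Basis. (x \<bullet> b) ^ 2)"
    by (intro smooth_sum smooth_power smooth_linear bounded_linear_inner_left)
  moreover have "(norm x)\<^sup>2 = (\<Sum>b\<in>Basis. (x \<bullet> b) ^ 2)" for x :: 'a
    unfolding power2_norm_eq_inner by (subst euclidean_inner) (simp add: power2_eq_square)
  ultimately show ?thesis by simp
qed

lemma cutoff_exists:
  assumes "0 \<le> a" "a < b"
  obtains \<eta> :: "'a::euclidean_space \<Rightarrow> real" where "smooth \<eta>" "\<And>x. 0 \<le> \<eta> x" "\<And>x. \<eta> x \<le> 1"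
    "\<And>x. norm x \<le> a \<Longrightarrow> \<eta> x = 1" "\<And>x. norm x \<ge> b \<Longrightarrow> \<eta> x = 0"
proof -
  have ab: "a\<^sup>2 < b\<^sup>2" using assms by (simp add: power_strict_mono)
  \<comment> \<open>The squared norm is smooth at the origin, the norm is not. The affine rescaling
    sends \<open>a\<^sup>2\<close> to 0 and \<open>b\<^sup>2\<close> to 1.\<close>
  define \<eta> where "\<eta> x = step ((1 / (b\<^sup>2 - a\<^sup>2)) * ((norm x)\<^sup>2 - a\<^sup>2))" for x :: 'a
  have "smooth \<eta>" unfolding \<eta>_def[abs_def]
    by (rule smooth_comp_real[OF smooth_step]) (intro smooth_cmult smooth_diff smooth_norm_sq smooth_const)
  moreover have "\<eta> x = 1" if "norm x \<le> a" for x
  proof -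
    have "(norm x)\<^sup>2 \<le> a\<^sup>2" using that by (simp add: power_mono)
    then show ?thesis unfolding \<eta>_def using ab by (intro step_props) (auto simp: divide_simps)
  qed
  moreover have "\<eta> x = 0" if "norm x \<ge> b" for x
  proof -
    have "(norm x)\<^sup>2 \<ge> b\<^sup>2" using that assms by (simp add: power_mono)
    then show ?thesis unfolding \<eta>_def using ab by (intro step_props) (auto simp: divide_simps)
  qed
  ultimately show ?thesis using that[of \<eta>] step_props unfolding \<eta>_def by blast
qed

lemma closure_support_subset:
  assumes "\<And>x. r \<le> norm (x - z0) \<Longrightarrow> \<phi> x = 0"
  shows "closure {x::'a::euclidean_space. \<phi> x \<noteq> 0} \<subseteq> cball z0 r" "compact (closure {x. \<phi> x \<noteq> 0})"
proof -
  have "{x. \<phi> x \<noteq> 0} \<subseteq> cball z0 r"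
    using assms by (force simp: dist_norm norm_minus_commute)
  then show sub: "closure {x. \<phi> x \<noteq> 0} \<subseteq> cball z0 r" by (rule closure_minimal) simp
  show "compact (closure {x. \<phi> x \<noteq> 0})"
    using sub by (meson bounded_cball bounded_subset closed_closure compact_eq_bounded_closed)
qed

lemma bump_exists:
  assumes r: "0 < r"
  obtains \<phi> :: "'a::euclidean_space \<Rightarrow> real" where "smooth \<phi>" "\<And>x. 0 \<le> \<phi> x" "\<phi> z0 = 1"
    "\<And>x. r \<le> norm (x - z0) \<Longrightarrow> \<phi> x = 0"
    "integrable lborel \<phi>" "0 < integral\<^sup>L lborel \<phi>"
proof -
  obtain \<eta> :: "'a \<Rightarrow> real" where eta: "smooth \<eta>" "\<And>x. 0 \<le> \<eta> x" "\<And>x. \<eta> x \<le> 1"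
      "\<And>x. norm x \<le> r/2 \<Longrightarrow> \<eta> x = 1" "\<And>x. norm x \<ge> r \<Longrightarrow> \<eta> x = 0"
    using cutoff_exists[of "r/2" r] r by auto
  define \<phi> where "\<phi> x = \<eta> (x + - z0)" for x
  have s: "smooth \<phi>" unfolding \<phi>_def by (rule smooth_affine[OF bounded_linear_ident eta(1)])
  have cb: "integrable lborel (indicator (cball z0 R) :: 'a \<Rightarrow> real)" for R
    by (rule integrable_real_indicator, simp, rule emeasure_bounded_finite, rule bounded_cball)
  have i: "integrable lborel \<phi>"
  proof (rule Bochner_Integration.integrable_bound[OF cb[of r]])
    show "AE x in lborel. norm (\<phi> x) \<le> norm (indicat_real (cball z0 r) x)"
      using eta by (intro AE_I2) (auto simp: \<phi>_def indicator_def dist_norm norm_minus_commute not_le)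
  qed (use smooth_borel[OF s] in simp)
  have "(LINT x|lborel. indicat_real (cball z0 (r/2)) x) \<le> integral\<^sup>L lborel \<phi>"
    using eta by (intro integral_mono cb i) (auto simp: \<phi>_def indicator_def dist_norm norm_minus_commute)
  moreover have "(LINT x|lborel. indicat_real (cball z0 (r/2)) x) > 0"
    using content_cball_pos[of "r/2" z0] r by simp
  ultimately have pos: "integral\<^sup>L lborel \<phi> > 0" by linarith
  show ?thesis
    by (rule that[of \<phi>]) (use s eta i r pos in \<open>auto simp: \<phi>_def\<close>)
qed

text \<open>Duality between L1 and the supremum norm for continuous densities. If the bound failed
  at \<open>z0\<close>, the real part of the phase-rotated \<open>H\<close> would exceed
  \<open>B'\<close>, the midpoint of \<open>B\<close> and \<open>norm (H z0)\<close>, on a whole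
  ball, and a bump supported there would violate the assumption. This converts estimates of
  functionals into pointwise ones.\<close>

lemma continuous_bound_by_testing:
  fixes H :: "'a::euclidean_space \<Rightarrow> complex"
  assumes c: "continuous_on UNIV H" and V: "open V" "z0 \<in> V"
    and B: "\<And>\<phi>::'a \<Rightarrow> real. smooth \<phi> \<Longrightarrow> (\<And>x. 0 \<le> \<phi> x) \<Longrightarrow> compact (closure {x. \<phi> x \<noteq> 0}) \<Longrightarrow> closure {x. \<phi> x \<noteq> 0} \<subseteq> V \<Longrightarrow>
        norm (LINT z|lborel. H z * complex_of_real (\<phi> z)) \<le> B * (LINT z|lborel. \<phi> z)"
  shows "norm (H z0) \<le> B"
proof (rule ccontr)
  assume "\<not> norm (H z0) \<le> B"
  then have gt: "B < norm (H z0)" by simp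
  define \<theta> where "\<theta> = (if H z0 = 0 then 1 else cnj (H z0) / of_real (norm (H z0)))"
  define B' where "B' = (B + norm (H z0)) / 2"
  have n: "norm \<theta> = 1" unfolding \<theta>_def by (simp add: norm_divide)
  have th: "\<theta> * H z0 = of_real (norm (H z0))"
    unfolding \<theta>_def by (auto simp: mult.commute complex_norm_square[symmetric] power2_eq_square)
  have "continuous_on UNIV (\<lambda>z. Re (\<theta> * H z))" by (intro continuous_intros c)
  then have "open {z. B' < Re (\<theta> * H z)}"
    by (intro open_Collect_less) auto
  then have "open (V \<inter> {z. B' < Re (\<theta> * H z)})" using V by blast
  moreover have "z0 \<in> V \<inter> {z. B' < Re (\<theta> * H z)}" using V gt by (simp add: B'_def th del: times_complex.sel)
  ultimately obtain r where r: "r > 0" "cball z0 r \<subseteq> V \<inter> {z. B' < Re (\<theta> * H z)}"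
    using open_contains_cball by metis
  obtain \<phi> :: "'a \<Rightarrow> real" where phi: "smooth \<phi>" "\<And>x. 0 \<le> \<phi> x" "\<phi> z0 = 1"
    "\<And>x. r \<le> norm (x - z0) \<Longrightarrow> \<phi> x = 0" "integrable lborel \<phi>" "0 < integral\<^sup>L lborel \<phi>"
    using bump_exists[OF r(1), of z0] by blast
  have sub: "closure {x. \<phi> x \<noteq> 0} \<subseteq> cball z0 r" and cpt: "compact (closure {x. \<phi> x \<noteq> 0})"
    using closure_support_subset[of r z0 \<phi>] phi by auto
  have le: "norm (LINT z|lborel. H z * complex_of_real (\<phi> z)) \<le> B * (LINT z|lborel. \<phi> z)"
    by (rule B) (use phi sub cpt r in auto)
  have Hc: "continuous_on (cball z0 r) H" using c continuous_on_subset by blast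
  obtain M where M: "\<And>z. z \<in> cball z0 r \<Longrightarrow> norm (H z) \<le> M"
    using compact_imp_bounded[OF compact_continuous_image[OF Hc compact_cball]] unfolding bounded_iff by blast
  have iH: "integrable lborel (\<lambda>z. H z * complex_of_real (\<phi> z))"
  proof (rule Bochner_Integration.integrable_bound[OF integrable_mult_right[OF phi(5), of M]])
    show "AE z in lborel. norm (H z * complex_of_real (\<phi> z)) \<le> norm (M * \<phi> z)"
    proof (rule AE_I2)
      fix z
      show "norm (H z * complex_of_real (\<phi> z)) \<le> norm (M * \<phi> z)"
      proof (cases "z \<in> cball z0 r")
        case True
        then show ?thesis using M[OF True] phi(2)[of z]
          by (simp add: norm_mult abs_mult) (meson abs_ge_self mult_right_mono order_trans)
      next
        case False
        then show ?thesis using phi(4)[of z] by (simp add: dist_norm norm_minus_commute)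
      qed
    qed
    show "(\<lambda>z. H z * complex_of_real (\<phi> z)) \<in> borel_measurable lborel"
      using continuous_borel[OF c] smooth_borel[OF phi(1)] by simp
  qed
  have iT: "integrable lborel (\<lambda>z. \<theta> * (H z * complex_of_real (\<phi> z)))"
    by (rule integrable_mult_right[OF iH])
  have "B' * (LINT z|lborel. \<phi> z) = (LINT z|lborel. B' * \<phi> z)" by simp
  also have "\<dots> \<le> (LINT z|lborel. Re (\<theta> * (H z * complex_of_real (\<phi> z))))"
  proof (rule integral_mono)
    show "integrable lborel (\<lambda>z. B' * \<phi> z)" using phi by simp
    show "integrable lborel (\<lambda>z. Re (\<theta> * (H z * complex_of_real (\<phi> z))))"
      by (rule integrable_bounded_linear[OF bounded_linear_Re iT])
    fix z
    show "B' * \<phi> z \<le> Re (\<theta> * (H z * complex_of_real (\<phi> z)))"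
    proof (cases "z \<in> cball z0 r")
      case True
      then have "B' \<le> Re (\<theta> * H z)" using r by force
      then have "B' * \<phi> z \<le> Re (\<theta> * H z) * \<phi> z" using phi(2) by (rule mult_right_mono)
      then show ?thesis by (simp flip: mult.assoc)
    next
      case False
      then show ?thesis using phi(4)[of z] by (simp add: dist_norm norm_minus_commute)
    qed
  qed
  also have "\<dots> = Re (\<theta> * (LINT z|lborel. H z * complex_of_real (\<phi> z)))"
    using integral_bounded_linear[OF bounded_linear_Re iT] by simp
  also have "\<dots> \<le> norm (\<theta> * (LINT z|lborel. H z * complex_of_real (\<phi> z)))" by (rule complex_Re_le_cmod)
  also have "\<dots> \<le> B * (LINT z|lborel. \<phi> z)" using le n by (simp add: norm_mult)
  finally have "B' \<le> B" using phi(6) by simp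
  then show False using gt by (simp add: B'_def)
qed

section \<open>Schwartz functions and tempered functionals\<close>

lemma dderivs_local:
  fixes f g :: "'a::real_normed_vector \<Rightarrow> 'b::real_normed_vector"
  assumes fg: "smooth f" "smooth g" and S: "open S" "\<And>x. x \<in> S \<Longrightarrow> f x = g x" and x: "x \<in> S"
  shows "dderivs vs f x = dderivs vs g x"
  using x
proof (induct vs arbitrary: x)
  case Nil then show ?case using S by simp
next
  case (Cons v vs)
  have "(dderivs vs g has_derivative (\<lambda>v. dderiv v (dderivs vs g) x)) (at x)"
    by (rule smooth_has_derivative[OF smooth_dderivs[OF fg(2)]])
  then have "(dderivs vs f has_derivative (\<lambda>v. dderiv v (dderivs vs g) x)) (at x)"
    by (rule has_derivative_transform_within_open[OF _ S(1) Cons(2)]) (simp add: Cons(1))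
  then show ?case by (simp add: dderiv_eq)
qed

lemma dderivs_zero: "dderivs vs (\<lambda>x. 0) = (\<lambda>x. 0)"
  by (induct vs) (simp_all add: dderiv_const)

lemma dderivs_zero_outside:
  assumes f: "smooth f" and K: "closed K" "\<And>x. x \<notin> K \<Longrightarrow> f x = 0" and x: "x \<notin> K"
  shows "dderivs vs f x = 0"
  using dderivs_local[OF f smooth_const[of 0], of "- K" x vs] K x by (simp add: dderivs_zero open_Compl)

lemma one_plus_norm_pos [simp]: "0 < 1 + norm x" "0 \<le> 1 + norm x" "1 \<le> 1 + norm x" "1 + norm x \<noteq> 0"
proof -
  show "0 < 1 + norm x" by (smt (verit) norm_ge_zero)
  then show "0 \<le> 1 + norm x" "1 \<le> 1 + norm x" "1 + norm x \<noteq> 0" by auto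
qed

section \<open>Families of Schwartz functions with a common rate\<close>

definition fbd :: "'i set \<Rightarrow> ('i \<Rightarrow> real) \<Rightarrow> ('i \<Rightarrow> 'a::euclidean_space \<Rightarrow> complex) \<Rightarrow> bool" where
  "fbd I w F \<longleftrightarrow> (\<forall>k. \<exists>C. \<forall>i\<in>I. \<forall>x. (1 + norm x) ^ k * norm (F i x) \<le> C * w i)"

text \<open>Every Schwartz seminorm of \<open>F i\<close> is \<open>O(w i)\<close>, uniformly in
  \<open>i\<close>. This stands in for the topology of Schwartz space: convergence is always stated
  with an explicit rate \<open>w\<close>, which \<open>tempered_family\<close> transports to the
  values of a functional.\<close>

definition sfam :: "'i set \<Rightarrow> ('i \<Rightarrow> real) \<Rightarrow> ('i \<Rightarrow> 'a::euclidean_space \<Rightarrow> complex) \<Rightarrow> bool" where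
  "sfam I w F \<longleftrightarrow> (\<forall>i\<in>I. smooth (F i)) \<and> (\<forall>vs. fbd I w (\<lambda>i. dderivs vs (F i)))"

lemma fbd_add:
  assumes "fbd I w f" "fbd I w g" "\<And>i x. i \<in> I \<Longrightarrow> h i x = f i x + g i x"
  shows "fbd I w h"
  unfolding fbd_def
proof
  fix k
  obtain C1 C2 where C: "\<And>i x. i \<in> I \<Longrightarrow> (1 + norm x) ^ k * norm (f i x) \<le> C1 * w i"
    "\<And>i x. i \<in> I \<Longrightarrow> (1 + norm x) ^ k * norm (g i x) \<le> C2 * w i"
    using assms unfolding fbd_def by metis
  have "(1 + norm x) ^ k * norm (h i x) \<le> (C1 + C2) * w i" if "i \<in> I" for i x
  proof -
    have "(1 + norm x) ^ k * norm (h i x) \<le> (1 + norm x) ^ k * (norm (f i x) + norm (g i x))"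
      unfolding assms(3)[OF that] by (intro mult_left_mono norm_triangle_ineq) simp
    then show ?thesis using C[OF that, of x] by (simp add: distrib_left distrib_right)
  qed
  then show "\<exists>C. \<forall>i\<in>I. \<forall>x. (1 + norm x) ^ k * norm (h i x) \<le> C * w i" by blast
qed

lemma fbd_cong: "fbd I w f \<Longrightarrow> (\<And>i x. i \<in> I \<Longrightarrow> g i x = f i x) \<Longrightarrow> fbd I w g"
  unfolding fbd_def by simp

lemma sfam_sumcl:
  assumes "\<And>f. B f \<Longrightarrow> (\<forall>i\<in>I. \<forall>x. f i differentiable (at x)) \<and> fbd I w f \<and> (\<forall>v. sumcl I B (\<lambda>i. dderiv v (f i)))"
    and F: "sumcl I B F"
  shows "sfam I w F"
proof -
  have "(\<forall>i\<in>I. \<forall>x. dderivs vs (F i) differentiable (at x)) \<and> fbd I w (\<lambda>i. dderivs vs (F i))" for vs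
    by (rule sumcl_coinduct[where B=B]) (use assms fbd_add fbd_cong in blast)+
  then show ?thesis unfolding sfam_def smooth_def by blast
qed

section \<open>Schwartz functions and their multipliers\<close>

lemma schwartz_iff:
  "schwartz f \<longleftrightarrow> smooth f \<and> (\<forall>vs k. \<exists>C. \<forall>x. (1 + norm x) ^ k * norm (dderivs vs f x) \<le> C)"
  unfolding schwartz_def bounded_iff by simp

lemma schwartz_sfam: "schwartz f \<longleftrightarrow> sfam (UNIV :: unit set) (\<lambda>_. 1) (\<lambda>_. f)"
  unfolding sfam_def fbd_def schwartz_iff by simp

lemma sfam_schwartz: "sfam I w F \<Longrightarrow> i \<in> I \<Longrightarrow> schwartz (F i)"
  unfolding sfam_def fbd_def schwartz_iff by blast

lemma schwartz_smooth: "schwartz f \<Longrightarrow> smooth f"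
  by (simp add: schwartz_def)

lemma schwartz_bound:
  assumes "schwartz f" obtains C where "0 \<le> C" "\<And>x. norm (dderivs vs f x) \<le> C / (1 + norm x) ^ k"
proof -
  obtain C where C: "\<And>x. (1 + norm x) ^ k * norm (dderivs vs f x) \<le> C" using assms unfolding schwartz_iff by meson
  have "0 \<le> (1 + norm (0::'a)) ^ k * norm (dderivs vs f 0)" by (intro mult_nonneg_nonneg) auto
  then have "0 \<le> C" using C[of 0] by linarith
  then show ?thesis using that[of C] C by (simp add: le_divide_eq mult.commute)
qed

lemma schwartz_bound0:
  assumes "schwartz f" obtains C where "0 \<le> C" "\<And>x. norm (f x) \<le> C / (1 + norm x) ^ k"
  using schwartz_bound[OF assms, of "[]" k] by auto

lemma schwartz_dderivs: "schwartz f \<Longrightarrow> schwartz (dderivs vs f)"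
  unfolding schwartz_iff by (simp add: smooth_dderivs flip: dderivs_append)

lemma schwartz_dderiv: "schwartz f \<Longrightarrow> schwartz (dderiv v f)"
  using schwartz_dderivs[of f "[v]"] by simp

text \<open>The multiplier space of Schwartz space, commonly written O_M; the power in the bound may
  depend on the derivative.\<close>

definition slow :: "('a::euclidean_space \<Rightarrow> complex) \<Rightarrow> bool" where
  "slow f \<longleftrightarrow> smooth f \<and> (\<forall>vs. \<exists>C n. \<forall>x. norm (dderivs vs f x) \<le> C * (1 + norm x) ^ n)"

lemma slow_smooth: "slow f \<Longrightarrow> smooth f" by (simp add: slow_def)

lemma slow_bound: assumes "slow f" obtains C n where "0 \<le> C" "\<And>x. norm (f x) \<le> C * (1 + norm x) ^ n"
proof -
  obtain C n where C: "\<And>x. norm (f x) \<le> C * (1 + norm x) ^ n"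
    using assms unfolding slow_def by (metis dderivs.simps(1))
  have "0 \<le> C * (1 + norm (0::'a)) ^ n" using order_trans[OF norm_ge_zero C[of 0]] .
  then show ?thesis using that[of C n] C by simp
qed

lemma slow_dderiv: "slow f \<Longrightarrow> slow (dderiv v f)"
proof -
  assume f: "slow f"
  have "dderivs vs (dderiv v f) = dderivs (vs @ [v]) f" for vs by (simp add: dderivs_append)
  then show ?thesis using f unfolding slow_def by (auto simp: smooth_dderiv)
qed

text \<open>The one-point index type reduces a single function to the coinduction for
  families.\<close>

lemma slow_sumcl:
  fixes F :: "unit \<Rightarrow> 'a::euclidean_space \<Rightarrow> complex"
  assumes B: "\<And>f. B f \<Longrightarrow> (\<forall>x. f () differentiable (at x)) \<and> (\<exists>C n. \<forall>x. norm (f () x) \<le> C * (1 + norm x) ^ n) \<and>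
      (\<forall>v. sumcl UNIV B (\<lambda>i. dderiv v (f i)))"
    and F: "sumcl UNIV B F"
  shows "slow (F ())"
proof -
  have "(\<forall>i\<in>UNIV. \<forall>x. dderivs vs (F i) differentiable (at x)) \<and> (\<lambda>F. \<exists>C n. \<forall>x. norm (F () x) \<le> C * (1 + norm x) ^ n) (\<lambda>i. dderivs vs (F i))" for vs
  proof (rule sumcl_coinduct[where B=B, OF _ _ _ F])
    fix f assume "B f"
    then show "(\<forall>i\<in>UNIV. \<forall>x. f i differentiable at x) \<and> (\<exists>C n. \<forall>x. norm (f () x) \<le> C * (1 + norm x) ^ n) \<and>
         (\<forall>v. sumcl UNIV B (\<lambda>i. dderiv v (f i)))" using B by simp
  next
    fix f g h :: "unit \<Rightarrow> 'a \<Rightarrow> complex"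
    assume f: "\<exists>C n. \<forall>x. norm (f () x) \<le> C * (1 + norm x) ^ n"
      and g: "\<exists>C n. \<forall>x. norm (g () x) \<le> C * (1 + norm x) ^ n" and h: "\<And>i x. i \<in> UNIV \<Longrightarrow> h i x = f i x + g i x"
    obtain C1 n1 C2 n2 where C: "\<And>x. norm (f () x) \<le> C1 * (1 + norm x) ^ n1" "\<And>x. norm (g () x) \<le> C2 * (1 + norm x) ^ n2"
      using f g by metis
    have up: "C * (1 + norm x) ^ n \<le> \<bar>C\<bar> * (1 + norm x) ^ (n + m)" for C :: real and x :: 'a and n m
      by (intro mult_mono power_increasing) auto
    have "norm (h () x) \<le> (\<bar>C1\<bar> + \<bar>C2\<bar>) * (1 + norm x) ^ (n1 + n2)" for x
    proof -
      have "norm (h () x) \<le> norm (f () x) + norm (g () x)" using h norm_triangle_ineq by simp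
      then show ?thesis using C[of x] up[of C1 x n1 n2] up[of C2 x n2 n1] by (simp add: distrib_right add.commute)
    qed
    then show "\<exists>C n. \<forall>x. norm (h () x) \<le> C * (1 + norm x) ^ n" by blast
  qed simp
  then show ?thesis unfolding slow_def smooth_def by blast
qed

lemma slow_mult: assumes "slow a" "slow b" shows "slow (\<lambda>x. a x * b x)"
proof -
  let ?B = "\<lambda>F. \<exists>f g. slow f \<and> slow g \<and> F = (\<lambda>(i::unit) (x::'a). f x * g x)"
  have "slow ((\<lambda>(i::unit) x. a x * b x) ())"
  proof (rule slow_sumcl[where B="?B"])
    fix F assume "?B F"
    then obtain f g where fg: "slow f" "slow g" and F: "F = (\<lambda>(i::unit) x. f x * g x)" by blast
    note s = fg[THEN slow_smooth]
    have "sumcl UNIV ?B (\<lambda>i. dderiv v (F i))" for v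
      unfolding F by (rule sumcl_mult[OF s]) (use fg slow_dderiv in blast)+
    moreover obtain C n C' n' where "0 \<le> C" "\<And>x. norm (f x) \<le> C * (1 + norm x) ^ n" "0 \<le> C'" "\<And>x. norm (g x) \<le> C' * (1 + norm x) ^ n'"
      using slow_bound fg by metis
    then have "norm (F () x) \<le> (C * C') * (1 + norm x) ^ (n + n')" for x
      using mult_mono[of "norm (f x)" "C * (1 + norm x) ^ n" "norm (g x)" "C' * (1 + norm x) ^ n'"]
      by (simp add: F norm_mult power_add mult_ac)
    moreover have "F () differentiable at x" for x
      unfolding F by (intro differentiable_mult smooth_differentiable s)
    ultimately show "(\<forall>x. F () differentiable (at x)) \<and> (\<exists>C n. \<forall>x. norm (F () x) \<le> C * (1 + norm x) ^ n) \<and>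
      (\<forall>v. sumcl UNIV ?B (\<lambda>i. dderiv v (F i)))" by blast
  qed (rule sumcl.base, use assms in auto)
  then show ?thesis .
qed

lemma slow_const: "slow (\<lambda>x. c)"
  unfolding slow_def
proof (intro conjI allI smooth_const)
  fix vs :: "'a list"
  have "norm (dderivs vs (\<lambda>x. c) x) \<le> norm c * (1 + norm x) ^ 0" for x
    by (cases vs rule: rev_cases) (simp_all add: dderivs_append dderiv_const dderivs_zero)
  then show "\<exists>C n. \<forall>x. norm (dderivs vs (\<lambda>x. c) x) \<le> C * (1 + norm x) ^ n" by blast
qed

lemma slow_add: assumes "slow f" "slow g" shows "slow (\<lambda>x. f x + g x)"
proof -
  have "slow ((\<lambda>(i::unit) x. f x + g x) ())"
  proof (rule slow_sumcl[where B="\<lambda>F. slow (F ())"])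
    fix F :: "unit \<Rightarrow> 'a \<Rightarrow> complex" assume F: "slow (F ())"
    have "\<exists>C n. \<forall>x. norm (F () x) \<le> C * (1 + norm x) ^ n" using slow_bound[OF F] by metis
    moreover have "sumcl UNIV (\<lambda>F. slow (F ())) (\<lambda>i. dderiv v (F i))" for v
      by (rule sumcl.base[of _ "\<lambda>i. dderiv v (F i)"]) (use F slow_dderiv in auto)
    ultimately show "(\<forall>x. F () differentiable (at x)) \<and> (\<exists>C n. \<forall>x. norm (F () x) \<le> C * (1 + norm x) ^ n) \<and>
      (\<forall>v. sumcl UNIV (\<lambda>F. slow (F ())) (\<lambda>i. dderiv v (F i)))" using smooth_differentiable[OF slow_smooth[OF F]] by blast
  next
    show "sumcl UNIV (\<lambda>F. slow (F ())) (\<lambda>(i::unit) x. f x + g x)"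
      by (rule sumcl_bases[of _ "\<lambda>_. f" "\<lambda>_. g"]) (use assms in auto)
  qed
  then show ?thesis .
qed

lemma slow_inner: "slow (\<lambda>x. complex_of_real (x \<bullet> w))"
proof -
  have bl: "bounded_linear (\<lambda>x. complex_of_real (x \<bullet> w))"
    by (rule bounded_linear_compose[OF bounded_linear_of_real bounded_linear_inner_left])
  have "norm (dderivs vs (\<lambda>x. complex_of_real (x \<bullet> w)) x) \<le> (norm w + norm w * norm (last vs)) * (1 + norm x) ^ 1" for vs :: "'a list" and x
  proof (cases vs rule: rev_cases)
    case Nil
    have "\<bar>x \<bullet> w\<bar> \<le> norm w * norm x" using Cauchy_Schwarz_ineq2[of x w] by (simp add: mult.commute)
    also have "\<dots> \<le> (norm w + norm w * norm (last vs)) * (1 + norm x)" by (intro mult_mono) auto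
    finally show ?thesis using Nil by simp
  next
    case (snoc ys v)
    have "dderivs vs (\<lambda>x. complex_of_real (x \<bullet> w)) = dderivs ys (\<lambda>x. complex_of_real (v \<bullet> w))"
      unfolding snoc by (simp add: dderivs_append dderiv_linear[OF bl])
    then have "norm (dderivs vs (\<lambda>x. complex_of_real (x \<bullet> w)) x) \<le> \<bar>v \<bullet> w\<bar>"
      by (cases ys rule: rev_cases) (simp_all add: dderivs_append dderiv_const dderivs_zero)
    also have "\<dots> \<le> (norm w + norm w * norm v) * 1" by (smt (verit) Cauchy_Schwarz_ineq2 mult.commute mult_1_right norm_ge_zero)
    also have "\<dots> \<le> (norm w + norm w * norm v) * (1 + norm x)" by (intro mult_left_mono) auto
    finally show ?thesis using snoc by simp
  qed
  then show ?thesis unfolding slow_def using smooth_linear[OF bl] by blast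
qed

lemma slow_cis: "slow (\<lambda>x. cis (k \<bullet> x))"
proof -
  have "\<exists>c. dderivs vs (\<lambda>x. cis (k \<bullet> x)) = (\<lambda>x. c * cis (k \<bullet> x))" for vs
  proof (induct vs)
    case Nil show ?case by (rule exI[of _ 1]) simp
  next
    case (Cons v vs)
    then obtain c where "dderivs vs (\<lambda>x. cis (k \<bullet> x)) = (\<lambda>x. c * cis (k \<bullet> x))" by blast
    then show ?case by (auto simp: dderiv_cmult[OF smooth_cis] dderiv_cis intro!: exI[of _ "c * (\<i> * of_real (k \<bullet> v))"])
  qed
  then have "\<exists>C n. \<forall>x. norm (dderivs vs (\<lambda>x. cis (k \<bullet> x)) x) \<le> C * (1 + norm x) ^ n" for vs
    by (metis norm_cis norm_mult mult.right_neutral order_refl power_0)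
  then show ?thesis unfolding slow_def using smooth_cis by blast
qed

lemma slow_comp_linear:
  assumes A: "bounded_linear A" and f: "slow f" shows "slow (\<lambda>x. f (A x))"
  unfolding slow_def
proof (intro conjI allI smooth_comp_linear[OF A slow_smooth[OF f]])
  fix vs
  obtain K where K: "\<And>x. norm (A x) \<le> norm x * K" "K \<ge> 0" using bounded_linear.nonneg_bounded[OF A] by blast
  obtain C n where C: "\<And>x. norm (dderivs (map A vs) f x) \<le> C * (1 + norm x) ^ n" using f unfolding slow_def by blast
  have "norm (dderivs vs (\<lambda>x. f (A x)) x) \<le> (\<bar>C\<bar> * (1 + K) ^ n) * (1 + norm x) ^ n" for x
  proof -
    have "1 + norm (A x) \<le> (1 + K) * (1 + norm x)"     proof -
      have "(1 + K) * (1 + norm x) = 1 + K + norm x + norm x * K" by (simp add: algebra_simps)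
      then show ?thesis using K(1)[of x] K(2) norm_ge_zero[of x] by linarith
    qed
    then have "(1 + norm (A x)) ^ n \<le> ((1 + K) * (1 + norm x)) ^ n" by (rule power_mono) simp
    then have "C * (1 + norm (A x)) ^ n \<le> \<bar>C\<bar> * ((1 + K) * (1 + norm x)) ^ n"
      using K(2) by (intro mult_mono) auto
    then show ?thesis unfolding dderivs_comp_linear[OF A slow_smooth[OF f]]
      using C[of "A x"] by (simp add: power_mult_distrib mult_ac)
  qed
  then show "\<exists>C n. \<forall>x. norm (dderivs vs (\<lambda>x. f (A x)) x) \<le> C * (1 + norm x) ^ n" by blast
qed

lemma schwartz_slow: "schwartz f \<Longrightarrow> slow f"
proof -
  assume f: "schwartz f"
  have "\<exists>C n. \<forall>x. norm (dderivs vs f x) \<le> C * (1 + norm x) ^ n" for vs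
    using schwartz_bound[OF f, of vs 0] by (metis div_by_1 mult.right_neutral power_0)
  then show ?thesis unfolding slow_def using schwartz_smooth[OF f] by blast
qed

lemma schwartz_mult: assumes "slow a" "schwartz b" shows "schwartz (\<lambda>x. a x * b x)"
proof -
  let ?B = "\<lambda>F. \<exists>f g. slow f \<and> schwartz g \<and> F = (\<lambda>(i::unit) (x::'a). f x * g x)"
  have "sfam UNIV (\<lambda>_. 1) (\<lambda>(i::unit) x. a x * b x)"
  proof (rule sfam_sumcl[where B="?B"])
    fix F assume "?B F"
    then obtain f g where fg: "slow f" "schwartz g" and F: "F = (\<lambda>(i::unit) x. f x * g x)" by blast
    note s = slow_smooth[OF fg(1)] schwartz_smooth[OF fg(2)]
    have 1: "sumcl UNIV ?B (\<lambda>i. dderiv v (F i))" for v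
      unfolding F by (rule sumcl_mult[OF s]) (use fg slow_dderiv schwartz_dderiv in blast)+
    have 2: "fbd UNIV (\<lambda>_. 1) F"
      unfolding fbd_def
    proof
      fix k
      obtain C n where C: "0 \<le> C" "\<And>x. norm (f x) \<le> C * (1 + norm x) ^ n" using slow_bound fg by metis
      obtain C' where C': "0 \<le> C'" "\<And>x. norm (g x) \<le> C' / (1 + norm x) ^ (k + n)" using schwartz_bound0[OF fg(2)] by metis
      have "(1 + norm x) ^ k * norm (F () x) \<le> C * C'" for x
      proof -
        have "norm (F () x) \<le> (C * (1 + norm x) ^ n) * (C' / (1 + norm x) ^ (k + n))"
          unfolding F norm_mult using C C' by (intro mult_mono) auto
        also have "\<dots> = (C * C') / (1 + norm x) ^ k" by (simp add: power_add)
        finally show ?thesis by (simp add: le_divide_eq mult.commute)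
      qed
      then show "\<exists>C. \<forall>i\<in>UNIV. \<forall>x. (1 + norm x) ^ k * norm (F i x) \<le> C * 1" by auto
    qed
    have 3: "F i differentiable at x" for i x
      unfolding F by (intro differentiable_mult smooth_differentiable s)
    show "(\<forall>i\<in>UNIV. \<forall>x. F i differentiable at x) \<and> fbd UNIV (\<lambda>_. 1) F \<and> (\<forall>v. sumcl UNIV ?B (\<lambda>i. dderiv v (F i)))"
      using 1 2 3 by blast
  qed (rule sumcl.base, use assms in auto)
  then show ?thesis by (simp add: schwartz_sfam)
qed

lemma schwartz_cmult: "schwartz f \<Longrightarrow> schwartz (\<lambda>x. c * f x)"
  by (rule schwartz_mult[OF slow_const])

lemma schwartz_add: assumes f: "schwartz f" and g: "schwartz g" shows "schwartz (\<lambda>x. f x + g x)"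
  unfolding schwartz_iff
proof (intro conjI allI smooth_add schwartz_smooth f g)
  fix vs :: "'a list" and k
  obtain C1 C2 where C: "\<And>x. (1 + norm x) ^ k * norm (dderivs vs f x) \<le> C1" "\<And>x. (1 + norm x) ^ k * norm (dderivs vs g x) \<le> C2"
    using f g unfolding schwartz_iff by metis
  have "(1 + norm x) ^ k * norm (dderivs vs f x + dderivs vs g x) \<le> C1 + C2" for x
  proof -
    have "(1 + norm x) ^ k * norm (dderivs vs f x + dderivs vs g x) \<le> (1 + norm x) ^ k * (norm (dderivs vs f x) + norm (dderivs vs g x))"
      by (intro mult_left_mono norm_triangle_ineq) simp
    then show ?thesis using C[of x] by (simp add: distrib_left)
  qed
  then show "\<exists>C. \<forall>x. (1 + norm x) ^ k * norm (dderivs vs (\<lambda>x. f x + g x) x) \<le> C"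
    unfolding dderivs_add[OF schwartz_smooth[OF f] schwartz_smooth[OF g]] by blast
qed

lemma schwartz_diff: "schwartz f \<Longrightarrow> schwartz g \<Longrightarrow> schwartz (\<lambda>x. f x - g x)"
  using schwartz_add[of f "\<lambda>x. -1 * g x"] schwartz_cmult[of g "-1"] by simp

lemma schwartz_zero: "schwartz (\<lambda>x. 0)"
  unfolding schwartz_iff by (auto simp: smooth_const dderivs_zero)

lemma schwartz_sum: "(\<And>i. i \<in> A \<Longrightarrow> schwartz (f i)) \<Longrightarrow> schwartz (\<lambda>x. \<Sum>i\<in>A. f i x)"
  by (induct A rule: infinite_finite_induct) (simp_all add: schwartz_zero schwartz_add)

text \<open>The inequality \<open>K\<close> prevents the affine map from contracting large vectors
  too much, so decay in \<open>A x + b\<close> is decay in \<open>x\<close>. Reflections,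
  translations (by Peetre's inequality) and dilations by \<open>0 < c \<le> 1\<close> satisfy
  it.\<close>

lemma schwartz_affine:
  assumes A: "bounded_linear A" and f: "schwartz f" and K: "\<And>x. 1 + norm x \<le> K * (1 + norm (A x + b))"
  shows "schwartz (\<lambda>x. f (A x + b))"
  unfolding schwartz_iff
proof (intro conjI allI smooth_affine[OF A schwartz_smooth[OF f]])
  fix vs k
  obtain C where C: "0 \<le> C" "\<And>x. norm (dderivs (map A vs) f x) \<le> C / (1 + norm x) ^ k" using schwartz_bound[OF f] by metis
  have "(1 + norm x) ^ k * norm (dderivs vs (\<lambda>x. f (A x + b)) x) \<le> K ^ k * C" for x
  proof -
    have "(1 + norm x) ^ k \<le> K ^ k * (1 + norm (A x + b)) ^ k"
      using power_mono[OF K[of x], of k] by (simp add: power_mult_distrib)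
    moreover have "norm (dderivs vs (\<lambda>x. f (A x + b)) x) \<le> C / (1 + norm (A x + b)) ^ k"
      unfolding dderivs_affine[OF A schwartz_smooth[OF f]] by (rule C(2))
    ultimately have "(1 + norm x) ^ k * norm (dderivs vs (\<lambda>x. f (A x + b)) x) \<le> (K ^ k * (1 + norm (A x + b)) ^ k) * (C / (1 + norm (A x + b)) ^ k)"
      by (intro mult_mono) (auto intro: order_trans[OF zero_le_power[of "1 + norm x" k]])
    then show ?thesis by simp
  qed
  then show "\<exists>C. \<forall>x. (1 + norm x) ^ k * norm (dderivs vs (\<lambda>x. f (A x + b)) x) \<le> C" by blast
qed

lemma schwartz_uminus: "schwartz f \<Longrightarrow> schwartz (\<lambda>x. f (- x))"
  using schwartz_affine[of uminus f 1 0] by (simp add: bounded_linear_minus[OF bounded_linear_ident])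

lemma schwartz_shift: "schwartz f \<Longrightarrow> schwartz (\<lambda>x. f (x + b))"
  using schwartz_affine[of "\<lambda>x. x" f "1 + norm b" b, OF bounded_linear_ident _ peetre] by simp

lemma schwartz_scale:
  assumes "schwartz f" "0 < c" "c \<le> 1" shows "schwartz (\<lambda>x. f (c *\<^sub>R x))"
proof -
  have "1 + norm x \<le> 1 / c * (1 + norm (c *\<^sub>R x + 0))" for x :: 'a
  proof -
    have "c * (1 + norm x) \<le> 1 + c * norm x" using assms by (simp add: distrib_left)
    then show ?thesis using assms by (simp add: divide_simps mult.commute)
  qed
  then show ?thesis using schwartz_affine[of "\<lambda>x. c *\<^sub>R x" f "1 / c" 0] assms
    by (simp add: bounded_linear_scaleR_right)
qed

lemma schwartz_borel: "schwartz f \<Longrightarrow> f \<in> borel_measurable borel"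
  by (rule smooth_borel[OF schwartz_smooth])

lemma schwartz_integrable: "schwartz (f :: 'a::euclidean_space \<Rightarrow> complex) \<Longrightarrow> integrable lborel f"
proof -
  assume f: "schwartz f"
  obtain C where "0 \<le> C" "\<And>x. norm (f x) \<le> C / (1 + norm x) ^ (2 * DIM('a))"
    using schwartz_bound0[OF f] by metis
  then show ?thesis using integrable_by_decay[OF schwartz_borel[OF f]] by blast
qed

lemma schwartzI_compact:
  assumes f: "smooth f" and K: "compact K" "\<And>x. x \<notin> K \<Longrightarrow> f x = 0"
  shows "schwartz f"
  unfolding schwartz_iff
proof (intro conjI allI f)
  fix vs k
  have "continuous_on K (\<lambda>x. (1 + norm x) ^ k * norm (dderivs vs f x))"
    by (intro continuous_intros smooth_continuous_on smooth_dderivs f)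
  then obtain C where C: "\<And>x. x \<in> K \<Longrightarrow> (1 + norm x) ^ k * norm (dderivs vs f x) \<le> C"
    using compact_continuous_image[OF _ K(1)] compact_imp_bounded bounded_imp_bdd_above unfolding bdd_above_def
    by (metis (no_types, lifting) image_eqI)
  have "(1 + norm x) ^ k * norm (dderivs vs f x) \<le> max C 0" for x
    using C[of x] dderivs_zero_outside[OF f compact_imp_closed[OF K(1)] K(2), of x vs] by (cases "x \<in> K") auto
  then show "\<exists>C. \<forall>x. (1 + norm x) ^ k * norm (dderivs vs f x) \<le> C" by blast
qed

section \<open>Test functions and tempered functionals\<close>

lemma test_funI:
  assumes "smooth f" "compact K" "K \<subseteq> U" "\<And>z. z \<notin> K \<Longrightarrow> f z = 0"
  shows "test_fun U f"
proof -
  have "closure {z. f z \<noteq> 0} \<subseteq> K"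
    by (rule closure_minimal) (use assms compact_imp_closed in auto)
  then have "compact (closure {z. f z \<noteq> 0})"
    using assms(2) by (metis closed_closure compact_Int_closed inf.absorb_iff2)
  then show ?thesis unfolding test_fun_def using assms \<open>closure {z. f z \<noteq> 0} \<subseteq> K\<close> by blast
qed

lemma test_funE:
  assumes "test_fun U f" obtains K where "compact K" "K \<subseteq> U" "\<And>z. z \<notin> K \<Longrightarrow> f z = 0" "smooth f"
proof (rule that[of "closure {z. f z \<noteq> 0}"])
  show "f z = 0" if "z \<notin> closure {z. f z \<noteq> 0}" for z
    using that closure_subset[of "{z. f z \<noteq> 0}"] by blast
qed (use assms in \<open>auto simp: test_fun_def\<close>)

lemma test_fun_schwartz: assumes "test_fun U f" shows "schwartz f"
proof -
  obtain K where K: "compact K" "K \<subseteq> U" "\<And>z. z \<notin> K \<Longrightarrow> f z = 0" "smooth f"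
    using test_funE[OF assms] by metis
  show ?thesis by (rule schwartzI_compact[OF K(4) K(1) K(3)])
qed

lemma test_fun_dderivs: assumes "test_fun U f" shows "test_fun U (dderivs vs f)"
proof -
  obtain K where K: "compact K" "K \<subseteq> U" "\<And>z. z \<notin> K \<Longrightarrow> f z = 0" "smooth f"
    using test_funE[OF assms] by metis
  show ?thesis
    by (rule test_funI[OF smooth_dderivs[OF K(4)] K(1,2)], rule dderivs_zero_outside[OF K(4) compact_imp_closed[OF K(1)] K(3)])
qed

lemma tempered_add: "tempered T \<Longrightarrow> schwartz f \<Longrightarrow> schwartz g \<Longrightarrow> T (\<lambda>x. f x + g x) = T f + T g"
  unfolding tempered_def by blast

lemma tempered_cmult: "tempered T \<Longrightarrow> schwartz f \<Longrightarrow> T (\<lambda>x. a * f x) = a * T f"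
  unfolding tempered_def by blast

lemma tempered_zero: "tempered T \<Longrightarrow> T (\<lambda>x. 0) = 0"
  using tempered_cmult[of T "\<lambda>x. 0" 0] schwartz_zero by simp

lemma tempered_diff: "tempered T \<Longrightarrow> schwartz f \<Longrightarrow> schwartz g \<Longrightarrow> T (\<lambda>x. f x - g x) = T f - T g"
  using tempered_add[of T f "\<lambda>x. -1 * g x"] tempered_cmult[of T g "-1"] schwartz_cmult[of g "-1"] by simp

lemma tempered_sum:
  assumes T: "tempered T"
  shows "(\<And>i. i \<in> A \<Longrightarrow> schwartz (f i)) \<Longrightarrow> T (\<lambda>x. \<Sum>i\<in>A. f i x) = (\<Sum>i\<in>A. T (f i))"
proof (induct A rule: infinite_finite_induct)
  case (insert i A)
  have "T (\<lambda>x. f i x + (\<Sum>i\<in>A. f i x)) = T (f i) + T (\<lambda>x. \<Sum>i\<in>A. f i x)"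
    by (rule tempered_add[OF T]) (use insert in \<open>auto intro: schwartz_sum\<close>)
  then show ?case using insert by simp
qed (simp_all add: tempered_zero[OF T])

text \<open>A tempered functional is bounded by a single \<open>schw_seminorm k m\<close>, which
  involves only the finitely many lists of at most \<open>m\<close> basis directions; the constants
  for these lists add up to one constant.\<close>

lemma tempered_family:
  fixes F :: "'i \<Rightarrow> 'a::euclidean_space \<Rightarrow> complex"
  assumes T: "tempered T" and F: "sfam I w F" and w: "\<And>i. i \<in> I \<Longrightarrow> 0 \<le> w i"
  shows "\<exists>C. 0 \<le> C \<and> (\<forall>i\<in>I. norm (T (F i)) \<le> C * w i)"
proof -
  obtain C k m where C: "\<And>f. schwartz f \<Longrightarrow> norm (T f) \<le> C * schw_seminorm k m f"
    using T unfolding tempered_def by blast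
  let ?L = "{vs::'a list. set vs \<subseteq> Basis \<and> length vs \<le> m}"
  have fin: "finite ?L" by (rule finite_lists_length_le) simp
  obtain D where D: "\<And>vs i x. i \<in> I \<Longrightarrow> (1 + norm x) ^ k * norm (dderivs vs (F i) x) \<le> D vs * w i"
  proof -
    have "\<forall>vs. \<exists>C. \<forall>i\<in>I. \<forall>x. (1 + norm x) ^ k * norm (dderivs vs (F i) x) \<le> C * w i"
      using F unfolding sfam_def fbd_def by blast
    then obtain D where "\<forall>vs. \<forall>i\<in>I. \<forall>x. (1 + norm x) ^ k * norm (dderivs vs (F i) x) \<le> D vs * w i"
      unfolding choice_iff by blast
    then show ?thesis using that[of D] by blast
  qed
  define M where "M = (\<Sum>vs\<in>?L. \<bar>D vs\<bar>)"
  have M: "0 \<le> M" unfolding M_def by (simp add: sum_nonneg)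
  have "norm (T (F i)) \<le> (\<bar>C\<bar> * M) * w i" if i: "i \<in> I" for i
  proof -
    let ?S = "{(1 + norm x) ^ k * norm (dderivs vs (F i) x) | x vs. set vs \<subseteq> Basis \<and> length vs \<le> m}"
    have le: "y \<le> M * w i" if "y \<in> ?S" for y
    proof -
      obtain x vs where y: "y = (1 + norm x) ^ k * norm (dderivs vs (F i) x)" and vs: "vs \<in> ?L" using \<open>y \<in> ?S\<close> by blast
      have "y \<le> D vs * w i" unfolding y by (rule D[OF i])
      also have "\<dots> \<le> \<bar>D vs\<bar> * w i" by (intro mult_right_mono w i) simp
      also have "\<dots> \<le> M * w i" unfolding M_def
        by (intro mult_right_mono w i member_le_sum vs fin) auto
      finally show ?thesis .
    qed
    \<comment> \<open>The seminorm is a supremum of reals, so nonemptiness and an upper bound are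
      required before it can be compared with anything. Its nonnegativity then permits replacing
      \<open>C\<close> by \<open>\<bar>C\<bar>\<close>.\<close>
    have ne: "(1 + norm (0::'a)) ^ k * norm (dderivs [] (F i) 0) \<in> ?S"
      by (rule CollectI, rule exI[of _ "0::'a"], rule exI[of _ "[]"]) simp
    have up: "schw_seminorm k m (F i) \<le> M * w i"
      unfolding schw_seminorm_def by (rule cSup_least) (use ne le in blast)+
    have "0 \<le> (1 + norm (0::'a)) ^ k * norm (dderivs [] (F i) 0)" by simp
    also have "\<dots> \<le> schw_seminorm k m (F i)"
      unfolding schw_seminorm_def by (rule cSup_upper[OF ne]) (rule bdd_aboveI[of _ "M * w i"], rule le)
    finally have lo: "0 \<le> schw_seminorm k m (F i)" .
    have "norm (T (F i)) \<le> C * schw_seminorm k m (F i)" by (rule C[OF sfam_schwartz[OF F i]])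
    also have "\<dots> \<le> \<bar>C\<bar> * schw_seminorm k m (F i)" by (intro mult_right_mono lo) simp
    also have "\<dots> \<le> \<bar>C\<bar> * (M * w i)" by (intro mult_left_mono up) simp
    finally show ?thesis by (simp add: mult.assoc)
  qed
  then show ?thesis using M by (intro exI[of _ "\<bar>C\<bar> * M"]) simp
qed

section \<open>The Fourier transform\<close>

lemma has_vector_derivative_cis: "(cis has_vector_derivative \<i> * cis t) (at t)"
  unfolding has_vector_derivative_complex_iff by (auto intro!: derivative_eq_intros)

lemma norm_cis_minus_1: "norm (cis \<theta> - 1) \<le> \<bar>\<theta>\<bar>"
proof -
  have pos: "norm (cis t - 1) \<le> t" if "0 \<le> t" for t
  proof -
    have "norm (cis t - cis 0) \<le> 1 * t"
      by (rule hvd_bound[where g'="\<lambda>t. \<i> * cis t"]) (use that has_vector_derivative_cis in \<open>auto simp: norm_mult\<close>)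
    then show ?thesis by simp
  qed
  show ?thesis
  proof (cases "0 \<le> \<theta>")
    case True then show ?thesis using pos by simp
  next
    case False
    have "norm (cis \<theta> - 1) = norm (cnj (cis (- \<theta>) - 1))" by (simp add: cis_cnj)
    also have "\<dots> = norm (cis (- \<theta>) - 1)" by (rule complex_mod_cnj)
    finally show ?thesis using pos[of "- \<theta>"] False by simp
  qed
qed

lemma norm_cis_taylor: "norm (cis \<theta> - 1 - \<i> * of_real \<theta>) \<le> \<theta>\<^sup>2"
proof -
  have pos: "norm (cis t - 1 - \<i> * of_real t) \<le> t\<^sup>2" if t: "0 \<le> t" for t
  proof -
    have "norm ((cis t - \<i> * of_real t) - (cis 0 - \<i> * of_real 0)) \<le> t * t"
    proof (rule hvd_bound[where g="\<lambda>t. cis t - \<i> * of_real t" and g'="\<lambda>t. \<i> * (cis t - 1)"])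
      fix s assume s: "0 \<le> s" "s \<le> t"
      show "((\<lambda>t. cis t - \<i> * of_real t) has_vector_derivative \<i> * (cis s - 1)) (at s)"
        by (auto intro!: derivative_eq_intros has_vector_derivative_cis simp: algebra_simps)
      show "norm (\<i> * (cis s - 1)) \<le> t" using norm_cis_minus_1[of s] s by (simp add: norm_mult)
    qed (use t in auto)
    then show ?thesis by (simp add: power2_eq_square algebra_simps)
  qed
  show ?thesis
  proof (cases "0 \<le> \<theta>")
    case True then show ?thesis using pos by simp
  next
    case False
    have "norm (cis \<theta> - 1 - \<i> * of_real \<theta>) = norm (cnj (cis (- \<theta>) - 1 - \<i> * of_real (- \<theta>)))" by (simp add: cis_cnj)
    also have "\<dots> = norm (cis (- \<theta>) - 1 - \<i> * of_real (- \<theta>))" by (rule complex_mod_cnj)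
    finally show ?thesis using pos[of "- \<theta>"] False by simp
  qed
qed

text \<open>The derivatives of Fourier integrals, of convolutions and of functionals of plane waves
  are all obtained from a second order remainder that is estimated explicitly.\<close>

lemma has_derivative_quadratic:
  fixes f :: "'a::real_normed_vector \<Rightarrow> 'b::real_normed_vector"
  assumes L: "bounded_linear L" and C: "\<And>h. norm h \<le> 1 \<Longrightarrow> norm (f (x + h) - f x - L h) \<le> C * (norm h)\<^sup>2"
  shows "(f has_derivative L) (at x)"
  unfolding has_derivative_at
proof (intro conjI L)
  have "((\<lambda>h. norm (f (x + h) - f x - L h) / norm h) \<longlongrightarrow> 0) (at 0)"
  proof (rule tendsto_sandwich[where f="\<lambda>_. 0" and h="\<lambda>h. \<bar>C\<bar> * norm h"])
    have "((\<lambda>h::'a. \<bar>C\<bar> * norm h) \<longlongrightarrow> \<bar>C\<bar> * norm (0::'a)) (at 0)" by (intro tendsto_intros)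
    then show "((\<lambda>h::'a. \<bar>C\<bar> * norm h) \<longlongrightarrow> 0) (at 0)" by simp
    have "\<forall>\<^sub>F h::'a in at 0. norm h \<le> 1"
      unfolding eventually_at by (rule exI[of _ 1]) (auto simp: dist_norm)
    then show "\<forall>\<^sub>F h in at 0. norm (f (x + h) - f x - L h) / norm h \<le> \<bar>C\<bar> * norm h"
    proof eventually_elim
      fix h :: 'a assume h: "norm h \<le> 1"
      have "norm (f (x + h) - f x - L h) \<le> \<bar>C\<bar> * (norm h)\<^sup>2"
        using C[OF h] by (rule order_trans) (intro mult_right_mono, auto)
      then show "norm (f (x + h) - f x - L h) / norm h \<le> \<bar>C\<bar> * norm h"
        by (cases "h = 0") (simp_all add: divide_le_eq power2_eq_square mult.assoc)
    qed
  qed (auto intro!: always_eventually)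
  then show "(\<lambda>h. norm (f (x + h) - f x - L h) / norm h) \<midarrow>0\<rightarrow> 0" .
qed

lemma cis_inner_measurable [measurable]:
  "\<kappa> \<in> borel_measurable M \<Longrightarrow> (\<lambda>k. cis (z \<bullet> \<kappa> k)) \<in> borel_measurable M"
  for \<kappa> :: "'b \<Rightarrow> 'a::euclidean_space"
proof -
  assume [measurable]: "\<kappa> \<in> borel_measurable M"
  have "continuous_on UNIV (\<lambda>y::'a. cis (z \<bullet> y))" by (rule smooth_continuous_on[OF smooth_cis])
  then have [measurable]: "(\<lambda>y::'a. cis (z \<bullet> y)) \<in> borel_measurable borel" by (rule continuous_borel)
  show ?thesis by measurable
qed

text \<open>The Fourier transform with the frequency variable replaced by a measurable function of it;
  simple functions \<open>\<kappa>\<close> turn it into a finite sum of plane waves.\<close>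
definition ftk :: "('b::euclidean_space \<Rightarrow> 'a::euclidean_space) \<Rightarrow> ('b \<Rightarrow> complex) \<Rightarrow> 'a \<Rightarrow> complex" where
  "ftk \<kappa> g z = (LINT k|lborel. cis (z \<bullet> \<kappa> k) * g k)"

lemma fourier_ftk: "fourier f = ftk (\<lambda>k. k) f"
  unfolding fourier_def ftk_def[abs_def] ..

lemma integrable_cis_mult:
  fixes g :: "'b::euclidean_space \<Rightarrow> complex" and \<kappa> :: "'b \<Rightarrow> 'a::euclidean_space"
  assumes "\<kappa> \<in> borel_measurable borel" "integrable lborel g"
  shows "integrable lborel (\<lambda>k. cis (z \<bullet> \<kappa> k) * g k)"
proof (rule Bochner_Integration.integrable_bound[OF assms(2)])
  have [measurable]: "\<kappa> \<in> borel_measurable borel" "g \<in> borel_measurable lborel" using assms by auto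
  show "(\<lambda>k. cis (z \<bullet> \<kappa> k) * g k) \<in> borel_measurable lborel" by measurable
qed (simp add: norm_mult)

lemma norm_ftk_le:
  assumes "\<kappa> \<in> borel_measurable borel" "integrable lborel g"
  shows "norm (ftk \<kappa> g z) \<le> (LINT k|lborel. norm (g k))"
proof -
  have "norm (ftk \<kappa> g z) \<le> (LINT k|lborel. norm (cis (z \<bullet> \<kappa> k) * g k))" unfolding ftk_def by (rule integral_norm_bound)
  then show ?thesis by (simp add: norm_mult)
qed

lemma norm_fourier_le: "integrable lborel g \<Longrightarrow> norm (fourier g z) \<le> (LINT k|lborel. norm (g k))"
  unfolding fourier_ftk by (rule norm_ftk_le) auto

text \<open>The plane wave is expanded to second order in \<open>h\<close>. Its remainder is at most
  \<open>(h \<bullet> \<kappa> k)\<^sup>2\<close>, which calls for the second moment in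
  \<open>g2\<close>; the first moment follows from it by
  \<open>t \<le> 1 + t\<^sup>2\<close>.\<close>

lemma ftk_has_derivative:
  fixes g :: "'b::euclidean_space \<Rightarrow> complex" and \<kappa> :: "'b \<Rightarrow> 'a::euclidean_space"
  assumes [measurable]: "\<kappa> \<in> borel_measurable borel" and g: "integrable lborel g"
    and g2: "integrable lborel (\<lambda>k. (norm (\<kappa> k))\<^sup>2 * norm (g k))"
  shows "(ftk \<kappa> g has_derivative (\<lambda>v. ftk \<kappa> (\<lambda>k. \<i> * of_real (v \<bullet> \<kappa> k) * g k) z)) (at z)"
proof (rule has_derivative_quadratic)
  have [measurable]: "g \<in> borel_measurable borel" using g by (simp add: borel_measurable_integrable)
  have g1: "integrable lborel (\<lambda>k. norm (\<kappa> k) * norm (g k))"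
  proof (rule Bochner_Integration.integrable_bound[OF Bochner_Integration.integrable_add[OF integrable_norm[OF g] g2]])
    show "AE k in lborel. norm (norm (\<kappa> k) * norm (g k)) \<le> norm (norm (g k) + (norm (\<kappa> k))\<^sup>2 * norm (g k))"
    proof (rule AE_I2)
      fix k
      have "t \<le> 1 + t\<^sup>2" if "0 \<le> t" for t :: real
        using sum_squares_ge_zero[of "t - 1" 0] that by (simp add: power2_eq_square algebra_simps)
      from mult_right_mono[OF this[of "norm (\<kappa> k)"], of "norm (g k)"]
      show "norm (norm (\<kappa> k) * norm (g k)) \<le> norm (norm (g k) + (norm (\<kappa> k))\<^sup>2 * norm (g k))"
        by (simp add: distrib_right abs_mult)
    qed
  qed measurable
  have iv: "integrable lborel (\<lambda>k. \<i> * of_real (v \<bullet> \<kappa> k) * g k)" for v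
  proof (rule Bochner_Integration.integrable_bound[OF integrable_mult_right[OF g1, of "norm v"]])
    show "AE k in lborel. norm (\<i> * of_real (v \<bullet> \<kappa> k) * g k) \<le> norm (norm v * (norm (\<kappa> k) * norm (g k)))"
    proof (rule AE_I2)
      fix k
      show "norm (\<i> * of_real (v \<bullet> \<kappa> k) * g k) \<le> norm (norm v * (norm (\<kappa> k) * norm (g k)))"
        using mult_right_mono[OF Cauchy_Schwarz_ineq2[of v "\<kappa> k"], of "norm (g k)"] by (simp add: norm_mult abs_mult mult.assoc)
    qed
  qed measurable
  have ic: "integrable lborel (\<lambda>k. cis (z \<bullet> \<kappa> k) * (\<i> * of_real (v \<bullet> \<kappa> k) * g k))" for v
    by (rule integrable_cis_mult[OF _ iv]) measurable
  show "bounded_linear (\<lambda>v. ftk \<kappa> (\<lambda>k. \<i> * of_real (v \<bullet> \<kappa> k) * g k) z)"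
  proof (rule bounded_linear_intro)
    fix u v :: 'a and r :: real
    have "ftk \<kappa> (\<lambda>k. \<i> * of_real ((u + v) \<bullet> \<kappa> k) * g k) z =
       (LINT k|lborel. cis (z \<bullet> \<kappa> k) * (\<i> * of_real (u \<bullet> \<kappa> k) * g k) + cis (z \<bullet> \<kappa> k) * (\<i> * of_real (v \<bullet> \<kappa> k) * g k))"
      unfolding ftk_def by (rule Bochner_Integration.integral_cong[OF refl]) (simp add: inner_add_left algebra_simps)
    also have "\<dots> = ftk \<kappa> (\<lambda>k. \<i> * of_real (u \<bullet> \<kappa> k) * g k) z + ftk \<kappa> (\<lambda>k. \<i> * of_real (v \<bullet> \<kappa> k) * g k) z"
      unfolding ftk_def by (rule Bochner_Integration.integral_add[OF ic ic])
    finally show "ftk \<kappa> (\<lambda>k. \<i> * of_real ((u + v) \<bullet> \<kappa> k) * g k) z = \<dots>" .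
    have "ftk \<kappa> (\<lambda>k. \<i> * of_real ((r *\<^sub>R v) \<bullet> \<kappa> k) * g k) z =
       (LINT k|lborel. r *\<^sub>R (cis (z \<bullet> \<kappa> k) * (\<i> * of_real (v \<bullet> \<kappa> k) * g k)))"
      unfolding ftk_def by (rule Bochner_Integration.integral_cong[OF refl]) (simp add: scaleR_conv_of_real mult_ac)
    also have "\<dots> = r *\<^sub>R ftk \<kappa> (\<lambda>k. \<i> * of_real (v \<bullet> \<kappa> k) * g k) z"
      unfolding ftk_def by simp
    finally show "ftk \<kappa> (\<lambda>k. \<i> * of_real ((r *\<^sub>R v) \<bullet> \<kappa> k) * g k) z = \<dots>" .
    have "norm (ftk \<kappa> (\<lambda>k. \<i> * of_real (v \<bullet> \<kappa> k) * g k) z) \<le> (LINT k|lborel. norm (\<i> * of_real (v \<bullet> \<kappa> k) * g k))"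
      by (rule norm_ftk_le[OF _ iv]) measurable
    also have "\<dots> \<le> (LINT k|lborel. norm v * (norm (\<kappa> k) * norm (g k)))"
    proof (rule integral_mono[OF integrable_norm[OF iv] integrable_mult_right[OF g1]])
      fix k
      show "norm (\<i> * of_real (v \<bullet> \<kappa> k) * g k) \<le> norm v * (norm (\<kappa> k) * norm (g k))"
        using mult_right_mono[OF Cauchy_Schwarz_ineq2[of v "\<kappa> k"], of "norm (g k)"] by (simp add: norm_mult mult.assoc)
    qed
    also have "\<dots> = norm v * (LINT k|lborel. norm (\<kappa> k) * norm (g k))" by simp
    finally show "norm (ftk \<kappa> (\<lambda>k. \<i> * of_real (v \<bullet> \<kappa> k) * g k) z) \<le> norm v * (LINT k|lborel. norm (\<kappa> k) * norm (g k))" .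
  qed
  fix h :: 'a
  have i1: "integrable lborel (\<lambda>k. cis (z \<bullet> \<kappa> k) * g k)" for z
    by (rule integrable_cis_mult[OF _ g]) measurable
  have "ftk \<kappa> g (z + h) - ftk \<kappa> g z - ftk \<kappa> (\<lambda>k. \<i> * of_real (h \<bullet> \<kappa> k) * g k) z =
    (LINT k|lborel. cis ((z + h) \<bullet> \<kappa> k) * g k - cis (z \<bullet> \<kappa> k) * g k - cis (z \<bullet> \<kappa> k) * (\<i> * of_real (h \<bullet> \<kappa> k) * g k))"
    unfolding ftk_def using i1 ic by simp
  also have "norm \<dots> \<le> (LINT k|lborel. (norm h)\<^sup>2 * ((norm (\<kappa> k))\<^sup>2 * norm (g k)))"
  proof (rule order_trans[OF integral_norm_bound integral_mono], rule integrable_norm)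
    show "integrable lborel (\<lambda>k. cis ((z + h) \<bullet> \<kappa> k) * g k - cis (z \<bullet> \<kappa> k) * g k - cis (z \<bullet> \<kappa> k) * (\<i> * of_real (h \<bullet> \<kappa> k) * g k))"
      by (intro Bochner_Integration.integrable_diff i1 ic)
    show "integrable lborel (\<lambda>k. (norm h)\<^sup>2 * ((norm (\<kappa> k))\<^sup>2 * norm (g k)))" by (rule integrable_mult_right[OF g2])
    fix k
    have "cis ((z + h) \<bullet> \<kappa> k) * g k - cis (z \<bullet> \<kappa> k) * g k - cis (z \<bullet> \<kappa> k) * (\<i> * of_real (h \<bullet> \<kappa> k) * g k) =
      cis (z \<bullet> \<kappa> k) * ((cis (h \<bullet> \<kappa> k) - 1 - \<i> * of_real (h \<bullet> \<kappa> k)) * g k)"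
      by (simp add: inner_add_left cis_mult[symmetric] algebra_simps)
    also have "norm \<dots> \<le> (h \<bullet> \<kappa> k)\<^sup>2 * norm (g k)"
      using mult_right_mono[OF norm_cis_taylor[of "h \<bullet> \<kappa> k"], of "norm (g k)"] by (simp add: norm_mult)
    also have "\<dots> \<le> (norm h * norm (\<kappa> k))\<^sup>2 * norm (g k)"
    proof (intro mult_right_mono)
      show "(h \<bullet> \<kappa> k)\<^sup>2 \<le> (norm h * norm (\<kappa> k))\<^sup>2"
        using Cauchy_Schwarz_ineq2[of h "\<kappa> k"] by (metis abs_le_square_iff abs_mult abs_norm_cancel)
    qed simp
    finally show "norm (cis ((z + h) \<bullet> \<kappa> k) * g k - cis (z \<bullet> \<kappa> k) * g k - cis (z \<bullet> \<kappa> k) * (\<i> * of_real (h \<bullet> \<kappa> k) * g k))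
       \<le> (norm h)\<^sup>2 * ((norm (\<kappa> k))\<^sup>2 * norm (g k))" by (simp add: power_mult_distrib mult.assoc)
  qed
  also have "\<dots> = (LINT k|lborel. (norm (\<kappa> k))\<^sup>2 * norm (g k)) * (norm h)\<^sup>2" by simp
  finally show "norm (ftk \<kappa> g (z + h) - ftk \<kappa> g z - ftk \<kappa> (\<lambda>k. \<i> * of_real (h \<bullet> \<kappa> k) * g k) z)
     \<le> (LINT k|lborel. (norm (\<kappa> k))\<^sup>2 * norm (g k)) * (norm h)\<^sup>2" .
qed

lemma schwartz_norm_sq_integrable:
  fixes f :: "'a::euclidean_space \<Rightarrow> complex"
  assumes f: "schwartz f" shows "integrable lborel (\<lambda>k. (norm k)\<^sup>2 * norm (f k))"
proof -
  obtain C where C: "0 \<le> C" "\<And>x. norm (f x) \<le> C / (1 + norm x) ^ (2 * DIM('a) + 2)" using schwartz_bound0[OF f] by metis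
  show ?thesis
  proof (rule integrable_by_decay)
    show "(\<lambda>k. (norm k)\<^sup>2 * norm (f k)) \<in> borel_measurable borel" using schwartz_borel[OF f] by measurable
    fix x :: 'a
    have "norm ((norm x)\<^sup>2 * norm (f x)) \<le> (1 + norm x)\<^sup>2 * (C / (1 + norm x) ^ (2 * DIM('a) + 2))"
      unfolding norm_mult using C by (intro mult_mono) (auto intro: power_mono)
    also have "\<dots> = C / (1 + norm x) ^ (2 * DIM('a))" by (simp add: power_add power2_eq_square)
    finally show "norm ((norm x)\<^sup>2 * norm (f x)) \<le> C / (1 + norm x) ^ (2 * DIM('a))" .
  qed
qed

lemma fourier_has_derivative:
  assumes f: "schwartz f"
  shows "(fourier f has_derivative (\<lambda>v. fourier (\<lambda>y. (\<i> * of_real (y \<bullet> v)) * f y) z)) (at z)"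
  using ftk_has_derivative[OF _ schwartz_integrable[OF f] schwartz_norm_sq_integrable[OF f], of z]
  unfolding fourier_ftk by (simp add: inner_commute)

lemma schwartz_inner_mult: "schwartz f \<Longrightarrow> schwartz (\<lambda>y. (\<i> * of_real (y \<bullet> v)) * f y)"
  by (rule schwartz_mult[OF slow_mult[OF slow_const slow_inner]])

lemma dderiv_fourier:
  assumes f: "schwartz f" shows "dderiv v (fourier f) = fourier (\<lambda>y. (\<i> * of_real (y \<bullet> v)) * f y)"
  by (rule ext, rule dderiv_eq[OF fourier_has_derivative[OF f]])

lemma fourier_dderiv_eq:
  assumes f: "schwartz f"
  shows "of_real (k \<bullet> v) * fourier f k = \<i> * fourier (dderiv v f) k"
proof -
  obtain C0 where C0: "0 \<le> C0" "\<And>x. norm (f x) \<le> C0 / (1 + norm x) ^ (2 * DIM('a))" using schwartz_bound0[OF f] by metis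
  obtain C1 where C1: "0 \<le> C1" "\<And>x. norm (dderiv v f x) \<le> C1 / (1 + norm x) ^ (2 * DIM('a))"
    using schwartz_bound0[OF schwartz_dderiv[OF f]] by metis
  define C where "C = C0 + \<bar>k \<bullet> v\<bar> * C0 + C1"
  have mono: "a \<le> C \<Longrightarrow> a / (1 + norm x) ^ (2 * DIM('a)) \<le> C / (1 + norm x) ^ (2 * DIM('a))" for a and x :: 'a
    by (rule divide_right_mono) auto
  have "(LINT y|lborel. cis (k \<bullet> y) * dderiv v f y) = - (LINT y|lborel. (\<i> * of_real (k \<bullet> v)) * cis (k \<bullet> y) * f y)"
  proof (rule integration_by_parts[where C=C])
    show "hdd v (\<lambda>y. cis (k \<bullet> y)) (\<lambda>y. (\<i> * of_real (k \<bullet> v)) * cis (k \<bullet> y))"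
      using hdd_smooth[OF smooth_cis, of v k] by (simp add: dderiv_cis)
    show "hdd v f (dderiv v f)" by (rule hdd_smooth[OF schwartz_smooth[OF f]])
    have c: "continuous_on UNIV (\<lambda>y. cis (k \<bullet> y))" by (rule smooth_continuous_on[OF smooth_cis])
    then show "continuous_on UNIV (\<lambda>y. cis (k \<bullet> y))" "continuous_on UNIV (\<lambda>y. (\<i> * of_real (k \<bullet> v)) * cis (k \<bullet> y))"
      by (auto intro!: continuous_intros)
    show "continuous_on UNIV f" "continuous_on UNIV (dderiv v f)"
      by (intro smooth_continuous_on schwartz_smooth f schwartz_dderiv)+
    fix z
    show "norm (cis (k \<bullet> z) * f z) \<le> C / (1 + norm z) ^ (2 * DIM('a))"
      using C0(2)[of z] mono[of C0 z] C0(1) C1(1) by (auto simp: norm_mult C_def elim: order_trans)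
    show "norm (cis (k \<bullet> z) * dderiv v f z) \<le> C / (1 + norm z) ^ (2 * DIM('a))"
      using C1(2)[of z] mono[of C1 z] C0(1) C1(1) by (auto simp: norm_mult C_def elim: order_trans)
    show "norm (\<i> * of_real (k \<bullet> v) * cis (k \<bullet> z) * f z) \<le> C / (1 + norm z) ^ (2 * DIM('a))"
      using mult_left_mono[OF C0(2)[of z], of "\<bar>k \<bullet> v\<bar>"] mono[of "\<bar>k \<bullet> v\<bar> * C0" z] C0(1) C1(1)
      by (auto simp: norm_mult C_def elim: order_trans)
  qed
  then have "fourier (dderiv v f) k = - (LINT y|lborel. (\<i> * of_real (k \<bullet> v)) * (cis (k \<bullet> y) * f y))"
    unfolding fourier_def by (simp add: mult.assoc)
  also have "\<dots> = - ((\<i> * of_real (k \<bullet> v)) * fourier f k)"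
    unfolding fourier_def by simp
  finally show ?thesis by (simp flip: mult.assoc)
qed

lemma fourier_power_eq:
  assumes f: "schwartz f"
  shows "of_real (k \<bullet> v) ^ n * fourier f k = \<i> ^ n * fourier (dderivs (replicate n v) f) k"
proof (induct n)
  case (Suc n)
  have "of_real (k \<bullet> v) ^ Suc n * fourier f k = \<i> ^ n * (of_real (k \<bullet> v) * fourier (dderivs (replicate n v) f) k)"
    using Suc by (simp add: mult_ac)
  also have "\<dots> = \<i> ^ Suc n * fourier (dderivs (replicate (Suc n) v) f) k"
    unfolding fourier_dderiv_eq[OF schwartz_dderivs[OF f]] by (simp add: mult_ac)
  finally show ?case .
qed simp

text \<open>Comparison with the largest coordinate. The pure powers on the right are what repeated
  differentiation in one direction produces on the Fourier side, so decay estimates involve no mixed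
  derivatives.\<close>

lemma norm_power_le_sum:
  fixes x :: "'a::euclidean_space"
  shows "(1 + norm x) ^ n \<le> (real DIM('a) + 1) ^ n * (1 + (\<Sum>b\<in>Basis. \<bar>x \<bullet> b\<bar> ^ n))"
proof -
  obtain b0 :: 'a where b0: "b0 \<in> Basis" "\<And>b. b \<in> Basis \<Longrightarrow> \<bar>x \<bullet> b\<bar> \<le> \<bar>x \<bullet> b0\<bar>"
  proof -
    have "Max ((\<lambda>b. \<bar>x \<bullet> b\<bar>) ` Basis) \<in> (\<lambda>b. \<bar>x \<bullet> b\<bar>) ` Basis" by (rule Max_in) auto
    then obtain b0 where "b0 \<in> Basis" "Max ((\<lambda>b. \<bar>x \<bullet> b\<bar>) ` Basis) = \<bar>x \<bullet> b0\<bar>" by blast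
    then show ?thesis using that[of b0] Max_ge[of "(\<lambda>b. \<bar>x \<bullet> b\<bar>) ` Basis"] by auto
  qed
  define M where "M = max 1 \<bar>x \<bullet> b0\<bar>"
  have "norm x \<le> (\<Sum>b\<in>Basis. \<bar>x \<bullet> b\<bar>)" by (rule norm_le_l1)
  also have "\<dots> \<le> (\<Sum>b\<in>(Basis::'a set). M)" by (rule sum_mono) (use b0 in \<open>auto simp: M_def le_max_iff_disj\<close>)
  finally have "1 + norm x \<le> (real DIM('a) + 1) * M" by (simp add: M_def algebra_simps)
  then have "(1 + norm x) ^ n \<le> ((real DIM('a) + 1) * M) ^ n" by (rule power_mono) simp
  also have "\<dots> = (real DIM('a) + 1) ^ n * M ^ n" by (simp add: power_mult_distrib)
  also have "\<dots> \<le> (real DIM('a) + 1) ^ n * (1 + (\<Sum>b\<in>Basis. \<bar>x \<bullet> b\<bar> ^ n))"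
  proof (rule mult_left_mono)
    have "M ^ n \<le> 1 + \<bar>x \<bullet> b0\<bar> ^ n" unfolding M_def by (cases "\<bar>x \<bullet> b0\<bar> \<le> 1") (auto simp: max_def)
    also have "\<bar>x \<bullet> b0\<bar> ^ n \<le> (\<Sum>b\<in>Basis. \<bar>x \<bullet> b\<bar> ^ n)" by (rule member_le_sum[OF b0(1)]) auto
    finally show "M ^ n \<le> 1 + (\<Sum>b\<in>Basis. \<bar>x \<bullet> b\<bar> ^ n)" by simp
  qed simp
  finally show ?thesis .
qed

lemma fourier_decay:
  fixes f :: "'a::euclidean_space \<Rightarrow> complex"
  assumes f: "schwartz f"
  shows "(1 + norm k) ^ n * norm (fourier f k) \<le>
    (real DIM('a) + 1) ^ n * ((LINT y|lborel. norm (f y)) + (\<Sum>b\<in>Basis. LINT y|lborel. norm (dderivs (replicate n b) f y)))"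
proof -
  have "(1 + norm k) ^ n * norm (fourier f k) \<le> ((real DIM('a) + 1) ^ n * (1 + (\<Sum>b\<in>Basis. \<bar>k \<bullet> b\<bar> ^ n))) * norm (fourier f k)"
    by (rule mult_right_mono[OF norm_power_le_sum]) simp
  also have "\<dots> = (real DIM('a) + 1) ^ n * (norm (fourier f k) + (\<Sum>b\<in>Basis. norm (fourier (dderivs (replicate n b) f) k)))"
  proof -
    have "\<bar>k \<bullet> b\<bar> ^ n * norm (fourier f k) = norm (fourier (dderivs (replicate n b) f) k)" for b
      using arg_cong[OF fourier_power_eq[OF f, of k b n], of norm] by (simp add: norm_mult norm_power)
    then show ?thesis by (simp add: distrib_right sum_distrib_right mult.assoc)
  qed
  also have "\<dots> \<le> (real DIM('a) + 1) ^ n * ((LINT y|lborel. norm (f y)) + (\<Sum>b\<in>Basis. LINT y|lborel. norm (dderivs (replicate n b) f y)))"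
    by (intro mult_left_mono add_mono sum_mono norm_fourier_le schwartz_integrable f schwartz_dderivs) simp
  finally show ?thesis .
qed

lemma schwartz_fourier: assumes f: "schwartz f" shows "schwartz (fourier f)"
proof -
  \<comment> \<open>Derivatives of a Fourier transform are Fourier transforms of Schwartz functions
    again, so differentiability and decay need to be checked for \<open>fourier g\<close>
    only.\<close>
  have all: "\<exists>g. schwartz g \<and> dderivs vs (fourier f) = fourier g" for vs
  proof (induct vs)
    case (Cons v vs)
    then obtain g where "schwartz g" "dderivs vs (fourier f) = fourier g" by blast
    then show ?case using dderiv_fourier[of g v] schwartz_inner_mult[of g v] by auto
  qed (use f in auto)
  have "dderivs vs (fourier f) differentiable at x" for vs x
  proof -
    obtain g where g: "schwartz g" "dderivs vs (fourier f) = fourier g" using all by blast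
    show ?thesis unfolding g(2) differentiable_def using fourier_has_derivative[OF g(1)] by blast
  qed
  moreover have "\<exists>C. \<forall>x. (1 + norm x) ^ k * norm (dderivs vs (fourier f) x) \<le> C" for vs k
  proof -
    obtain g where g: "schwartz g" "dderivs vs (fourier f) = fourier g" using all by blast
    show ?thesis unfolding g(2) using fourier_decay[OF g(1), of _ k] by blast
  qed
  ultimately show ?thesis unfolding schwartz_iff smooth_def by blast
qed

section \<open>The multiplication formula and Fourier inversion\<close>

lemma fourier_multiplication:
  fixes f g :: "'a::euclidean_space \<Rightarrow> complex"
  assumes f: "integrable lborel f" and g: "integrable lborel g"
  shows "(LINT k|lborel. fourier f k * g k) = (LINT y|lborel. f y * fourier g y)"
proof -
  have [measurable]: "f \<in> borel_measurable borel" "g \<in> borel_measurable borel"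
    using f g by (simp_all add: borel_measurable_integrable)
  have [measurable]: "(\<lambda>p::'a \<times> 'a. cis (fst p \<bullet> snd p)) \<in> borel_measurable borel"
  proof (rule continuous_borel)
    have "continuous_on UNIV cis" using has_vector_derivative_cis
      by (meson continuous_at_imp_continuous_on has_vector_derivative_continuous)
    then show "continuous_on UNIV (\<lambda>p::'a \<times> 'a. cis (fst p \<bullet> snd p))"
      by (rule continuous_on_compose2) (auto intro!: continuous_intros)
  qed
  have i: "integrable (lborel \<Otimes>\<^sub>M lborel) (\<lambda>(k, y). cis (k \<bullet> y) * f y * g k)"
  proof (rule lborel_pair.Fubini_integrable)
    have "fst \<in> (borel :: ('a \<times> 'a) measure) \<rightarrow>\<^sub>M borel" "snd \<in> (borel :: ('a \<times> 'a) measure) \<rightarrow>\<^sub>M borel"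
      by (intro continuous_borel continuous_intros)+
    then have [measurable]: "(\<lambda>p::'a \<times> 'a. f (snd p)) \<in> borel_measurable borel" "(\<lambda>p::'a \<times> 'a. g (fst p)) \<in> borel_measurable borel"
      by (auto intro: measurable_compose)
    have "(\<lambda>p::'a \<times> 'a. cis (fst p \<bullet> snd p) * f (snd p) * g (fst p)) \<in> borel_measurable borel"
      by measurable
    then show "(\<lambda>(k, y). cis (k \<bullet> y) * f y * g k) \<in> borel_measurable (lborel \<Otimes>\<^sub>M lborel)"
      by (simp add: case_prod_unfold lborel_prod)
    have "integrable lborel (\<lambda>k. (LINT y|lborel. norm (f y)) * norm (g k))"
      by (intro integrable_mult_right integrable_norm g)
    then show "integrable lborel (\<lambda>k. LINT y|lborel. norm (case (k, y) of (k, y) \<Rightarrow> cis (k \<bullet> y) * f y * g k))"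
      by (simp add: norm_mult)
    have "integrable lborel (\<lambda>y. cis (k \<bullet> y) * f y * g k)" for k
      by (intro integrable_mult_left integrable_cis_mult f) simp
    then show "AE k in lborel. integrable lborel (\<lambda>y. case (k, y) of (k, y) \<Rightarrow> cis (k \<bullet> y) * f y * g k)" by simp
  qed
  have "(LINT k|lborel. fourier f k * g k) = (LINT k|lborel. LINT y|lborel. cis (k \<bullet> y) * f y * g k)"
    unfolding fourier_def by simp
  also have "\<dots> = (LINT y|lborel. LINT k|lborel. cis (k \<bullet> y) * f y * g k)"
    by (rule lborel_pair.Fubini_integral[OF i, symmetric])
  also have "\<dots> = (LINT y|lborel. LINT k|lborel. f y * (cis (y \<bullet> k) * g k))"
    by (simp add: mult_ac inner_commute)
  also have "\<dots> = (LINT y|lborel. f y * fourier g y)"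
    unfolding fourier_def by simp
  finally show ?thesis .
qed

lemma fourier_scale:
  fixes g :: "'a::euclidean_space \<Rightarrow> complex"
  assumes g: "schwartz g" and c: "0 < c"
  shows "fourier (\<lambda>k. g (c *\<^sub>R k)) y = of_real (1 / c ^ DIM('a)) * fourier g ((1 / c) *\<^sub>R y)"
proof -
  have [measurable]: "g \<in> borel_measurable borel" by (rule schwartz_borel[OF g])
  have "fourier (\<lambda>k. g (c *\<^sub>R k)) y = (LINT k|lborel. (\<lambda>k. cis ((1/c) *\<^sub>R y \<bullet> k) * g k) (c *\<^sub>R k))"
    unfolding fourier_def using c by simp
  also have "\<dots> = (1 / \<bar>c\<bar> ^ DIM('a)) *\<^sub>R (LINT k|lborel. cis ((1/c) *\<^sub>R y \<bullet> k) * g k)"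
  proof (rule lborel_integral_scale)
    show "(\<lambda>k. cis ((1/c) *\<^sub>R y \<bullet> k) * g k) \<in> borel_measurable borel"
      by (intro borel_measurable_times cis_inner_measurable) auto
  qed (use c in simp)
  finally show ?thesis using c by (simp add: fourier_def scaleR_conv_of_real)
qed

text \<open>Rescaling one factor of the multiplication formula and passing to the limit gives the
  inversion formula at the origin, up to a universal constant.\<close>
lemma fourier_integral_at_0:
  fixes f g :: "'a::euclidean_space \<Rightarrow> complex"
  assumes f: "schwartz f" and g: "schwartz g"
  shows "g 0 * (LINT k|lborel. fourier f k) = f 0 * (LINT y|lborel. fourier g y)"
proof -
  have [measurable]: "f \<in> borel_measurable borel" "g \<in> borel_measurable borel"
      "fourier f \<in> borel_measurable borel" "fourier g \<in> borel_measurable borel"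
    by (intro schwartz_borel f g schwartz_fourier)+
  define h where "h n = 1 / (real n + 1)" for n :: nat
  have h: "0 < h n" "h n \<le> 1" for n unfolding h_def by (auto simp: field_simps)
  have h0: "h \<longlonglongrightarrow> 0" unfolding h_def using LIMSEQ_Suc[OF lim_1_over_n] by (simp add: add.commute)
  \<comment> \<open>The multiplication formula moves the dilation of \<open>g\<close> to
    \<open>fourier g\<close>, and a change of variables moves it on to \<open>f\<close>; the powers
    of \<open>h n\<close> cancel.\<close>
  have eq: "(LINT k|lborel. fourier f k * g (h n *\<^sub>R k)) = (LINT y|lborel. f (h n *\<^sub>R y) * fourier g y)" for n
  proof -
    have "(LINT k|lborel. fourier f k * g (h n *\<^sub>R k)) = (LINT y|lborel. f y * fourier (\<lambda>k. g (h n *\<^sub>R k)) y)"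
      by (intro fourier_multiplication schwartz_integrable f schwartz_scale g h)
    also have "\<dots> = (LINT y|lborel. of_real (1 / h n ^ DIM('a)) * ((\<lambda>y. f (h n *\<^sub>R y) * fourier g y) ((1 / h n) *\<^sub>R y)))"
      unfolding fourier_scale[OF g h(1)] using h(1)[of n] by (simp add: mult_ac)
    also have "\<dots> = of_real (1 / h n ^ DIM('a)) * (LINT y|lborel. (\<lambda>y. f (h n *\<^sub>R y) * fourier g y) ((1 / h n) *\<^sub>R y))"
      by simp
    also have "(LINT y|lborel. (\<lambda>y. f (h n *\<^sub>R y) * fourier g y) ((1 / h n) *\<^sub>R y)) =
        (1 / \<bar>1 / h n\<bar> ^ DIM('a)) *\<^sub>R (LINT y|lborel. f (h n *\<^sub>R y) * fourier g y)"
    proof (rule lborel_integral_scale)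
      have "(\<lambda>y. f (h n *\<^sub>R y)) \<in> borel_measurable borel"
        by (rule measurable_compose[of _ borel borel f]) auto
      then show "(\<lambda>y. f (h n *\<^sub>R y) * fourier g y) \<in> borel_measurable borel" by simp
    qed (use h(1)[of n] in simp)
    finally show ?thesis using h(1)[of n] by (simp add: scaleR_conv_of_real power_divide)
  qed
  have cont: "(\<lambda>n. u (h n *\<^sub>R k)) \<longlonglongrightarrow> u 0" if "schwartz u" for u :: "'a \<Rightarrow> complex" and k
  proof -
    have "isCont u 0" using smooth_differentiable[OF schwartz_smooth[OF that]] differentiable_imp_continuous_within by blast
    moreover have "(\<lambda>n. h n *\<^sub>R k) \<longlonglongrightarrow> 0" using tendsto_scaleR[OF h0 tendsto_const[of k]] by simp
    ultimately show ?thesis by (rule isCont_tendsto_compose)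
  qed
  have lim: "(\<lambda>n. LINT k|lborel. u (h n *\<^sub>R k) * v k) \<longlonglongrightarrow> (LINT k|lborel. u 0 * v k)"
    if u: "schwartz u" and v: "schwartz v" for u v :: "'a \<Rightarrow> complex"
  proof -
    have [measurable]: "u \<in> borel_measurable borel" "v \<in> borel_measurable borel" by (intro schwartz_borel u v)+
    obtain C where C: "0 \<le> C" "\<And>x. norm (u x) \<le> C / (1 + norm x) ^ 0" using schwartz_bound0[OF u] by metis
    show ?thesis
    proof (rule integral_dominated_convergence)
      show "integrable lborel (\<lambda>k. C * norm (v k))" by (intro integrable_mult_right integrable_norm schwartz_integrable v)
      show "AE k in lborel. (\<lambda>n. u (h n *\<^sub>R k) * v k) \<longlonglongrightarrow> u 0 * v k"
        by (intro AE_I2 tendsto_mult cont u tendsto_const)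
      show "\<And>i. AE x in lborel. norm (u (h i *\<^sub>R x) * v x) \<le> C * norm (v x)"
        using C by (intro AE_I2) (simp add: norm_mult mult_right_mono)
    qed measurable
  qed
  have "(\<lambda>n. LINT k|lborel. fourier f k * g (h n *\<^sub>R k)) \<longlonglongrightarrow> (LINT k|lborel. g 0 * fourier f k)"
    using lim[OF g schwartz_fourier[OF f]] by (simp add: mult.commute)
  moreover have "(\<lambda>n. LINT k|lborel. fourier f k * g (h n *\<^sub>R k)) \<longlonglongrightarrow> (LINT k|lborel. f 0 * fourier g k)"
    unfolding eq by (rule lim[OF f schwartz_fourier[OF g]])
  ultimately have "(LINT k|lborel. g 0 * fourier f k) = (LINT k|lborel. f 0 * fourier g k)"
    by (rule LIMSEQ_unique)
  then show ?thesis by simp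
qed

lemma fourier_shift:
  fixes f :: "'a::euclidean_space \<Rightarrow> complex"
  assumes f: "schwartz f" shows "fourier (\<lambda>y. f (y - x)) k = cis (k \<bullet> x) * fourier f k"
proof -
  have [measurable]: "f \<in> borel_measurable borel" by (rule schwartz_borel[OF f])
  have "(LINT y|lborel. cis (k \<bullet> y) * f (y - x)) = (LINT y|lborel. (\<lambda>y. cis (k \<bullet> y) * f (y - x)) (y + x))"
    by (rule lborel_integral_shift[symmetric]) measurable
  also have "\<dots> = (LINT y|lborel. cis (k \<bullet> x) * (cis (k \<bullet> y) * f y))"
    by (simp add: inner_add_right cis_mult[symmetric] mult_ac)
  finally show ?thesis unfolding fourier_def by simp
qed

lemma fourier_uminus:
  fixes f :: "'a::euclidean_space \<Rightarrow> complex"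
  assumes f: "schwartz f" shows "fourier (\<lambda>y. f (- y)) k = fourier f (- k)"
proof -
  have [measurable]: "f \<in> borel_measurable borel" by (rule schwartz_borel[OF f])
  have "(LINT y|lborel. (\<lambda>y. cis ((- k) \<bullet> y) * f y) (- y)) = (LINT y|lborel. cis ((- k) \<bullet> y) * f y)"
    by (rule lborel_integral_uminus) measurable
  then show ?thesis unfolding fourier_def by simp
qed

text \<open>Applied to translates of \<open>f\<close>, the identity at the origin gives the formula
  at every point. The constant is \<open>(2 * pi) ^ DIM('a)\<close>, but it is characterised only as
  nonzero, which is what makes the transform surjective.\<close>

lemma fourier_inversion:
  obtains c :: complex where "c \<noteq> 0"
    "\<And>f x. schwartz f \<Longrightarrow> fourier (fourier f) x = c * f (- x :: 'a::euclidean_space)"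
proof -
  obtain b :: "'a \<Rightarrow> real" where b: "smooth b" "\<And>x. 0 \<le> b x" "b 0 = 1"
    "\<And>x. 1 \<le> norm (x - 0) \<Longrightarrow> b x = 0" "integrable lborel b" "0 < integral\<^sup>L lborel b"
    using bump_exists[of 1 "0::'a"] by auto
  define g where "g x = complex_of_real (b x)" for x
  have sg: "schwartz g" unfolding g_def
    by (rule schwartzI_compact[where K="cball 0 1"]) (use b in \<open>auto intro: smooth_blin[OF bounded_linear_of_real]\<close>)
  define c where "c = (LINT y|lborel. fourier g y)"
  have c: "(LINT k|lborel. fourier f k) = c * f 0" if "schwartz f" for f :: "'a \<Rightarrow> complex"
    using fourier_integral_at_0[OF that sg] b(3) by (simp add: g_def c_def mult.commute)
  have inv: "fourier (fourier f) x = c * f (- x)" if f: "schwartz f" for f :: "'a \<Rightarrow> complex" and x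
  proof -
    have "schwartz (\<lambda>y. f (y - x))" using schwartz_shift[OF f, of "- x"] by simp
    then have "(LINT k|lborel. fourier (\<lambda>y. f (y - x)) k) = c * f (0 - x)" by (rule c)
    then show ?thesis unfolding fourier_shift[OF f] by (simp add: fourier_def inner_commute)
  qed
  \<comment> \<open>For \<open>c = 0\<close> the multiplication formula for \<open>g\<close> and its
    reflection would make the integral of \<open>(norm (fourier g k))\<^sup>2\<close> vanish,
    whereas \<open>fourier g\<close> is continuous and \<open>fourier g 0\<close> is the positive
    integral of the bump.\<close>
  have "c \<noteq> 0"
  proof
    assume c0: "c = 0"
    have s2: "schwartz (\<lambda>y. g (- y))" by (rule schwartz_uminus[OF sg])
    have cn: "fourier (\<lambda>y. g (- y)) k = cnj (fourier g k)" for k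
    proof -
      have "cnj (fourier g k) = (LINT y|lborel. cnj (cis (k \<bullet> y) * g y))"
        unfolding fourier_def by (rule Bochner_Integration.integral_cnj[symmetric])
      also have "\<dots> = fourier g (- k)" unfolding fourier_def by (simp add: g_def cis_cnj)
      finally show ?thesis using fourier_uminus[OF sg] by simp
    qed
    have "(LINT k|lborel. fourier g k * fourier (\<lambda>y. g (- y)) k) = (LINT y|lborel. g y * fourier (fourier (\<lambda>y. g (- y))) y)"
      by (intro fourier_multiplication schwartz_integrable sg schwartz_fourier s2)
    also have "\<dots> = 0" using inv[OF s2] c0 by simp
    finally have z: "(LINT k|lborel. complex_of_real ((norm (fourier g k))\<^sup>2)) = 0"
      unfolding cn by (simp add: complex_norm_square[symmetric])
    then have z: "(LINT k|lborel. (norm (fourier g k))\<^sup>2) = 0"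
      by (simp only: integral_complex_of_real of_real_eq_0_iff)
    have "fourier g 0 = of_real (integral\<^sup>L lborel b)" unfolding fourier_def g_def by simp
    then have p: "norm (fourier g 0) > 0" using b(6) by simp
    define d where "d = norm (fourier g 0) / 2"
    have "continuous_on UNIV (\<lambda>k. norm (fourier g k))"
      by (intro continuous_intros smooth_continuous_on schwartz_smooth schwartz_fourier sg)
    then have "open {k. d < norm (fourier g k)}" by (intro open_Collect_less) auto
    moreover have "0 \<in> {k. d < norm (fourier g k)}" using p by (simp add: d_def)
    ultimately obtain r where r: "r > 0" "cball 0 r \<subseteq> {k. d < norm (fourier g k)}" using open_contains_cball by metis
    have i1: "integrable lborel (\<lambda>k. d\<^sup>2 * indicator (cball 0 r) k :: real)"
      by (rule integrable_mult_right, rule integrable_real_indicator, simp, rule emeasure_bounded_finite, rule bounded_cball)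
    have i2: "integrable lborel (\<lambda>k. (norm (fourier g k))\<^sup>2)"
    proof -
      have "schwartz (\<lambda>k. fourier g k * fourier (\<lambda>y. g (- y)) k)"
        by (intro schwartz_mult schwartz_slow schwartz_fourier sg s2)
      from integrable_norm[OF schwartz_integrable[OF this]]
      show ?thesis unfolding cn by (simp add: norm_mult power2_eq_square)
    qed
    have "d\<^sup>2 * measure lborel (cball (0::'a) r) = (LINT k|lborel. d\<^sup>2 * indicator (cball (0::'a) r) k)" by simp
    also have "\<dots> \<le> (LINT k|lborel. (norm (fourier g k))\<^sup>2)"
    proof (rule integral_mono[OF i1 i2])
      fix k :: 'a
      show "d\<^sup>2 * indicator (cball 0 r) k \<le> (norm (fourier g k))\<^sup>2"
        using r(2) p by (cases "k \<in> cball 0 r") (auto simp: d_def intro!: power_mono)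
    qed
    finally have "d\<^sup>2 * measure lborel (cball (0::'a) r) \<le> 0" using z by simp
    moreover have "d\<^sup>2 * measure lborel (cball (0::'a) r) > 0"
      using p r(1) content_cball_pos[of r "0::'a"] by (intro mult_pos_pos) (auto simp: d_def)
    ultimately show False by linarith
  qed
  then show ?thesis using that inv by blast
qed

lemma fourier_surj:
  fixes \<sigma> :: "'a::euclidean_space \<Rightarrow> complex"
  assumes s: "schwartz \<sigma>" obtains S where "schwartz S" "\<And>k. fourier S k = \<sigma> k"
proof -
  obtain c :: complex where c: "c \<noteq> 0" "\<And>f x. schwartz f \<Longrightarrow> fourier (fourier f) x = c * f (- x :: 'a)"
    using fourier_inversion by blast
  have u: "schwartz (\<lambda>x. fourier \<sigma> (- x))" by (rule schwartz_uminus[OF schwartz_fourier[OF s]])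
  define S where "S x = (1 / c) * fourier \<sigma> (- x)" for x
  have "schwartz S" unfolding S_def[abs_def] by (rule schwartz_cmult[OF u])
  moreover have "fourier S k = \<sigma> k" for k
  proof -
    have "fourier S k = (1 / c) * fourier (\<lambda>x. fourier \<sigma> (- x)) k"
      unfolding fourier_def S_def by (simp flip: integral_mult_right_zero add: mult_ac)
    also have "\<dots> = (1 / c) * fourier (fourier \<sigma>) (- k)" by (simp add: fourier_uminus[OF schwartz_fourier[OF s]])
    finally show ?thesis using c(1) c(2)[OF s, of "- k"] by simp
  qed
  ultimately show ?thesis using that by blast
qed

section \<open>Fourier integrals inside tempered functionals\<close>

abbreviation pw_mult :: "'a::euclidean_space \<Rightarrow> ('a \<Rightarrow> complex) \<Rightarrow> 'a \<Rightarrow> complex" where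
  "pw_mult k F \<equiv> \<lambda>z. cis (k \<bullet> z) * F z"

text \<open>The derivative conjugated by the plane wave: differentiating \<open>pw_mult k F\<close>
  in direction \<open>w\<close> gives \<open>pw_mult k (pw_step k w F)\<close>, so the wave always
  stays in front of a Schwartz function.\<close>

definition pw_step :: "'a::euclidean_space \<Rightarrow> 'a \<Rightarrow> ('a \<Rightarrow> complex) \<Rightarrow> 'a \<Rightarrow> complex" where
  "pw_step k w F = (\<lambda>z. dderiv w F z + \<i> * of_real (k \<bullet> w) * F z)"

lemma schwartz_pw_step: "schwartz F \<Longrightarrow> schwartz (pw_step k w F)"
  unfolding pw_step_def by (intro schwartz_add schwartz_dderiv schwartz_cmult)

lemma schwartz_pw_mult: "schwartz F \<Longrightarrow> schwartz (pw_mult k F)"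
  by (rule schwartz_mult[OF slow_cis])

lemma pw_mult_derivative:
  assumes F: "schwartz F"
  shows "(pw_mult k F has_derivative (\<lambda>w. pw_mult k (pw_step k w F) z)) (at z)"
proof -
  have "(pw_mult k F has_derivative (\<lambda>w. cis (k \<bullet> z) * dderiv w F z + (\<i> * of_real (k \<bullet> w)) * cis (k \<bullet> z) * F z)) (at z)"
    by (rule has_derivative_mult[OF has_derivative_cis_inner smooth_has_derivative[OF schwartz_smooth[OF F]]])
  then show ?thesis by (simp add: pw_step_def algebra_simps)
qed

lemma schwartz_weighted_bound:
  assumes "schwartz F" obtains C where "0 \<le> C" "\<And>z. (1 + norm z) ^ k * norm (F z) \<le> C"
proof -
  obtain C where "0 \<le> C" "\<And>z. norm (F z) \<le> C / (1 + norm z) ^ k" using schwartz_bound0[OF assms] by metis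
  then show ?thesis using that[of C] by (simp add: le_divide_eq mult.commute)
qed

text \<open>The three kinds of families which occur among the derivatives of the second order Taylor
  remainder in \<open>h\<close> of the plane wave \<open>cis ((k + h) \<bullet> z)\<close>.\<close>
definition taylor_fams :: "'a::euclidean_space \<Rightarrow> ('a \<Rightarrow> 'a \<Rightarrow> complex) \<Rightarrow> bool" where
  "taylor_fams k f \<longleftrightarrow> (\<exists>F c K. schwartz F \<and> 0 \<le> K \<and>
     ((\<forall>h. norm (c h :: complex) \<le> K * norm h) \<and> f = (\<lambda>h z. c h * (pw_mult (k + h) F z - pw_mult k F z)) \<or>
      (\<forall>h. norm h \<le> 1 \<longrightarrow> norm (c h) \<le> K * (norm h)\<^sup>2) \<and> f = (\<lambda>h z. c h * pw_mult (k + h) F z) \<or>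
      f = (\<lambda>h z. pw_mult (k + h) F z - pw_mult k F z - \<i> * of_real (h \<bullet> z) * pw_mult k F z)))"

lemma taylor_famsI1: "schwartz F \<Longrightarrow> (\<And>h. norm (c h :: complex) \<le> K * norm h) \<Longrightarrow> 0 \<le> K \<Longrightarrow>
    taylor_fams k (\<lambda>h z. c h * (pw_mult (k + h) F z - pw_mult k F z))"
  unfolding taylor_fams_def by blast

lemma taylor_famsI2: "schwartz F \<Longrightarrow> (\<And>h. norm h \<le> 1 \<Longrightarrow> norm (c h :: complex) \<le> K * (norm h)\<^sup>2) \<Longrightarrow> 0 \<le> K \<Longrightarrow>
    taylor_fams k (\<lambda>h z. c h * pw_mult (k + h) F z)"
  unfolding taylor_fams_def by blast

lemma taylor_famsI3: "schwartz F \<Longrightarrow>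
    taylor_fams k (\<lambda>h z. pw_mult (k + h) F z - pw_mult k F z - \<i> * of_real (h \<bullet> z) * pw_mult k F z)"
  unfolding taylor_fams_def by (rule exI[of _ F], rule exI[of _ "\<lambda>_. 0"], rule exI[of _ 0]) auto

lemma norm_pw_diff: "norm (pw_mult (k + h) F z - pw_mult k F z) \<le> norm h * ((1 + norm z) * norm (F z))"
proof -
  have "pw_mult (k + h) F z - pw_mult k F z = cis (k \<bullet> z) * ((cis (h \<bullet> z) - 1) * F z)"
    by (simp add: inner_add_left cis_mult[symmetric] algebra_simps)
  then have "norm (pw_mult (k + h) F z - pw_mult k F z) = norm (cis (h \<bullet> z) - 1) * norm (F z)"
    by (simp add: norm_mult)
  also have "\<dots> \<le> (norm h * (1 + norm z)) * norm (F z)"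
  proof (rule mult_right_mono)
    have "norm (cis (h \<bullet> z) - 1) \<le> \<bar>h \<bullet> z\<bar>" by (rule norm_cis_minus_1)
    also have "\<dots> \<le> norm h * norm z" by (rule Cauchy_Schwarz_ineq2)
    also have "\<dots> \<le> norm h * (1 + norm z)" by (intro mult_left_mono) auto
    finally show "norm (cis (h \<bullet> z) - 1) \<le> norm h * (1 + norm z)" .
  qed simp
  finally show ?thesis by (simp add: mult.assoc)
qed

text \<open>Each kind is quadratic in \<open>h\<close> for its own reason: a linear coefficient
  times a first difference, a quadratic coefficient, or a second order remainder of
  \<open>cis\<close>. The powers of \<open>norm z\<close> lost on the way, at most two, are paid by
  the decay of \<open>F\<close>.\<close>

lemma taylor_fams_bound:
  assumes "taylor_fams k f" shows "fbd {h. norm h \<le> 1} (\<lambda>h. (norm h)\<^sup>2) f"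
  unfolding fbd_def
proof
  fix n
  obtain F c K where F: "schwartz F" and K: "0 \<le> K" and alt:
     "(\<forall>h. norm (c h :: complex) \<le> K * norm h) \<and> f = (\<lambda>h z. c h * (pw_mult (k + h) F z - pw_mult k F z)) \<or>
      (\<forall>h. norm h \<le> 1 \<longrightarrow> norm (c h) \<le> K * (norm h)\<^sup>2) \<and> f = (\<lambda>h z. c h * pw_mult (k + h) F z) \<or>
      f = (\<lambda>h z. pw_mult (k + h) F z - pw_mult k F z - \<i> * of_real (h \<bullet> z) * pw_mult k F z)"
    using assms unfolding taylor_fams_def by blast
  obtain C where C: "0 \<le> C" "\<And>z. (1 + norm z) ^ (n + 2) * norm (F z) \<le> C" using schwartz_weighted_bound[OF F] by metis
  have le2: "norm (f h z) \<le> (K + 1) * (norm h)\<^sup>2 * ((1 + norm z)\<^sup>2 * norm (F z))" if h: "norm h \<le> 1" for h z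
  proof -
    have one: "1 \<le> 1 + norm z" by simp
    have F1: "(1 + norm z) * norm (F z) \<le> (1 + norm z)\<^sup>2 * norm (F z)"
      by (intro mult_right_mono) (auto simp: power2_eq_square)
    have F0: "norm (F z) \<le> (1 + norm z)\<^sup>2 * norm (F z)"
      using mult_right_mono[of 1 "(1 + norm z)\<^sup>2" "norm (F z)"] by simp
    have KK: "K * (norm h)\<^sup>2 * ((1 + norm z)\<^sup>2 * norm (F z)) \<le> (K + 1) * (norm h)\<^sup>2 * ((1 + norm z)\<^sup>2 * norm (F z))"
      by (intro mult_right_mono) auto
    from alt consider (1) "\<forall>h. norm (c h) \<le> K * norm h" "f = (\<lambda>h z. c h * (pw_mult (k + h) F z - pw_mult k F z))"
      | (2) "\<forall>h. norm h \<le> 1 \<longrightarrow> norm (c h) \<le> K * (norm h)\<^sup>2" "f = (\<lambda>h z. c h * pw_mult (k + h) F z)"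
      | (3) "f = (\<lambda>h z. pw_mult (k + h) F z - pw_mult k F z - \<i> * of_real (h \<bullet> z) * pw_mult k F z)" by blast
    then show ?thesis
    proof cases
      case 1
      have "norm (f h z) \<le> (K * norm h) * (norm h * ((1 + norm z) * norm (F z)))"
        unfolding 1(2) norm_mult using 1(1) norm_pw_diff[of k h z F] K by (intro mult_mono) auto
      also have "\<dots> = K * (norm h)\<^sup>2 * ((1 + norm z) * norm (F z))" by (simp add: power2_eq_square)
      also have "\<dots> \<le> K * (norm h)\<^sup>2 * ((1 + norm z)\<^sup>2 * norm (F z))" using K by (intro mult_left_mono F1) auto
      finally show ?thesis using KK by linarith
    next
      case 2
      have "norm (f h z) \<le> K * (norm h)\<^sup>2 * norm (F z)"
        unfolding 2(2) using 2(1) h by (simp add: norm_mult mult_right_mono)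
      also have "\<dots> \<le> K * (norm h)\<^sup>2 * ((1 + norm z)\<^sup>2 * norm (F z))" using K by (intro mult_left_mono F0) auto
      finally show ?thesis using KK by linarith
    next
      case 3
      have "f h z = cis (k \<bullet> z) * ((cis (h \<bullet> z) - 1 - \<i> * of_real (h \<bullet> z)) * F z)"
        unfolding 3 by (simp add: inner_add_left cis_mult[symmetric] algebra_simps)
      then have "norm (f h z) \<le> (h \<bullet> z)\<^sup>2 * norm (F z)"
        using mult_right_mono[OF norm_cis_taylor[of "h \<bullet> z"], of "norm (F z)"] by (simp add: norm_mult)
      also have "\<dots> \<le> (norm h * (1 + norm z))\<^sup>2 * norm (F z)"
      proof (intro mult_right_mono)
        have "\<bar>h \<bullet> z\<bar> \<le> norm h * norm z" by (rule Cauchy_Schwarz_ineq2)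
        also have "\<dots> \<le> norm h * (1 + norm z)" by (intro mult_left_mono) auto
        finally have "\<bar>h \<bullet> z\<bar>\<^sup>2 \<le> (norm h * (1 + norm z))\<^sup>2" by (intro power_mono) auto
        then show "(h \<bullet> z)\<^sup>2 \<le> (norm h * (1 + norm z))\<^sup>2" by simp
      qed simp
      also have "\<dots> = 1 * (norm h)\<^sup>2 * ((1 + norm z)\<^sup>2 * norm (F z))" by (simp add: power_mult_distrib)
      also have "\<dots> \<le> (K + 1) * (norm h)\<^sup>2 * ((1 + norm z)\<^sup>2 * norm (F z))" using K by (intro mult_right_mono) auto
      finally show ?thesis .
    qed
  qed
  have "(1 + norm z) ^ n * norm (f h z) \<le> ((K + 1) * C) * (norm h)\<^sup>2" if h: "norm h \<le> 1" for h z
  proof -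
    have "(1 + norm z) ^ n * norm (f h z) \<le> (1 + norm z) ^ n * ((K + 1) * (norm h)\<^sup>2 * ((1 + norm z)\<^sup>2 * norm (F z)))"
      by (intro mult_left_mono le2 h) simp
    also have "\<dots> = ((K + 1) * (norm h)\<^sup>2) * ((1 + norm z) ^ (n + 2) * norm (F z))" by (simp only: power_add mult_ac)
    also have "\<dots> \<le> ((K + 1) * (norm h)\<^sup>2) * C" using K by (intro mult_left_mono C) auto
    finally show ?thesis by (simp add: mult_ac)
  qed
  then show "\<exists>C. \<forall>h\<in>{h. norm h \<le> 1}. \<forall>z. (1 + norm z) ^ n * norm (f h z) \<le> C * (norm h)\<^sup>2" by blast
qed

text \<open>Differentiating the wave of frequency \<open>k + h\<close> produces, besides the term
  with \<open>pw_step k\<close>, an extra factor \<open>h \<bullet> w\<close> that raises the order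
  in \<open>h\<close>. A remainder thus yields a remainder and a first difference, a first
  difference yields another one and a term with quadratic coefficient, and the latter kind
  reproduces itself.\<close>

lemma taylor_fams_deriv:
  assumes "taylor_fams k f"
  shows "(\<forall>h\<in>{h. norm h \<le> 1}. \<forall>z. f h differentiable (at z)) \<and>
    (\<forall>w. sumcl {h. norm h \<le> 1} (taylor_fams k) (\<lambda>h. dderiv w (f h)))"
proof -
  let ?I = "{h::'a. norm h \<le> 1}"
  obtain F c K where F: "schwartz F" and K: "0 \<le> K" and alt:
     "(\<forall>h. norm (c h :: complex) \<le> K * norm h) \<and> f = (\<lambda>h z. c h * (pw_mult (k + h) F z - pw_mult k F z)) \<or>
      (\<forall>h. norm h \<le> 1 \<longrightarrow> norm (c h) \<le> K * (norm h)\<^sup>2) \<and> f = (\<lambda>h z. c h * pw_mult (k + h) F z) \<or>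
      f = (\<lambda>h z. pw_mult (k + h) F z - pw_mult k F z - \<i> * of_real (h \<bullet> z) * pw_mult k F z)"
    using assms unfolding taylor_fams_def by blast
  note D = pw_mult_derivative[OF F]
  have SF: "schwartz (pw_step k w F)" for w by (rule schwartz_pw_step[OF F])
  have split: "pw_mult (k + h) (pw_step (k + h) w F) z = pw_mult (k + h) (pw_step k w F) z + \<i> * of_real (h \<bullet> w) * pw_mult (k + h) F z" for h w z
    by (simp add: pw_step_def inner_add_left algebra_simps)
  have hw: "\<bar>h \<bullet> w\<bar> \<le> norm w * norm h" for h w :: 'a using Cauchy_Schwarz_ineq2[of h w] by (simp add: mult.commute)
  from alt consider (1) "\<forall>h. norm (c h) \<le> K * norm h" "f = (\<lambda>h z. c h * (pw_mult (k + h) F z - pw_mult k F z))"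
    | (2) "\<forall>h. norm h \<le> 1 \<longrightarrow> norm (c h) \<le> K * (norm h)\<^sup>2" "f = (\<lambda>h z. c h * pw_mult (k + h) F z)"
    | (3) "f = (\<lambda>h z. pw_mult (k + h) F z - pw_mult k F z - \<i> * of_real (h \<bullet> z) * pw_mult k F z)" by blast
  then show ?thesis
  proof cases
    case 1
    have d: "(f h has_derivative (\<lambda>w. c h * (pw_mult (k + h) (pw_step (k + h) w F) z - pw_mult k (pw_step k w F) z))) (at z)" for h z
      unfolding 1(2) by (intro has_derivative_mult_right has_derivative_diff D)
    have "sumcl ?I (taylor_fams k) (\<lambda>h. dderiv w (f h))" for w
    proof (rule sumcl_bases)
      show "taylor_fams k (\<lambda>h z. c h * (pw_mult (k + h) (pw_step k w F) z - pw_mult k (pw_step k w F) z))"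
        by (rule taylor_famsI1[OF SF _ K]) (use 1 in blast)
      show "taylor_fams k (\<lambda>h z. (c h * (\<i> * of_real (h \<bullet> w))) * pw_mult (k + h) F z)"
      proof (rule taylor_famsI2[OF F])
        show "norm (c h * (\<i> * of_real (h \<bullet> w))) \<le> (K * norm w) * (norm h)\<^sup>2" for h
        proof -
          have "norm (c h) * \<bar>h \<bullet> w\<bar> \<le> (K * norm h) * (norm w * norm h)"
            using 1(1) K by (intro mult_mono hw) auto
          then show ?thesis by (simp add: norm_mult power2_eq_square mult_ac)
        qed
      qed (use K in simp)
    qed (simp only: dderiv_eq[OF d] split, simp add: algebra_simps)
    then show ?thesis using d by (auto simp: differentiable_def)
  next
    case 2
    have d: "(f h has_derivative (\<lambda>w. c h * pw_mult (k + h) (pw_step (k + h) w F) z)) (at z)" for h z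
      unfolding 2(2) by (intro has_derivative_mult_right D)
    have "sumcl ?I (taylor_fams k) (\<lambda>h. dderiv w (f h))" for w
    proof (rule sumcl_bases)
      show "taylor_fams k (\<lambda>h z. c h * pw_mult (k + h) (pw_step k w F) z)"
        by (rule taylor_famsI2[OF SF _ K]) (use 2 in blast)
      show "taylor_fams k (\<lambda>h z. (c h * (\<i> * of_real (h \<bullet> w))) * pw_mult (k + h) F z)"
      proof (rule taylor_famsI2[OF F])
        show "norm (c h * (\<i> * of_real (h \<bullet> w))) \<le> (K * norm w) * (norm h)\<^sup>2" if h: "norm h \<le> 1" for h
        proof -
          have "norm w * norm h \<le> norm w * 1" using h by (intro mult_left_mono) auto
          then have "norm (c h) * \<bar>h \<bullet> w\<bar> \<le> (K * (norm h)\<^sup>2) * norm w"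
            using 2(1) h K hw[of h w] by (intro mult_mono) auto
          then show ?thesis by (simp add: norm_mult mult_ac)
        qed
      qed (use K in simp)
    qed (simp only: dderiv_eq[OF d] split, simp add: algebra_simps)
    then show ?thesis using d by (auto simp: differentiable_def)
  next
    case 3
    have bl: "bounded_linear (\<lambda>z. complex_of_real (h \<bullet> z))" for h :: 'a
      by (rule bounded_linear_compose[OF bounded_linear_of_real bounded_linear_inner_right])
    have d: "(f h has_derivative (\<lambda>w. pw_mult (k + h) (pw_step (k + h) w F) z - pw_mult k (pw_step k w F) z -
        ((\<i> * of_real (h \<bullet> z)) * pw_mult k (pw_step k w F) z + (\<i> * of_real (h \<bullet> w)) * pw_mult k F z))) (at z)" for h z
      unfolding 3 by (intro has_derivative_diff has_derivative_mult D has_derivative_mult_right bounded_linear_imp_has_derivative[OF bl])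
    have "sumcl ?I (taylor_fams k) (\<lambda>h. dderiv w (f h))" for w
    proof (rule sumcl_bases)
      show "taylor_fams k (\<lambda>h z. pw_mult (k + h) (pw_step k w F) z - pw_mult k (pw_step k w F) z - \<i> * of_real (h \<bullet> z) * pw_mult k (pw_step k w F) z)"
        by (rule taylor_famsI3[OF SF])
      show "taylor_fams k (\<lambda>h z. (\<i> * of_real (h \<bullet> w)) * (pw_mult (k + h) F z - pw_mult k F z))"
        by (rule taylor_famsI1[OF F, where K="norm w"]) (use hw in \<open>auto simp: norm_mult\<close>)
    qed (simp only: dderiv_eq[OF d] split, simp add: algebra_simps)
    then show ?thesis using d by (auto simp: differentiable_def)
  qed
qed

text \<open>As a function of \<open>k\<close>, the Fourier transform of the distribution
  \<open>F s\<close>; the decay of \<open>F\<close> makes it a smooth function.\<close>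

definition pwt :: "(('a::euclidean_space \<Rightarrow> complex) \<Rightarrow> complex) \<Rightarrow> ('a \<Rightarrow> complex) \<Rightarrow> 'a \<Rightarrow> complex" where
  "pwt s F k = s (pw_mult k F)"

lemma schwartz_inner_mult': "schwartz F \<Longrightarrow> schwartz (\<lambda>z. \<i> * of_real (v \<bullet> z) * F z)"
  using schwartz_inner_mult[of F v] by (simp add: inner_commute)

text \<open>The Taylor remainders of the plane wave form an \<open>sfam\<close> of rate
  \<open>(norm h)\<^sup>2\<close>, so \<open>s\<close> maps them to a quadratic remainder of
  \<open>pwt s F\<close>.\<close>

lemma pwt_has_derivative:
  assumes s: "tempered s" and F: "schwartz F"
  shows "(pwt s F has_derivative (\<lambda>v. pwt s (\<lambda>z. \<i> * of_real (v \<bullet> z) * F z) k)) (at k)"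
proof -
  let ?R = "\<lambda>h z. pw_mult (k + h) F z - pw_mult k F z - \<i> * of_real (h \<bullet> z) * pw_mult k F z"
  have fam: "sfam {h. norm h \<le> 1} (\<lambda>h. (norm h)\<^sup>2) ?R"
  proof (rule sfam_sumcl[where B="taylor_fams k"])
    show "sumcl {h. norm h \<le> 1} (taylor_fams k) ?R" by (rule sumcl.base[where f="?R"], rule taylor_famsI3[OF F], simp)
  qed (use taylor_fams_bound taylor_fams_deriv in blast)
  have w: "\<And>h::'a. h \<in> {h. norm h \<le> 1} \<Longrightarrow> 0 \<le> (norm h)\<^sup>2" by simp
  obtain C where C: "0 \<le> C" "\<And>h. h \<in> {h. norm h \<le> 1} \<Longrightarrow> norm (s (?R h)) \<le> C * (norm h)\<^sup>2"
    using tempered_family[OF s fam w] by blast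
  have Sv: "schwartz (\<lambda>z. \<i> * of_real (v \<bullet> z) * pw_mult k F z)" for v
    by (rule schwartz_inner_mult'[OF schwartz_pw_mult[OF F]])
  have eqv: "pwt s (\<lambda>z. \<i> * of_real (v \<bullet> z) * F z) k = s (\<lambda>z. \<i> * of_real (v \<bullet> z) * pw_mult k F z)" for v
    unfolding pwt_def by (simp add: mult_ac)
  have lin: "linear (\<lambda>v. s (\<lambda>z. \<i> * of_real (v \<bullet> z) * pw_mult k F z))"
  proof
    fix u v :: 'a and r :: real
    show "s (\<lambda>z. \<i> * of_real ((u + v) \<bullet> z) * pw_mult k F z) =
      s (\<lambda>z. \<i> * of_real (u \<bullet> z) * pw_mult k F z) + s (\<lambda>z. \<i> * of_real (v \<bullet> z) * pw_mult k F z)"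
      using tempered_add[OF s Sv[of u] Sv[of v]] by (simp add: inner_add_left algebra_simps)
    show "s (\<lambda>z. \<i> * of_real ((r *\<^sub>R v) \<bullet> z) * pw_mult k F z) = r *\<^sub>R s (\<lambda>z. \<i> * of_real (v \<bullet> z) * pw_mult k F z)"
      using tempered_cmult[OF s Sv[of v], of "of_real r"] by (simp add: scaleR_conv_of_real mult_ac)
  qed
  show ?thesis unfolding eqv
  proof (rule has_derivative_quadratic)
    show "bounded_linear (\<lambda>v. s (\<lambda>z. \<i> * of_real (v \<bullet> z) * pw_mult k F z))"
      using lin by (simp add: linear_conv_bounded_linear)
    fix h :: 'a assume h: "norm h \<le> 1"
    have "s (?R h) = pwt s F (k + h) - pwt s F k - s (\<lambda>z. \<i> * of_real (h \<bullet> z) * pw_mult k F z)"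
      unfolding pwt_def
      using tempered_diff[OF s schwartz_diff[OF schwartz_pw_mult[OF F, of "k + h"] schwartz_pw_mult[OF F, of k]] Sv[of h]]
        tempered_diff[OF s schwartz_pw_mult[OF F, of "k + h"] schwartz_pw_mult[OF F, of k]] by simp
    then show "norm (pwt s F (k + h) - pwt s F k - s (\<lambda>z. \<i> * of_real (h \<bullet> z) * pw_mult k F z)) \<le> C * (norm h)\<^sup>2"
      using C(2)[of h] h by simp
  qed
qed

lemma dderiv_pwt: "tempered s \<Longrightarrow> schwartz F \<Longrightarrow> dderiv v (pwt s F) = pwt s (\<lambda>z. \<i> * of_real (v \<bullet> z) * F z)"
  by (rule ext, rule dderiv_eq[OF pwt_has_derivative])

lemma smooth_pwt:
  assumes s: "tempered s" and F: "schwartz F" shows "smooth (pwt s F)"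
proof (rule smooth_coinduct[where P="\<lambda>h. \<exists>F. schwartz F \<and> h = pwt s F"])
  fix h assume "\<exists>F. schwartz F \<and> h = pwt s F"
  then obtain F where F: "schwartz F" and h: "h = pwt s F" by blast
  show "(\<forall>x. h differentiable at x) \<and> (\<forall>v. \<exists>F. schwartz F \<and> dderiv v h = pwt s F)"
    unfolding h dderiv_pwt[OF s F] differentiable_def
    using pwt_has_derivative[OF s F] schwartz_inner_mult'[OF F] by blast
qed (use F in blast)

section \<open>Exchanging a tempered functional with a Fourier integral\<close>

fun waves :: "'a::euclidean_space list \<Rightarrow> 'a \<Rightarrow> complex" where
  "waves [] k = 1"
| "waves (w # ws) k = \<i> * of_real (w \<bullet> k) * waves ws k"

text \<open>\<open>waves\<close> collects the factors brought down from
  \<open>cis (z \<bullet> k)\<close> by derivatives in \<open>z\<close>. The Lipschitz bound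
  compares them at the true frequency and at its approximation by a simple function.\<close>

lemma waves_lipschitz: "\<exists>A L. 0 \<le> A \<and> 0 \<le> L \<and> (\<forall>k. norm k \<le> R \<longrightarrow> norm (waves ws k) \<le> A) \<and>
   (\<forall>k l. norm k \<le> R \<longrightarrow> norm l \<le> R \<longrightarrow> norm (waves ws k - waves ws l) \<le> L * norm (l - k))"
proof (induct ws)
  case Nil show ?case by (rule exI[of _ 1], rule exI[of _ 0]) auto
next
  case (Cons w ws)
  then obtain A L where A: "0 \<le> A" "0 \<le> L" "\<And>k. norm k \<le> R \<Longrightarrow> norm (waves ws k) \<le> A"
    "\<And>k l. norm k \<le> R \<Longrightarrow> norm l \<le> R \<Longrightarrow> norm (waves ws k - waves ws l) \<le> L * norm (l - k)" by blast
  have w: "\<bar>w \<bullet> k\<bar> \<le> norm w * \<bar>R\<bar>" if "norm k \<le> R" for k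
  proof -
    have "\<bar>w \<bullet> k\<bar> \<le> norm w * norm k" by (rule Cauchy_Schwarz_ineq2)
    also have "\<dots> \<le> norm w * \<bar>R\<bar>" using that by (intro mult_left_mono) auto
    finally show ?thesis .
  qed
  have 1: "norm (waves (w # ws) k) \<le> (norm w * \<bar>R\<bar>) * A" if "norm k \<le> R" for k
    using mult_mono[OF w[OF that] A(3)[OF that]] A(1) by (simp add: norm_mult)
  have 2: "norm (waves (w # ws) k - waves (w # ws) l) \<le> (norm w * \<bar>R\<bar> * L + norm w * A) * norm (l - k)"
    if kl: "norm k \<le> R" "norm l \<le> R" for k l
  proof -
    have "waves (w # ws) k - waves (w # ws) l = \<i> * (of_real (w \<bullet> k) * (waves ws k - waves ws l) - of_real (w \<bullet> (l - k)) * waves ws l)"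
      by (simp add: inner_diff_right algebra_simps)
    then have "norm (waves (w # ws) k - waves (w # ws) l) = norm (of_real (w \<bullet> k) * (waves ws k - waves ws l) - of_real (w \<bullet> (l - k)) * waves ws l)"
      by (simp add: norm_mult)
    also have "\<dots> \<le> \<bar>w \<bullet> k\<bar> * norm (waves ws k - waves ws l) + \<bar>w \<bullet> (l - k)\<bar> * norm (waves ws l)"
      by (rule order_trans[OF norm_triangle_ineq4]) (simp add: norm_mult)
    also have "\<dots> \<le> (norm w * \<bar>R\<bar>) * (L * norm (l - k)) + (norm w * norm (l - k)) * A"
      using w[OF kl(1)] A kl by (intro add_mono mult_mono Cauchy_Schwarz_ineq2) auto
    finally show ?thesis by (simp add: algebra_simps)
  qed
  show ?case
    by (rule exI[of _ "(norm w * \<bar>R\<bar>) * A"], rule exI[of _ "norm w * \<bar>R\<bar> * L + norm w * A"]) (use 1 2 A in auto)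
qed

lemma waves_measurable [measurable]: "waves ws \<in> borel_measurable borel"
proof -
  have "continuous_on UNIV (waves ws)" by (induct ws) (auto intro!: continuous_intros)
  then show ?thesis by (rule continuous_borel)
qed

text \<open>Approximating the frequency by simple functions turns the Fourier integral into finite sums
  of plane waves, on which the functional can be evaluated by linearity.\<close>
lemma tempered_exchange:
  fixes s :: "('a::euclidean_space \<Rightarrow> complex) \<Rightarrow> complex"
  assumes s: "tempered s" and F: "schwartz F" and phi: "schwartz \<phi>" and supp: "\<And>k. norm k > R \<Longrightarrow> \<phi> k = 0"
    and R: "0 \<le> R"
  shows "s (\<lambda>z. F z * fourier \<phi> z) = (LINT k|lborel. pwt s F k * \<phi> k)"
proof -
  have [measurable]: "\<phi> \<in> borel_measurable borel" by (rule schwartz_borel[OF phi])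
  note ip = schwartz_integrable[OF phi]
  obtain \<kappa> :: "nat \<Rightarrow> 'a \<Rightarrow> 'a" where sf: "\<And>n. simple_function borel (\<kappa> n)"
    and lim: "\<And>x. (\<lambda>n. \<kappa> n x) \<longlonglongrightarrow> x" and bd: "\<And>n x. dist (\<kappa> n x) 0 \<le> 2 * dist x 0"
    using borel_measurable_implies_sequence_metric[of "\<lambda>x::'a. x" borel 0] by auto
  have [measurable]: "\<kappa> n \<in> borel_measurable borel" for n using sf borel_measurable_simple_function by blast
  have bdR: "norm (\<kappa> n x) \<le> 2 * R" if "norm x \<le> R" for n x using bd[of n x] that by simp
  have supp': "norm x \<le> R" if "\<phi> x \<noteq> 0" for x using supp[of x] that by force
  have ib: "integrable lborel (\<lambda>k. g k * \<phi> k)" if m: "g \<in> borel_measurable borel" and b: "\<And>k. norm k \<le> R \<Longrightarrow> norm (g k) \<le> B" for g B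
  proof (rule Bochner_Integration.integrable_bound[OF integrable_mult_right[OF ip, of "of_real B"]])
    show "AE k in lborel. norm (g k * \<phi> k) \<le> norm (of_real B * \<phi> k)"
    proof (rule AE_I2)
      fix k show "norm (g k * \<phi> k) \<le> norm (of_real B * \<phi> k)"
      proof (cases "\<phi> k = 0")
        case False
        then have "norm (g k) \<le> \<bar>B\<bar>" using b[OF supp'[OF False]] by simp
        then show ?thesis by (simp add: norm_mult mult_right_mono)
      qed simp
    qed
  qed (use m in simp)
  \<comment> \<open>The rate of approximation. It tends to 0 by dominated convergence, because
    \<open>norm (\<kappa> n k - k)\<close> is at most \<open>3 * R\<close> on the support of
    \<open>\<phi>\<close>.\<close>
  define w where "w n = (LINT k|lborel. norm (\<kappa> n k - k) * norm (\<phi> k))" for n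
  have ib': "integrable lborel (\<lambda>k. norm (\<kappa> n k - k) * norm (\<phi> k))" for n
  proof -
    have "integrable lborel (\<lambda>k. of_real (norm (\<kappa> n k - k)) * \<phi> k)"
    proof (rule ib)
      show "norm (complex_of_real (norm (\<kappa> n k - k))) \<le> 3 * R" if "norm k \<le> R" for k
        using norm_triangle_ineq4[of "\<kappa> n k" k] bdR[OF that, of n] that by simp
    qed measurable
    from integrable_norm[OF this] show ?thesis by (simp add: norm_mult)
  qed
  have w0: "0 \<le> w n" for n unfolding w_def by (rule integral_nonneg_AE) simp
  have wlim: "w \<longlonglongrightarrow> 0"
  proof -
    have "(\<lambda>n. LINT k|lborel. norm (\<kappa> n k - k) * norm (\<phi> k)) \<longlonglongrightarrow> (LINT k|(lborel::'a measure). 0)"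
    proof (rule integral_dominated_convergence)
      show "integrable lborel (\<lambda>k. 3 * R * norm (\<phi> k))" by (intro integrable_mult_right integrable_norm ip)
      show "AE k in lborel. (\<lambda>n. norm (\<kappa> n k - k) * norm (\<phi> k)) \<longlonglongrightarrow> 0"
      proof (rule AE_I2)
        fix k
        have "(\<lambda>n. norm (\<kappa> n k - k) * norm (\<phi> k)) \<longlonglongrightarrow> norm (k - k) * norm (\<phi> k)"
          by (intro tendsto_intros lim)
        then show "(\<lambda>n. norm (\<kappa> n k - k) * norm (\<phi> k)) \<longlonglongrightarrow> 0" by simp
      qed
      show "AE k in lborel. norm (norm (\<kappa> n k - k) * norm (\<phi> k)) \<le> 3 * R * norm (\<phi> k)" for n
      proof (rule AE_I2)
        fix k show "norm (norm (\<kappa> n k - k) * norm (\<phi> k)) \<le> 3 * R * norm (\<phi> k)"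
        proof (cases "\<phi> k = 0")
          case False
          have "norm (\<kappa> n k - k) \<le> 3 * R"
            using norm_triangle_ineq4[of "\<kappa> n k" k] bdR[OF supp'[OF False], of n] supp'[OF False] by simp
          then show ?thesis by (simp add: mult_right_mono)
        qed simp
      qed
    qed (measurable)
    then show ?thesis unfolding w_def by simp
  qed
  \<comment> \<open>\<open>D [] n\<close> is the error in the Fourier transform, and prefixing
    \<open>v\<close> to the list differentiates it in direction \<open>v\<close>. All these errors
    grow at most linearly in \<open>z\<close> and are of rate \<open>w n\<close>, so their products
    with Schwartz functions form an \<open>sfam\<close>.\<close>
  define D where "D ws n z = ftk (\<lambda>k. k) (\<lambda>k. waves ws k * \<phi> k) z - ftk (\<kappa> n) (\<lambda>k. waves ws (\<kappa> n k) * \<phi> k) z" for ws n z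
  have iw: "integrable lborel (\<lambda>k. waves ws k * \<phi> k)" "integrable lborel (\<lambda>k. waves ws (\<kappa> n k) * \<phi> k)"
    "integrable lborel (\<lambda>k. (norm k)\<^sup>2 * norm (waves ws k * \<phi> k))" "integrable lborel (\<lambda>k. (norm (\<kappa> n k))\<^sup>2 * norm (waves ws (\<kappa> n k) * \<phi> k))" for ws n
  proof -
    obtain A L where A: "0 \<le> A" "\<And>k. norm k \<le> 2 * R \<Longrightarrow> norm (waves ws k) \<le> A"
      using waves_lipschitz[of "2 * R" ws] by blast
    have A': "norm (waves ws k) \<le> A" "norm (waves ws (\<kappa> n k)) \<le> A" if "norm k \<le> R" for k
      using A(2)[of k] A(2)[OF bdR[OF that]] that norm_ge_zero[of k] by auto
    show "integrable lborel (\<lambda>k. waves ws k * \<phi> k)" by (rule ib[OF _ A'(1)]) measurable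
    show "integrable lborel (\<lambda>k. waves ws (\<kappa> n k) * \<phi> k)" by (rule ib[OF _ A'(2)]) measurable
    have n1: "norm (of_real ((norm k)\<^sup>2) * waves ws k) \<le> (2 * R)\<^sup>2 * A"
      and n2: "norm (of_real ((norm (\<kappa> n k))\<^sup>2) * waves ws (\<kappa> n k)) \<le> (2 * R)\<^sup>2 * A" if "norm k \<le> R" for k
    proof -
      have "(norm k)\<^sup>2 \<le> (2 * R)\<^sup>2" "(norm (\<kappa> n k))\<^sup>2 \<le> (2 * R)\<^sup>2"
        using power_mono[of "norm k" "2 * R" 2] power_mono[of "norm (\<kappa> n k)" "2 * R" 2] that bdR[OF that, of n] R by auto
      then show "norm (of_real ((norm k)\<^sup>2) * waves ws k) \<le> (2 * R)\<^sup>2 * A"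
        "norm (of_real ((norm (\<kappa> n k))\<^sup>2) * waves ws (\<kappa> n k)) \<le> (2 * R)\<^sup>2 * A"
        unfolding norm_mult using A'[OF that] by (auto intro!: mult_mono simp: norm_power)
    qed
    have "integrable lborel (\<lambda>k. (of_real ((norm k)\<^sup>2) * waves ws k) * \<phi> k)" by (rule ib[OF _ n1]) measurable
    from integrable_norm[OF this] show "integrable lborel (\<lambda>k. (norm k)\<^sup>2 * norm (waves ws k * \<phi> k))"
      by (simp add: norm_mult mult.assoc norm_power)
    have "integrable lborel (\<lambda>k. (of_real ((norm (\<kappa> n k))\<^sup>2) * waves ws (\<kappa> n k)) * \<phi> k)" by (rule ib[OF _ n2]) measurable
    from integrable_norm[OF this] show "integrable lborel (\<lambda>k. (norm (\<kappa> n k))\<^sup>2 * norm (waves ws (\<kappa> n k) * \<phi> k))"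
      by (simp add: norm_mult mult.assoc norm_power)
  qed
  have dD: "(D ws n has_derivative (\<lambda>v. D (v # ws) n z)) (at z)" for ws n z
  proof -
    have "(D ws n has_derivative (\<lambda>v. ftk (\<lambda>k. k) (\<lambda>k. \<i> * of_real (v \<bullet> k) * (waves ws k * \<phi> k)) z
        - ftk (\<kappa> n) (\<lambda>k. \<i> * of_real (v \<bullet> \<kappa> n k) * (waves ws (\<kappa> n k) * \<phi> k)) z)) (at z)"
      unfolding D_def by (intro has_derivative_diff ftk_has_derivative iw) auto
    then show ?thesis by (simp add: D_def mult.assoc)
  qed
  have Dbound: "\<exists>C. 0 \<le> C \<and> (\<forall>n z. norm (D ws n z) \<le> C * (1 + norm z) * w n)" for ws
  proof -
    obtain A L where A: "0 \<le> A" "0 \<le> L" "\<And>k. norm k \<le> 2 * R \<Longrightarrow> norm (waves ws k) \<le> A"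
      "\<And>k l. norm k \<le> 2 * R \<Longrightarrow> norm l \<le> 2 * R \<Longrightarrow> norm (waves ws k - waves ws l) \<le> L * norm (l - k)"
      using waves_lipschitz[of "2 * R" ws] by blast
    have "norm (D ws n z) \<le> (A + L) * (1 + norm z) * w n" for n z
    proof -
      have i1: "integrable lborel (\<lambda>k. cis (z \<bullet> k) * (waves ws k * \<phi> k))" "integrable lborel (\<lambda>k. cis (z \<bullet> \<kappa> n k) * (waves ws (\<kappa> n k) * \<phi> k))"
        by (intro integrable_cis_mult iw, simp)+
      have "D ws n z = (LINT k|lborel. cis (z \<bullet> k) * (waves ws k * \<phi> k) - cis (z \<bullet> \<kappa> n k) * (waves ws (\<kappa> n k) * \<phi> k))"
        unfolding D_def ftk_def by (rule Bochner_Integration.integral_diff[symmetric, OF i1])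
      also have "norm \<dots> \<le> (LINT k|lborel. ((A + L) * (1 + norm z)) * (norm (\<kappa> n k - k) * norm (\<phi> k)))"
      proof (rule order_trans[OF integral_norm_bound integral_mono], rule integrable_norm)
        show "integrable lborel (\<lambda>k. cis (z \<bullet> k) * (waves ws k * \<phi> k) - cis (z \<bullet> \<kappa> n k) * (waves ws (\<kappa> n k) * \<phi> k))"
          by (rule Bochner_Integration.integrable_diff[OF i1])
        show "integrable lborel (\<lambda>k. ((A + L) * (1 + norm z)) * (norm (\<kappa> n k - k) * norm (\<phi> k)))"
          by (rule integrable_mult_right[OF ib'])
        fix k
        show "norm (cis (z \<bullet> k) * (waves ws k * \<phi> k) - cis (z \<bullet> \<kappa> n k) * (waves ws (\<kappa> n k) * \<phi> k))
            \<le> ((A + L) * (1 + norm z)) * (norm (\<kappa> n k - k) * norm (\<phi> k))"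
        proof (cases "\<phi> k = 0")
          case False
          note kR = supp'[OF False]
          have kR2: "norm k \<le> 2 * R" using kR R by simp
          let ?k = "\<kappa> n k"
          have c: "norm (cis (z \<bullet> k) - cis (z \<bullet> ?k)) \<le> norm z * norm (?k - k)"
          proof -
            have "cis (z \<bullet> ?k) - cis (z \<bullet> k) = cis (z \<bullet> k) * (cis (z \<bullet> (?k - k)) - 1)"
              by (simp add: right_diff_distrib cis_mult inner_diff_right)
            then have "norm (cis (z \<bullet> ?k) - cis (z \<bullet> k)) = norm (cis (z \<bullet> (?k - k)) - 1)" by (simp add: norm_mult)
            also have "\<dots> \<le> \<bar>z \<bullet> (?k - k)\<bar>" by (rule norm_cis_minus_1)
            also have "\<dots> \<le> norm z * norm (?k - k)" by (rule Cauchy_Schwarz_ineq2)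
            finally show ?thesis by (simp add: norm_minus_commute)
          qed
          have "cis (z \<bullet> k) * waves ws k - cis (z \<bullet> ?k) * waves ws ?k =
             (cis (z \<bullet> k) - cis (z \<bullet> ?k)) * waves ws k + cis (z \<bullet> ?k) * (waves ws k - waves ws ?k)"
            by (simp add: algebra_simps)
          also have "norm \<dots> \<le> norm (cis (z \<bullet> k) - cis (z \<bullet> ?k)) * norm (waves ws k) + norm (waves ws k - waves ws ?k)"
            by (rule order_trans[OF norm_triangle_ineq]) (simp add: norm_mult)
          also have "\<dots> \<le> (norm z * norm (?k - k)) * A + L * norm (?k - k)"
            by (intro add_mono mult_mono c A(3)[OF kR2] A(4)[OF kR2 bdR[OF kR]]) auto
          also have "\<dots> \<le> ((A + L) * (1 + norm z)) * norm (?k - k)"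
            using A(1,2) by (simp add: distrib_left distrib_right mult_ac)
          finally have "norm (cis (z \<bullet> k) * waves ws k - cis (z \<bullet> ?k) * waves ws ?k) * norm (\<phi> k) \<le> (((A + L) * (1 + norm z)) * norm (?k - k)) * norm (\<phi> k)"
            by (rule mult_right_mono) simp
          then show ?thesis by (simp add: norm_mult[symmetric] left_diff_distrib mult.assoc)
        qed simp
      qed
      also have "\<dots> = (A + L) * (1 + norm z) * w n" unfolding w_def by simp
      finally show ?thesis .
    qed
    then show ?thesis using A(1,2) by (intro exI[of _ "A + L"]) auto
  qed
  let ?B = "\<lambda>f. \<exists>F ws. schwartz F \<and> f = (\<lambda>n z. F z * D ws n z)"
  have fam: "sfam UNIV w (\<lambda>n z. F z * D [] n z)"
  proof (rule sfam_sumcl[where B="?B"])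
    show "sumcl UNIV ?B (\<lambda>n z. F z * D [] n z)" by (rule sumcl.base[where f="\<lambda>n z. F z * D [] n z"]) (use F in auto)
    fix f assume "?B f"
    then obtain F ws where F: "schwartz F" and f: "f = (\<lambda>n z. F z * D ws n z)" by blast
    have d: "(f n has_derivative (\<lambda>v. F z * D (v # ws) n z + dderiv v F z * D ws n z)) (at z)" for n z
      unfolding f by (intro has_derivative_mult dD smooth_has_derivative schwartz_smooth F)
    have "sumcl UNIV ?B (\<lambda>n. dderiv v (f n))" for v
    proof (rule sumcl_bases)
      show "?B (\<lambda>n z. F z * D (v # ws) n z)" using F by blast
      show "?B (\<lambda>n z. dderiv v F z * D ws n z)" using schwartz_dderiv[OF F] by blast
    qed (simp add: dderiv_eq[OF d])
    moreover have "fbd UNIV w f"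
      unfolding fbd_def
    proof
      fix m
      obtain C where C: "0 \<le> C" "\<And>n z. norm (D ws n z) \<le> C * (1 + norm z) * w n" using Dbound by blast
      obtain C' where C': "0 \<le> C'" "\<And>z. (1 + norm z) ^ (m + 1) * norm (F z) \<le> C'" using schwartz_weighted_bound[OF F] by metis
      have "(1 + norm z) ^ m * norm (f n z) \<le> (C' * C) * w n" for n z
      proof -
        have "(1 + norm z) ^ m * norm (f n z) \<le> (1 + norm z) ^ m * (norm (F z) * (C * (1 + norm z) * w n))"
          unfolding f norm_mult using C by (intro mult_left_mono) auto
        also have "\<dots> = ((1 + norm z) ^ (m + 1) * norm (F z)) * (C * w n)" by (simp add: mult_ac)
        also have "\<dots> \<le> C' * (C * w n)" using C' C w0 by (intro mult_right_mono) auto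
        finally show ?thesis by (simp add: mult.assoc)
      qed
      then show "\<exists>C. \<forall>n\<in>UNIV. \<forall>x. (1 + norm x) ^ m * norm (f n x) \<le> C * w n" by blast
    qed
    ultimately show "(\<forall>n\<in>UNIV. \<forall>x. f n differentiable at x) \<and> fbd UNIV w f \<and> (\<forall>v. sumcl UNIV ?B (\<lambda>n. dderiv v (f n)))"
      using d by (auto simp: differentiable_def)
  qed
  obtain C where C': "0 \<le> C" "\<And>n. n \<in> UNIV \<Longrightarrow> norm (s (\<lambda>z. F z * D [] n z)) \<le> C * w n"
    using tempered_family[OF s fam w0] by blast
  then have C: "\<And>n. norm (s (\<lambda>z. F z * D [] n z)) \<le> C * w n" by simp
  have lim0: "(\<lambda>n. s (\<lambda>z. F z * D [] n z)) \<longlonglongrightarrow> 0"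
  proof (rule Lim_null_comparison)
    show "(\<lambda>n. C * w n) \<longlonglongrightarrow> 0" using tendsto_mult_left[OF wlim, of C] by simp
  qed (use C in auto)
  have D0: "D [] n z = fourier \<phi> z - ftk (\<kappa> n) \<phi> z" for n z unfolding D_def fourier_ftk by simp
  have SF: "schwartz (\<lambda>z. F z * fourier \<phi> z)"
    by (rule schwartz_mult[OF schwartz_slow[OF F] schwartz_fourier[OF phi]])
  have SD: "schwartz (\<lambda>z. F z * D [] n z)" for n by (rule sfam_schwartz[OF fam]) simp
  \<comment> \<open>For a simple \<open>\<kappa> n\<close> both sides are finite sums over its
    range, weighted by the integrals \<open>c r\<close> of \<open>\<phi>\<close> over the level
    sets, and linearity of \<open>s\<close> suffices.\<close>
  have step: "s (\<lambda>z. F z * ftk (\<kappa> n) \<phi> z) = (LINT k|lborel. pwt s F (\<kappa> n k) * \<phi> k)" for n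
  proof -
    define Rg where "Rg = range (\<kappa> n)"
    have fin: "finite Rg" using sf[of n] unfolding simple_function_def Rg_def by (simp add: space_borel)
    define c where "c r = (LINT k|lborel. indicator {k. \<kappa> n k = r} k * \<phi> k)" for r
    have mr [measurable]: "{k. \<kappa> n k = r} \<in> sets borel" for r
    proof -
      have "\<kappa> n -` {r} \<inter> space borel \<in> sets borel" by (rule measurable_sets[of _ _ borel]) auto
      then show ?thesis by (simp add: vimage_def)
    qed
    have ii: "integrable lborel (\<lambda>k. g r * (indicator {k. \<kappa> n k = r} k * \<phi> k))" for r and g :: "'a \<Rightarrow> complex"
    proof (rule integrable_mult_right, rule ib[where B=1])
      show "(\<lambda>x. indicator {k. \<kappa> n k = r} x) \<in> borel_measurable borel" by measurable
    qed (simp add: indicator_def)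
    have sumform: "(LINT k|lborel. g (\<kappa> n k) * \<phi> k) = (\<Sum>r\<in>Rg. g r * c r)" for g :: "'a \<Rightarrow> complex"
    proof -
      have "g (\<kappa> n k) * \<phi> k = (\<Sum>r\<in>Rg. g r * (indicator {k. \<kappa> n k = r} k * \<phi> k))" for k
      proof -
        have "(\<Sum>r\<in>Rg. g r * (indicator {k. \<kappa> n k = r} k * \<phi> k)) = (\<Sum>r\<in>{\<kappa> n k}. g r * (indicator {k. \<kappa> n k = r} k * \<phi> k))"
          by (rule sum.mono_neutral_right[OF fin]) (auto simp: Rg_def indicator_def)
        then show ?thesis by (simp add: indicator_def)
      qed
      then have "(LINT k|lborel. g (\<kappa> n k) * \<phi> k) = (LINT k|lborel. (\<Sum>r\<in>Rg. g r * (indicator {k. \<kappa> n k = r} k * \<phi> k)))" by presburger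
      also have "\<dots> = (\<Sum>r\<in>Rg. LINT k|lborel. g r * (indicator {k. \<kappa> n k = r} k * \<phi> k))"
        by (rule Bochner_Integration.integral_sum) (rule ii)
      also have "\<dots> = (\<Sum>r\<in>Rg. g r * c r)" unfolding c_def by simp
      finally show ?thesis .
    qed
    have "ftk (\<kappa> n) \<phi> z = (\<Sum>r\<in>Rg. cis (z \<bullet> r) * c r)" for z
      unfolding ftk_def by (rule sumform[of "\<lambda>r. cis (z \<bullet> r)"])
    then have "(\<lambda>z. F z * ftk (\<kappa> n) \<phi> z) = (\<lambda>z. \<Sum>r\<in>Rg. c r * pw_mult r F z)"
      by (auto simp: sum_distrib_left inner_commute mult_ac)
    then have "s (\<lambda>z. F z * ftk (\<kappa> n) \<phi> z) = s (\<lambda>z. \<Sum>r\<in>Rg. c r * pw_mult r F z)" by simp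
    also have "\<dots> = (\<Sum>r\<in>Rg. s (\<lambda>z. c r * pw_mult r F z))"
      by (rule tempered_sum[OF s]) (intro schwartz_cmult schwartz_pw_mult F)
    also have "\<dots> = (\<Sum>r\<in>Rg. pwt s F r * c r)"
      unfolding tempered_cmult[OF s schwartz_pw_mult[OF F]] pwt_def by (simp only: mult.commute)
    also have "\<dots> = (LINT k|lborel. pwt s F (\<kappa> n k) * \<phi> k)" by (rule sumform[symmetric])
    finally show ?thesis .
  qed
  have cG: "continuous_on UNIV (pwt s F)" by (rule smooth_continuous_on[OF smooth_pwt[OF s F]])
  have mG [measurable]: "pwt s F \<in> borel_measurable borel" by (rule continuous_borel[OF cG])
  obtain M where M: "\<And>k. k \<in> cball 0 (2 * R) \<Longrightarrow> norm (pwt s F k) \<le> M"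
    using compact_imp_bounded[OF compact_continuous_image[OF continuous_on_subset[OF cG] compact_cball]] unfolding bounded_iff by blast
  have limG: "(\<lambda>n. LINT k|lborel. pwt s F (\<kappa> n k) * \<phi> k) \<longlonglongrightarrow> (LINT k|lborel. pwt s F k * \<phi> k)"
  proof (rule integral_dominated_convergence)
    show "integrable lborel (\<lambda>k. M * norm (\<phi> k))" by (intro integrable_mult_right integrable_norm ip)
    show "AE k in lborel. (\<lambda>n. pwt s F (\<kappa> n k) * \<phi> k) \<longlonglongrightarrow> pwt s F k * \<phi> k"
    proof (rule AE_I2)
      fix k
      have "isCont (pwt s F) k" using cG by (simp add: continuous_on_eq_continuous_at)
      then show "(\<lambda>n. pwt s F (\<kappa> n k) * \<phi> k) \<longlonglongrightarrow> pwt s F k * \<phi> k"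
        by (intro tendsto_mult isCont_tendsto_compose[OF _ lim] tendsto_const)
    qed
    show "AE k in lborel. norm (pwt s F (\<kappa> n k) * \<phi> k) \<le> M * norm (\<phi> k)" for n
    proof (rule AE_I2)
      fix k show "norm (pwt s F (\<kappa> n k) * \<phi> k) \<le> M * norm (\<phi> k)"
      proof (cases "\<phi> k = 0")
        case False
        have "norm (pwt s F (\<kappa> n k)) \<le> M" by (rule M) (use bdR[OF supp'[OF False], of n] in simp)
        then show ?thesis by (simp add: norm_mult mult_right_mono)
      qed simp
    qed
  qed measurable
  have e: "s (\<lambda>z. F z * ftk (\<kappa> n) \<phi> z) = s (\<lambda>z. F z * fourier \<phi> z) - s (\<lambda>z. F z * D [] n z)" for n
    using tempered_diff[OF s SF SD[of n]] unfolding D0 by (simp add: algebra_simps)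
  have "(\<lambda>n. LINT k|lborel. pwt s F (\<kappa> n k) * \<phi> k) \<longlonglongrightarrow> s (\<lambda>z. F z * fourier \<phi> z) - 0"
    unfolding step[symmetric] e by (intro tendsto_diff tendsto_const lim0)
  from LIMSEQ_unique[OF this limG] show ?thesis by simp
qed

section \<open>Convolution in part of the variables\<close>

lemma dderiv_expand:
  fixes f :: "'a::euclidean_space \<Rightarrow> 'b::real_normed_vector"
  assumes f: "smooth f" shows "dderiv h f x = (\<Sum>b\<in>Basis. (h \<bullet> b) *\<^sub>R dderiv b f x)"
proof -
  interpret linear "\<lambda>v. dderiv v f x" by (rule linear_dderiv[OF f])
  have "dderiv h f x = dderiv (\<Sum>b\<in>Basis. (h \<bullet> b) *\<^sub>R b) f x" by (simp add: euclidean_representation)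
  also have "\<dots> = (\<Sum>b\<in>Basis. (h \<bullet> b) *\<^sub>R dderiv b f x)" by (simp add: sum scale)
  finally show ?thesis .
qed

text \<open>Peetre's inequality moves the decay from the points of the segment back to
  \<open>q\<close>. With \<open>n\<close> large the remainder is integrable in \<open>q\<close>,
  which is what differentiating the kernel of a convolution takes.\<close>

lemma schwartz_taylor:
  fixes S :: "'a::euclidean_space \<Rightarrow> complex"
  assumes S: "schwartz S" and R: "0 \<le> R"
  shows "\<exists>C. 0 \<le> C \<and> (\<forall>h q. norm h \<le> R \<longrightarrow> norm (S (q + h) - S q - dderiv h S q) \<le> C * (norm h)\<^sup>2 * (1 / (1 + norm q) ^ n))"
proof -
  note sm = schwartz_smooth[OF S]
  have "\<forall>b b'. \<exists>C. 0 \<le> C \<and> (\<forall>x. norm (dderiv b' (dderiv b S) x) \<le> C / (1 + norm x) ^ n)"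
    using schwartz_bound0[OF schwartz_dderiv[OF schwartz_dderiv[OF S]]] by metis
  then obtain C where C: "\<And>b b'. 0 \<le> C b b'" "\<And>b b' x. norm (dderiv b' (dderiv b S) x) \<le> C b b' / (1 + norm x) ^ n"
    by metis
  define M where "M = (\<Sum>b\<in>Basis. \<Sum>b'\<in>Basis. C b b')"
  have M: "0 \<le> M" unfolding M_def by (intro sum_nonneg C)
  have hb: "\<bar>h \<bullet> b\<bar> \<le> norm h" if "b \<in> Basis" for h b :: 'a using Basis_le_norm[OF that] .
  have dd: "norm (dderiv h (dderiv h S) x) \<le> (norm h)\<^sup>2 * M * (1 / (1 + norm x) ^ n)" for h x
  proof -
    have "dderiv h (dderiv h S) x = (\<Sum>b\<in>Basis. (h \<bullet> b) *\<^sub>R dderiv b (dderiv h S) x)"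
      by (rule dderiv_expand[OF smooth_dderiv[OF sm]])
    also have "\<dots> = (\<Sum>b\<in>Basis. (h \<bullet> b) *\<^sub>R (\<Sum>b'\<in>Basis. (h \<bullet> b') *\<^sub>R dderiv b' (dderiv b S) x))"
      by (simp add: dderiv_commute[OF sm, of _ h] dderiv_expand[OF smooth_dderiv[OF sm], of h])
    also have "norm \<dots> \<le> (\<Sum>b\<in>Basis. norm h * (\<Sum>b'\<in>Basis. norm h * (C b b' / (1 + norm x) ^ n)))"
    proof (rule sum_norm_le)
      fix b :: 'a assume b: "b \<in> Basis"
      have "norm (\<Sum>b'\<in>Basis. (h \<bullet> b') *\<^sub>R dderiv b' (dderiv b S) x) \<le> (\<Sum>b'\<in>Basis. norm h * (C b b' / (1 + norm x) ^ n))"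
        by (rule sum_norm_le) (simp only: norm_scaleR, intro mult_mono hb C, auto)
      then show "norm ((h \<bullet> b) *\<^sub>R (\<Sum>b'\<in>Basis. (h \<bullet> b') *\<^sub>R dderiv b' (dderiv b S) x)) \<le> norm h * (\<Sum>b'\<in>Basis. norm h * (C b b' / (1 + norm x) ^ n))"
        using hb[OF b, of h] unfolding norm_scaleR by (intro mult_mono) auto
    qed
    also have "\<dots> = (norm h)\<^sup>2 * M * (1 / (1 + norm x) ^ n)"
      unfolding M_def by (simp add: sum_distrib_left sum_distrib_right power2_eq_square mult_ac sum_divide_distrib)
    finally show ?thesis .
  qed
  have "norm (S (q + h) - S q - dderiv h S q) \<le> (M * (1 + R) ^ n) * (norm h)\<^sup>2 * (1 / (1 + norm q) ^ n)" if h: "norm h \<le> R" for h q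
  proof -
    let ?B = "(M * (1 + R) ^ n) * (norm h)\<^sup>2 * (1 / (1 + norm q) ^ n)"
    have B0: "0 \<le> ?B" using M R by (intro mult_nonneg_nonneg) auto
    have b2: "norm (dderiv h (dderiv h S) (q + t *\<^sub>R h)) \<le> ?B" if t: "0 \<le> t" "t \<le> 1" for t
    proof -
      have "norm (dderiv h (dderiv h S) (q + t *\<^sub>R h)) \<le> (norm h)\<^sup>2 * M * (1 / (1 + norm (q + t *\<^sub>R h)) ^ n)" by (rule dd)
      also have "\<dots> \<le> (norm h)\<^sup>2 * M * ((1 + norm (t *\<^sub>R h)) ^ n / (1 + norm q) ^ n)"
        using M by (intro mult_left_mono peetre_inverse) auto
      also have "\<dots> \<le> (norm h)\<^sup>2 * M * ((1 + R) ^ n / (1 + norm q) ^ n)"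
      proof (intro mult_left_mono divide_right_mono power_mono)
        have "t * norm h \<le> norm h" using t by (simp add: mult_left_le_one_le)
        then show "1 + norm (t *\<^sub>R h) \<le> 1 + R" using t h by simp
      qed (use M in auto)
      finally show ?thesis by (simp add: mult_ac)
    qed
    have b1: "norm (dderiv h S (q + t *\<^sub>R h) - dderiv h S q) \<le> ?B" if t: "0 \<le> t" "t \<le> 1" for t
    proof -
      have "norm (dderiv h S (q + t *\<^sub>R h) - dderiv h S (q + 0 *\<^sub>R h)) \<le> ?B * t"
        by (rule hvd_bound[where g="\<lambda>t. dderiv h S (q + t *\<^sub>R h)", OF line_derivative[OF smooth_dderiv[OF sm]] b2]) (use t in auto)
      also have "\<dots> \<le> ?B * 1" using B0 t by (intro mult_left_mono) auto
      finally show ?thesis by simp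
    qed
    have "norm ((S (q + 1 *\<^sub>R h) - 1 *\<^sub>R dderiv h S q) - (S (q + 0 *\<^sub>R h) - 0 *\<^sub>R dderiv h S q)) \<le> ?B * 1"
    proof (rule hvd_bound[where g="\<lambda>t. S (q + t *\<^sub>R h) - t *\<^sub>R dderiv h S q"])
      show "((\<lambda>t. S (q + t *\<^sub>R h) - t *\<^sub>R dderiv h S q) has_vector_derivative dderiv h S (q + t *\<^sub>R h) - dderiv h S q) (at t)" for t
        by (auto intro!: derivative_eq_intros line_derivative sm)
    qed (use b1 in auto)
    then show ?thesis by (simp add: algebra_simps)
  qed
  then show ?thesis using M R by (intro exI[of _ "M * (1 + R) ^ n"]) auto
qed

definition nrm :: "('a::euclidean_space \<Rightarrow> complex) \<Rightarrow> real" where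
  "nrm f = (LINT z|lborel. norm (f z))"

lemma nrm_nonneg: "0 \<le> nrm f" unfolding nrm_def by (rule integral_nonneg_AE) simp

lemma nrm_add: "schwartz f \<Longrightarrow> schwartz g \<Longrightarrow> nrm (\<lambda>x. f x + g x) \<le> nrm f + nrm g"
proof -
  assume f: "schwartz f" and g: "schwartz g"
  have "nrm (\<lambda>x. f x + g x) \<le> (LINT x|lborel. norm (f x) + norm (g x))" unfolding nrm_def
    by (intro integral_mono integrable_norm schwartz_integrable schwartz_add Bochner_Integration.integrable_add f g norm_triangle_ineq)
  also have "\<dots> = nrm f + nrm g" unfolding nrm_def by (intro Bochner_Integration.integral_add integrable_norm schwartz_integrable f g)
  finally show ?thesis .
qed

lemma nrm_cmult: "nrm (\<lambda>x. c * f x) = norm c * nrm f"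
  unfolding nrm_def by (simp add: norm_mult)

lemma norm_mult_le': "norm b \<le> M \<Longrightarrow> norm (a * b) \<le> M * norm (a :: complex)"
  by (metis mult.commute mult_right_mono norm_ge_zero norm_mult)

definition bcont :: "('a::euclidean_space \<Rightarrow> complex) \<Rightarrow> bool" where
  "bcont v \<longleftrightarrow> continuous_on UNIV v \<and> (\<exists>M. \<forall>z. norm (v z) \<le> M)"

lemma bcontE: assumes "bcont v" obtains M where "0 \<le> M" "\<And>z. norm (v z) \<le> M"
proof -
  obtain M where "\<And>z. norm (v z) \<le> M" using assms unfolding bcont_def by blast
  then show ?thesis using that[of M] norm_ge_zero order_trans by blast
qed

lemma bcont_borel: "bcont v \<Longrightarrow> v \<in> borel_measurable borel"
  unfolding bcont_def by (blast intro: continuous_borel)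

lemma schwartz_bcont: assumes f: "schwartz f" shows "bcont f"
proof -
  obtain C where "0 \<le> C" "\<And>x. norm (f x) \<le> C / (1 + norm x) ^ 0" using schwartz_bound0[OF f] by metis
  then have "\<forall>x. norm (f x) \<le> C" by simp
  then show ?thesis unfolding bcont_def using smooth_continuous_on[OF schwartz_smooth[OF f]] by blast
qed

section \<open>Convolution in the \<open>q\<close>-directions of a split space\<close>

text \<open>\<open>J\<close> embeds the \<open>q\<close>-space isometrically, and \<open>p\<close>
  is both its adjoint and a left inverse. The \<open>x\<close>-space is not a type of its own but
  the range of \<open>proj\<close>, so the product case and the case without \<open>x\<close> become
  two interpretations of one locale.\<close>

locale split_space =
  fixes p :: "'a::euclidean_space \<Rightarrow> 'q::euclidean_space" and J :: "'q \<Rightarrow> 'a"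
  assumes lin_p: "linear p" and lin_J: "linear J" and pJ: "p (J v) = v" and adj: "J v \<bullet> z = v \<bullet> p z"
begin

definition proj :: "'a \<Rightarrow> 'a" where "proj z = z - J (p z)"

lemma bl_p: "bounded_linear p" using lin_p by (simp add: linear_conv_bounded_linear)
lemma bl_J: "bounded_linear J" using lin_J by (simp add: linear_conv_bounded_linear)

lemma norm_J [simp]: "norm (J v) = norm v"
  by (simp add: norm_eq_sqrt_inner adj pJ)

lemma norm_p_le: "norm (p z) \<le> norm z"
proof -
  have "norm (p z) * norm (p z) = J (p z) \<bullet> z" by (simp add: adj power2_norm_eq_inner[symmetric] power2_eq_square)
  also have "\<dots> \<le> norm (p z) * norm z" using norm_cauchy_schwarz[of "J (p z)" z] by simp
  finally show ?thesis by (cases "p z = 0") auto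
qed

lemmas p_simps = linear_add[OF lin_p] linear_diff[OF lin_p] linear_scale[OF lin_p] linear_0[OF lin_p]
lemmas J_simps = linear_add[OF lin_J] linear_diff[OF lin_J] linear_scale[OF lin_J] linear_0[OF lin_J] linear_neg[OF lin_J]

lemma p_proj [simp]: "p (proj z) = 0" by (simp add: proj_def p_simps pJ)

lemma proj_J [simp]: "proj (z + J v) = proj z" by (simp add: proj_def p_simps J_simps pJ)

lemma proj_scaleJ [simp]: "proj (z + c *\<^sub>R J v) = proj z" using proj_J[of z "c *\<^sub>R v"] by (simp add: J_simps)

lemma proj_plus: "proj z + J (p z) = z" by (simp add: proj_def)

lemma norm_split: "norm z \<le> norm (p z) + norm (proj z)"
  using norm_triangle_ineq[of "proj z" "J (p z)"] by (simp add: proj_plus)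

lemma continuous_p [continuous_intros]: "continuous_on S f \<Longrightarrow> continuous_on S (\<lambda>x. p (f x))"
  by (rule bounded_linear.continuous_on[OF bl_p])
lemma continuous_J [continuous_intros]: "continuous_on S f \<Longrightarrow> continuous_on S (\<lambda>x. J (f x))"
  by (rule bounded_linear.continuous_on[OF bl_J])
lemma continuous_proj [continuous_intros]: "continuous_on S f \<Longrightarrow> continuous_on S (\<lambda>x. proj (f x))"
  unfolding proj_def by (intro continuous_intros)

text \<open>Convolution in the \<open>q\<close>-variables with the reflected kernel
  \<open>S\<close>, rescaled to width \<open>c\<close> at constant integral.\<close>

definition cv :: "('q \<Rightarrow> complex) \<Rightarrow> real \<Rightarrow> ('a \<Rightarrow> complex) \<Rightarrow> 'a \<Rightarrow> complex" where
  "cv S c v z = (LINT q|lborel. S q * v (z + c *\<^sub>R J q))"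

lemma shift_measurable:
  "v \<in> borel_measurable borel \<Longrightarrow> (\<lambda>q. v (z + c *\<^sub>R J q)) \<in> borel_measurable borel"
proof -
  assume v: "v \<in> borel_measurable borel"
  have "(\<lambda>q. z + c *\<^sub>R J q) \<in> borel \<rightarrow>\<^sub>M borel" by (intro continuous_borel continuous_intros)
  from measurable_compose[OF this v] show ?thesis .
qed

lemma cv_integrable:
  assumes S: "integrable lborel S" and v: "bcont v"
  shows "integrable lborel (\<lambda>q. S q * v (z + c *\<^sub>R J q))"
proof -
  obtain M where M: "0 \<le> M" "\<And>z. norm (v z) \<le> M" using bcontE[OF v] by metis
  show ?thesis
  proof (rule Bochner_Integration.integrable_bound[OF integrable_mult_right[OF S, of "of_real M"]])
    show "(\<lambda>q. S q * v (z + c *\<^sub>R J q)) \<in> borel_measurable lborel"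
      using shift_measurable[OF bcont_borel[OF v]] borel_measurable_integrable[OF S] by simp
    show "AE q in lborel. norm (S q * v (z + c *\<^sub>R J q)) \<le> norm (of_real M * S q)"
      using norm_mult_le'[OF M(2)] M(1) by (intro AE_I2) (simp add: norm_mult)
  qed
qed

lemma cv_continuous:
  assumes S: "schwartz S" and v: "bcont v"
  shows "continuous_on UNIV (cv S c v)"
proof -
  obtain M where M: "0 \<le> M" "\<And>z. norm (v z) \<le> M" using bcontE[OF v] by metis
  have "continuous (at z) (cv S c v)" for z
    unfolding continuous_at_sequentially
  proof (intro allI impI)
    fix x assume x: "x \<longlonglongrightarrow> z"
    have "(\<lambda>n. LINT q|lborel. S q * v (x n + c *\<^sub>R J q)) \<longlonglongrightarrow> (LINT q|lborel. S q * v (z + c *\<^sub>R J q))"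
    proof (rule integral_dominated_convergence)
      show "integrable lborel (\<lambda>q. M * norm (S q))" by (intro integrable_mult_right integrable_norm schwartz_integrable S)
      show "AE q in lborel. (\<lambda>n. S q * v (x n + c *\<^sub>R J q)) \<longlonglongrightarrow> S q * v (z + c *\<^sub>R J q)"
      proof (rule AE_I2)
        fix q
        have "isCont v (z + c *\<^sub>R J q)" using v unfolding bcont_def by (simp add: continuous_on_eq_continuous_at)
        then show "(\<lambda>n. S q * v (x n + c *\<^sub>R J q)) \<longlonglongrightarrow> S q * v (z + c *\<^sub>R J q)"
          by (intro tendsto_mult tendsto_const isCont_tendsto_compose[where g=v] tendsto_add x)
      qed
      show "AE q in lborel. norm (S q * v (x n + c *\<^sub>R J q)) \<le> M * norm (S q)" for n
        by (intro AE_I2 norm_mult_le' M)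
    qed (use shift_measurable[OF bcont_borel[OF v]] schwartz_borel[OF S] in simp_all)
    then show "(cv S c v \<circ> x) \<longlonglongrightarrow> cv S c v z" by (simp add: cv_def o_def)
  qed
  then show ?thesis by (simp add: continuous_at_imp_continuous_on)
qed

text \<open>As \<open>v\<close> is only continuous, the increment of \<open>z\<close> is moved to
  the kernel by translating the integration variable, and \<open>S\<close> is differentiated
  instead. The increment arrives there as \<open>w\<close>, scaled by \<open>1 / c\<close>; this is
  the price of every \<open>q\<close>-derivative.\<close>

lemma cv_hdd:
  assumes S: "schwartz S" and v: "bcont v" and c: "0 < c"
  shows "hdd (J u) (cv S c v) (\<lambda>z. - of_real (1 / c) * cv (dderiv u S) c v z)"
  unfolding hdd_def has_vector_derivative_def
proof
  fix z
  obtain M where M: "0 \<le> M" "\<And>z. norm (v z) \<le> M" using bcontE[OF v] by metis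
  have sm: "smooth S" by (rule schwartz_smooth[OF S])
  define R where "R = norm u / c"
  have R: "0 \<le> R" using c by (simp add: R_def)
  obtain C where C: "0 \<le> C" "\<And>h q. norm h \<le> R \<Longrightarrow> norm (S (q + h) - S q - dderiv h S q) \<le> C * (norm h)\<^sup>2 * (1 / (1 + norm q) ^ (2 * DIM('q)))"
    using schwartz_taylor[OF S R] by blast
  have bm [measurable]: "(\<lambda>q. v (z + c *\<^sub>R J q)) \<in> borel_measurable borel" by (rule shift_measurable[OF bcont_borel[OF v]])
  define I0 where "I0 = (LINT q|lborel. 1 / (1 + norm (q::'q)) ^ (2 * DIM('q)))"
  show "((\<lambda>t. cv S c v (z + t *\<^sub>R J u)) has_derivative (\<lambda>t. t *\<^sub>R (- of_real (1 / c) * cv (dderiv u S) c v z))) (at 0)"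
  proof (rule has_derivative_quadratic)
    fix t :: real assume t: "norm t \<le> 1"
    define w where "w = - (t / c) *\<^sub>R u"
    have w: "norm w \<le> R" "norm w = \<bar>t\<bar> * R"
      unfolding w_def R_def using t c by (auto simp: divide_right_mono mult_left_le_one_le)
    have Sw [measurable]: "(\<lambda>q. S (q + w)) \<in> borel_measurable borel"
      by (rule schwartz_borel[OF schwartz_shift[OF S]])
    have "cv S c v (z + t *\<^sub>R J u) = (LINT q|lborel. (\<lambda>q. S (q + w) * v (z + c *\<^sub>R J q)) (q + - w))"
      unfolding cv_def w_def using c by (simp add: J_simps algebra_simps)
    also have "\<dots> = (LINT q|lborel. S (q + w) * v (z + c *\<^sub>R J q))"
      by (rule lborel_integral_shift) measurable
    finally have 1: "cv S c v (z + t *\<^sub>R J u) = (LINT q|lborel. S (q + w) * v (z + c *\<^sub>R J q))" .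
    have dw: "dderiv w S q = - of_real (t / c) * dderiv u S q" for q
      unfolding w_def using linear_scale[OF linear_dderiv[OF sm, of q], of "- (t / c)" u] by (simp add: scaleR_conv_of_real)
    have 2: "t *\<^sub>R (- of_real (1 / c) * cv (dderiv u S) c v z) = (LINT q|lborel. dderiv w S q * v (z + c *\<^sub>R J q))"
      unfolding dw cv_def by (simp add: scaleR_conv_of_real mult.assoc)
    have i: "integrable lborel (\<lambda>q. S (q + w) * v (z + c *\<^sub>R J q))" "integrable lborel (\<lambda>q. S q * v (z + c *\<^sub>R J q))"
      "integrable lborel (\<lambda>q. dderiv w S q * v (z + c *\<^sub>R J q))"
      by (intro cv_integrable v schwartz_integrable schwartz_shift schwartz_dderiv S)+
    have "cv S c v (z + (0 + t) *\<^sub>R J u) - cv S c v (z + 0 *\<^sub>R J u) - t *\<^sub>R (- of_real (1 / c) * cv (dderiv u S) c v z) =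
       (LINT q|lborel. S (q + w) * v (z + c *\<^sub>R J q) - S q * v (z + c *\<^sub>R J q) - dderiv w S q * v (z + c *\<^sub>R J q))"
      unfolding 2 using i by (simp add: 1) (simp add: cv_def)
    also have "norm \<dots> \<le> (LINT q::'q|lborel. (C * (norm w)\<^sup>2 * M) * (1 / (1 + norm q) ^ (2 * DIM('q))))"
    proof (rule order_trans[OF integral_norm_bound integral_mono])
      show "integrable lborel (\<lambda>q. norm (S (q + w) * v (z + c *\<^sub>R J q) - S q * v (z + c *\<^sub>R J q) - dderiv w S q * v (z + c *\<^sub>R J q)))"
        by (intro integrable_norm Bochner_Integration.integrable_diff i)
      show "integrable lborel (\<lambda>q::'q. (C * (norm w)\<^sup>2 * M) * (1 / (1 + norm q) ^ (2 * DIM('q))))"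
        by (rule integrable_mult_right[OF integrable_decay])
      fix q
      have "norm (S (q + w) * v (z + c *\<^sub>R J q) - S q * v (z + c *\<^sub>R J q) - dderiv w S q * v (z + c *\<^sub>R J q))
        = norm (S (q + w) - S q - dderiv w S q) * norm (v (z + c *\<^sub>R J q))"
        unfolding norm_mult[symmetric] by (simp add: algebra_simps)
      also have "\<dots> \<le> (C * (norm w)\<^sup>2 * (1 / (1 + norm q) ^ (2 * DIM('q)))) * M"
        using C(1) by (intro mult_mono C(2) w M) auto
      finally show "norm (S (q + w) * v (z + c *\<^sub>R J q) - S q * v (z + c *\<^sub>R J q) - dderiv w S q * v (z + c *\<^sub>R J q))
        \<le> (C * (norm w)\<^sup>2 * M) * (1 / (1 + norm q) ^ (2 * DIM('q)))" by (simp add: mult_ac)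
    qed
    also have "\<dots> = (C * (norm w)\<^sup>2 * M) * I0" unfolding I0_def by (rule integral_mult_right_zero)
    also have "\<dots> = (C * R\<^sup>2 * M * I0) * (norm t)\<^sup>2" unfolding w(2) by (simp add: power_mult_distrib)
    finally show "norm (cv S c v (z + (0 + t) *\<^sub>R J u) - cv S c v (z + 0 *\<^sub>R J u) - t *\<^sub>R (- of_real (1 / c) * cv (dderiv u S) c v z))
        \<le> (C * R\<^sup>2 * M * I0) * (norm t)\<^sup>2" .
  qed (rule bounded_linear_scaleR_left)
qed

lemma cv_has_derivative:
  assumes S: "schwartz S" and f: "schwartz f"
  shows "(cv S c f has_derivative (\<lambda>w. cv S c (dderiv w f) z)) (at z)"
proof -
  note sm = schwartz_smooth[OF f]
  have i: "integrable lborel (\<lambda>q. S q * g (z + c *\<^sub>R J q))" if "schwartz g" for g z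
    by (rule cv_integrable[OF schwartz_integrable[OF S] schwartz_bcont[OF that]])
  note id = i[OF schwartz_dderiv[OF f]]
  have "linear (\<lambda>w. cv S c (dderiv w f) z)"
  proof
    fix u v :: 'a and r :: real
    show "cv S c (dderiv (u + v) f) z = cv S c (dderiv u f) z + cv S c (dderiv v f) z"
      unfolding cv_def linear_add[OF linear_dderiv[OF sm]] using id by (simp add: distrib_left)
    show "cv S c (dderiv (r *\<^sub>R v) f) z = r *\<^sub>R cv S c (dderiv v f) z"
      unfolding cv_def linear_scale[OF linear_dderiv[OF sm]] by simp
  qed
  then have bl: "bounded_linear (\<lambda>w. cv S c (dderiv w f) z)" by (simp add: linear_conv_bounded_linear)
  obtain C where C: "0 \<le> C" "\<And>h q. norm h \<le> 1 \<Longrightarrow> norm (f (q + h) - f q - dderiv h f q) \<le> C * (norm h)\<^sup>2 * (1 / (1 + norm q) ^ 0)"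
    using schwartz_taylor[OF f, of 1 0] by auto
  show ?thesis
  proof (rule has_derivative_quadratic[OF bl])
  fix h :: 'a assume h: "norm h \<le> 1"
  have "cv S c f (z + h) - cv S c f z - cv S c (dderiv h f) z =
    (LINT q|lborel. S q * f ((z + h) + c *\<^sub>R J q) - S q * f (z + c *\<^sub>R J q) - S q * dderiv h f (z + c *\<^sub>R J q))"
    unfolding cv_def using i[OF f] id by simp
  also have "norm \<dots> \<le> (LINT q|lborel. (C * (norm h)\<^sup>2) * norm (S q))"
  proof (rule order_trans[OF integral_norm_bound integral_mono])
    show "integrable lborel (\<lambda>q. norm (S q * f ((z + h) + c *\<^sub>R J q) - S q * f (z + c *\<^sub>R J q) - S q * dderiv h f (z + c *\<^sub>R J q)))"
      by (intro integrable_norm Bochner_Integration.integrable_diff i f id)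
    show "integrable lborel (\<lambda>q. (C * (norm h)\<^sup>2) * norm (S q))" by (intro integrable_mult_right integrable_norm schwartz_integrable S)
    fix q
    have "norm (S q * f ((z + h) + c *\<^sub>R J q) - S q * f (z + c *\<^sub>R J q) - S q * dderiv h f (z + c *\<^sub>R J q)) =
       norm (S q) * norm (f ((z + c *\<^sub>R J q) + h) - f (z + c *\<^sub>R J q) - dderiv h f (z + c *\<^sub>R J q))"
      unfolding norm_mult[symmetric] by (simp add: algebra_simps)
    also have "\<dots> \<le> norm (S q) * (C * (norm h)\<^sup>2)" using C(2)[OF h, of "z + c *\<^sub>R J q"] by (intro mult_left_mono) auto
    finally show "norm (S q * f ((z + h) + c *\<^sub>R J q) - S q * f (z + c *\<^sub>R J q) - S q * dderiv h f (z + c *\<^sub>R J q)) \<le> (C * (norm h)\<^sup>2) * norm (S q)"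
      by (simp add: mult.commute)
  qed
  also have "\<dots> = (C * (LINT q|lborel. norm (S q))) * (norm h)\<^sup>2" by simp
  finally show "norm (cv S c f (z + h) - cv S c f z - cv S c (dderiv h f) z) \<le> (C * (LINT q|lborel. norm (S q))) * (norm h)\<^sup>2" .
  qed
qed

lemma dderiv_cv: "schwartz S \<Longrightarrow> schwartz f \<Longrightarrow> dderiv w (cv S c f) = cv S c (dderiv w f)"
  by (rule ext, rule dderiv_eq[OF cv_has_derivative])

lemma dderivs_cv: "schwartz S \<Longrightarrow> schwartz f \<Longrightarrow> dderivs ws (cv S c f) = cv S c (dderivs ws f)"
  by (induct ws) (simp_all add: dderiv_cv schwartz_dderivs)

lemma schwartz_cv:
  assumes S: "schwartz S" and f: "schwartz f" and c: "0 < c" "c \<le> 1"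
  shows "schwartz (cv S c f)"
  unfolding schwartz_iff
proof (intro conjI allI)
  show "smooth (cv S c f)"
    unfolding smooth_def dderivs_cv[OF S f] differentiable_def
    using cv_has_derivative[OF S schwartz_dderivs[OF f]] by blast
  fix vs k
  obtain C where C: "0 \<le> C" "\<And>x. norm (dderivs vs f x) \<le> C / (1 + norm x) ^ k" using schwartz_bound[OF f] by metis
  obtain D where D: "0 \<le> D" "\<And>q. norm (S q) \<le> D / (1 + norm q) ^ (2 * DIM('q) + k)" using schwartz_bound0[OF S] by metis
  have "(1 + norm z) ^ k * norm (dderivs vs (cv S c f) z) \<le> C * D * (LINT q|lborel. 1 / (1 + norm (q::'q)) ^ (2 * DIM('q)))" for z
  proof -
    have "norm (dderivs vs (cv S c f) z) \<le> (LINT q|lborel. (C * D / (1 + norm z) ^ k) * (1 / (1 + norm (q::'q)) ^ (2 * DIM('q))))"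
      unfolding dderivs_cv[OF S f] cv_def
    proof (rule order_trans[OF integral_norm_bound integral_mono])
      show "integrable lborel (\<lambda>q. norm (S q * dderivs vs f (z + c *\<^sub>R J q)))"
        by (intro integrable_norm cv_integrable schwartz_integrable S schwartz_bcont schwartz_dderivs f)
      show "integrable lborel (\<lambda>q::'q. (C * D / (1 + norm z) ^ k) * (1 / (1 + norm q) ^ (2 * DIM('q))))"
        by (rule integrable_mult_right[OF integrable_decay])
      fix q :: 'q
      have "norm (dderivs vs f (z + c *\<^sub>R J q)) \<le> C * (1 / (1 + norm (z + c *\<^sub>R J q)) ^ k)" using C by simp
      also have "\<dots> \<le> C * ((1 + norm (c *\<^sub>R J q)) ^ k / (1 + norm z) ^ k)" by (intro mult_left_mono peetre_inverse C)
      also have "\<dots> \<le> C * ((1 + norm q) ^ k / (1 + norm z) ^ k)"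
        using c C by (intro mult_left_mono divide_right_mono power_mono) (auto simp: mult_left_le_one_le)
      finally have "norm (S q * dderivs vs f (z + c *\<^sub>R J q)) \<le> (D / (1 + norm q) ^ (2 * DIM('q) + k)) * (C * ((1 + norm q) ^ k / (1 + norm z) ^ k))"
        unfolding norm_mult using D by (intro mult_mono) auto
      also have "\<dots> = (C * D / (1 + norm z) ^ k) * (1 / (1 + norm q) ^ (2 * DIM('q)))" by (simp add: power_add mult_ac)
      finally show "norm (S q * dderivs vs f (z + c *\<^sub>R J q)) \<le> (C * D / (1 + norm z) ^ k) * (1 / (1 + norm q) ^ (2 * DIM('q)))" .
    qed
    also have "\<dots> = (C * D / (1 + norm z) ^ k) * (LINT q|lborel. 1 / (1 + norm (q::'q)) ^ (2 * DIM('q)))"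
      by (rule integral_mult_right_zero)
    also have "\<dots> = (C * D * (LINT q|lborel. 1 / (1 + norm (q::'q)) ^ (2 * DIM('q)))) / (1 + norm z) ^ k" by simp
    finally show ?thesis by (simp add: le_divide_eq mult.commute)
  qed
  then show "\<exists>C. \<forall>x. (1 + norm x) ^ k * norm (dderivs vs (cv S c f) x) \<le> C" by blast
qed

text \<open>For Schwartz \<open>f\<close> the Frechet derivative exists by differentiating
  \<open>f\<close>; uniqueness of derivatives along lines identifies it with the expression in which
  the kernel is differentiated.\<close>

lemma dderiv_J_cv:
  assumes S: "schwartz S" and f: "schwartz f" and c: "0 < c" "c \<le> 1"
  shows "dderiv (J u) (cv S c f) = (\<lambda>z. - of_real (1 / c) * cv (dderiv u S) c f z)"
  by (rule hdd_unique[OF hdd_smooth[OF schwartz_smooth[OF schwartz_cv[OF S f c]]] cv_hdd[OF S schwartz_bcont[OF f] c(1)]])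

text \<open>The bounded factor \<open>a\<close> allows one statement to serve all exchanges of
  integrals: it becomes a plane wave, the function \<open>v\<close>, a translate of
  \<open>v\<close>, or 1.\<close>

lemma pair_integrable:
  fixes S :: "'q \<Rightarrow> 'c::{real_normed_field,banach,second_countable_topology}"
  assumes S: "integrable lborel S" and f: "integrable lborel f"
    and a: "a \<in> borel_measurable borel" "\<And>x. norm (a x) \<le> M"
  shows "integrable (lborel \<Otimes>\<^sub>M lborel) (\<lambda>(q, z). a (q, z) * (S q * f (z + c *\<^sub>R J q)))"
proof -
  have [measurable]: "S \<in> borel_measurable borel" "f \<in> borel_measurable borel" "a \<in> borel_measurable borel"
    using S f a by (auto dest: borel_measurable_integrable)
  have m1: "fst \<in> (borel :: ('q \<times> 'a) measure) \<rightarrow>\<^sub>M borel" and m2: "(\<lambda>x. snd x + c *\<^sub>R J (fst x)) \<in> (borel :: ('q \<times> 'a) measure) \<rightarrow>\<^sub>M borel"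
    by (intro continuous_borel continuous_intros)+
  have [measurable]: "(\<lambda>x::'q \<times> 'a. S (fst x)) \<in> borel_measurable borel"
    by (rule measurable_compose[OF m1]) measurable
  have [measurable]: "(\<lambda>x::'q \<times> 'a. f (snd x + c *\<^sub>R J (fst x))) \<in> borel_measurable borel"
    by (rule measurable_compose[OF m2]) measurable
  have fz: "integrable lborel (\<lambda>z. f (z + c *\<^sub>R J q))" for q using f by (simp add: lborel_integrable_shift)
  have 1: "integrable (lborel \<Otimes>\<^sub>M lborel) (\<lambda>(q, z). S q * f (z + c *\<^sub>R J q))"
  proof (rule lborel_pair.Fubini_integrable)
    show "(\<lambda>(q, z). S q * f (z + c *\<^sub>R J q)) \<in> borel_measurable (lborel \<Otimes>\<^sub>M lborel)"
      by (simp add: case_prod_unfold lborel_prod)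
    have "(LINT z|lborel. norm (S q * f (z + c *\<^sub>R J q))) = norm (S q) * (LINT z|lborel. norm (f z))" for q
      using lborel_integral_shift[of "\<lambda>z. norm (f z)" "c *\<^sub>R J q"] by (simp add: norm_mult)
    then show "integrable lborel (\<lambda>q. LINT z|lborel. norm (case (q, z) of (q, z) \<Rightarrow> S q * f (z + c *\<^sub>R J q)))"
      using S by simp
    show "AE q in lborel. integrable lborel (\<lambda>z. case (q, z) of (q, z) \<Rightarrow> S q * f (z + c *\<^sub>R J q))"
      using fz by simp
  qed
  show ?thesis
  proof (rule Bochner_Integration.integrable_bound[OF integrable_mult_right[OF 1, of "of_real M"]])
    show "(\<lambda>(q, z). a (q, z) * (S q * f (z + c *\<^sub>R J q))) \<in> borel_measurable (lborel \<Otimes>\<^sub>M lborel)"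
      by (simp add: case_prod_unfold lborel_prod)
    have "norm (a x) \<le> \<bar>M\<bar>" for x using a(2)[of x] by linarith
    then show "AE x in lborel \<Otimes>\<^sub>M lborel. norm (case x of (q, z) \<Rightarrow> a (q, z) * (S q * f (z + c *\<^sub>R J q)))
        \<le> norm (of_real M * (case x of (q, z) \<Rightarrow> S q * f (z + c *\<^sub>R J q)))"
      by (intro AE_I2) (auto simp: norm_mult intro!: mult_right_mono)
  qed
qed

lemma pair_swap:
  fixes S :: "'q \<Rightarrow> 'c::{real_normed_field,banach,second_countable_topology}"
  assumes "integrable lborel S" "integrable lborel f" "a \<in> borel_measurable borel" "\<And>x. norm (a x) \<le> M"
  shows "(LINT z|lborel. LINT q|lborel. a (q, z) * (S q * f (z + c *\<^sub>R J q))) =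
    (LINT q|lborel. LINT z|lborel. a (q, z) * (S q * f (z + c *\<^sub>R J q)))"
  by (rule lborel_pair.Fubini_integral[OF pair_integrable[OF assms]])

lemma snd_measurable: "g \<in> borel_measurable borel \<Longrightarrow> (\<lambda>x::'q \<times> 'a. g (snd x)) \<in> borel_measurable borel"
  by (rule measurable_compose[of snd borel borel g]) (intro continuous_borel continuous_intros)

text \<open>The convolution theorem: \<open>p\<close> appears as the adjoint of \<open>J\<close>,
  and the sign comes from the reflected kernel. A multiplier
  \<open>\<sigma> (c *\<^sub>R p k)\<close> thus requires a kernel with
  \<open>fourier S k = \<sigma> (- k)\<close>.\<close>

lemma fourier_cv:
  assumes S: "schwartz S" and f: "schwartz f"
  shows "fourier (cv S c f) k = fourier S (- (c *\<^sub>R p k)) * fourier f k"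
proof -
  have m: "(\<lambda>z. cis (k \<bullet> z)) \<in> borel_measurable borel" by (rule smooth_borel[OF smooth_cis])
  have [measurable]: "f \<in> borel_measurable borel" by (rule schwartz_borel[OF f])
  have inner: "(LINT z|lborel. cis (k \<bullet> z) * f (z + c *\<^sub>R J q)) = cis ((- (c *\<^sub>R p k)) \<bullet> q) * fourier f k" for q
  proof -
    have "(LINT z|lborel. cis (k \<bullet> z) * f (z + c *\<^sub>R J q)) = (LINT z|lborel. (\<lambda>z. cis (k \<bullet> (z - c *\<^sub>R J q)) * f z) (z + c *\<^sub>R J q))"
      by simp
    also have "\<dots> = (LINT z|lborel. cis (k \<bullet> (z - c *\<^sub>R J q)) * f z)"
    proof (rule lborel_integral_shift)
      have "continuous_on UNIV cis" using has_vector_derivative_cis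
        by (meson continuous_at_imp_continuous_on has_vector_derivative_continuous)
      then have "continuous_on UNIV (\<lambda>z. cis (k \<bullet> (z - c *\<^sub>R J q)))"
        by (rule continuous_on_compose2) (auto intro!: continuous_intros)
      then show "(\<lambda>z. cis (k \<bullet> (z - c *\<^sub>R J q)) * f z) \<in> borel_measurable borel"
        using continuous_borel by (intro borel_measurable_times) auto
    qed
    also have "\<dots> = (LINT z|lborel. cis ((- (c *\<^sub>R p k)) \<bullet> q) * (cis (k \<bullet> z) * f z))"
    proof (rule Bochner_Integration.integral_cong[OF refl])
      fix z
      have "k \<bullet> (z - c *\<^sub>R J q) = (- (c *\<^sub>R p k)) \<bullet> q + k \<bullet> z"
        by (simp add: inner_diff_right inner_commute[of k "J q"] adj inner_commute[of q])
      then show "cis (k \<bullet> (z - c *\<^sub>R J q)) * f z = cis ((- (c *\<^sub>R p k)) \<bullet> q) * (cis (k \<bullet> z) * f z)"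
        by (simp only: cis_mult[symmetric] mult.assoc)
    qed
    finally show ?thesis by (simp add: fourier_def)
  qed
  have "fourier (cv S c f) k = (LINT z|lborel. LINT q|lborel. cis (k \<bullet> snd (q, z)) * (S q * f (z + c *\<^sub>R J q)))"
    unfolding fourier_def cv_def by simp
  also have "\<dots> = (LINT q|lborel. LINT z|lborel. cis (k \<bullet> snd (q, z)) * (S q * f (z + c *\<^sub>R J q)))"
    by (rule pair_swap[where M=1 and a="\<lambda>x. cis (k \<bullet> snd x)"]) (intro schwartz_integrable S, intro schwartz_integrable f, rule snd_measurable[OF m], simp)
  also have "\<dots> = (LINT q|lborel. S q * (LINT z|lborel. cis (k \<bullet> z) * f (z + c *\<^sub>R J q)))"
    by (simp add: mult.left_commute)
  also have "\<dots> = (LINT q|lborel. (cis ((- (c *\<^sub>R p k)) \<bullet> q) * S q) * fourier f k)"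
    unfolding inner by (simp add: mult_ac)
  also have "\<dots> = fourier S (- (c *\<^sub>R p k)) * fourier f k" unfolding fourier_def by simp
  finally show ?thesis .
qed

text \<open>Translating the integration variable moves the convolution from the test function to
  \<open>v\<close> and reflects the kernel, so \<open>v\<close> needs no regularity beyond
  continuity.\<close>

lemma cv_adjoint:
  assumes S: "schwartz S" and f: "schwartz f" and v: "bcont v"
  shows "(LINT z|lborel. v z * cv S c f z) = (LINT z|lborel. cv (\<lambda>q. S (- q)) c v z * f z)"
proof -
  have [measurable]: "f \<in> borel_measurable borel" "v \<in> borel_measurable borel" "S \<in> borel_measurable borel"
    by (intro schwartz_borel f bcont_borel v S)+
  obtain M where M: "0 \<le> M" "\<And>z. norm (v z) \<le> M" using bcontE[OF v] by metis
  have "(\<lambda>x. snd x - c *\<^sub>R J (fst x)) \<in> (borel :: ('q \<times> 'a) measure) \<rightarrow>\<^sub>M borel"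
    by (intro continuous_borel continuous_intros)
  then have va: "(\<lambda>x::'q \<times> 'a. v (snd x - c *\<^sub>R J (fst x))) \<in> borel_measurable borel"
    by (rule measurable_compose) measurable
  have "(LINT z|lborel. v z * cv S c f z) = (LINT z|lborel. LINT q|lborel. v (snd (q, z)) * (S q * f (z + c *\<^sub>R J q)))"
    unfolding cv_def by simp
  also have "\<dots> = (LINT q|lborel. LINT z|lborel. v (snd (q, z)) * (S q * f (z + c *\<^sub>R J q)))"
    by (rule pair_swap[where a="\<lambda>x. v (snd x)"], intro schwartz_integrable S, intro schwartz_integrable f, rule snd_measurable, simp, rule M)
  also have "\<dots> = (LINT q|lborel. LINT z|lborel. v (snd (q, z) - c *\<^sub>R J (fst (q, z))) * (S q * f (z + 0 *\<^sub>R J q)))"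
  proof (rule Bochner_Integration.integral_cong[OF refl])
    fix q
    have "(\<lambda>z. v (z - c *\<^sub>R J q)) \<in> borel_measurable borel"
      using shift_measurable[of v] measurable_compose[of "\<lambda>z. z - c *\<^sub>R J q" borel borel v] by simp
    then have "(\<lambda>z. v (z - c *\<^sub>R J q) * (S q * f z)) \<in> borel_measurable borel" by measurable
    from lborel_integral_shift[OF this, of "c *\<^sub>R J q"]
    show "(LINT z|lborel. v (snd (q, z)) * (S q * f (z + c *\<^sub>R J q))) = (LINT z|lborel. v (snd (q, z) - c *\<^sub>R J (fst (q, z))) * (S q * f (z + 0 *\<^sub>R J q)))"
      by simp
  qed
  also have "\<dots> = (LINT z|lborel. LINT q|lborel. v (snd (q, z) - c *\<^sub>R J (fst (q, z))) * (S q * f (z + 0 *\<^sub>R J q)))"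
    by (rule pair_swap[symmetric, where a="\<lambda>x. v (snd x - c *\<^sub>R J (fst x))"], intro schwartz_integrable S, intro schwartz_integrable f, rule va, rule M)
  also have "\<dots> = (LINT z|lborel. (LINT q|lborel. S q * v (z - c *\<^sub>R J q)) * f z)"
  proof (rule Bochner_Integration.integral_cong[OF refl])
    fix z
    have "(LINT q|lborel. v (snd (q, z) - c *\<^sub>R J (fst (q, z))) * (S q * f (z + 0 *\<^sub>R J q))) = (LINT q|lborel. (S q * v (z - c *\<^sub>R J q)) * f z)"
      by (simp add: mult_ac)
    also have "\<dots> = (LINT q|lborel. S q * v (z - c *\<^sub>R J q)) * f z" by (rule integral_mult_left_zero)
    finally show "(LINT q|lborel. v (snd (q, z) - c *\<^sub>R J (fst (q, z))) * (S q * f (z + 0 *\<^sub>R J q))) = (LINT q|lborel. S q * v (z - c *\<^sub>R J q)) * f z" .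
  qed
  also have "\<dots> = (LINT z|lborel. cv (\<lambda>q. S (- q)) c v z * f z)"
  proof (rule Bochner_Integration.integral_cong[OF refl])
    fix z
    have "(\<lambda>q. S q * v (z + (- c) *\<^sub>R J q)) \<in> borel_measurable borel"
      by (intro borel_measurable_times shift_measurable) simp_all
    from lborel_integral_uminus[OF this]
    show "(LINT q|lborel. S q * v (z - c *\<^sub>R J q)) * f z = cv (\<lambda>q. S (- q)) c v z * f z"
      by (simp add: cv_def J_simps)
  qed
  finally show ?thesis .
qed

section \<open>The contribution away from \<open>q = 0\<close>\<close>

definition cyl :: "real \<Rightarrow> 'a set" where "cyl r = {z. norm (p z) < r \<and> norm (proj z) < r}"

definition scaled_tests :: "real \<Rightarrow> (real \<times> ('a \<Rightarrow> complex)) set" where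
  "scaled_tests r = {(c, \<psi>). 0 < c \<and> c \<le> 1 \<and> test_fun (cyl r) \<psi>}"

text \<open>The factor 2 leaves a gap of width \<open>r\<close>, measured in \<open>q\<close>,
  between the support of \<open>m\<close> and the cylinder \<open>cyl r\<close> that carries the
  test functions.\<close>

definition far_mult :: "real \<Rightarrow> ('a \<Rightarrow> complex) \<Rightarrow> bool" where
  "far_mult r m \<longleftrightarrow> slow m \<and> (\<forall>z. norm (p z) < 2 * r \<longrightarrow> m z = 0)"

text \<open>Rapid decay in \<open>x\<close> but mere boundedness in \<open>q\<close>: the abstract
  form of the factor \<open>f\<close> in \<open>t = s f\<close>. Without \<open>x\<close>-directions
  the constant 1 qualifies.\<close>

definition qschw :: "('a \<Rightarrow> complex) \<Rightarrow> bool" where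
  "qschw f \<longleftrightarrow> smooth f \<and> (\<forall>vs n. \<exists>C. \<forall>z. norm (dderivs vs f z) \<le> C / (1 + norm (proj z)) ^ n)"

lemma open_cyl: "open (cyl r)"
proof -
  have p: "continuous_on UNIV (\<lambda>z. norm (p z))" and q: "continuous_on UNIV (\<lambda>z. norm (proj z))"
    by (intro continuous_on_norm continuous_p continuous_proj continuous_on_id)+
  have "cyl r = {z. norm (p z) < r} \<inter> {z. norm (proj z) < r}" by (auto simp: cyl_def)
  then show ?thesis
    using open_Int[OF open_Collect_less[OF p continuous_on_const] open_Collect_less[OF q continuous_on_const]] by metis
qed

lemma norm_cyl: "z \<in> cyl r \<Longrightarrow> norm z \<le> 2 * r"
  using norm_split[of z] unfolding cyl_def by auto

lemma test_fun_cyl: "test_fun (cyl r) \<psi> \<Longrightarrow> \<psi> z \<noteq> 0 \<Longrightarrow> z \<in> cyl r"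
  by (erule test_funE) blast

lemma far_mult_dderiv: assumes m: "far_mult r m" shows "far_mult r (dderiv v m)"
proof -
  have sl: "slow m" using m by (simp add: far_mult_def)
  have o: "open {z. norm (p z) < 2 * r}" by (rule open_Collect_less; intro continuous_intros)
  have "dderivs [v] m z = 0" if "norm (p z) < 2 * r" for z
    using dderivs_local[OF slow_smooth[OF sl] smooth_const[of 0] o, of z "[v]"] m that
    by (simp add: far_mult_def dderiv_const)
  then show ?thesis using slow_dderiv[OF sl] by (simp add: far_mult_def)
qed

lemma far_mult_inner: "far_mult r m \<Longrightarrow> far_mult r (\<lambda>k. (\<i> * of_real (k \<bullet> w)) * m k)"
  unfolding far_mult_def using slow_mult[OF slow_mult[OF slow_const[of \<i>] slow_inner[of w]]] by auto

lemma far_schwartz: "schwartz S \<Longrightarrow> far_mult r m \<Longrightarrow> (c, \<psi>) \<in> scaled_tests r \<Longrightarrow> schwartz (\<lambda>z. m z * cv S c \<psi> z)"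
  unfolding far_mult_def scaled_tests_def by (auto intro: schwartz_mult schwartz_cv test_fun_schwartz)

text \<open>If \<open>m z\<close> is nonzero and \<open>z + c *\<^sub>R J q\<close> lies in the
  cylinder, then \<open>r \<le> c * norm q\<close>. Hence
  \<open>1 \<le> (c * norm q / r) ^ n\<close> can be inserted, and the decay of \<open>S\<close>
  absorbs the powers of \<open>norm q\<close> together with the polynomial growth of
  \<open>m\<close>. Integrating over \<open>z\<close> inside leaves the L1 norm of
  \<open>\<psi>\<close>.\<close>

lemma far_bound_0:
  assumes r: "0 < r" and S: "schwartz S" and m: "far_mult r m"
  shows "\<exists>C. 0 \<le> C \<and> (\<forall>(c, \<psi>)\<in>scaled_tests r. nrm (\<lambda>z. m z * cv S c \<psi> z) \<le> C * (c ^ n * nrm \<psi>))"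
proof -
  obtain A k where A: "0 \<le> A" "\<And>z. norm (m z) \<le> A * (1 + norm z) ^ k" using slow_bound m unfolding far_mult_def by metis
  obtain B where B: "0 \<le> B" "\<And>q. norm (S q) \<le> B / (1 + norm q) ^ (2 * DIM('q) + k + n)" using schwartz_bound0[OF S] by metis
  define g where "g q = 1 / (1 + norm q) ^ (2 * DIM('q))" for q :: 'q
  have g: "integrable lborel g" unfolding g_def by (rule integrable_decay)
  have g0: "0 \<le> g q" for q unfolding g_def by simp
  define K where "K = A * B * (1 + 2 * r) ^ k / r ^ n"
  have K: "0 \<le> K" unfolding K_def using A B r by simp
  have "nrm (\<lambda>z. m z * cv S c \<psi> z) \<le> (K * integral\<^sup>L lborel g) * (c ^ n * nrm \<psi>)" if "(c, \<psi>) \<in> scaled_tests r" for c \<psi>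
  proof -
    have c: "0 < c" "c \<le> 1" and psi: "test_fun (cyl r) \<psi>" using that unfolding scaled_tests_def by auto
    note sp = test_fun_schwartz[OF psi]
    have pt: "norm (m z) * norm (S q * \<psi> (z + c *\<^sub>R J q)) \<le> (K * c ^ n) * (g q * norm (\<psi> (z + c *\<^sub>R J q)))" for z q
    proof (cases "\<psi> (z + c *\<^sub>R J q) = 0 \<or> m z = 0")
      case True then show ?thesis using K c g0 by auto
    next
      case False
      then have b: "z + c *\<^sub>R J q \<in> cyl r" and far: "2 * r \<le> norm (p z)"
        using test_fun_cyl[OF psi] m unfolding far_mult_def by (auto simp: not_less[symmetric])
      have "norm (p z) \<le> norm (p (z + c *\<^sub>R J q)) + norm (c *\<^sub>R q)"
        using norm_triangle_ineq4[of "p (z + c *\<^sub>R J q)" "c *\<^sub>R q"] by (simp add: p_simps pJ)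
      then have "r \<le> c * norm q" using b far c unfolding cyl_def by simp
      then have "1 \<le> c * norm q / r" using r by simp
      then have one: "1 \<le> (c * norm q / r) ^ n" by simp
      also have "\<dots> \<le> (c * (1 + norm q) / r) ^ n" using c r by (intro power_mono divide_right_mono mult_left_mono) auto
      also have "\<dots> = c ^ n * (1 + norm q) ^ n / r ^ n" by (simp add: power_mult_distrib power_divide)
      finally have one: "1 \<le> c ^ n * (1 + norm q) ^ n / r ^ n" .
      have "norm z \<le> norm (z + c *\<^sub>R J q) + norm (c *\<^sub>R J q)" using norm_triangle_ineq4[of "z + c *\<^sub>R J q" "c *\<^sub>R J q"] by simp
      also have "\<dots> \<le> 2 * r + norm q" using norm_cyl[OF b] c by (simp add: add_mono mult_left_le_one_le)
      also have "1 + (2 * r + norm q) \<le> (1 + 2 * r) * (1 + norm q)" using r by (simp add: algebra_simps)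
      finally have "1 + norm z \<le> (1 + 2 * r) * (1 + norm q)" by simp
      then have "(1 + norm z) ^ k \<le> ((1 + 2 * r) * (1 + norm q)) ^ k" by (intro power_mono) auto
      then have "A * (1 + norm z) ^ k \<le> A * ((1 + 2 * r) * (1 + norm q)) ^ k" using A by (intro mult_left_mono) auto
      then have mz: "norm (m z) \<le> A * ((1 + 2 * r) * (1 + norm q)) ^ k" using A(2)[of z] by linarith
      have "norm (m z) * norm (S q) \<le> (A * ((1 + 2 * r) * (1 + norm q)) ^ k) * (B / (1 + norm q) ^ (2 * DIM('q) + k + n))"
        using mz B A r by (intro mult_mono) auto
      also have "\<dots> = (A * B * (1 + 2 * r) ^ k / (1 + norm q) ^ (2 * DIM('q) + n)) * 1"
        by (simp add: power_mult_distrib power_add)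
      also have "\<dots> \<le> (A * B * (1 + 2 * r) ^ k / (1 + norm q) ^ (2 * DIM('q) + n)) * (c ^ n * (1 + norm q) ^ n / r ^ n)"
        using A B r by (intro mult_left_mono one) auto
      also have "\<dots> = K * c ^ n * g q" unfolding K_def g_def by (simp add: power_add mult_ac)
      finally have "(norm (m z) * norm (S q)) * norm (\<psi> (z + c *\<^sub>R J q)) \<le> (K * c ^ n * g q) * norm (\<psi> (z + c *\<^sub>R J q))"
        by (rule mult_right_mono) simp
      then show ?thesis by (simp add: norm_mult mult.assoc)
    qed
    have ig: "integrable lborel (\<lambda>q. g q * norm (\<psi> (z + c *\<^sub>R J q)))" for z
    proof -
      have "bcont (\<lambda>z. complex_of_real (norm (\<psi> z)))" using schwartz_bcont[OF sp] unfolding bcont_def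
        by (auto intro!: continuous_intros)
      then have "integrable lborel (\<lambda>q. complex_of_real (g q) * complex_of_real (norm (\<psi> (z + c *\<^sub>R J q))))"
        by (intro cv_integrable) (use g in auto)
      from integrable_norm[OF this] show ?thesis using g0 by (simp add: norm_mult)
    qed
    have ip: "integrable lborel (\<lambda>z. norm (\<psi> z))" by (intro integrable_norm schwartz_integrable sp)
    have pairi: "integrable (lborel \<Otimes>\<^sub>M lborel) (\<lambda>(q, z). 1 * (g q * norm (\<psi> (z + c *\<^sub>R J q))))"
      by (rule pair_integrable[where a="\<lambda>_. 1" and M=1, OF g ip]) auto
    have "integrable lborel (\<lambda>z. LINT q|lborel. 1 * (g q * norm (\<psi> (z + c *\<^sub>R J q))))"
      using lborel_pair.integrable_snd[OF pairi] by simp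
    then have iz: "integrable lborel (\<lambda>z. (K * c ^ n) * (LINT q|lborel. g q * norm (\<psi> (z + c *\<^sub>R J q))))" by simp
    have "nrm (\<lambda>z. m z * cv S c \<psi> z) \<le> (LINT z|lborel. (K * c ^ n) * (LINT q|lborel. g q * norm (\<psi> (z + c *\<^sub>R J q))))"
      unfolding nrm_def
    proof (rule integral_mono[OF _ iz])
      show "integrable lborel (\<lambda>z. norm (m z * cv S c \<psi> z))"
        by (intro integrable_norm schwartz_integrable far_schwartz[OF S m that])
      fix z
      have "norm (m z * cv S c \<psi> z) = norm (LINT q|lborel. m z * (S q * \<psi> (z + c *\<^sub>R J q)))" unfolding cv_def by simp
      also have "\<dots> \<le> (LINT q|lborel. (K * c ^ n) * (g q * norm (\<psi> (z + c *\<^sub>R J q))))"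
      proof (rule order_trans[OF integral_norm_bound integral_mono])
        show "integrable lborel (\<lambda>q. norm (m z * (S q * \<psi> (z + c *\<^sub>R J q))))"
          by (intro integrable_norm integrable_mult_right cv_integrable schwartz_integrable S schwartz_bcont sp)
        show "integrable lborel (\<lambda>q. (K * c ^ n) * (g q * norm (\<psi> (z + c *\<^sub>R J q))))" by (rule integrable_mult_right[OF ig])
        show "norm (m z * (S q * \<psi> (z + c *\<^sub>R J q))) \<le> (K * c ^ n) * (g q * norm (\<psi> (z + c *\<^sub>R J q)))" for q
          using pt[of z q] by (simp add: norm_mult mult.assoc)
      qed
      finally show "norm (m z * cv S c \<psi> z) \<le> (K * c ^ n) * (LINT q|lborel. g q * norm (\<psi> (z + c *\<^sub>R J q)))" by simp
    qed
    also have "\<dots> = (K * c ^ n) * (LINT z|lborel. LINT q|lborel. 1 * (g q * norm (\<psi> (z + c *\<^sub>R J q))))" by simp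
    also have "(LINT z|lborel. LINT q|lborel. 1 * (g q * norm (\<psi> (z + c *\<^sub>R J q)))) =
       (LINT q|lborel. LINT z|lborel. 1 * (g q * norm (\<psi> (z + c *\<^sub>R J q))))"
      by (rule lborel_pair.Fubini_integral[OF pairi])
    also have "\<dots> = (LINT q|lborel. g q * nrm \<psi>)"
    proof (rule Bochner_Integration.integral_cong[OF refl])
      fix q
      have "(\<lambda>z. norm (\<psi> z)) \<in> borel_measurable borel" using schwartz_borel[OF sp] by simp
      from lborel_integral_shift[OF this, of "c *\<^sub>R J q"]
      show "(LINT z|lborel. 1 * (g q * norm (\<psi> (z + c *\<^sub>R J q)))) = g q * nrm \<psi>" by (simp add: nrm_def)
    qed
    also have "\<dots> = integral\<^sup>L lborel g * nrm \<psi>" by simp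
    finally show ?thesis by (simp add: mult_ac)
  qed
  moreover have "0 \<le> integral\<^sup>L lborel g" using g0 by (intro integral_nonneg_AE) simp
  ultimately show ?thesis using K by (intro exI[of _ "K * integral\<^sup>L lborel g"]) auto
qed

text \<open>A derivative in a \<open>q\<close>-direction falls on \<open>m\<close>, which stays a
  far multiplier, or on the kernel, at the price of \<open>1 / c\<close>. Since the power
  \<open>n\<close> is arbitrary, the latter case invokes the induction hypothesis with
  \<open>Suc n\<close>.\<close>

lemma far_bound:
  assumes r: "0 < r"
  shows "schwartz S \<Longrightarrow> far_mult r m \<Longrightarrow> \<exists>C. 0 \<le> C \<and>
    (\<forall>(c, \<psi>)\<in>scaled_tests r. nrm (dderivs (map J us) (\<lambda>z. m z * cv S c \<psi> z)) \<le> C * (c ^ n * nrm \<psi>))"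
proof (induct us arbitrary: S m n rule: rev_induct)
  case Nil
  then show ?case using far_bound_0[OF r, of S m n] by simp
next
  case (snoc u us)
  note S = snoc(2) and m = snoc(3)
  obtain C1 where C1: "0 \<le> C1" "\<And>c \<psi>. (c, \<psi>) \<in> scaled_tests r \<Longrightarrow> nrm (dderivs (map J us) (\<lambda>z. m z * cv (dderiv u S) c \<psi> z)) \<le> C1 * (c ^ Suc n * nrm \<psi>)"
    using snoc(1)[OF schwartz_dderiv[OF S] m, of u "Suc n"] by blast
  obtain C2 where C2: "0 \<le> C2" "\<And>c \<psi>. (c, \<psi>) \<in> scaled_tests r \<Longrightarrow> nrm (dderivs (map J us) (\<lambda>z. dderiv (J u) m z * cv S c \<psi> z)) \<le> C2 * (c ^ n * nrm \<psi>)"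
    using snoc(1)[OF S far_mult_dderiv[OF m], of "J u" n] by blast
  have "nrm (dderivs (map J (us @ [u])) (\<lambda>z. m z * cv S c \<psi> z)) \<le> (C1 + C2) * (c ^ n * nrm \<psi>)" if t: "(c, \<psi>) \<in> scaled_tests r" for c \<psi>
  proof -
    have c: "0 < c" "c \<le> 1" and psi: "schwartz \<psi>" using t unfolding scaled_tests_def by (auto intro: test_fun_schwartz)
    have sm: "smooth m" using m unfolding far_mult_def by (blast intro: slow_smooth)
    note s1 = far_schwartz[OF schwartz_dderiv[OF S, of u] m t]
    note s2 = far_schwartz[OF S far_mult_dderiv[OF m, of "J u"] t]
    have "dderiv (J u) (\<lambda>z. m z * cv S c \<psi> z) = (\<lambda>z. (- of_real (1 / c)) * (m z * cv (dderiv u S) c \<psi> z) + dderiv (J u) m z * cv S c \<psi> z)"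
      unfolding dderiv_mult[OF sm schwartz_smooth[OF schwartz_cv[OF S psi c]]] dderiv_J_cv[OF S psi c] by (simp add: mult_ac)
    then have "dderivs (map J (us @ [u])) (\<lambda>z. m z * cv S c \<psi> z) =
      dderivs (map J us) (\<lambda>z. (- of_real (1 / c)) * (m z * cv (dderiv u S) c \<psi> z) + dderiv (J u) m z * cv S c \<psi> z)"
      by (simp add: dderivs_append)
    also have "\<dots> = (\<lambda>z. (- of_real (1 / c)) * dderivs (map J us) (\<lambda>z. m z * cv (dderiv u S) c \<psi> z) z + dderivs (map J us) (\<lambda>z. dderiv (J u) m z * cv S c \<psi> z) z)"
      using dderivs_add[OF smooth_cmult[OF schwartz_smooth[OF s1]] schwartz_smooth[OF s2], of "map J us" "- of_real (1 / c)"]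
        dderivs_cmult[OF schwartz_smooth[OF s1], of "map J us" "- of_real (1 / c)"] by simp
    finally have "nrm (dderivs (map J (us @ [u])) (\<lambda>z. m z * cv S c \<psi> z)) \<le>
      nrm (\<lambda>z. (- of_real (1 / c)) * dderivs (map J us) (\<lambda>z. m z * cv (dderiv u S) c \<psi> z) z) + nrm (dderivs (map J us) (\<lambda>z. dderiv (J u) m z * cv S c \<psi> z))"
      using nrm_add[OF schwartz_cmult[OF schwartz_dderivs[OF s1], of "- of_real (1 / c)" "map J us"] schwartz_dderivs[OF s2, of "map J us"]] by simp
    also have "nrm (\<lambda>z. (- of_real (1 / c)) * dderivs (map J us) (\<lambda>z. m z * cv (dderiv u S) c \<psi> z) z) = (1 / c) * nrm (dderivs (map J us) (\<lambda>z. m z * cv (dderiv u S) c \<psi> z))"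
      unfolding nrm_cmult using c by (simp add: norm_divide)
    also have "\<dots> \<le> (1 / c) * (C1 * (c ^ Suc n * nrm \<psi>))" using c by (intro mult_left_mono C1 t) auto
    also have "\<dots> = C1 * (c ^ n * nrm \<psi>)" using c by simp
    finally show ?thesis using C2(2)[OF t] by (simp add: distrib_right)
  qed
  then show ?case using C1(1) C2(1) by (intro exI[of _ "C1 + C2"]) auto
qed

lemma qschw_dderiv: assumes "qschw f" shows "qschw (dderiv v f)"
proof -
  have "dderivs vs (dderiv v f) = dderivs (vs @ [v]) f" for vs by (simp add: dderivs_append)
  then show ?thesis using assms unfolding qschw_def by (auto simp: smooth_dderiv)
qed

lemma norm_split_mult: "1 + norm z \<le> (1 + norm (p z)) * (1 + norm (proj z))"
proof -
  have "(1 + norm (p z)) * (1 + norm (proj z)) = 1 + norm (p z) + norm (proj z) + norm (p z) * norm (proj z)" by (simp add: algebra_simps)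
  then show ?thesis using norm_split[of z] by (smt (verit) mult_nonneg_nonneg norm_ge_zero)
qed

text \<open>Decay in \<open>p z\<close> comes from derivatives in the \<open>q\<close>-directions,
  which \<open>far_bound\<close> controls by \<open>nrm \<psi>\<close>. Derivatives in the other
  directions would fall on \<open>\<psi>\<close>, so decay in \<open>proj z\<close> is taken from
  \<open>f\<close>.\<close>

lemma far_fourier_bound:
  assumes r: "0 < r" and S: "schwartz S" and m: "far_mult r m" and f: "qschw f"
  shows "\<exists>C. \<forall>i\<in>scaled_tests r. \<forall>z. (1 + norm z) ^ k * norm (f z * fourier (\<lambda>k. m k * cv S (fst i) (snd i) k) z) \<le> C * (fst i ^ n * nrm (snd i))"
proof -
  obtain A where A: "\<And>z. norm (f z) \<le> A / (1 + norm (proj z)) ^ k" using f unfolding qschw_def by (metis dderivs.simps(1))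
  have "norm (f 0) * (1 + norm (proj 0)) ^ k \<le> A" using A[of 0] by (simp add: pos_le_divide_eq)
  then have A0: "0 \<le> A" by (rule order_trans[rotated]) simp
  have "\<forall>b. \<exists>C. 0 \<le> C \<and> (\<forall>(c, \<psi>)\<in>scaled_tests r. nrm (dderivs (map J (replicate k b)) (\<lambda>z. m z * cv S c \<psi> z)) \<le> C * (c ^ n * nrm \<psi>))"
    using far_bound[OF r S m] by blast
  then obtain C where C: "\<And>b. 0 \<le> C b" "\<And>b c \<psi>. (c, \<psi>) \<in> scaled_tests r \<Longrightarrow> nrm (dderivs (map J (replicate k b)) (\<lambda>z. m z * cv S c \<psi> z)) \<le> C b * (c ^ n * nrm \<psi>)"
    by (subst (asm) choice_iff) blast
  obtain C0 where C0: "0 \<le> C0" "\<And>c \<psi>. (c, \<psi>) \<in> scaled_tests r \<Longrightarrow> nrm (\<lambda>z. m z * cv S c \<psi> z) \<le> C0 * (c ^ n * nrm \<psi>)"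
    using far_bound_0[OF r S m, of n] by blast
  have "(1 + norm z) ^ k * norm (f z * fourier (\<lambda>k. m k * cv S c \<psi> k) z) \<le> (A * ((real DIM('q) + 1) ^ k * (C0 + (\<Sum>b\<in>Basis. C b)))) * (c ^ n * nrm \<psi>)"
    if t: "(c, \<psi>) \<in> scaled_tests r" for c \<psi> z
  proof -
    let ?g = "\<lambda>k. m k * cv S c \<psi> k"
    note sg = far_schwartz[OF S m t]
    have "(1 + norm z) ^ k \<le> (1 + norm (p z)) ^ k * (1 + norm (proj z)) ^ k"
      using power_mono[OF norm_split_mult[of z], of k] by (simp add: power_mult_distrib)
    then have "(1 + norm z) ^ k * norm (f z) \<le> ((1 + norm (p z)) ^ k * (1 + norm (proj z)) ^ k) * (A / (1 + norm (proj z)) ^ k)"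
      using A by (intro mult_mono) auto
    also have "\<dots> = A * (1 + norm (p z)) ^ k" by simp
    finally have "(1 + norm z) ^ k * norm (f z * fourier ?g z) \<le> A * (1 + norm (p z)) ^ k * norm (fourier ?g z)"
      by (simp add: norm_mult mult.assoc[symmetric] mult_right_mono)
    also have "\<dots> = A * ((1 + norm (p z)) ^ k * norm (fourier ?g z))" by simp
    also have "(1 + norm (p z)) ^ k * norm (fourier ?g z) \<le> ((real DIM('q) + 1) ^ k * (1 + (\<Sum>b\<in>Basis. \<bar>p z \<bullet> b\<bar> ^ k))) * norm (fourier ?g z)"
      by (rule mult_right_mono[OF norm_power_le_sum]) simp
    also have "\<dots> = (real DIM('q) + 1) ^ k * (norm (fourier ?g z) + (\<Sum>b\<in>Basis. \<bar>p z \<bullet> b\<bar> ^ k * norm (fourier ?g z)))"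
      by (simp add: distrib_right sum_distrib_right mult.assoc)
    also have "\<dots> \<le> (real DIM('q) + 1) ^ k * (C0 * (c ^ n * nrm \<psi>) + (\<Sum>b\<in>Basis. C b * (c ^ n * nrm \<psi>)))"
    proof (intro mult_left_mono add_mono sum_mono)
      show "norm (fourier ?g z) \<le> C0 * (c ^ n * nrm \<psi>)"
        using norm_fourier_le[OF schwartz_integrable[OF sg], of z] C0(2)[OF t] unfolding nrm_def by linarith
      fix b :: 'q
      have "z \<bullet> J b = p z \<bullet> b" by (metis adj inner_commute)
      then have "\<bar>p z \<bullet> b\<bar> ^ k * norm (fourier ?g z) = norm (of_real (z \<bullet> J b) ^ k * fourier ?g z)" by (simp add: norm_mult norm_power)
      also have "\<dots> = norm (fourier (dderivs (replicate k (J b)) ?g) z)"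
        unfolding fourier_power_eq[OF sg] by (simp add: norm_mult norm_power)
      also have "\<dots> \<le> nrm (dderivs (map J (replicate k b)) ?g)"
        unfolding nrm_def using norm_fourier_le[OF schwartz_integrable[OF schwartz_dderivs[OF sg]]] by simp
      also have "\<dots> \<le> C b * (c ^ n * nrm \<psi>)" by (rule C(2)[OF t])
      finally show "\<bar>p z \<bullet> b\<bar> ^ k * norm (fourier ?g z) \<le> C b * (c ^ n * nrm \<psi>)" .
    qed simp
    finally show ?thesis using A0 by (simp add: sum_distrib_right[symmetric] distrib_right mult_left_mono mult.assoc)
  qed
  then show ?thesis by (intro exI[of _ "A * ((real DIM('q) + 1) ^ k * (C0 + (\<Sum>b\<in>Basis. C b)))"]) auto
qed

text \<open>Differentiating the Fourier factor multiplies \<open>m\<close> by a linear function, and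
  differentiating \<open>f\<close> keeps it \<open>qschw\<close>. The class is closed up to sums, so
  the bound just proved extends to all derivatives.\<close>

lemma far_family:
  assumes r: "0 < r" and S: "schwartz S" and m: "far_mult r m" and f: "qschw f"
  shows "sfam (scaled_tests r) (\<lambda>i. fst i ^ n * nrm (snd i)) (\<lambda>i z. f z * fourier (\<lambda>k. m k * cv S (fst i) (snd i) k) z)"
proof -
  let ?F = "\<lambda>f m i z. f z * fourier (\<lambda>k. m k * cv S (fst i) (snd i) k) z"
  let ?B = "\<lambda>F. \<exists>f m. qschw f \<and> far_mult r m \<and> F = ?F f m"
  show ?thesis
  proof (rule sfam_sumcl[where B="?B"])
    show "sumcl (scaled_tests r) ?B (?F f m)" by (rule sumcl.base[where f="?F f m"]) (use f m in auto)
    fix F assume "?B F"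
    then obtain f m where f: "qschw f" and m: "far_mult r m" and F: "F = ?F f m" by blast
    have d: "(F i has_derivative (\<lambda>w. ?F f (\<lambda>k. (\<i> * of_real (k \<bullet> w)) * m k) i z + ?F (dderiv w f) m i z)) (at z)" if i: "i \<in> scaled_tests r" for i z
    proof -
      have sg: "schwartz (\<lambda>k. m k * cv S (fst i) (snd i) k)" by (rule far_schwartz[OF S m]) (use i in simp)
      have "smooth f" using f by (simp add: qschw_def)
      from has_derivative_mult[OF smooth_has_derivative[OF this] fourier_has_derivative[OF sg], of z]
      show ?thesis unfolding F by (simp add: mult.assoc)
    qed
    have "sumcl (scaled_tests r) ?B (\<lambda>i. dderiv w (F i))" for w
    proof (rule sumcl_bases)
      show "?B (?F f (\<lambda>k. (\<i> * of_real (k \<bullet> w)) * m k))" using f far_mult_inner[OF m] by blast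
      show "?B (?F (dderiv w f) m)" using qschw_dderiv[OF f] m by blast
    qed (simp add: dderiv_eq[OF d])
    moreover have "fbd (scaled_tests r) (\<lambda>i. fst i ^ n * nrm (snd i)) F"
      unfolding fbd_def F using far_fourier_bound[OF r S m f] by blast
    ultimately show "(\<forall>i\<in>scaled_tests r. \<forall>x. F i differentiable at x) \<and> fbd (scaled_tests r) (\<lambda>i. fst i ^ n * nrm (snd i)) F \<and>
      (\<forall>w. sumcl (scaled_tests r) ?B (\<lambda>i. dderiv w (F i)))"
      unfolding differentiable_def using d by blast
  qed
qed

end

section \<open>Taylor expansion and dyadic summation\<close>

text \<open>Induction on \<open>K\<close> for the shifted sequence of derivatives. The mean value
  inequality in each step gives up the factorial in the remainder.\<close>

lemma taylor_remainder_bound: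
  fixes g :: "nat \<Rightarrow> real \<Rightarrow> complex"
  assumes "\<And>n t. (g n has_vector_derivative g (Suc n) t) (at t)"
    and "\<And>t. 0 \<le> t \<Longrightarrow> t \<le> 1 \<Longrightarrow> norm (g K t) \<le> B" and "0 \<le> t" "t \<le> 1"
  shows "norm (g 0 t - (\<Sum>n<K. (t ^ n / fact n) *\<^sub>R g n 0)) \<le> B"
  using assms
proof (induct K arbitrary: g t)
  case 0 then show ?case by simp
next
  case (Suc K)
  have IH: "norm (g (Suc 0) t - (\<Sum>n<K. (t ^ n / fact n) *\<^sub>R g (Suc n) 0)) \<le> B" if "0 \<le> t" "t \<le> 1" for t
    using Suc(1)[of "\<lambda>n. g (Suc n)" t] Suc(2,3) that by simp
  have B: "0 \<le> B" using order_trans[OF norm_ge_zero Suc(3)[of 0]] by simp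
  let ?h = "\<lambda>t. g 0 t - (\<Sum>n<Suc K. (t ^ n / fact n) *\<^sub>R g n 0)"
  have d: "((\<lambda>t. (t ^ Suc n / fact (Suc n)) *\<^sub>R c) has_vector_derivative (t ^ n / fact n) *\<^sub>R c) (at t)" for n t and c :: complex
  proof -
    have "((\<lambda>t::real. t ^ Suc n / fact (Suc n)) has_real_derivative (real (Suc n) * t ^ n / fact (Suc n))) (at t)"
      by (intro DERIV_cdivide) (use DERIV_pow[of "Suc n"] in simp)
    moreover have "real (Suc n) * t ^ n / fact (Suc n) = t ^ n / fact n"
      by (simp add: fact_Suc divide_simps del: of_nat_Suc)
    ultimately have "((\<lambda>t::real. t ^ Suc n / fact (Suc n)) has_vector_derivative (t ^ n / fact n)) (at t)"
      by (simp add: has_real_derivative_iff_has_vector_derivative del: fact_Suc)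
    from has_vector_derivative_scaleR[OF _ has_vector_derivative_const, of "\<lambda>t::real. t ^ Suc n / fact (Suc n)" "t ^ n / fact n" t UNIV c]
    show ?thesis using \<open>((\<lambda>t::real. t ^ Suc n / fact (Suc n)) has_real_derivative _) (at t)\<close>
      \<open>real (Suc n) * t ^ n / fact (Suc n) = t ^ n / fact n\<close> by (simp del: fact_Suc)
  qed
  have "norm (?h t - ?h 0) \<le> B * t"
  proof (rule hvd_bound)
    fix s assume s: "0 \<le> s" "s \<le> t"
    have "((\<lambda>t. g 0 t - (g 0 0 + (\<Sum>n<K. (t ^ Suc n / fact (Suc n)) *\<^sub>R g (Suc n) 0))) has_vector_derivative
        (g (Suc 0) s - (0 + (\<Sum>n<K. (s ^ n / fact n) *\<^sub>R g (Suc n) 0)))) (at s)"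
      by (intro has_vector_derivative_diff has_vector_derivative_add has_vector_derivative_const has_vector_derivative_sum d Suc(2))
    then show "(?h has_vector_derivative (g (Suc 0) s - (\<Sum>n<K. (s ^ n / fact n) *\<^sub>R g (Suc n) 0))) (at s)"
      by (simp add: sum.lessThan_Suc_shift del: sum.lessThan_Suc fact_Suc)
    show "norm (g (Suc 0) s - (\<Sum>n<K. (s ^ n / fact n) *\<^sub>R g (Suc n) 0)) \<le> B" using IH s Suc(5) by simp
  qed (use Suc in simp)
  also have "\<dots> \<le> B" using B Suc(4,5) by (simp add: mult_left_le)
  finally show ?case by (simp add: sum.lessThan_Suc_shift del: sum.lessThan_Suc)
qed

definition dyad :: "real \<Rightarrow> real \<Rightarrow> real" where
  "dyad \<kappa> x = (if x \<le> 1 then x powr \<kappa> else x powr - \<kappa>)"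

text \<open>A potential \<open>F\<close> with values between 0 and \<open>E\<close> and with
  \<open>dyad \<kappa> x + F (2 * x) \<le> F x\<close> bounds all partial sums over
  \<open>x\<close>, \<open>2 * x\<close>, \<open>4 * x\<close> and so on.\<close>

lemma dyad_sum_bounded:
  assumes \<kappa>: "0 < \<kappa>"
  shows "\<exists>E. \<forall>x>0. \<forall>n. (\<Sum>j<n. dyad \<kappa> (2 ^ j * x)) \<le> E"
proof -
  define \<rho> where "\<rho> = (2::real) powr \<kappa>"
  have \<rho>: "1 < \<rho>" unfolding \<rho>_def using \<kappa> by simp
  define c where "c = 1 / (\<rho> - 1)"
  define a where "a = 1 / (1 - 1 / \<rho>)"
  define E where "E = c + 1 + a"
  have c: "0 \<le> c" "c * \<rho> = c + 1" and a: "0 \<le> a" "a = 1 + a / \<rho>"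
    unfolding c_def a_def using \<rho> by (auto simp: field_simps)
  \<comment> \<open>To the right of 1, \<open>F\<close> is the geometric sum of all terms still to
    come, with ratio \<open>1 / \<rho>\<close> and total weight \<open>a\<close>. To the left, it is
    \<open>E\<close> minus \<open>c * x powr \<kappa>\<close>, the sum of the terms at
    \<open>x / 2\<close>, \<open>x / 4\<close> and so on. The summand 1 in \<open>E\<close> pays for
    the step across 1.\<close>
  define F where "F x = (if x \<le> 1 then E - c * x powr \<kappa> else a * x powr - \<kappa>)" for x
  have p2: "(2 * x) powr \<kappa> = \<rho> * x powr \<kappa>" "(2 * x) powr - \<kappa> = x powr - \<kappa> / \<rho>" if "0 < x" for x
    using that by (simp_all add: powr_mult \<rho>_def powr_minus_divide)
  have step: "dyad \<kappa> x + F (2 * x) \<le> F x" if x: "0 < x" for x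
  proof -
    consider "2 * x \<le> 1" | "x \<le> 1" "1 < 2 * x" | "1 < x" using x by linarith
    then show ?thesis
    proof cases
      case 1
      have "c * (\<rho> * x powr \<kappa>) = (c + 1) * x powr \<kappa>" using c(2) by (simp flip: mult.assoc)
      then have "c * (2 * x) powr \<kappa> = c * x powr \<kappa> + x powr \<kappa>" unfolding p2(1)[OF x] by (simp add: distrib_right)
      then show ?thesis using 1 x by (simp add: dyad_def F_def)
    next
      case 2
      have xk: "x powr \<kappa> \<le> 1" using 2 x \<kappa> by (simp add: powr_le_one_le powr_le1)
      have "(2 * x) powr - \<kappa> \<le> 1" using 2 x \<kappa> powr_mono2'[of "-\<kappa>" 1 "2 * x"] by simp
      then have "a * (2 * x) powr - \<kappa> \<le> a" using a by (simp add: mult_left_le)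
      moreover have "c * x powr \<kappa> \<le> c" using xk c by (simp add: mult_left_le)
      ultimately show ?thesis using 2 x xk by (simp add: dyad_def F_def E_def)
    next
      case 3
      have "x powr - \<kappa> + a * (x powr - \<kappa> / \<rho>) = (1 + a / \<rho>) * x powr - \<kappa>" by (simp add: algebra_simps)
      also have "\<dots> = a * x powr - \<kappa>" using a(2) by simp
      finally show ?thesis using 3 x by (simp add: dyad_def F_def p2)
    qed
  qed
  have F0: "0 \<le> F x" if "0 < x" for x
  proof (cases "x \<le> 1")
    case True
    have "x powr \<kappa> \<le> 1" using True that \<kappa> by (simp add: powr_le1)
    then have "c * x powr \<kappa> \<le> c" using c by (simp add: mult_left_le)
    then show ?thesis using True a by (simp add: F_def E_def)
  qed (use a in \<open>simp add: F_def\<close>)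
  have FE: "F x \<le> E" if "0 < x" for x
  proof (cases "x \<le> 1")
    case False
    have "x powr - \<kappa> \<le> 1" using False \<kappa> powr_mono2'[of "-\<kappa>" 1 x] by simp
    then have "a * x powr - \<kappa> \<le> a" using a by (simp add: mult_left_le)
    then show ?thesis using False c by (simp add: F_def E_def)
  qed (use c in \<open>simp add: F_def\<close>)
  have "(\<Sum>j<n. dyad \<kappa> (2 ^ j * x)) \<le> F x" if "0 < x" for x n
    using that
  proof (induct n arbitrary: x)
    case 0 then show ?case using F0 by simp
  next
    case (Suc n)
    have "(\<Sum>j<Suc n. dyad \<kappa> (2 ^ j * x)) = dyad \<kappa> x + (\<Sum>j<n. dyad \<kappa> (2 ^ j * (2 * x)))"
      by (simp add: sum.lessThan_Suc_shift mult_ac del: sum.lessThan_Suc)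
    also have "\<dots> \<le> dyad \<kappa> x + F (2 * x)" using Suc(1)[of "2 * x"] Suc(2) by simp
    also have "\<dots> \<le> F x" by (rule step[OF Suc(2)])
    finally show ?case .
  qed
  then show ?thesis using FE order_trans by blast
qed

lemma mi_abs_upd: "mi_abs (\<gamma>(i := Suc (\<gamma> i))) = Suc (mi_abs \<gamma>)"
proof -
  have "(\<Sum>k\<in>UNIV - {i}. (\<gamma>(i := Suc (\<gamma> i))) k) = (\<Sum>k\<in>UNIV - {i}. \<gamma> k)"
    by (rule sum.cong) auto
  then show ?thesis unfolding mi_abs_def sum.remove[OF finite UNIV_I, of _ i] by simp
qed

lemma finite_mi_abs_less: "finite {\<gamma>::'n::finite \<Rightarrow> nat. int (mi_abs \<gamma>) < D}"
proof (rule finite_subset)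
  show "{\<gamma>::'n \<Rightarrow> nat. int (mi_abs \<gamma>) < D} \<subseteq> UNIV \<rightarrow>\<^sub>E {..nat D}"
  proof
    fix \<gamma> :: "'n \<Rightarrow> nat" assume "\<gamma> \<in> {\<gamma>. int (mi_abs \<gamma>) < D}"
    then have "mi_abs \<gamma> \<le> nat D" by simp
    moreover have "\<gamma> i \<le> mi_abs \<gamma>" for i unfolding mi_abs_def by (rule member_le_sum) auto
    ultimately show "\<gamma> \<in> UNIV \<rightarrow>\<^sub>E {..nat D}" by (auto intro: order_trans)
  qed
  show "finite (UNIV \<rightarrow>\<^sub>E {..nat D} :: ('n \<Rightarrow> nat) set)" by (rule finite_PiE) auto
qed

section \<open>Jets and Taylor polynomials in the \<open>q\<close>-directions\<close>

locale split_n = split_space p J for p :: "'a::euclidean_space \<Rightarrow> real^'n" and J :: "real^'n \<Rightarrow> 'a"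
begin

text \<open>The \<open>n\<close>-th power of the derivative along \<open>q\<close>, expanded in
  coordinates and applied to the entry \<open>is\<close> of a jet.\<close>

fun ct :: "real^'n \<Rightarrow> ('n list \<Rightarrow> 'a \<Rightarrow> complex) \<Rightarrow> nat \<Rightarrow> 'n list \<Rightarrow> 'a \<Rightarrow> complex" where
  "ct q Y 0 is z = Y is z"
| "ct q Y (Suc n) is z = (\<Sum>i\<in>UNIV. of_real (q $ i) * ct q Y n (i # is) z)"

text \<open>A function bundled with its iterated \<open>q\<close>-derivatives, indexed by lists.
  This is the differentiability that convolutions of continuous functions have, and it suffices for
  Taylor expansion and integration by parts.\<close>

definition qjet :: "('n list \<Rightarrow> 'a \<Rightarrow> complex) \<Rightarrow> bool" where
  "qjet Y \<longleftrightarrow> (\<forall>is. continuous_on UNIV (Y is)) \<and>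
     (\<forall>is v. hdd (J v) (Y is) (\<lambda>z. \<Sum>i\<in>UNIV. of_real (v $ i) * Y (i # is) z))"

lemma ct_hdd: "qjet Y \<Longrightarrow> hdd (J q) (ct q Y n is) (ct q Y (Suc n) is)"
proof (induct n arbitrary: "is")
  case 0
  have 1: "ct q Y 0 is = Y is" and 2: "ct q Y (Suc 0) is = (\<lambda>z. \<Sum>i\<in>UNIV. of_real (q $ i) * Y (i # is) z)" by auto
  show ?case unfolding 1 2 using 0 unfolding qjet_def by blast
next
  case (Suc n)
  have 1: "ct q Y (Suc n) is = (\<lambda>z. \<Sum>i\<in>UNIV. of_real (q $ i) * ct q Y n (i # is) z)"
    and 2: "ct q Y (Suc (Suc n)) is = (\<lambda>z. \<Sum>i\<in>UNIV. of_real (q $ i) * ct q Y (Suc n) (i # is) z)" by auto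
  show ?case unfolding 1 2 by (intro hdd_sum hdd_cmult Suc)
qed

lemma ct_bound:
  assumes "\<And>is'. length is' = n + length is \<Longrightarrow> norm (Y is' z) \<le> B"
  shows "norm (ct q Y n is z) \<le> (real CARD('n) * norm q) ^ n * B"
  using assms
proof (induct n arbitrary: "is")
  case 0 then show ?case by simp
next
  case (Suc n)
  have IH: "norm (ct q Y n (i # is) z) \<le> (real CARD('n) * norm q) ^ n * B" for i
    by (rule Suc(1)) (simp add: Suc(2))
  have "norm (ct q Y (Suc n) is z) \<le> (\<Sum>i\<in>(UNIV::'n set). norm q * ((real CARD('n) * norm q) ^ n * B))"
    unfolding ct.simps
  proof (rule sum_norm_le)
    fix i :: 'n
    show "norm (of_real (q $ i) * ct q Y n (i # is) z) \<le> norm q * ((real CARD('n) * norm q) ^ n * B)"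
      unfolding norm_mult using component_le_norm_cart[of q i] by (intro mult_mono IH) auto
  qed
  also have "\<dots> = (real CARD('n) * norm q) ^ Suc n * B" by simp
  finally show ?case .
qed

lemma ct_sums:
  assumes "\<And>is'. length is' = n + length is \<Longrightarrow> (\<lambda>j. X j is' z) sums C is' z"
  shows "(\<lambda>j. ct q (X j) n is z) sums ct q C n is z"
  using assms
proof (induct n arbitrary: "is")
  case 0 then show ?case by simp
next
  case (Suc n)
  show ?case unfolding ct.simps
    by (intro sums_sum sums_mult Suc(1)) (simp add: Suc(2))
qed

lemma ct_continuous:
  assumes "\<And>is. continuous_on UNIV (Y is)"
  shows "continuous_on UNIV (\<lambda>z. ct (p z) Y n is (proj z))"
proof (induct n arbitrary: "is")
  case 0
  show ?case using continuous_on_compose2[OF assms continuous_proj[OF continuous_on_id]] by simp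
next
  case (Suc n)
  show ?case unfolding ct.simps
    by (intro continuous_on_sum continuous_on_mult continuous_on_of_real continuous_on_component continuous_p continuous_on_id Suc)
qed

text \<open>One-dimensional Taylor expansion on the segment from \<open>proj z\<close>, where the
  \<open>q\<close>-variable is 0, to \<open>z\<close>.\<close>

lemma taylor_jet:
  assumes Y: "qjet Y" and B: "\<And>t. 0 \<le> t \<Longrightarrow> t \<le> 1 \<Longrightarrow> norm (ct (p z) Y K [] (proj z + t *\<^sub>R J (p z))) \<le> B"
  shows "norm (Y [] z - (\<Sum>n<K. (1 / fact n) *\<^sub>R ct (p z) Y n [] (proj z))) \<le> B"
proof -
  have "norm ((\<lambda>n t. ct (p z) Y n [] (proj z + t *\<^sub>R J (p z))) 0 1 - (\<Sum>n<K. (1 ^ n / fact n) *\<^sub>R (\<lambda>n t. ct (p z) Y n [] (proj z + t *\<^sub>R J (p z))) n 0)) \<le> B"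
    by (rule taylor_remainder_bound) (use hddD[OF ct_hdd[OF Y]] B in auto)
  then show ?thesis by (simp add: proj_plus)
qed

lemma norm_proj_le: "norm (proj z) \<le> norm z"
proof -
  have "proj z \<bullet> proj z + J (p z) \<bullet> J (p z) = z \<bullet> z - 2 * (J (p z) \<bullet> proj z)"
    by (simp add: proj_def inner_diff_left inner_diff_right inner_commute)
  also have "J (p z) \<bullet> proj z = 0" by (simp add: adj)
  finally have "proj z \<bullet> proj z \<le> z \<bullet> z" using inner_ge_zero[of "J (p z)"] by linarith
  then show ?thesis by (simp add: norm_le)
qed

lemma proj_proj [simp]: "proj (proj z) = proj z" by (simp add: proj_def p_simps J_simps pJ)

lemma segment_cyl: "z \<in> cyl r \<Longrightarrow> 0 \<le> t \<Longrightarrow> t \<le> 1 \<Longrightarrow> proj z + t *\<^sub>R J (p z) \<in> cyl r"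
  unfolding cyl_def using mult_left_le_one_le[of "norm (p z)" t] by (simp add: p_simps pJ)

lemma proj_cyl: "z \<in> cyl r \<Longrightarrow> proj z \<in> cyl r"
  using segment_cyl[of z r 0] by simp

text \<open>The Littlewood--Paley summation: after subtracting Taylor polynomials in the \<open>q\<close>-variables,
  the \<open>j\<close>-th piece is \<open>|q|\<close> to the power \<open>A\<close> times a quantity decaying in \<open>|log (2 ^ j |q|)|\<close>, so the
  noninteger order \<open>A\<close> makes the remainders summable to \<open>O(|q| powr A)\<close>.\<close>
lemma taylor_summation:
  fixes X :: "nat \<Rightarrow> 'n list \<Rightarrow> 'a \<Rightarrow> complex"
  assumes r: "0 < r" and jet: "\<And>j. qjet (X j)"
    and A: "A = real K - \<epsilon>" "0 < \<epsilon>" "\<epsilon> < 1" and b: "0 \<le> b" "b \<le> A - 1"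
    and bound: "\<And>is. length is \<le> K \<Longrightarrow> \<exists>C. 0 \<le> C \<and> (\<forall>j. \<forall>z\<in>cyl r.
        norm (X j is z) \<le> C * (2 powr (real j * (real (length is) - A)) * (1 + (2 ^ j * norm (p z)) powr b)))"
  shows "\<exists>R Y. continuous_on (cyl (r / 2)) R \<and> (\<exists>C. \<forall>z\<in>cyl (r / 2). norm (R z) \<le> C * norm (p z) powr A) \<and>
     (\<forall>is. continuous_on UNIV (Y is)) \<and> (\<exists>M. summable M \<and> (\<forall>j. \<forall>z\<in>cyl (r / 2). norm (X j [] z) \<le> M j)) \<and>
     (\<forall>z\<in>cyl (r / 2). (\<lambda>j. X j [] z) sums (R z + (\<Sum>n<K. (1 / fact n) *\<^sub>R ct (p z) Y n [] (proj z))))"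
proof -
  define N where "N = real CARD('n)"
  have N: "1 \<le> N" unfolding N_def using zero_less_card_finite[where 'a='n] by linarith
  obtain C where C: "\<And>is. length is \<le> K \<Longrightarrow> 0 \<le> C is" "\<And>is j z. length is \<le> K \<Longrightarrow> z \<in> cyl r \<Longrightarrow>
        norm (X j is z) \<le> C is * (2 powr (real j * (real (length is) - A)) * (1 + (2 ^ j * norm (p z)) powr b))"
    using bound by metis
  define C0 where "C0 = (\<Sum>is\<in>{is. length is \<le> K}. \<bar>C is\<bar>)"
  have finL: "finite {is::'n list. length is \<le> K}" using finite_lists_length_le[OF finite[of "UNIV :: 'n set"], of K] by simp
  have C0: "0 \<le> C0" unfolding C0_def by (simp add: sum_nonneg)
  have XC: "norm (X j is z) \<le> C0 * (2 powr (real j * (real (length is) - A)) * (1 + (2 ^ j * norm (p z)) powr b))"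
    if "length is \<le> K" "z \<in> cyl r" for j "is" z
  proof -
    have "C is \<le> \<bar>C is\<bar>" by simp
    also have "\<dots> \<le> C0" unfolding C0_def by (rule member_le_sum[OF _ _ finL]) (use that in auto)
    finally show ?thesis by (intro order_trans[OF C(2)[OF that]] mult_right_mono) auto
  qed
  have K1: "1 \<le> K" using A b by linarith
  have XP: "norm (X j is (proj z)) \<le> C0 * 2 powr (real j * (real (length is) - A))" if "length is \<le> K" "proj z \<in> cyl r" for j "is" z
    using XC[OF that, of j] by simp
  \<comment> \<open>The retraction onto a ball makes the coefficients \<open>Y\<close> continuous on
    the whole space, although the series defining them is controlled only near the origin.\<close>
  define cp where "cp = closest_point (cball (0::'a) (r / 2))"
  have cpc: "continuous_on UNIV cp" unfolding cp_def
    by (rule continuous_on_closest_point) (use r in auto)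
  have cpn: "norm (cp z) \<le> r / 2" for z
    using closest_point_in_set[of "cball (0::'a) (r / 2)" z] r unfolding cp_def by auto
  have cpin: "proj (cp z) \<in> cyl r" for z
    unfolding cyl_def using norm_proj_le[of "cp z"] cpn[of z] r by simp
  have cpid: "cp z = z" if "norm z \<le> r / 2" for z
    unfolding cp_def using that by (intro closest_point_self) simp
  \<comment> \<open>At \<open>q = 0\<close> the entries of order \<open>n\<close> have size
    \<open>2 powr (j * (n - A))\<close>, which is summable for \<open>n < K\<close> because
    \<open>A > K - 1\<close>. Entries of higher order never occur in the polynomial and get the
    default 0.\<close>
  define Y where "Y is z = (if length is < K then \<Sum>j. X j is (proj (cp z)) else 0)" for "is" z
  have geo: "summable (\<lambda>j. C0 * 2 powr (real j * (real n - A)))" if "n < K" for n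
  proof -
    have "real n - A < 0" using A that by (simp add: of_nat_diff)
    then have "2 powr (real n - A) < (1::real)" using powr_less_mono[of "real n - A" 0 "2::real"] by simp
    then have "summable (\<lambda>j. (2 powr (real n - A)) ^ j)" by (intro summable_geometric) simp
    moreover have "(2 powr (real n - A)) ^ j = 2 powr (real j * (real n - A))" for j
      by (simp add: powr_realpow[symmetric] powr_powr mult.commute)
    ultimately show ?thesis by (intro summable_mult) simp
  qed
  have Yc: "continuous_on UNIV (Y is)" for "is"
  proof (cases "length is < K")
    case True
    have Xc: "continuous_on UNIV (X j is)" for j using jet[of j] by (simp add: qjet_def)
    have "uniform_limit UNIV (\<lambda>n z. \<Sum>j<n. X j is (proj (cp z))) (\<lambda>z. \<Sum>j. X j is (proj (cp z))) sequentially"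
      by (rule Weierstrass_m_test[OF XP geo[OF True]]) (use True cpin in auto)
    moreover have "continuous_on UNIV (\<lambda>z. \<Sum>j<n. X j is (proj (cp z)))" for n
      by (intro continuous_on_sum continuous_on_compose2[OF Xc] continuous_proj cpc) auto
    ultimately have "continuous_on UNIV (\<lambda>z. \<Sum>j. X j is (proj (cp z)))"
      by (intro uniform_limit_theorem[where F=sequentially]) auto
    then show ?thesis using True by (simp add: Y_def[abs_def])
  qed (simp add: Y_def[abs_def])
  have Ysums: "(\<lambda>j. X j is (proj z)) sums Y is (proj z)" if "length is < K" "z \<in> cyl (r / 2)" for "is" z
  proof -
    have "norm (proj z) \<le> r / 2" using that unfolding cyl_def by simp
    then have e: "proj (cp (proj z)) = proj z" by (simp add: cpid)
    have in_cyl: "proj z \<in> cyl r" using cpin[of "proj z"] by (simp only: e)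
    have "summable (\<lambda>j. X j is (proj z))"
      by (rule summable_comparison_test[OF _ geo[OF that(1)]]) (use XP[of "is" z] in_cyl that in auto)
    then show ?thesis using that(1) by (simp add: Y_def e summable_sums)
  qed
  define M where "M j = C0 * (1 + r powr b) * (1 / 2) ^ j" for j :: nat
  have Msum: "summable M" unfolding M_def[abs_def] by (intro summable_mult summable_geometric) simp
  \<comment> \<open>Without subtracting anything, the pieces decay like
    \<open>2 powr (j * (b - A))\<close>, and \<open>b \<le> A - 1\<close> makes this at most
    \<open>(1 / 2) ^ j\<close>.\<close>
  have XM: "norm (X j [] z) \<le> M j" if "z \<in> cyl r" for j z
  proof -
    have "norm (X j [] z) \<le> C0 * (2 powr (real j * (0 - A)) * (1 + (2 ^ j * norm (p z)) powr b))"
      using XC[of "[]" z j] that by simp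
    also have "\<dots> \<le> C0 * (2 powr (real j * (0 - A)) * ((1 + r powr b) * 2 powr (real j * b)))"
    proof (intro mult_left_mono C0)
      have "(2 ^ j * norm (p z)) powr b \<le> (2 ^ j * r) powr b"
        using that b unfolding cyl_def by (intro powr_mono2) auto
      also have "\<dots> = r powr b * 2 powr (real j * b)"
        using r by (simp add: powr_mult powr_realpow[symmetric] powr_powr)
      finally show "1 + (2 ^ j * norm (p z)) powr b \<le> (1 + r powr b) * 2 powr (real j * b)"
        using b ge_one_powr_ge_zero[of 2 "real j * b"] by (simp add: distrib_right)
    qed simp
    also have "\<dots> = C0 * (1 + r powr b) * 2 powr (real j * (b - A))"
      by (simp add: powr_add[symmetric] algebra_simps)
    also have "\<dots> \<le> C0 * (1 + r powr b) * 2 powr (real j * (- 1))"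
      using b C0 by (intro mult_left_mono powr_mono mult_nonneg_nonneg) auto
    also have "\<dots> = C0 * (1 + r powr b) * (1 / 2) ^ j"
    proof -
      have "2 powr (real j * (- 1)) = 1 / (2::real) ^ j"
        by (simp only: mult_minus_right mult_1_right powr_minus_divide powr_realpow zero_less_numeral)
      then show ?thesis by (simp only: power_one_over)
    qed
    finally show ?thesis by (simp add: M_def)
  qed
  define P where "P z = (\<Sum>n<K. (1 / fact n) *\<^sub>R ct (p z) Y n [] (proj z))" for z
  define T where "T j z = (\<Sum>n<K. (1 / fact n) *\<^sub>R ct (p z) (X j) n [] (proj z))" for j z
  define R where "R z = (\<Sum>j. X j [] z) - P z" for z
  have half: "z \<in> cyl r" if "z \<in> cyl (r / 2)" for z using that r unfolding cyl_def by auto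
  have Xsums: "(\<lambda>j. X j [] z) sums (\<Sum>j. X j [] z)" if "z \<in> cyl (r / 2)" for z
    by (rule summable_sums, rule summable_comparison_test[OF _ Msum]) (use XM half[OF that] in auto)
  have Tsums: "(\<lambda>j. T j z) sums P z" if z: "z \<in> cyl (r / 2)" for z
    unfolding T_def P_def
  proof (intro sums_sum sums_scaleR_right)
    fix n assume "n \<in> {..<K}"
    then show "(\<lambda>j. ct (p z) (X j) n [] (proj z)) sums ct (p z) Y n [] (proj z)"
      by (intro ct_sums Ysums z) auto
  qed
  \<comment> \<open>The distance of \<open>A = K - \<epsilon>\<close> to the nearest integer: a
    margin that is available in both ranges below.\<close>
  define \<kappa> where "\<kappa> = min \<epsilon> (1 - \<epsilon>)"
  have \<kappa>: "0 < \<kappa>" "\<kappa> \<le> \<epsilon>" "\<kappa> \<le> 1 - \<epsilon>" using A unfolding \<kappa>_def by auto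
  define D where "D = 2 * C0 * N ^ K + real K * (C0 * N ^ K)"
  have D: "0 \<le> D" unfolding D_def using C0 N by simp
  have key: "norm (X j [] z - T j z) \<le> D * (norm (p z) powr A * dyad \<kappa> (2 ^ j * norm (p z)))"
    if z: "z \<in> cyl r" and q: "0 < norm (p z)" for j z
  proof -
    define y where "y = norm (p z)"
    define x where "x = 2 ^ j * y"
    have y: "0 < y" and x: "0 < x" using q by (auto simp: y_def x_def)
    \<comment> \<open>Homogeneity: in the variable \<open>x = 2 ^ j * y\<close> every bound becomes
      \<open>y powr A\<close> times a power of \<open>x\<close> alone.\<close>
    have scale: "y ^ n * 2 powr (real j * (real n - A)) = y powr A * x powr (real n - A)" for n
      using y by (simp add: x_def powr_mult powr_realpow[symmetric] powr_powr powr_add[symmetric] mult.assoc mult.left_commute)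
    have NK: "N ^ n \<le> N ^ K" if "n \<le> K" for n using N that by (rule power_increasing[rotated])
    \<comment> \<open>For \<open>x \<le> 1\<close> the Taylor remainder of order \<open>K\<close>
      gains \<open>x powr \<epsilon>\<close>. For \<open>x > 1\<close> nothing needs to cancel: the
      piece itself is \<open>O(x powr (b - A))\<close>, and the Taylor terms are
      \<open>O(x powr (n - A))\<close> with \<open>n \<le> K - 1\<close>, hence at most of size
      \<open>x powr (\<epsilon> - 1)\<close>.\<close>
    show ?thesis
    proof (cases "x \<le> 1")
      case True
      have "norm (X j [] z - T j z) \<le> 2 * C0 * N ^ K * (y powr A * x powr (real K - A))"
        unfolding T_def
      proof (rule taylor_jet[OF jet])
        fix t :: real assume t: "0 \<le> t" "t \<le> 1"
        let ?w = "proj z + t *\<^sub>R J (p z)"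
        have pw: "norm (p ?w) = t * y" using t by (simp add: p_simps pJ y_def)
        have "(2 ^ j * norm (p ?w)) powr b \<le> 1"
        proof -
          have "2 ^ j * norm (p ?w) = t * x" unfolding pw x_def by simp
          moreover have "t * x \<le> 1" using t True x mult_le_one[of t x] by simp
          ultimately show ?thesis using t x b by (simp add: powr_le1)
        qed
        then have "norm (X j is' ?w) \<le> C0 * (2 powr (real j * (real K - A)) * 2)" if "length is' = K + length []" for is'
          using XC[of is' ?w j] that segment_cyl[OF z t] C0
          by (intro order_trans[OF XC[of is' ?w j]] mult_left_mono) (auto)
        then have "norm (ct (p z) (X j) K [] ?w) \<le> (N * norm (p z)) ^ K * (C0 * (2 powr (real j * (real K - A)) * 2))"
          unfolding N_def by (rule ct_bound)
        also have "\<dots> = 2 * C0 * N ^ K * (y ^ K * 2 powr (real j * (real K - A)))" by (simp add: power_mult_distrib y_def)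
        finally show "norm (ct (p z) (X j) K [] ?w) \<le> 2 * C0 * N ^ K * (y powr A * x powr (real K - A))" unfolding scale .
      qed
      also have "\<dots> \<le> 2 * C0 * N ^ K * (y powr A * x powr \<kappa>)"
        using True x \<kappa> A C0 N by (intro mult_left_mono powr_mono') auto
      also have "\<dots> \<le> D * (y powr A * x powr \<kappa>)" unfolding D_def using C0 N by (intro mult_right_mono) auto
      finally show ?thesis using True by (simp add: dyad_def x_def y_def)
    next
      case False
      then have x1: "1 < x" by simp
      have 1: "norm (X j [] z) \<le> 2 * C0 * N ^ K * (y powr A * x powr - \<kappa>)"
      proof -
        have "norm (X j [] z) \<le> C0 * (2 powr (real j * (real 0 - A)) * (1 + x powr b))"
          using XC[of "[]" z j] z by (simp add: x_def y_def)
        also have "\<dots> \<le> C0 * (2 powr (real j * (real 0 - A)) * (2 * x powr b))"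
          using ge_one_powr_ge_zero[of x b] x1 b C0 by (intro mult_left_mono) auto
        also have "\<dots> = 2 * C0 * (y ^ 0 * 2 powr (real j * (real 0 - A))) * x powr b" by simp
        also have "\<dots> = 2 * C0 * (y powr A * x powr (b - A))" unfolding scale by (simp add: powr_add[symmetric] mult.assoc)
        also have "\<dots> \<le> 2 * C0 * (y powr A * x powr - \<kappa>)"
          using x1 b \<kappa> A C0 by (intro mult_left_mono powr_mono) auto
        also have "\<dots> \<le> 2 * C0 * N ^ K * (y powr A * x powr - \<kappa>)"
        proof -
          have "2 * C0 * 1 \<le> 2 * C0 * N ^ K" using C0 N one_le_power[OF N, of K] by (intro mult_left_mono) auto
          then show ?thesis by (intro mult_right_mono) auto
        qed
        finally show ?thesis .
      qed
      have 2: "norm ((1 / fact n) *\<^sub>R ct (p z) (X j) n [] (proj z)) \<le> C0 * N ^ K * (y powr A * x powr - \<kappa>)" if n: "n < K" for n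
      proof -
        have "norm ((1 / fact n) *\<^sub>R ct (p z) (X j) n [] (proj z)) \<le> 1 * norm (ct (p z) (X j) n [] (proj z))"
          unfolding norm_scaleR by (intro mult_right_mono) (auto simp: divide_le_eq fact_ge_1)
        also have "norm (ct (p z) (X j) n [] (proj z)) \<le> (N * norm (p z)) ^ n * (C0 * 2 powr (real j * (real n - A)))"
          unfolding N_def by (rule ct_bound) (use XP[OF _ proj_cyl[OF z]] n in auto)
        also have "\<dots> = C0 * N ^ n * (y ^ n * 2 powr (real j * (real n - A)))" by (simp add: power_mult_distrib y_def)
        also have "\<dots> = C0 * N ^ n * (y powr A * x powr (real n - A))" unfolding scale ..
        also have "\<dots> \<le> C0 * N ^ K * (y powr A * x powr - \<kappa>)"
        proof (rule mult_mono)
          have "real n \<le> real K - 1" using n by linarith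
          then have "x powr (real n - A) \<le> x powr - \<kappa>" using A \<kappa> x1 by (intro powr_mono) auto
          then show "y powr A * x powr (real n - A) \<le> y powr A * x powr - \<kappa>" by (intro mult_left_mono) auto
          show "C0 * N ^ n \<le> C0 * N ^ K" by (intro mult_left_mono NK C0) (use n in simp)
        qed (use C0 N in auto)
        finally show ?thesis by simp
      qed
      have "norm (T j z) \<le> (\<Sum>n<K. C0 * N ^ K * (y powr A * x powr - \<kappa>))"
        unfolding T_def by (rule sum_norm_le) (use 2 in auto)
      then have "norm (X j [] z - T j z) \<le> 2 * C0 * N ^ K * (y powr A * x powr - \<kappa>) + real K * (C0 * N ^ K * (y powr A * x powr - \<kappa>))"
        using norm_triangle_ineq4[of "X j [] z" "T j z"] 1 by simp
      also have "\<dots> = D * (y powr A * x powr - \<kappa>)" unfolding D_def by (simp add: algebra_simps)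
      finally show ?thesis using False by (simp add: dyad_def x_def y_def)
    qed
  qed
  obtain E where E: "\<And>x n. 0 < x \<Longrightarrow> (\<Sum>j<n. dyad \<kappa> (2 ^ j * x)) \<le> E" using dyad_sum_bounded[OF \<kappa>(1)] by blast
  have RB: "norm (R z) \<le> (D * E) * norm (p z) powr A" if z: "z \<in> cyl (r / 2)" for z
  proof -
    have s: "(\<lambda>j. X j [] z - T j z) sums R z" unfolding R_def by (rule sums_diff[OF Xsums[OF z] Tsums[OF z]])
    have "norm (\<Sum>j<n. X j [] z - T j z) \<le> (D * E) * norm (p z) powr A" for n
    proof (cases "p z = 0")
      \<comment> \<open>Here the claimed bound \<open>0 powr A\<close> is 0, so every difference has
        to vanish exactly: a contraction with \<open>q = 0\<close> of order \<open>K \<ge> 1\<close>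
        is zero.\<close>
      case True
      have "norm (X j [] z - T j z) \<le> 0" for j
        unfolding T_def
      proof (rule taylor_jet[OF jet])
        fix t :: real
        have "ct (p z) (X j) K [] (proj z + t *\<^sub>R J (p z)) = 0" using K1 True by (cases K) auto
        then show "norm (ct (p z) (X j) K [] (proj z + t *\<^sub>R J (p z))) \<le> 0" by simp
      qed
      then show ?thesis using True by simp
    next
      case False
      have "norm (\<Sum>j<n. X j [] z - T j z) \<le> (\<Sum>j<n. D * (norm (p z) powr A * dyad \<kappa> (2 ^ j * norm (p z))))"
        by (rule sum_norm_le) (use key half[OF z] False in auto)
      also have "\<dots> = D * norm (p z) powr A * (\<Sum>j<n. dyad \<kappa> (2 ^ j * norm (p z)))" by (simp add: sum_distrib_left mult.assoc)
      also have "\<dots> \<le> D * norm (p z) powr A * E" using False D by (intro mult_left_mono E) auto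
      finally show ?thesis by (simp add: mult_ac)
    qed
    then show ?thesis using tendsto_norm[OF s[unfolded sums_def]] by (intro LIMSEQ_le_const2) auto
  qed
  have "continuous_on (cyl (r / 2)) (\<lambda>z. \<Sum>j. X j [] z)"
  proof -
    have "uniform_limit (cyl (r / 2)) (\<lambda>n z. \<Sum>j<n. X j [] z) (\<lambda>z. \<Sum>j. X j [] z) sequentially"
      by (rule Weierstrass_m_test[OF _ Msum]) (use XM half in auto)
    moreover have "continuous_on (cyl (r / 2)) (\<lambda>z. \<Sum>j<n. X j [] z)" for n
      by (intro continuous_on_sum) (use jet in \<open>auto simp: qjet_def intro: continuous_on_subset\<close>)
    ultimately show ?thesis by (intro uniform_limit_theorem[where F=sequentially]) auto
  qed
  moreover have "continuous_on UNIV P" unfolding P_def[abs_def]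
    by (intro continuous_on_sum continuous_on_scaleR continuous_on_const ct_continuous Yc)
  ultimately have "continuous_on (cyl (r / 2)) R" unfolding R_def[abs_def]
    by (intro continuous_on_diff) (auto intro: continuous_on_subset)
  moreover have "(\<lambda>j. X j [] z) sums (R z + P z)" if "z \<in> cyl (r / 2)" for z
    using Xsums[OF that] by (simp add: R_def)
  ultimately show ?thesis using RB Yc Msum XM half unfolding P_def by blast
qed

section \<open>Polynomials in \<open>q\<close> with continuous coefficients\<close>

text \<open>\<open>D\<close> is a strict bound for the degree, so for \<open>D \<le> 0\<close> only
  the zero function remains, in accordance with an empty sum over \<open>|\<gamma>| < d\<close>. The
  coefficients see \<open>proj z\<close> only, hence are constant in \<open>q\<close>.\<close>

inductive polc :: "int \<Rightarrow> ('a \<Rightarrow> complex) \<Rightarrow> bool" where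
  polc_zero: "polc D (\<lambda>z. 0)"
| polc_monom: "int (mi_abs \<gamma>) < D \<Longrightarrow> continuous_on UNIV c \<Longrightarrow> polc D (\<lambda>z. c (proj z) * of_real (mi_mono \<gamma> (p z)))"
| polc_add: "polc D f \<Longrightarrow> polc D g \<Longrightarrow> polc D (\<lambda>z. f z + g z)"

lemma polc_cmult: "polc D f \<Longrightarrow> polc D (\<lambda>z. a * f z)"
proof (induct rule: polc.induct)
  case (polc_monom \<gamma> D c)
  have "polc D (\<lambda>z. (\<lambda>x. a * c x) (proj z) * of_real (mi_mono \<gamma> (p z)))"
    by (rule polc.polc_monom[OF polc_monom(1)]) (intro continuous_intros polc_monom)
  then show ?case by (simp add: mult.assoc)
qed (auto simp: distrib_left intro: polc.intros)

lemma polc_sum: "(\<And>i. i \<in> I \<Longrightarrow> polc D (f i)) \<Longrightarrow> polc D (\<lambda>z. \<Sum>i\<in>I. f i z)"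
  by (induct I rule: infinite_finite_induct) (auto intro: polc.intros)

lemma polc_mono: "polc D f \<Longrightarrow> D \<le> D' \<Longrightarrow> polc D' f"
  by (induct rule: polc.induct) (auto intro: polc.intros)

lemma polc_coord: "polc D f \<Longrightarrow> polc (D + 1) (\<lambda>z. of_real (p z $ i) * f z)"
proof (induct rule: polc.induct)
  case (polc_monom \<gamma> D c)
  have m: "mi_mono (\<gamma>(i := Suc (\<gamma> i))) q = q $ i * mi_mono \<gamma> q" for q :: "real^'n"
  proof -
    have "(\<Prod>k\<in>UNIV - {i}. q $ k ^ (\<gamma>(i := Suc (\<gamma> i))) k) = (\<Prod>k\<in>UNIV - {i}. q $ k ^ \<gamma> k)"
      by (rule prod.cong) auto
    then show ?thesis unfolding mi_mono_def prod.remove[OF finite UNIV_I, of _ i] by simp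
  qed
  have a: "mi_abs (\<gamma>(i := Suc (\<gamma> i))) = Suc (mi_abs \<gamma>)"
    by (rule mi_abs_upd)
  have "polc (D + 1) (\<lambda>z. c (proj z) * of_real (mi_mono (\<gamma>(i := Suc (\<gamma> i))) (p z)))"
  proof (rule polc.polc_monom)
    show "int (mi_abs (\<gamma>(i := Suc (\<gamma> i)))) < D + 1" unfolding a using polc_monom(1) by simp
  qed (rule polc_monom(2))
  then show ?case unfolding m by (simp add: mult_ac)
qed (auto simp: distrib_left intro: polc.intros)

lemma polc_ct:
  assumes "\<And>is. continuous_on UNIV (Y is)"
  shows "polc (int n + 1) (\<lambda>z. ct (p z) Y n is (proj z))"
proof (induct n arbitrary: "is")
  case 0
  have "polc 1 (\<lambda>z. Y is (proj z) * of_real (mi_mono (\<lambda>_. 0) (p z)))"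
    by (rule polc_monom) (use assms in \<open>auto simp: mi_abs_def\<close>)
  then show ?case by (simp add: mi_mono_def)
next
  case (Suc n)
  have "polc (int n + 1 + 1) (\<lambda>z. of_real (p z $ i) * ct (p z) Y n (i # is) (proj z))" for i
    by (rule polc_coord[OF Suc])
  then show ?case unfolding ct.simps by (intro polc_sum) (simp add: add_ac)
qed

lemma mi_mono_continuous: "continuous_on UNIV (mi_mono \<gamma>)"
  unfolding mi_mono_def[abs_def] by (intro continuous_intros)

lemma polc_continuous: "polc D f \<Longrightarrow> continuous_on UNIV f"
proof (induct rule: polc.induct)
  case (polc_monom \<gamma> D c)
  show ?case
    by (intro continuous_on_mult continuous_on_of_real continuous_on_compose2[OF polc_monom(2)] continuous_on_compose2[OF mi_mono_continuous]
        continuous_proj continuous_p continuous_on_id) auto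
qed (auto intro: continuous_intros)

lemma mi_mono_hdd:
  "hdd (J (axis i 1)) (\<lambda>z. complex_of_real (mi_mono \<gamma> (p z))) (\<lambda>z. of_nat (\<gamma> i) * of_real (mi_mono (\<gamma>(i := \<gamma> i - 1)) (p z)))"
  unfolding hdd_def
proof
  fix z
  define Q where "Q = (\<Prod>k\<in>UNIV - {i}. (p z $ k) ^ \<gamma> k)"
  have e: "mi_mono \<gamma> (p (z + t *\<^sub>R J (axis i 1))) = (p z $ i + t) ^ \<gamma> i * Q" for t
  proof -
    have "mi_mono \<gamma> (p (z + t *\<^sub>R J (axis i 1))) = (\<Prod>k\<in>UNIV. (p z $ k + t * axis i 1 $ k) ^ \<gamma> k)"
      unfolding mi_mono_def by (simp add: p_simps pJ)
    also have "\<dots> = (p z $ i + t) ^ \<gamma> i * (\<Prod>k\<in>UNIV - {i}. (p z $ k + t * axis i 1 $ k) ^ \<gamma> k)"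
      by (subst prod.remove[of UNIV i]) auto
    also have "(\<Prod>k\<in>UNIV - {i}. (p z $ k + t * axis i 1 $ k) ^ \<gamma> k) = Q"
      unfolding Q_def by (rule prod.cong) (auto simp: axis_def)
    finally show ?thesis .
  qed
  \<comment> \<open>For \<open>\<gamma> i = 0\<close> the truncated exponent
    \<open>\<gamma> i - 1\<close> is 0 instead of negative; the derivative carries the factor
    \<open>\<gamma> i\<close> and vanishes anyway.\<close>
  have e2: "mi_mono (\<gamma>(i := \<gamma> i - 1)) (p z) = (p z $ i) ^ (\<gamma> i - 1) * Q"
    unfolding mi_mono_def Q_def by (subst prod.remove[of UNIV i]) (auto intro!: prod.cong)
  have "((\<lambda>t. (p z $ i + t) ^ \<gamma> i * Q) has_real_derivative (real (\<gamma> i) * (p z $ i + 0) ^ (\<gamma> i - 1) * Q)) (at 0)"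
    by (auto intro!: derivative_eq_intros)
  from has_vector_derivative_of_real[OF this]
  show "((\<lambda>t. complex_of_real (mi_mono \<gamma> (p (z + t *\<^sub>R J (axis i 1))))) has_vector_derivative
      of_nat (\<gamma> i) * of_real (mi_mono (\<gamma>(i := \<gamma> i - 1)) (p z))) (at 0)"
    unfolding e e2 by (simp add: mult.assoc)
qed

text \<open>Each \<open>q\<close>-derivative lowers the degree bound by one, down to the zero
  polynomial. This is how the degree of the summed Taylor polynomials is brought below
  \<open>d\<close>.\<close>

lemma polc_hdd: "polc D f \<Longrightarrow> \<exists>g. polc (D - 1) g \<and> hdd (J (axis i 1)) f g"
proof (induct rule: polc.induct)
  case (polc_zero D) then show ?case using polc.polc_zero hdd_const by blast
next
  case (polc_add D f g)
  then show ?case using polc.polc_add hdd_add by blast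
next
  case (polc_monom \<gamma> D c)
  let ?g = "\<lambda>z. c (proj z) * (of_nat (\<gamma> i) * complex_of_real (mi_mono (\<gamma>(i := \<gamma> i - 1)) (p z)))"
  have "hdd (J (axis i 1)) (\<lambda>z. c (proj z)) (\<lambda>z. 0)" unfolding hdd_def by simp
  from hdd_mult[OF this mi_mono_hdd] have "hdd (J (axis i 1)) (\<lambda>z. c (proj z) * of_real (mi_mono \<gamma> (p z))) ?g" by simp
  moreover have "polc (D - 1) ?g"
  proof (cases "\<gamma> i = 0")
    case True then show ?thesis using polc.polc_zero by simp
  next
    case False
    have "mi_abs \<gamma> = Suc (mi_abs (\<gamma>(i := \<gamma> i - 1)))"
      using mi_abs_upd[of "\<gamma>(i := \<gamma> i - 1)" i] False by simp
    then have "int (mi_abs (\<gamma>(i := \<gamma> i - 1))) < D - 1" using polc_monom(1) by linarith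
    then have "polc (D - 1) (\<lambda>z. c (proj z) * of_real (mi_mono (\<gamma>(i := \<gamma> i - 1)) (p z)))"
      by (rule polc.polc_monom[OF _ polc_monom(2)])
    from polc_cmult[OF this, of "of_nat (\<gamma> i)"] show ?thesis by (simp add: mult_ac)
  qed
  ultimately show ?case by blast
qed

lemma polc_normal_form:
  "polc D f \<Longrightarrow> \<exists>c. (\<forall>\<gamma>. continuous_on UNIV (c \<gamma>)) \<and>
     f = (\<lambda>z. \<Sum>\<gamma>\<in>{\<gamma>. int (mi_abs \<gamma>) < D}. c \<gamma> (proj z) * complex_of_real (mi_mono \<gamma> (p z)))"
proof (induct rule: polc.induct)
  case (polc_zero D)
  show ?case by (rule exI[of _ "\<lambda>_ _. 0"]) simp
next
  case (polc_monom \<gamma> D c)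
  have "(\<Sum>\<gamma>'\<in>{\<gamma>. int (mi_abs \<gamma>) < D}. (if \<gamma>' = \<gamma> then c (proj z) else 0) * complex_of_real (mi_mono \<gamma>' (p z))) =
     (\<Sum>\<gamma>'\<in>{\<gamma>}. (if \<gamma>' = \<gamma> then c (proj z) else 0) * complex_of_real (mi_mono \<gamma>' (p z)))" for z
    by (rule sum.mono_neutral_right[OF finite_mi_abs_less]) (use polc_monom in auto)
  moreover have "continuous_on UNIV (\<lambda>x. if \<gamma>' = \<gamma> then c x else 0)" for \<gamma>'
    by (cases "\<gamma>' = \<gamma>") (use polc_monom in auto)
  ultimately show ?case
    by (intro exI[of _ "\<lambda>\<gamma>' x. if \<gamma>' = \<gamma> then c x else 0"]) auto
next
  case (polc_add D f g)
  then obtain c c' where c: "\<forall>\<gamma>. continuous_on UNIV (c \<gamma>)" "f = (\<lambda>z. \<Sum>\<gamma>\<in>{\<gamma>. int (mi_abs \<gamma>) < D}. c \<gamma> (proj z) * complex_of_real (mi_mono \<gamma> (p z)))"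
    "\<forall>\<gamma>. continuous_on UNIV (c' \<gamma>)" "g = (\<lambda>z. \<Sum>\<gamma>\<in>{\<gamma>. int (mi_abs \<gamma>) < D}. c' \<gamma> (proj z) * complex_of_real (mi_mono \<gamma> (p z)))" by blast
  show ?case
    by (rule exI[of _ "\<lambda>\<gamma> x. c \<gamma> x + c' \<gamma> x"]) (use c(1,3) in \<open>auto simp: c(2,4) sum.distrib distrib_right intro!: continuous_intros\<close>)
qed

end

section \<open>Integrals against test functions\<close>

lemma fourier_add: "schwartz f \<Longrightarrow> schwartz g \<Longrightarrow> fourier (\<lambda>x. f x + g x) = (\<lambda>k. fourier f k + fourier g k)"
  unfolding fourier_def distrib_left
  by (rule ext, rule Bochner_Integration.integral_add)
    (rule integrable_cis_mult[where \<kappa>="\<lambda>x. x"], simp, erule schwartz_integrable)+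

lemma fourier_cmult: "fourier (\<lambda>x. c * f x) = (\<lambda>k. c * fourier f k)"
  unfolding fourier_def by (simp add: mult.left_commute)

lemma test_fun_mono: assumes "test_fun U f" "U \<subseteq> V" shows "test_fun V f"
proof -
  obtain K where K: "compact K" "K \<subseteq> U" "\<And>z. z \<notin> K \<Longrightarrow> f z = 0" "smooth f" using test_funE[OF assms(1)] by metis
  show ?thesis by (rule test_funI[OF K(4) K(1) _ K(3)]) (use K(2) assms(2) in auto)
qed

lemma compact_support_integrable:
  fixes X \<psi> :: "'a::euclidean_space \<Rightarrow> complex"
  assumes U: "open U" "continuous_on U X" and psi: "test_fun U \<psi>"
  shows "integrable lborel (\<lambda>z. X z * \<psi> z)"
proof -
  obtain K where K: "compact K" "K \<subseteq> U" "\<And>z. z \<notin> K \<Longrightarrow> \<psi> z = 0" "smooth \<psi>" using test_funE[OF psi] by metis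
  have cK: "continuous_on K X" using U(2) K(2) continuous_on_subset by blast
  obtain M where M: "\<And>z. z \<in> K \<Longrightarrow> norm (X z) \<le> M"
    using compact_imp_bounded[OF compact_continuous_image[OF cK K(1)]] unfolding bounded_iff by blast
  \<comment> \<open>\<open>X\<close> is arbitrary outside \<open>U\<close>. Inserting the indicator
    changes nothing on the support of \<open>\<psi>\<close> and gives measurability from continuity
    on an open set.\<close>
  have e: "(\<lambda>z. X z * \<psi> z) = (\<lambda>z. (indicator U z *\<^sub>R X z) * \<psi> z)"
  proof
    fix z show "X z * \<psi> z = (indicator U z *\<^sub>R X z) * \<psi> z"
      using K(2) K(3)[of z] by (cases "z \<in> U") auto
  qed
  have m: "(\<lambda>z. X z * \<psi> z) \<in> borel_measurable borel"
    unfolding e using U smooth_borel[OF K(4)]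
    by (intro borel_measurable_times borel_measurable_continuous_on_indicator) auto
  show ?thesis
  proof (rule Bochner_Integration.integrable_bound[OF integrable_mult_right[OF schwartz_integrable[OF test_fun_schwartz[OF psi]], of "of_real M"]])
    show "AE z in lborel. norm (X z * \<psi> z) \<le> norm (of_real M * \<psi> z)"
    proof (rule AE_I2)
      fix z show "norm (X z * \<psi> z) \<le> norm (of_real M * \<psi> z)"
      proof (cases "z \<in> K")
        case True
        then have "norm (X z) \<le> \<bar>M\<bar>" using M[OF True] by linarith
        then show ?thesis by (simp add: norm_mult mult_right_mono)
      qed (simp add: K(3))
    qed
  qed (use m in simp)
qed

lemma compact_support_decay:
  fixes X \<psi> :: "'a::euclidean_space \<Rightarrow> complex"
  assumes X: "continuous_on UNIV X" and psi: "test_fun U \<psi>"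
  shows "\<exists>C. 0 \<le> C \<and> (\<forall>z. norm (X z * \<psi> z) \<le> C / (1 + norm z) ^ n)"
proof -
  obtain K where K: "compact K" "K \<subseteq> U" "\<And>z. z \<notin> K \<Longrightarrow> \<psi> z = 0" "smooth \<psi>" using test_funE[OF psi] by metis
  have cK: "continuous_on K (\<lambda>z. (1 + norm z) ^ n * norm (X z * \<psi> z))"
    by (intro continuous_intros continuous_on_subset[OF X] smooth_continuous_on K(4)) auto
  obtain M where M: "\<And>y. y \<in> (\<lambda>z. (1 + norm z) ^ n * norm (X z * \<psi> z)) ` K \<Longrightarrow> norm y \<le> M"
    using compact_imp_bounded[OF compact_continuous_image[OF cK K(1)]] unfolding bounded_iff by blast
  have "(1 + norm z) ^ n * norm (X z * \<psi> z) \<le> max M 0" for z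
  proof (cases "z \<in> K")
    case True
    then have "norm ((1 + norm z) ^ n * norm (X z * \<psi> z)) \<le> M" by (intro M imageI)
    then have "(1 + norm z) ^ n * norm (X z * \<psi> z) \<le> M" by (metis abs_le_D1 real_norm_def)
    then show ?thesis by linarith
  qed (simp add: K(3))
  then have "norm (X z * \<psi> z) \<le> max M 0 / (1 + norm z) ^ n" for z
    by (simp add: le_divide_eq mult.commute)
  then show ?thesis by (intro exI[of _ "max M 0"]) auto
qed

lemma hdd_ibp_test:
  fixes X \<psi> :: "'a::euclidean_space \<Rightarrow> complex"
  assumes X: "hdd v X X'" "continuous_on UNIV X" "continuous_on UNIV X'" and psi: "test_fun U \<psi>"
  shows "(LINT z|lborel. X z * dderiv v \<psi> z) = - (LINT z|lborel. X' z * \<psi> z)"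
proof -
  have sm: "smooth \<psi>" using psi by (simp add: test_fun_def)
  have psi': "test_fun U (dderiv v \<psi>)" using test_fun_dderivs[OF psi, of "[v]"] by simp
  obtain C1 where C1: "0 \<le> C1" "\<And>z. norm (X z * \<psi> z) \<le> C1 / (1 + norm z) ^ (2 * DIM('a))" using compact_support_decay[OF X(2) psi] by metis
  obtain C2 where C2: "0 \<le> C2" "\<And>z. norm (X' z * \<psi> z) \<le> C2 / (1 + norm z) ^ (2 * DIM('a))" using compact_support_decay[OF X(3) psi] by metis
  obtain C3 where C3: "0 \<le> C3" "\<And>z. norm (X z * dderiv v \<psi> z) \<le> C3 / (1 + norm z) ^ (2 * DIM('a))" using compact_support_decay[OF X(2) psi'] by metis
  have up: "a \<le> (C1 + C2 + C3) / (1 + norm z) ^ (2 * DIM('a))" if "a \<le> c / (1 + norm z) ^ (2 * DIM('a))" "c \<le> C1 + C2 + C3" for a c and z :: 'a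
    using that(1) divide_right_mono[OF that(2), of "(1 + norm z) ^ (2 * DIM('a))"] by simp
  show ?thesis
    by (rule integration_by_parts[where C="C1 + C2 + C3"])
      (use X hdd_smooth[OF sm] smooth_continuous_on[OF sm] smooth_continuous_on[OF smooth_dderiv[OF sm]]
          up[OF C1(2)] up[OF C2(2)] up[OF C3(2)] C1(1) C2(1) C3(1) in auto)
qed

lemma sums_integral_test:
  fixes X :: "nat \<Rightarrow> 'a::euclidean_space \<Rightarrow> complex"
  assumes X: "\<And>j. continuous_on UNIV (X j)" and psi: "test_fun U \<psi>"
    and s: "\<And>z. z \<in> U \<Longrightarrow> (\<lambda>j. X j z) sums Z z" and M: "summable M" "\<And>j z. z \<in> U \<Longrightarrow> norm (X j z) \<le> M j"
  shows "(\<lambda>j. LINT z|lborel. X j z * \<psi> z) sums (LINT z|lborel. Z z * \<psi> z)"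
proof -
  have in_U: "z \<in> U" if "\<psi> z \<noteq> 0" for z
    using test_funE[OF psi] that by (metis subsetD)
  have i: "integrable lborel (\<lambda>z. X j z * \<psi> z)" for j
    by (rule compact_support_integrable[OF open_UNIV X test_fun_mono[OF psi]]) simp
  have ip: "integrable lborel \<psi>" by (rule schwartz_integrable[OF test_fun_schwartz[OF psi]])
  have lim: "(\<lambda>n. (\<Sum>j<n. X j z) * \<psi> z) \<longlonglongrightarrow> Z z * \<psi> z" for z
  proof (cases "\<psi> z = 0")
    case False
    then show ?thesis using s[OF in_U[OF False]] unfolding sums_def by (intro tendsto_mult tendsto_const)
  qed simp
  have mX: "(\<lambda>z. (\<Sum>j<n. X j z) * \<psi> z) \<in> borel_measurable lborel" for n
    by (intro borel_measurable_times borel_measurable_sum)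
      (use X continuous_borel borel_measurable_integrable[OF ip] in auto)
  have "(\<lambda>n. LINT z|lborel. (\<Sum>j<n. X j z) * \<psi> z) \<longlonglongrightarrow> (LINT z|lborel. Z z * \<psi> z)"
  proof (rule integral_dominated_convergence)
    show "(\<lambda>z. Z z * \<psi> z) \<in> borel_measurable lborel" by (rule borel_measurable_LIMSEQ_metric[OF mX lim])
    show "integrable lborel (\<lambda>z. suminf M * norm (\<psi> z))" by (intro integrable_mult_right integrable_norm ip)
    show "AE z in lborel. norm ((\<Sum>j<n. X j z) * \<psi> z) \<le> suminf M * norm (\<psi> z)" for n
    proof (rule AE_I2)
      fix z show "norm ((\<Sum>j<n. X j z) * \<psi> z) \<le> suminf M * norm (\<psi> z)"
      proof (cases "\<psi> z = 0")
        case False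
        note z = in_U[OF False]
        have "norm (\<Sum>j<n. X j z) \<le> (\<Sum>j<n. M j)" by (rule sum_norm_le) (use M(2)[OF z] in auto)
        also have "\<dots> \<le> suminf M"
          by (rule sum_le_suminf[OF M(1)]) (use order_trans[OF norm_ge_zero M(2)[OF z]] in auto)
        finally show ?thesis by (simp add: norm_mult mult_right_mono)
      qed simp
    qed
  qed (use mX lim in auto)
  moreover have "(LINT z|lborel. (\<Sum>j<n. X j z) * \<psi> z) = (\<Sum>j<n. LINT z|lborel. X j z * \<psi> z)" for n
    unfolding sum_distrib_right by (rule Bochner_Integration.integral_sum) (rule i)
  ultimately show ?thesis unfolding sums_def by simp
qed

lemma powr_add_le: "0 \<le> x \<Longrightarrow> 0 \<le> y \<Longrightarrow> 0 \<le> a \<Longrightarrow> (x + y) powr a \<le> 2 powr a * (x powr a + y powr (a::real))"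
proof -
  assume xy: "0 \<le> x" "0 \<le> y" and a: "0 \<le> a"
  have "(x + y) powr a \<le> (2 * max x y) powr a" using xy a by (intro powr_mono2) auto
  also have "\<dots> = 2 powr a * max x y powr a" using xy by (simp add: powr_mult)
  also have "max x y powr a \<le> x powr a + y powr a" by (simp add: max_def)
  finally show ?thesis by simp
qed

section \<open>Jets of convolutions and their size near \<open>q = 0\<close>\<close>

context split_n
begin

abbreviation ax :: "'n \<Rightarrow> real^'n" where "ax i \<equiv> axis i 1"
abbreviation e :: "'n \<Rightarrow> 'a" where "e i \<equiv> J (axis i 1)"

lemma map_e: "map e l = map J (map ax l)" by simp

lemma vec_expand: "v = (\<Sum>i\<in>UNIV. (v $ i) *\<^sub>R ax i)"
  by (simp add: vec_eq_iff axis_def if_distrib[of "\<lambda>x. _ * x"] cong: if_cong)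

lemma dderiv_vec:
  fixes g :: "real^'n \<Rightarrow> 'c::real_normed_vector"
  assumes "smooth g" shows "dderiv v g x = (\<Sum>i\<in>UNIV. (v $ i) *\<^sub>R dderiv (ax i) g x)"
proof -
  interpret linear "\<lambda>v. dderiv v g x" by (rule linear_dderiv[OF assms])
  have "dderiv v g x = dderiv (\<Sum>i\<in>UNIV. (v $ i) *\<^sub>R ax i) g x" using vec_expand[of v] by simp
  then show ?thesis by (simp add: sum scale)
qed

lemma dderiv_J_vec:
  assumes "smooth g" shows "dderiv (J v) g x = (\<Sum>i\<in>UNIV. (v $ i) *\<^sub>R dderiv (e i) g x)"
proof -
  interpret linear "\<lambda>v. dderiv v g x" by (rule linear_dderiv[OF assms])
  have "J v = J (\<Sum>i\<in>UNIV. (v $ i) *\<^sub>R ax i)" using vec_expand[of v] by simp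
  also have "\<dots> = (\<Sum>i\<in>UNIV. (v $ i) *\<^sub>R e i)" by (simp add: linear_sum[OF lin_J] linear_scale[OF lin_J])
  finally show ?thesis by (simp add: sum scale)
qed

lemma qjet_smooth:
  fixes g :: "'a \<Rightarrow> complex"
  assumes "smooth g" shows "qjet (\<lambda>is. dderivs (map e is) g)"
  unfolding qjet_def
proof (intro conjI allI smooth_continuous_on smooth_dderivs assms)
  fix "is" v
  have "hdd (J v) (dderivs (map e is) g) (dderiv (J v) (dderivs (map e is) g))"
    by (rule hdd_smooth[OF smooth_dderivs[OF assms]])
  also have "dderiv (J v) (dderivs (map e is) g) = (\<lambda>z. \<Sum>i\<in>UNIV. of_real (v $ i) * dderivs (map e (i # is)) g z)"
  proof
    fix z
    show "dderiv (J v) (dderivs (map e is) g) z = (\<Sum>i\<in>UNIV. of_real (v $ i) * dderivs (map e (i # is)) g z)"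
      by (subst dderiv_J_vec[OF smooth_dderivs[OF assms]]) (simp add: scaleR_conv_of_real)
  qed
  finally show "hdd (J v) (dderivs (map e is) g) (\<lambda>z. \<Sum>i\<in>UNIV. of_real (v $ i) * dderivs (map e (i # is)) g z)" .
qed

lemma qjet_shift: "qjet Y \<Longrightarrow> qjet (\<lambda>is. Y (is @ l))"
  unfolding qjet_def by simp

lemma qjet_diff: "qjet Y \<Longrightarrow> qjet Y' \<Longrightarrow> qjet (\<lambda>is z. Y is z - Y' is z)"
  unfolding qjet_def
proof (intro conjI allI)
  fix "is" v
  assume a: "(\<forall>is. continuous_on UNIV (Y is)) \<and> (\<forall>is v. hdd (J v) (Y is) (\<lambda>z. \<Sum>i\<in>UNIV. of_real (v $ i) * Y (i # is) z))"
    and b: "(\<forall>is. continuous_on UNIV (Y' is)) \<and> (\<forall>is v. hdd (J v) (Y' is) (\<lambda>z. \<Sum>i\<in>UNIV. of_real (v $ i) * Y' (i # is) z))"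
  show "continuous_on UNIV (\<lambda>z. Y is z - Y' is z)" using a b by (intro continuous_intros) auto
  have "hdd (J v) (\<lambda>z. Y is z - Y' is z) (\<lambda>z. (\<Sum>i\<in>UNIV. of_real (v $ i) * Y (i # is) z) - (\<Sum>i\<in>UNIV. of_real (v $ i) * Y' (i # is) z))"
    using a b by (intro hdd_diff) auto
  then show "hdd (J v) (\<lambda>z. Y is z - Y' is z) (\<lambda>z. \<Sum>i\<in>UNIV. of_real (v $ i) * (Y (i # is) z - Y' (i # is) z))"
    by (simp add: sum_subtractf right_diff_distrib)
qed

lemma qjet_cmult: "qjet Y \<Longrightarrow> qjet (\<lambda>is z. c * Y is z)"
  unfolding qjet_def
proof (intro conjI allI)
  fix "is" v
  assume a: "(\<forall>is. continuous_on UNIV (Y is)) \<and> (\<forall>is v. hdd (J v) (Y is) (\<lambda>z. \<Sum>i\<in>UNIV. of_real (v $ i) * Y (i # is) z))"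
  show "continuous_on UNIV (\<lambda>z. c * Y is z)" using a by (intro continuous_intros) auto
  have "hdd (J v) (\<lambda>z. c * Y is z) (\<lambda>z. c * (\<Sum>i\<in>UNIV. of_real (v $ i) * Y (i # is) z))"
    using a by (intro hdd_cmult) auto
  then show "hdd (J v) (\<lambda>z. c * Y is z) (\<lambda>z. \<Sum>i\<in>UNIV. of_real (v $ i) * (c * Y (i # is) z))"
    by (simp add: sum_distrib_left mult.left_commute)
qed

lemma qjet_zero: "qjet (\<lambda>is z. 0)"
  unfolding qjet_def using hdd_const by auto

lemma qjet_sum: "finite I \<Longrightarrow> (\<And>k. k \<in> I \<Longrightarrow> qjet (Y k)) \<Longrightarrow> qjet (\<lambda>is z. \<Sum>k\<in>I. Y k is z)"
proof (induct I rule: finite_induct)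
  case (insert k I)
  have "qjet (\<lambda>is z. Y k is z - (-1) * (\<Sum>k\<in>I. Y k is z))"
    by (intro qjet_diff qjet_cmult) (use insert in auto)
  then show ?case using insert by simp
qed (simp add: qjet_zero)

lemma qjet_hdd: "qjet Y \<Longrightarrow> hdd (e i) (Y is) (Y (i # is))"
proof -
  assume Y: "qjet Y"
  have "hdd (J (ax i)) (Y is) (\<lambda>z. \<Sum>k\<in>UNIV. of_real (ax i $ k) * Y (k # is) z)" using Y unfolding qjet_def by blast
  moreover have "(\<Sum>k\<in>UNIV. of_real (ax i $ k) * Y (k # is) z) = Y (i # is) z" for z
    by (simp add: axis_def if_distrib[of of_real] if_distrib[of "\<lambda>x. x * _"] cong: if_cong)
  ultimately show ?thesis by simp
qed

text \<open>Derivatives move one at a time from the head of \<open>l\<close> to the head of the jet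
  index, hence the reversal.\<close>

lemma jet_ibp:
  assumes Y: "qjet Y" and psi: "test_fun U \<psi>"
  shows "(LINT z|lborel. Y is z * dderivs (map e l) \<psi> z) = (-1) ^ length l * (LINT z|lborel. Y (rev l @ is) z * \<psi> z)"
proof (induct l arbitrary: "is")
  case Nil then show ?case by simp
next
  case (Cons i l)
  have "(LINT z|lborel. Y is z * dderiv (e i) (dderivs (map e l) \<psi>) z) = - (LINT z|lborel. Y (i # is) z * dderivs (map e l) \<psi> z)"
    by (rule hdd_ibp_test[OF qjet_hdd[OF Y] _ _ test_fun_dderivs[OF psi]]) (use Y in \<open>auto simp: qjet_def\<close>)
  then show ?case using Cons[of "i # is"] by simp
qed

text \<open>The \<open>q\<close>-jet of \<open>cv S c v\<close>: every derivative falls on the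
  kernel and contributes the factor \<open>- 1 / c\<close> of \<open>cv_hdd\<close>.\<close>

definition vjet :: "(real^'n \<Rightarrow> complex) \<Rightarrow> real \<Rightarrow> ('a \<Rightarrow> complex) \<Rightarrow> 'n list \<Rightarrow> 'a \<Rightarrow> complex" where
  "vjet S c v is z = (- of_real (1 / c)) ^ length is * cv (dderivs (map ax is) S) c v z"

lemma cv_sum:
  assumes "\<And>i. i \<in> I \<Longrightarrow> schwartz (f i)" and v: "bcont v"
  shows "cv (\<lambda>q. \<Sum>i\<in>I. a i * f i q) c v z = (\<Sum>i\<in>I. a i * cv (f i) c v z)"
proof -
  have "cv (\<lambda>q. \<Sum>i\<in>I. a i * f i q) c v z = (LINT q|lborel. (\<Sum>i\<in>I. a i * (f i q * v (z + c *\<^sub>R J q))))"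
    unfolding cv_def by (simp add: sum_distrib_right mult.assoc)
  also have "\<dots> = (\<Sum>i\<in>I. LINT q|lborel. a i * (f i q * v (z + c *\<^sub>R J q)))"
    by (intro Bochner_Integration.integral_sum integrable_mult_right cv_integrable schwartz_integrable assms)
  finally show ?thesis unfolding cv_def by simp
qed

lemma qjet_vjet:
  assumes S: "schwartz S" and v: "bcont v" and c: "0 < c"
  shows "qjet (vjet S c v)"
  unfolding qjet_def
proof (intro conjI allI)
  fix "is" u
  note Sis = schwartz_dderivs[OF S, of "map ax is"]
  have vj: "vjet S c v is = (\<lambda>z. (- of_real (1 / c)) ^ length is * cv (dderivs (map ax is) S) c v z)"
    by (rule ext) (simp add: vjet_def)
  show "continuous_on UNIV (vjet S c v is)" unfolding vj by (intro continuous_intros cv_continuous Sis v)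
  have "hdd (J u) (vjet S c v is) (\<lambda>z. (- of_real (1 / c)) ^ length is * (- of_real (1 / c) * cv (dderiv u (dderivs (map ax is) S)) c v z))"
    unfolding vj by (intro hdd_cmult cv_hdd Sis v c)
  also have "dderiv u (dderivs (map ax is) S) = (\<lambda>q. \<Sum>i\<in>UNIV. of_real (u $ i) * dderivs (map ax (i # is)) S q)"
  proof
    fix q
    show "dderiv u (dderivs (map ax is) S) q = (\<Sum>i\<in>UNIV. of_real (u $ i) * dderivs (map ax (i # is)) S q)"
      by (subst dderiv_vec[OF schwartz_smooth[OF Sis]]) (simp add: scaleR_conv_of_real)
  qed
  also have "cv \<dots> c v = (\<lambda>z. \<Sum>i\<in>UNIV. of_real (u $ i) * cv (dderivs (map ax (i # is)) S) c v z)"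
    by (rule ext) (intro cv_sum schwartz_dderivs S v)
  finally show "hdd (J u) (vjet S c v is) (\<lambda>z. \<Sum>i\<in>UNIV. of_real (u $ i) * vjet S c v (i # is) z)"
    unfolding vj by (simp add: vjet_def sum_distrib_left mult_ac)
qed

text \<open>Averaging over \<open>q\<close>-distances of order \<open>c\<close> smears a zero of
  order \<open>a\<close> at \<open>q = 0\<close> to size \<open>c powr a\<close>. The integer
  \<open>m \<ge> a\<close> is the number of extra powers of decay of \<open>S\<close> that this
  consumes.\<close>

lemma cv_near_bound:
  assumes S: "schwartz S" and v: "bcont v" and a: "0 \<le> a" and C: "\<And>z. norm (v z) \<le> C * norm (p z) powr a"
  shows "\<exists>D. 0 \<le> D \<and> (\<forall>c z. 0 < c \<longrightarrow> norm (cv S c v z) \<le> D * (norm (p z) powr a + c powr a))"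
proof -
  define m where "m = nat \<lceil>a\<rceil>"
  have m: "a \<le> real m" unfolding m_def by linarith
  obtain B where B: "0 \<le> B" "\<And>q. norm (S q) \<le> B / (1 + norm q) ^ (2 * DIM(real^'n) + m)" using schwartz_bound0[OF S] by metis
  define I where "I = (LINT q|lborel. 1 / (1 + norm (q::real^'n)) ^ (2 * DIM(real^'n)))"
  have I: "0 \<le> I" unfolding I_def by (rule integral_nonneg_AE) simp
  have "norm (cv S c v z) \<le> (\<bar>C\<bar> * 2 powr a * B * I) * (norm (p z) powr a + c powr a)" if c: "0 < c" for c z
  proof -
    let ?N = "norm (p z) powr a + c powr a"
    have "norm (cv S c v z) \<le> (LINT q|lborel. (\<bar>C\<bar> * 2 powr a * B * ?N) * (1 / (1 + norm (q::real^'n)) ^ (2 * DIM(real^'n))))"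
      unfolding cv_def
    proof (rule order_trans[OF integral_norm_bound integral_mono])
      show "integrable lborel (\<lambda>q. norm (S q * v (z + c *\<^sub>R J q)))" by (intro integrable_norm cv_integrable schwartz_integrable S v)
      show "integrable lborel (\<lambda>q::real^'n. (\<bar>C\<bar> * 2 powr a * B * ?N) * (1 / (1 + norm q) ^ (2 * DIM(real^'n))))"
        by (rule integrable_mult_right[OF integrable_decay])
      fix q :: "real^'n"
      have one: "1 \<le> (1 + norm q) powr a" using a by (simp add: ge_one_powr_ge_zero)
      have pm: "(1 + norm q) powr a \<le> (1 + norm q) ^ m"
        using powr_mono[OF m, of "1 + norm q"] by (simp add: powr_realpow)
      have "norm (p (z + c *\<^sub>R J q)) powr a \<le> (norm (p z) + c * norm q) powr a"
      proof (rule powr_mono2[OF a])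
        show "norm (p (z + c *\<^sub>R J q)) \<le> norm (p z) + c * norm q"
          using norm_triangle_ineq[of "p z" "c *\<^sub>R q"] c by (simp add: p_simps pJ)
      qed simp
      also have "\<dots> \<le> 2 powr a * (norm (p z) powr a + (c * norm q) powr a)" using c a by (intro powr_add_le) auto
      also have "(c * norm q) powr a = c powr a * norm q powr a" using c by (simp add: powr_mult)
      also have "2 powr a * (norm (p z) powr a + c powr a * norm q powr a) \<le> 2 powr a * (?N * (1 + norm q) powr a)"
      proof (rule mult_left_mono)
        have "norm q powr a \<le> (1 + norm q) powr a" using a by (intro powr_mono2) auto
        then have "c powr a * norm q powr a \<le> c powr a * (1 + norm q) powr a" by (intro mult_left_mono) auto
        moreover have "norm (p z) powr a * 1 \<le> norm (p z) powr a * (1 + norm q) powr a" using one by (intro mult_left_mono) auto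
        ultimately show "norm (p z) powr a + c powr a * norm q powr a \<le> ?N * (1 + norm q) powr a" by (simp add: distrib_right)
      qed simp
      also have "\<dots> \<le> 2 powr a * (?N * (1 + norm q) ^ m)" using pm by (intro mult_left_mono) auto
      finally have "norm (p (z + c *\<^sub>R J q)) powr a \<le> 2 powr a * (?N * (1 + norm q) ^ m)" .
      then have "\<bar>C\<bar> * norm (p (z + c *\<^sub>R J q)) powr a \<le> \<bar>C\<bar> * (2 powr a * (?N * (1 + norm q) ^ m))" by (intro mult_left_mono) auto
      moreover have "norm (v (z + c *\<^sub>R J q)) \<le> \<bar>C\<bar> * norm (p (z + c *\<^sub>R J q)) powr a"
        by (rule order_trans[OF C]) (intro mult_right_mono, auto)
      ultimately have "norm (S q * v (z + c *\<^sub>R J q)) \<le> (B / (1 + norm q) ^ (2 * DIM(real^'n) + m)) * (\<bar>C\<bar> * (2 powr a * (?N * (1 + norm q) ^ m)))"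
        unfolding norm_mult using B by (intro mult_mono) auto
      also have "\<dots> = (\<bar>C\<bar> * 2 powr a * B * ?N) * (1 / (1 + norm q) ^ (2 * DIM(real^'n)))" by (simp add: power_add)
      finally show "norm (S q * v (z + c *\<^sub>R J q)) \<le> (\<bar>C\<bar> * 2 powr a * B * ?N) * (1 / (1 + norm q) ^ (2 * DIM(real^'n)))" .
    qed
    also have "\<dots> = (\<bar>C\<bar> * 2 powr a * B * ?N) * I" unfolding I_def by (rule integral_mult_right_zero)
    finally show ?thesis by (simp add: mult_ac)
  qed
  then show ?thesis using B I by (intro exI[of _ "\<bar>C\<bar> * 2 powr a * B * I"]) auto
qed

text \<open>Decay in \<open>q\<close> comes from \<open>\<sigma>\<close>, decay in \<open>x\<close>
  from \<open>f\<close>, and \<open>norm_split_mult\<close> combines the two weights.\<close>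

lemma schwartz_tensor:
  assumes S: "schwartz \<sigma>" and f: "qschw f" shows "schwartz (\<lambda>z. \<sigma> (p z) * f z)"
proof -
  let ?B = "\<lambda>F. \<exists>\<sigma> f. schwartz \<sigma> \<and> qschw f \<and> F = (\<lambda>(i::unit) (z::'a). \<sigma> (p z) * f z)"
  have "sfam UNIV (\<lambda>_. 1) (\<lambda>(i::unit) z. \<sigma> (p z) * f z)"
  proof (rule sfam_sumcl[where B="?B"])
    fix F assume "?B F"
    then obtain \<sigma> f where S: "schwartz \<sigma>" and f: "qschw f" and F: "F = (\<lambda>(i::unit) z. \<sigma> (p z) * f z)" by blast
    have sf: "smooth f" using f by (simp add: qschw_def)
    have sS: "smooth (\<lambda>z. \<sigma> (p z))" by (rule smooth_comp_linear[OF bl_p schwartz_smooth[OF S]])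
    have 1: "sumcl UNIV ?B (\<lambda>i. dderiv v (F i))" for v
    proof (unfold F, rule sumcl_mult[OF sS sf])
      show "?B (\<lambda>_ z. \<sigma> (p z) * dderiv v f z)" using S qschw_dderiv[OF f] by blast
      show "?B (\<lambda>_ z. dderiv v (\<lambda>z. \<sigma> (p z)) z * f z)"
        unfolding dderiv_comp_linear[OF bl_p schwartz_smooth[OF S]] using schwartz_dderiv[OF S] f by blast
    qed
    have 2: "fbd UNIV (\<lambda>_. 1) F"
      unfolding fbd_def
    proof
      fix k
      obtain C where C: "0 \<le> C" "\<And>x. norm (\<sigma> x) \<le> C / (1 + norm x) ^ k" using schwartz_bound0[OF S] by metis
      obtain C' where C': "\<And>z. norm (f z) \<le> C' / (1 + norm (proj z)) ^ k" using f unfolding qschw_def by (metis dderivs.simps(1))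
      have "(1 + norm z) ^ k * norm (F i z) \<le> C * C'" for i z
      proof -
        have "(1 + norm z) ^ k \<le> (1 + norm (p z)) ^ k * (1 + norm (proj z)) ^ k"
          using power_mono[OF norm_split_mult[of z], of k] by (simp add: power_mult_distrib)
        moreover have "norm (F i z) \<le> (C / (1 + norm (p z)) ^ k) * (C' / (1 + norm (proj z)) ^ k)"
          unfolding F norm_mult using C C' by (intro mult_mono) auto
        ultimately have "(1 + norm z) ^ k * norm (F i z) \<le> ((1 + norm (p z)) ^ k * (1 + norm (proj z)) ^ k) * ((C / (1 + norm (p z)) ^ k) * (C' / (1 + norm (proj z)) ^ k))"
          by (intro mult_mono) auto
        then show ?thesis by simp
      qed
      then show "\<exists>C. \<forall>i\<in>UNIV. \<forall>x. (1 + norm x) ^ k * norm (F i x) \<le> C * 1" by auto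
    qed
    have 3: "F i differentiable at x" for i x
      unfolding F by (intro differentiable_mult smooth_differentiable sS sf)
    show "(\<forall>i\<in>UNIV. \<forall>x. F i differentiable at x) \<and> fbd UNIV (\<lambda>_. 1) F \<and> (\<forall>v. sumcl UNIV ?B (\<lambda>i. dderiv v (F i)))"
      using 1 2 3 by blast
  qed (rule sumcl.base, use assms in auto)
  then show ?thesis by (simp add: schwartz_sfam)
qed

lemma dderivs_e_cv:
  assumes S: "schwartz S" and f: "schwartz f" and c: "0 < c" "c \<le> 1"
  shows "cv S c (dderivs (map e l) f) = (\<lambda>z. (- of_real (1 / c)) ^ length l * cv (dderivs (map ax l) S) c f z)"
proof -
  have "dderivs (map e l) (cv S c f) = (\<lambda>z. (- of_real (1 / c)) ^ length l * cv (dderivs (map ax l) S) c f z)"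
  proof (induct l)
    case (Cons i l)
    note Sl = schwartz_dderivs[OF S, of "map ax l"]
    have "dderivs (map e (i # l)) (cv S c f) = dderiv (J (ax i)) (\<lambda>z. (- of_real (1 / c)) ^ length l * cv (dderivs (map ax l) S) c f z)"
      using Cons by simp
    also have "\<dots> = (\<lambda>z. (- of_real (1 / c)) ^ length l * (- of_real (1 / c) * cv (dderiv (ax i) (dderivs (map ax l) S)) c f z))"
      unfolding dderiv_cmult[OF schwartz_smooth[OF schwartz_cv[OF Sl f c]]] dderiv_J_cv[OF Sl f c] ..
    finally show ?case by (simp add: mult_ac)
  qed simp
  then show ?thesis using dderivs_cv[OF S f] by simp
qed

end

section \<open>The dyadic pieces near the origin\<close>

lemma half_powr: "2 powr (real j * x) = ((1 / 2) ^ j :: real) powr (- x)"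
proof -
  have "((1 / 2) ^ j :: real) = 2 powr (- real j)" by (simp add: powr_minus powr_realpow power_one_over inverse_eq_divide)
  then show ?thesis by (simp add: powr_powr)
qed

text \<open>Averaging over \<open>q\<close>-translates does not enlarge the support in the
  \<open>x\<close>-directions.\<close>

lemma (in split_space) qschw_add_J: "cv S c \<psi> z \<noteq> 0 \<Longrightarrow> test_fun (cyl r) \<psi> \<Longrightarrow> norm (proj z) < r"
proof (rule ccontr)
  assume nz: "cv S c \<psi> z \<noteq> 0" and psi: "test_fun (cyl r) \<psi>" and n: "\<not> norm (proj z) < r"
  have "\<psi> (z + c *\<^sub>R J q) = 0" for q
    using test_fun_cyl[OF psi, of "z + c *\<^sub>R J q"] n unfolding cyl_def by auto
  then show False using nz unfolding cv_def by simp
qed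

context split_n
begin

text \<open>Near the origin the pieces \<open>2 ^ (- j L) \<sigma> (2 ^ (- j) y) t\<close> have Fourier transform
  \<open>\<Sum>\<partial>V + H\<close>, where the \<open>V\<close> come from the local representation \<open>u\<close> of the Fourier
  transform of \<open>t\<close> and \<open>H\<close> is rapidly decreasing in \<open>j\<close>.\<close>
lemma dyadic_core:
  fixes t s :: "('a \<Rightarrow> complex) \<Rightarrow> complex" and f :: "'a \<Rightarrow> complex" and I :: "'k set"
    and l :: "'k \<Rightarrow> 'n list" and u :: "'k \<Rightarrow> 'a \<Rightarrow> complex" and d :: int and \<sigma> :: "real^'n \<Rightarrow> complex"
  assumes t: "tempered t" and s: "tempered s" and f: "qschw f"
    and ts: "\<And>\<phi>. schwartz \<phi> \<Longrightarrow> t \<phi> = s (\<lambda>z. f z * \<phi> z)"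
    and U: "open U" "0 \<in> U" and I: "finite I" and uc: "\<And>k. k \<in> I \<Longrightarrow> continuous_on U (u k)"
    and ub: "\<And>k. k \<in> I \<Longrightarrow> \<exists>C. \<forall>z\<in>U. norm (u k z) \<le> C * norm (p z) powr (real_of_int d - \<epsilon> + real (length (l k)))"
    and pos: "\<And>k. k \<in> I \<Longrightarrow> 0 < real_of_int d - \<epsilon> + real (length (l k))"
    and loc: "\<And>\<psi>. test_fun U \<psi> \<Longrightarrow> t (fourier \<psi>) = (\<Sum>k\<in>I. (-1) ^ length (l k) * (LINT z|lborel. u k z * dderivs (map e (l k)) \<psi> z))"
    and eps: "0 < \<epsilon>" "\<epsilon> < 1" and L: "2 \<le> L" "2 \<le> d + int L" and sig: "schwartz \<sigma>"
  shows "\<exists>r R P. 0 < r \<and> (\<forall>k\<in>insert None (Some ` I). continuous_on (cyl r) (R k) \<and>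
       (\<exists>C. \<forall>z\<in>cyl r. norm (R k z) \<le> C * norm (p z) powr (real_of_int d - \<epsilon> + real L + real (length (case_option [] l k)))) \<and>
       polc (d + int L + int (length (case_option [] l k))) (P k)) \<and>
     (\<forall>\<psi>. test_fun (cyl r) \<psi> \<longrightarrow>
        (\<lambda>j. of_real (((1/2) ^ j) ^ L) * t (\<lambda>z. \<sigma> (((1/2) ^ j) *\<^sub>R p z) * fourier \<psi> z)) sums
        (\<Sum>k\<in>insert None (Some ` I). (-1) ^ length (case_option [] l k) *
            (LINT z|lborel. (R k z + P k z) * dderivs (map e (case_option [] l k)) \<psi> z)))"
proof -
  obtain R0 where R0: "0 < R0" "cball 0 R0 \<subseteq> U" using U open_contains_cball by metis
  \<comment> \<open>The localised convolution below is supported in the ball of radius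
    \<open>4 * r\<close>, which must lie inside the ball of radius \<open>R0 / 2\<close> where
    \<open>cut\<close> is 1.\<close>
  define r where "r = R0 / 16"
  have r: "0 < r" using R0 by (simp add: r_def)
  \<comment> \<open>\<open>v\<close> extends \<open>u\<close> continuously to the whole space: it
    equals \<open>u\<close> on the ball of radius \<open>R0 / 2\<close>, vanishes outside radius
    \<open>R0\<close> and keeps the bound in \<open>norm (p z)\<close>. The retraction
    \<open>cp\<close> ensures that \<open>u\<close> is evaluated inside \<open>U\<close>
    only.\<close>
  define cut where "cut z = max 0 (min 1 (2 - 2 * norm z / R0))" for z :: 'a
  define cp where "cp = closest_point (cball (0::'a) R0)"
  define v where "v k z = of_real (cut z) * u k (cp z)" for k z
  have cpc: "continuous_on UNIV cp" unfolding cp_def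
    by (rule continuous_on_closest_point) (use R0 in auto)
  have cpin: "cp z \<in> cball 0 R0" for z
    unfolding cp_def by (rule closest_point_in_set) (use R0 in auto)
  have cpid: "cp z = z" if "norm z \<le> R0" for z
    unfolding cp_def using that by (intro closest_point_self) simp
  have chic: "continuous_on UNIV cut" unfolding cut_def[abs_def] by (intro continuous_intros) (use R0 in auto)
  have chi01: "0 \<le> cut z" "cut z \<le> 1" for z unfolding cut_def by auto
  have chi0: "cut z = 0" if "R0 \<le> norm z" for z
  proof -
    have "2 \<le> 2 * norm z / R0" using that R0 by (simp add: le_divide_eq)
    then show ?thesis unfolding cut_def by simp
  qed
  have chi1: "cut z = 1" if "norm z \<le> R0 / 2" for z
  proof -
    have "2 * norm z / R0 \<le> 1" using that R0 by (simp add: divide_le_eq)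
    then show ?thesis unfolding cut_def by simp
  qed
  have ucp: "continuous_on UNIV (\<lambda>z. u k (cp z))" if "k \<in> I" for k
    by (rule continuous_on_compose2[OF uc[OF that] cpc]) (use cpin R0 in auto)
  have vb: "bcont (v k)" if k: "k \<in> I" for k
  proof -
    have "continuous_on (cball 0 R0) (u k)" using uc[OF k] R0 continuous_on_subset by blast
    then obtain M where M: "\<And>z. z \<in> cball 0 R0 \<Longrightarrow> norm (u k z) \<le> M"
      using compact_imp_bounded[OF compact_continuous_image[OF _ compact_cball]] by (metis bounded_iff imageI)
    have "norm (v k z) \<le> 1 * M" for z
      unfolding v_def norm_mult using chi01 M[OF cpin] by (intro mult_mono) auto
    moreover have "continuous_on UNIV (v k)" unfolding v_def[abs_def]
      by (intro continuous_on_mult continuous_on_of_real chic ucp k)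
    ultimately show ?thesis unfolding bcont_def by blast
  qed
  have vu: "v k z = u k z" if "norm z \<le> R0 / 2" for k z
    unfolding v_def using chi1[OF that] cpid[of z] that R0 by simp
  define b where "b k = real_of_int d - \<epsilon> + real (length (l k))" for k
  have b0: "0 < b k" if "k \<in> I" for k using pos[OF that] by (simp add: b_def)
  have vC: "\<exists>C. \<forall>z. norm (v k z) \<le> C * norm (p z) powr b k" if k: "k \<in> I" for k
  proof -
    obtain C where C: "\<And>z. z \<in> U \<Longrightarrow> norm (u k z) \<le> C * norm (p z) powr b k" using ub[OF k] unfolding b_def by blast
    have "norm (v k z) \<le> \<bar>C\<bar> * norm (p z) powr b k" for z
    proof (cases "norm z \<le> R0")
      case True
      then have "z \<in> U" using R0 by auto
      from C[OF this] have "norm (u k z) \<le> \<bar>C\<bar> * norm (p z) powr b k"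
        by (rule order_trans) (intro mult_right_mono, auto)
      then have "norm (v k z) \<le> 1 * (\<bar>C\<bar> * norm (p z) powr b k)"
        unfolding v_def norm_mult cpid[OF True] using chi01[of z] by (intro mult_mono) auto
      then show ?thesis by simp
    next
      case False
      then show ?thesis by (simp add: v_def chi0)
    qed
    then show ?thesis by blast
  qed

  obtain \<eta> :: "real^'n \<Rightarrow> real" where eta: "smooth \<eta>" "\<And>x. 0 \<le> \<eta> x" "\<And>x. \<eta> x \<le> 1"
    "\<And>x. norm x \<le> 2 * r \<Longrightarrow> \<eta> x = 1" "\<And>x. norm x \<ge> 3 * r \<Longrightarrow> \<eta> x = 0"
    using cutoff_exists[of "2 * r" "3 * r"] r by auto
  define h where "h z = complex_of_real (\<eta> (p z))" for z
  have sh: "slow h"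
  proof -
    have "schwartz (\<lambda>x. complex_of_real (\<eta> x))"
      by (rule schwartzI_compact[where K="cball 0 (3 * r)"])
        (use eta(5) in \<open>auto intro: smooth_blin[OF bounded_linear_of_real eta(1)]\<close>)
    then show ?thesis unfolding h_def[abs_def] by (rule slow_comp_linear[OF bl_p schwartz_slow])
  qed
  \<comment> \<open>\<open>h\<close> and \<open>m\<close> add up to 1. They split a convolution into
    a part near the origin, where the local representation applies, and a part separated in
    \<open>q\<close> from the test function.\<close>
  define m where "m z = 1 + (-1) * h z" for z
  have m: "far_mult r m"
  proof -
    have "slow m" unfolding m_def[abs_def] by (intro slow_add slow_mult slow_const sh)
    then show ?thesis unfolding far_mult_def using eta(4) by (auto simp: m_def h_def)
  qed

  \<comment> \<open>The functional of the global distribution \<open>\<Sum>\<partial>v\<close>. It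
    replaces the Fourier transform of \<open>t\<close> and agrees with it on test functions
    supported where \<open>v = u\<close>.\<close>
  define W where "W g = (\<Sum>k\<in>I. (-1) ^ length (l k) * (LINT z|lborel. v k z * dderivs (map e (l k)) g z))" for g
  have vint: "integrable lborel (\<lambda>z. v k z * g z)" if k: "k \<in> I" and g: "schwartz g" for k g
  proof -
    obtain M where M: "0 \<le> M" "\<And>z. norm (v k z) \<le> M" using bcontE[OF vb[OF k]] by metis
    show ?thesis
    proof (rule Bochner_Integration.integrable_bound[OF integrable_mult_right[OF schwartz_integrable[OF g], of "of_real M"]])
      show "(\<lambda>z. v k z * g z) \<in> borel_measurable lborel" using bcont_borel[OF vb[OF k]] schwartz_borel[OF g] by simp
      show "AE z in lborel. norm (v k z * g z) \<le> norm (of_real M * g z)"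
        using M by (intro AE_I2) (simp add: norm_mult mult_right_mono)
    qed
  qed
  have Wadd: "W (\<lambda>z. g z + g' z) = W g + W g'" if g: "schwartz g" "schwartz g'" for g g'
    unfolding W_def dderivs_add[OF schwartz_smooth[OF g(1)] schwartz_smooth[OF g(2)]] distrib_left
    by (subst sum.distrib[symmetric], rule sum.cong[OF refl], subst Bochner_Integration.integral_add)
      (auto intro!: vint schwartz_dderivs g simp: distrib_left)
  have Wcmult: "W (\<lambda>z. a * g z) = a * W g" if g: "schwartz g" for a g
    unfolding W_def dderivs_cmult[OF schwartz_smooth[OF g]] by (simp add: sum_distrib_left mult.left_commute)
  have Wbound: "\<exists>C. 0 \<le> C \<and> (\<forall>(c, \<psi>)\<in>scaled_tests r. norm (W (\<lambda>z. m z * cv S c \<psi> z)) \<le> C * (c ^ n * nrm \<psi>))"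
    if S: "schwartz S" for S n
  proof -
    have "\<forall>k. \<exists>C. 0 \<le> C \<and> (k \<in> I \<longrightarrow> (\<forall>z. norm (v k z) \<le> C))" using bcontE[OF vb] by (metis order_refl)
    then obtain M where M: "\<And>k. 0 \<le> M k" "\<And>k z. k \<in> I \<Longrightarrow> norm (v k z) \<le> M k" by metis
    have "\<forall>k. \<exists>C. 0 \<le> C \<and> (\<forall>(c, \<psi>)\<in>scaled_tests r. nrm (dderivs (map J (map ax (l k))) (\<lambda>z. m z * cv S c \<psi> z)) \<le> C * (c ^ n * nrm \<psi>))"
      using far_bound[OF r S m] by blast
    then obtain C where C: "\<And>k. 0 \<le> C k" "\<And>k c \<psi>. (c, \<psi>) \<in> scaled_tests r \<Longrightarrow> nrm (dderivs (map J (map ax (l k))) (\<lambda>z. m z * cv S c \<psi> z)) \<le> C k * (c ^ n * nrm \<psi>)"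
      by (subst (asm) choice_iff) blast
    have "norm (W (\<lambda>z. m z * cv S c \<psi> z)) \<le> (\<Sum>k\<in>I. M k * C k) * (c ^ n * nrm \<psi>)" if ct: "(c, \<psi>) \<in> scaled_tests r" for c \<psi>
    proof -
      note sg = far_schwartz[OF S m ct]
      have "norm (W (\<lambda>z. m z * cv S c \<psi> z)) \<le> (\<Sum>k\<in>I. M k * (C k * (c ^ n * nrm \<psi>)))"
        unfolding W_def
      proof (rule sum_norm_le)
        fix k assume k: "k \<in> I"
        let ?g = "dderivs (map e (l k)) (\<lambda>z. m z * cv S c \<psi> z)"
        have "norm ((-1) ^ length (l k) * (LINT z|lborel. v k z * ?g z)) = norm (LINT z|lborel. v k z * ?g z)"
          by (simp add: norm_mult norm_power)
        also have "\<dots> \<le> (LINT z|lborel. M k * norm (?g z))"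
        proof (rule order_trans[OF integral_norm_bound integral_mono])
          show "integrable lborel (\<lambda>z. norm (v k z * ?g z))" by (intro integrable_norm vint k schwartz_dderivs sg)
          show "integrable lborel (\<lambda>z. M k * norm (?g z))" by (intro integrable_mult_right integrable_norm schwartz_integrable schwartz_dderivs sg)
          show "norm (v k z * ?g z) \<le> M k * norm (?g z)" for z
            unfolding norm_mult using M(2)[OF k] by (intro mult_right_mono) auto
        qed
        also have "\<dots> = M k * nrm (dderivs (map J (map ax (l k))) (\<lambda>z. m z * cv S c \<psi> z))" unfolding nrm_def map_e by simp
        also have "\<dots> \<le> M k * (C k * (c ^ n * nrm \<psi>))" by (intro mult_left_mono C ct M)
        finally show "norm ((-1) ^ length (l k) * (LINT z|lborel. v k z * ?g z)) \<le> M k * (C k * (c ^ n * nrm \<psi>))" .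
      qed
      then show ?thesis by (simp add: sum_distrib_right mult.assoc)
    qed
    moreover have "0 \<le> (\<Sum>k\<in>I. M k * C k)" using M C by (simp add: sum_nonneg)
    ultimately show ?thesis by (intro exI[of _ "\<Sum>k\<in>I. M k * C k"]) auto
  qed

  \<comment> \<open>The error of this replacement on the far part. Both terms are
    \<open>O(c ^ n * nrm \<psi>)\<close> for every \<open>n\<close>: the first through
    \<open>s\<close> and the decay of \<open>f\<close>, the second because \<open>v\<close> is
    bounded.\<close>
  define rest where "rest S c \<psi> = t (fourier (\<lambda>z. m z * cv S c \<psi> z)) - W (\<lambda>z. m z * cv S c \<psi> z)" for S c \<psi>
  have restB: "\<exists>C. 0 \<le> C \<and> (\<forall>(c, \<psi>)\<in>scaled_tests r. norm (rest S c \<psi>) \<le> C * (c ^ n * nrm \<psi>))" if S: "schwartz S" for S n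
  proof -
    have w0: "\<And>i. i \<in> scaled_tests r \<Longrightarrow> 0 \<le> fst i ^ n * nrm (snd i)"
      by (auto simp: scaled_tests_def intro!: mult_nonneg_nonneg nrm_nonneg)
    obtain C1 where C1: "0 \<le> C1" "\<And>i. i \<in> scaled_tests r \<Longrightarrow> norm (s (\<lambda>z. f z * fourier (\<lambda>k. m k * cv S (fst i) (snd i) k) z)) \<le> C1 * (fst i ^ n * nrm (snd i))"
      using tempered_family[OF s far_family[OF r S m f, of n] w0] by blast
    obtain C2 where C2: "0 \<le> C2" "\<And>c \<psi>. (c, \<psi>) \<in> scaled_tests r \<Longrightarrow> norm (W (\<lambda>z. m z * cv S c \<psi> z)) \<le> C2 * (c ^ n * nrm \<psi>)"
      using Wbound[OF S, of n] by blast
    have "norm (rest S c \<psi>) \<le> (C1 + C2) * (c ^ n * nrm \<psi>)" if ct: "(c, \<psi>) \<in> scaled_tests r" for c \<psi>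
    proof -
      have "t (fourier (\<lambda>z. m z * cv S c \<psi> z)) = s (\<lambda>z. f z * fourier (\<lambda>k. m k * cv S c \<psi> k) z)"
        by (rule ts[OF schwartz_fourier[OF far_schwartz[OF S m ct]]])
      then have "norm (t (fourier (\<lambda>z. m z * cv S c \<psi> z))) \<le> C1 * (c ^ n * nrm \<psi>)" using C1(2)[OF ct] by simp
      then show ?thesis unfolding rest_def
        using C2(2)[OF ct] norm_triangle_ineq4[of "t (fourier (\<lambda>z. m z * cv S c \<psi> z))" "W (\<lambda>z. m z * cv S c \<psi> z)"]
        by (simp add: distrib_right)
    qed
    then show ?thesis using C1(1) C2(1) by (intro exI[of _ "C1 + C2"]) auto
  qed

  \<comment> \<open>The reflection cancels the sign in \<open>fourier_cv\<close>, so multiplication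
    by \<open>\<sigma> (c *\<^sub>R p z)\<close> becomes \<open>cv S c\<close> on the test function;
    \<open>S'\<close> is the transposed kernel that acts on \<open>v\<close>.\<close>
  obtain S where S: "schwartz S" "\<And>k. fourier S k = \<sigma> (- k)" using fourier_surj[OF schwartz_uminus[OF sig]] by metis
  define S' where "S' q = S (- q)" for q
  have S': "schwartz S'" unfolding S'_def[abs_def] by (rule schwartz_uminus[OF S(1)])

  have split: "t (\<lambda>z. \<sigma> (c *\<^sub>R p z) * fourier \<psi> z) =
      (\<Sum>k\<in>I. (-1) ^ length (l k) * (LINT z|lborel. cv S' c (v k) z * dderivs (map e (l k)) \<psi> z)) + rest S c \<psi>"
    if c: "0 < c" "c \<le> 1" and psi: "test_fun (cyl r) \<psi>" for c \<psi>
  proof -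
    note sp = test_fun_schwartz[OF psi]
    let ?\<Psi> = "cv S c \<psi>"
    have ct: "(c, \<psi>) \<in> scaled_tests r" using c psi by (simp add: scaled_tests_def)
    have sPsi: "schwartz ?\<Psi>" by (rule schwartz_cv[OF S(1) sp c])
    have shP: "schwartz (\<lambda>z. h z * ?\<Psi> z)" by (rule schwartz_mult[OF sh sPsi])
    have smP: "schwartz (\<lambda>z. m z * ?\<Psi> z)" by (rule far_schwartz[OF S(1) m ct])
    have dec: "?\<Psi> = (\<lambda>z. h z * ?\<Psi> z + m z * ?\<Psi> z)" by (simp add: m_def algebra_simps)
    have out: "h z * ?\<Psi> z = 0" if "z \<notin> cball 0 (4 * r)" for z
    proof (rule ccontr)
      assume nz: "h z * ?\<Psi> z \<noteq> 0"
      then have "norm (proj z) < r" using qschw_add_J[OF _ psi] by auto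
      moreover have "norm (p z) < 3 * r" using nz eta(5)[of "p z"] unfolding h_def by force
      ultimately show False using norm_split[of z] that by simp
    qed
    have test: "test_fun U (\<lambda>z. h z * ?\<Psi> z)"
      by (rule test_funI[OF schwartz_smooth[OF shP] compact_cball[of 0 "4 * r"] _ out])
        (use R0 in \<open>auto simp: r_def\<close>)
    have near: "t (fourier (\<lambda>z. h z * ?\<Psi> z)) = W (\<lambda>z. h z * ?\<Psi> z)"
      unfolding loc[OF test] W_def
    proof (intro sum.cong refl arg_cong[where f="\<lambda>x. _ * x"] Bochner_Integration.integral_cong)
      fix k z
      show "u k z * dderivs (map e (l k)) (\<lambda>z. h z * ?\<Psi> z) z = v k z * dderivs (map e (l k)) (\<lambda>z. h z * ?\<Psi> z) z"
      proof (cases "z \<in> cball 0 (4 * r)")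
        case True
        then have "norm z \<le> R0 / 2" using R0 by (simp add: r_def)
        then show ?thesis by (simp add: vu)
      next
        case False
        then show ?thesis using dderivs_zero_outside[OF schwartz_smooth[OF shP] closed_cball out False] by simp
      qed
    qed
    have "(\<lambda>z. \<sigma> (c *\<^sub>R p z) * fourier \<psi> z) = fourier ?\<Psi>"
      using fourier_cv[OF S(1) sp, of c] S(2) by auto
    also have "fourier ?\<Psi> = (\<lambda>k. fourier (\<lambda>z. h z * ?\<Psi> z) k + fourier (\<lambda>z. m z * ?\<Psi> z) k)"
      by (subst dec) (rule fourier_add[OF shP smP])
    finally have "t (\<lambda>z. \<sigma> (c *\<^sub>R p z) * fourier \<psi> z) = t (fourier (\<lambda>z. h z * ?\<Psi> z)) + t (fourier (\<lambda>z. m z * ?\<Psi> z))"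
      using tempered_add[OF t schwartz_fourier[OF shP] schwartz_fourier[OF smP]] by simp
    also have "\<dots> = W ?\<Psi> + rest S c \<psi>"
    proof -
      have "W ?\<Psi> = W (\<lambda>z. h z * ?\<Psi> z) + W (\<lambda>z. m z * ?\<Psi> z)" by (subst dec) (rule Wadd[OF shP smP])
      then show ?thesis unfolding near rest_def by simp
    qed
    also have "W ?\<Psi> = (\<Sum>k\<in>I. (-1) ^ length (l k) * (LINT z|lborel. cv S' c (v k) z * dderivs (map e (l k)) \<psi> z))"
      unfolding W_def dderivs_cv[OF S(1) sp]
    proof (intro sum.cong refl arg_cong[where f="\<lambda>x. _ * x"])
      fix k assume "k \<in> I"
      from cv_adjoint[OF S(1) schwartz_dderivs[OF sp] vb[OF this]]
      show "(LINT z|lborel. v k z * cv S c (dderivs (map e (l k)) \<psi>) z) = (LINT z|lborel. cv S' c (v k) z * dderivs (map e (l k)) \<psi> z)"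
        unfolding S'_def[abs_def] .
    qed
    finally show ?thesis .
  qed

  define c where "c j = ((1/2) ^ j :: real)" for j :: nat
  have c: "0 < c j" "c j \<le> 1" for j unfolding c_def by (auto simp: power_le_one)
  define F where "F j z = of_real (c j ^ L) * (\<sigma> (c j *\<^sub>R p z) * f z)" for j z
  have SF: "schwartz (F j)" for j
    unfolding F_def[abs_def] by (rule schwartz_cmult[OF schwartz_tensor[OF schwartz_scale[OF sig c] f]])
  define V where "V k j is z = of_real (c j ^ L) * vjet S' (c j) (v k) is z" for k j "is" z
  have Vjet: "qjet (V k j)" if "k \<in> I" for k j
    unfolding V_def[abs_def] by (rule qjet_cmult[OF qjet_vjet[OF S' vb[OF that] c(1)]])
  \<comment> \<open>The Fourier transform of the piece, a smooth function by \<open>pwt\<close>,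
    minus the \<open>v\<close>-parts with their outer derivatives carried out on the smoothing
    kernel. Both are honest functions, so \<open>H\<close> can be estimated pointwise.\<close>
  define H where "H j is z = dderivs (map e is) (pwt s (F j)) z - (\<Sum>k\<in>I. V k j (is @ rev (l k)) z)" for j "is" z
  have Hjet: "qjet (H j)" for j
    unfolding H_def[abs_def]
    by (rule qjet_diff[OF qjet_smooth[OF smooth_pwt[OF s SF]] qjet_sum[OF I qjet_shift[OF Vjet]]])
  have cont: "continuous_on UNIV (Y is)" if "qjet Y" for Y "is" using that unfolding qjet_def by blast
  have jint: "integrable lborel (\<lambda>z. Y is z * \<psi> z)" if "qjet Y" "test_fun (cyl r) \<psi>" for Y "is" \<psi>
    by (rule compact_support_integrable[OF open_cyl continuous_on_subset[OF cont[OF that(1)]] that(2)]) simp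

  have exch: "of_real (c j ^ L) * t (\<lambda>z. \<sigma> (c j *\<^sub>R p z) * fourier \<psi> z) = (LINT z|lborel. pwt s (F j) z * \<psi> z)"
    if psi: "test_fun (cyl r) \<psi>" for j \<psi>
  proof -
    note sp = test_fun_schwartz[OF psi]
    have sig': "slow (\<lambda>z. \<sigma> (c j *\<^sub>R p z))"
      by (rule slow_comp_linear[OF bl_p schwartz_slow[OF schwartz_scale[OF sig c]]])
    have sg: "schwartz (\<lambda>z. \<sigma> (c j *\<^sub>R p z) * fourier \<psi> z)" by (rule schwartz_mult[OF sig' schwartz_fourier[OF sp]])
    have sg': "schwartz (\<lambda>z. of_real (c j ^ L) * (\<sigma> (c j *\<^sub>R p z) * fourier \<psi> z))" by (rule schwartz_cmult[OF sg])
    have "of_real (c j ^ L) * t (\<lambda>z. \<sigma> (c j *\<^sub>R p z) * fourier \<psi> z) = t (\<lambda>z. of_real (c j ^ L) * (\<sigma> (c j *\<^sub>R p z) * fourier \<psi> z))"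
      by (rule tempered_cmult[OF t sg, symmetric])
    also have "\<dots> = s (\<lambda>z. F j z * fourier \<psi> z)" unfolding ts[OF sg'] F_def by (simp add: mult_ac)
    also have "\<dots> = (LINT z|lborel. pwt s (F j) z * \<psi> z)"
    proof (rule tempered_exchange[OF s SF sp])
      show "\<psi> k = 0" if "2 * r < norm k" for k using norm_cyl[of k r] test_fun_cyl[OF psi, of k] that by force
    qed (use r in simp)
    finally show ?thesis .
  qed

  have VI: "(LINT z|lborel. V k j (rev (l k)) z * \<psi> z) = (-1) ^ length (l k) * of_real (c j ^ L) * (LINT z|lborel. cv S' (c j) (v k) z * dderivs (map e (l k)) \<psi> z)"
    if k: "k \<in> I" and psi: "test_fun (cyl r) \<psi>" for k j \<psi>
  proof -
    let ?A = "LINT z|lborel. V k j [] z * dderivs (map e (l k)) \<psi> z" and ?s = "(-1) ^ length (l k) :: complex"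
    have "?A = ?s * (LINT z|lborel. V k j (rev (l k) @ []) z * \<psi> z)" by (rule jet_ibp[OF Vjet[OF k] psi])
    then have "(LINT z|lborel. V k j (rev (l k)) z * \<psi> z) = ?s * ?A"
      by (simp add: power_mult_distrib[symmetric] mult.assoc[symmetric])
    also have "?A = of_real (c j ^ L) * (LINT z|lborel. cv S' (c j) (v k) z * dderivs (map e (l k)) \<psi> z)"
      by (simp add: V_def vjet_def mult.assoc)
    finally show ?thesis by (simp only: mult.assoc)
  qed
  \<comment> \<open>As a functional, \<open>H\<close> is exactly the error \<open>rest\<close> up to
    the factor \<open>c j ^ L\<close>; this links the pointwise object to the far estimates.\<close>
  have HI: "(LINT z|lborel. H j [] z * \<psi> z) = of_real (c j ^ L) * rest S (c j) \<psi>" if psi: "test_fun (cyl r) \<psi>" for j \<psi>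
  proof -
    have "(LINT z|lborel. H j [] z * \<psi> z) = (LINT z|lborel. pwt s (F j) z * \<psi> z - (\<Sum>k\<in>I. V k j (rev (l k)) z * \<psi> z))"
      by (simp add: H_def left_diff_distrib sum_distrib_right)
    also have "\<dots> = (LINT z|lborel. pwt s (F j) z * \<psi> z) - (LINT z|lborel. (\<Sum>k\<in>I. V k j (rev (l k)) z * \<psi> z))"
    proof (rule Bochner_Integration.integral_diff)
      show "integrable lborel (\<lambda>z. pwt s (F j) z * \<psi> z)"
        using jint[OF qjet_smooth[OF smooth_pwt[OF s SF]] psi, of "[]"] by simp
      show "integrable lborel (\<lambda>z. \<Sum>k\<in>I. V k j (rev (l k)) z * \<psi> z)"
        by (rule Bochner_Integration.integrable_sum) (rule jint[OF Vjet psi])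
    qed
    also have "(LINT z|lborel. (\<Sum>k\<in>I. V k j (rev (l k)) z * \<psi> z)) = (\<Sum>k\<in>I. LINT z|lborel. V k j (rev (l k)) z * \<psi> z)"
      by (rule Bochner_Integration.integral_sum) (rule jint[OF Vjet psi])
    also have "\<dots> = of_real (c j ^ L) * (\<Sum>k\<in>I. (-1) ^ length (l k) * (LINT z|lborel. cv S' (c j) (v k) z * dderivs (map e (l k)) \<psi> z))"
      unfolding sum_distrib_left by (rule sum.cong[OF refl]) (simp only: VI[OF _ psi], simp only: mult_ac)
    finally show ?thesis unfolding exch[OF psi, symmetric] split[OF c psi] by (simp add: distrib_left)
  qed
  have main: "of_real (c j ^ L) * t (\<lambda>z. \<sigma> (c j *\<^sub>R p z) * fourier \<psi> z) =
      (LINT z|lborel. H j [] z * \<psi> z) + (\<Sum>k\<in>I. (-1) ^ length (l k) * (LINT z|lborel. V k j [] z * dderivs (map e (l k)) \<psi> z))"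
    if psi: "test_fun (cyl r) \<psi>" for j \<psi>
    unfolding split[OF c psi] HI[OF psi] by (simp add: V_def vjet_def distrib_left sum_distrib_left mult_ac)

  \<comment> \<open>Derivatives of the test function are handed to the kernel, so the estimate for
    \<open>rest\<close> still involves \<open>nrm \<psi>\<close> and no derivative of
    \<open>\<psi>\<close>.\<close>
  have restD: "rest S c' (dderivs (map e l') \<psi>) = (- of_real (1 / c')) ^ length l' * rest (dderivs (map ax l') S) c' \<psi>"
    if ct: "(c', \<psi>) \<in> scaled_tests r" for c' l' \<psi>
  proof -
    have c': "0 < c'" "c' \<le> 1" and psi: "test_fun (cyl r) \<psi>" using ct by (auto simp: scaled_tests_def)
    note sl = far_schwartz[OF schwartz_dderivs[OF S(1), of "map ax l'"] m ct]
    let ?a = "(- of_real (1 / c')) ^ length l' :: complex"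
    have eq: "(\<lambda>z. m z * cv S c' (dderivs (map e l') \<psi>) z) = (\<lambda>z. ?a * (m z * cv (dderivs (map ax l') S) c' \<psi> z))"
      unfolding dderivs_e_cv[OF S(1) test_fun_schwartz[OF psi] c'] by (simp add: mult.left_commute)
    show ?thesis unfolding rest_def eq Wcmult[OF sl] fourier_cmult tempered_cmult[OF t schwartz_fourier[OF sl]]
      by (simp add: right_diff_distrib)
  qed
  \<comment> \<open>The derivatives cost \<open>(1 / c j) ^ length is\<close>, so the rapid decay is
    invoked with exponent \<open>length is + N\<close>. The resulting L1 bound becomes pointwise by
    testing with nonnegative bumps.\<close>
  have HB: "\<exists>C. 0 \<le> C \<and> (\<forall>j. \<forall>z\<in>cyl r. norm (H j is z) \<le> C * c j ^ N)" for "is" N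
  proof -
    let ?S = "dderivs (map ax (rev is)) S"
    obtain C where C: "0 \<le> C" "\<And>c \<psi>. (c, \<psi>) \<in> scaled_tests r \<Longrightarrow> norm (rest ?S c \<psi>) \<le> C * (c ^ (length is + N) * nrm \<psi>)"
      using restB[OF schwartz_dderivs[OF S(1)], of "map ax (rev is)" "length is + N"] by blast
    have test: "norm (LINT z|lborel. H j is z * \<psi> z) \<le> C * c j ^ N * nrm \<psi>" if psi: "test_fun (cyl r) \<psi>" for j \<psi>
    proof -
      have ct: "(c j, \<psi>) \<in> scaled_tests r" using c psi by (simp add: scaled_tests_def)
      have "(LINT z|lborel. H j [] z * dderivs (map e (rev is)) \<psi> z) = (-1) ^ length (rev is) * (LINT z|lborel. H j (rev (rev is) @ []) z * \<psi> z)"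
        by (rule jet_ibp[OF Hjet psi])
      then have "norm (LINT z|lborel. H j is z * \<psi> z) = norm (LINT z|lborel. H j [] z * dderivs (map e (rev is)) \<psi> z)"
        by (simp add: norm_mult norm_power)
      also have "\<dots> = norm (of_real (c j ^ L) * ((- of_real (1 / c j)) ^ length is * rest ?S (c j) \<psi>))"
        unfolding HI[OF test_fun_dderivs[OF psi]] restD[OF ct] by simp
      also have "\<dots> = c j ^ L * ((1 / c j) ^ length is * norm (rest ?S (c j) \<psi>))"
        using c(1)[of j] by (simp add: norm_mult norm_power norm_divide)
      also have "\<dots> \<le> 1 * ((1 / c j) ^ length is * (C * (c j ^ (length is + N) * nrm \<psi>)))"
        using c[of j] by (intro mult_mono mult_left_mono C ct) (auto simp: power_le_one)
      also have "\<dots> = C * c j ^ N * nrm \<psi>" using c(1)[of j] by (simp add: power_add power_one_over)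
      finally show ?thesis .
    qed
    have "norm (H j is z) \<le> C * c j ^ N" if z: "z \<in> cyl r" for j z
    proof (rule continuous_bound_by_testing[OF cont[OF Hjet] open_cyl z])
      fix \<phi> :: "'a \<Rightarrow> real"
      assume phi: "smooth \<phi>" "\<And>x. 0 \<le> \<phi> x" "compact (closure {x. \<phi> x \<noteq> 0})" "closure {x. \<phi> x \<noteq> 0} \<subseteq> cyl r"
      have "test_fun (cyl r) (\<lambda>x. complex_of_real (\<phi> x))"
        unfolding test_fun_def using phi smooth_blin[OF bounded_linear_of_real phi(1)] by simp
      from test[OF this, of j] show "norm (LINT z|lborel. H j is z * complex_of_real (\<phi> z)) \<le> (C * c j ^ N) * (LINT z|lborel. \<phi> z)"
        using phi(2) by (simp add: nrm_def)
    qed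
    then show ?thesis using C(1) by blast
  qed

  define \<delta> where "\<delta> k = d + int L + int (length (case_option [] l k))" for k
  define X where "X k = (case k of None \<Rightarrow> H | Some k \<Rightarrow> V k)" for k
  define ok where "ok k R Y \<longleftrightarrow> continuous_on (cyl (r / 2)) R \<and> (\<exists>C. \<forall>z\<in>cyl (r / 2). norm (R z) \<le> C * norm (p z) powr (real (nat (\<delta> k)) - \<epsilon>)) \<and>
     (\<forall>is. continuous_on UNIV (Y is)) \<and> (\<exists>M. summable M \<and> (\<forall>j. \<forall>z\<in>cyl (r / 2). norm (X k j [] z) \<le> M j)) \<and>
     (\<forall>z\<in>cyl (r / 2). (\<lambda>j. X k j [] z) sums (R z + (\<Sum>n<nat (\<delta> k). (1 / fact n) *\<^sub>R ct (p z) Y n [] (proj z))))" for k R and Y :: "'n list \<Rightarrow> 'a \<Rightarrow> complex"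
  have key: "\<exists>R Y. ok k R Y"
    if k: "k \<in> insert None (Some ` I)" for k
  proof (cases k)
    case None
    have K: "real (nat (\<delta> k)) = real_of_int d + real L" using L by (simp add: \<delta>_def None)
    show ?thesis unfolding ok_def
    proof (rule taylor_summation[OF r, where b=0 and \<epsilon>=\<epsilon>])
      show "qjet (X k j)" for j unfolding X_def None using Hjet by simp
      have "2 \<le> real_of_int d + real L" using L by linarith
      then show "0 \<le> real (nat (\<delta> k)) - \<epsilon> - 1" unfolding K using eps by linarith
      fix "is" :: "'n list"
      \<comment> \<open>Decay of order \<open>N\<close> already suffices with \<open>b = 0\<close>:
        the required size \<open>2 powr (j * (length is - N + \<epsilon>))\<close> is never below
        \<open>2 powr (- j * N)\<close>, and all derivatives of \<open>H\<close> decay that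
        fast.\<close>
      define N where "N = nat (\<delta> k)"
      obtain C where C: "0 \<le> C" "\<And>j z. z \<in> cyl r \<Longrightarrow> norm (H j is z) \<le> C * c j ^ N" using HB by blast
      have "norm (X k j is z) \<le> C * (2 powr (real j * (real (length is) - (real (nat (\<delta> k)) - \<epsilon>))) * (1 + (2 ^ j * norm (p z)) powr 0))"
        if z: "z \<in> cyl r" for j z
      proof -
        have "c j ^ N = 2 powr (real j * (- real N))"
          unfolding half_powr using c(1)[of j] by (simp add: c_def powr_realpow)
        also have "\<dots> \<le> 2 powr (real j * (real (length is) - (real (nat (\<delta> k)) - \<epsilon>)))"
          using eps by (intro powr_mono mult_left_mono) (auto simp: N_def)
        also have "\<dots> \<le> 2 powr (real j * (real (length is) - (real (nat (\<delta> k)) - \<epsilon>))) * (1 + (2 ^ j * norm (p z)) powr 0)"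
          by (simp add: distrib_left)
        finally have "C * c j ^ N \<le> C * (2 powr (real j * (real (length is) - (real (nat (\<delta> k)) - \<epsilon>))) * (1 + (2 ^ j * norm (p z)) powr 0))"
          using C(1) by (intro mult_left_mono) auto
        then show ?thesis using C(2)[OF z, of j] unfolding X_def None by simp
      qed
      then show "\<exists>C. 0 \<le> C \<and> (\<forall>j. \<forall>z\<in>cyl r. norm (X k j is z) \<le> C * (2 powr (real j * (real (length is) - (real (nat (\<delta> k)) - \<epsilon>))) * (1 + (2 ^ j * norm (p z)) powr 0)))"
        using C(1) by blast
    qed (use eps in auto)
  next
    case (Some k')
    then have k': "k' \<in> I" using k by auto
    \<comment> \<open>The order of the remainder is \<open>A = b k' + L\<close>, so
      \<open>L \<ge> 2\<close> provides the gap \<open>b \<le> A - 1\<close> demanded by the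
      summation.\<close>
    have K: "real (nat (\<delta> k)) - \<epsilon> = b k' + real L" using L by (simp add: \<delta>_def Some b_def)
    show ?thesis unfolding ok_def
    proof (rule taylor_summation[OF r, where b="b k'" and \<epsilon>=\<epsilon>])
      show "qjet (X k j)" for j unfolding X_def Some using Vjet[OF k'] by simp
      show "0 \<le> b k'" using b0[OF k'] by simp
      show "b k' \<le> real (nat (\<delta> k)) - \<epsilon> - 1" unfolding K using L by simp
      fix "is" :: "'n list"
      obtain C0 where C0: "\<And>z. norm (v k' z) \<le> C0 * norm (p z) powr b k'" using vC[OF k'] by blast
      obtain D where D: "0 \<le> D" "\<And>c z. 0 < c \<Longrightarrow> norm (cv (dderivs (map ax is) S') c (v k') z) \<le> D * (norm (p z) powr b k' + c powr b k')"
        using cv_near_bound[OF schwartz_dderivs[OF S'] vb[OF k'] less_imp_le[OF b0[OF k']] C0] by blast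
      have "norm (X k j is z) \<le> D * (2 powr (real j * (real (length is) - (real (nat (\<delta> k)) - \<epsilon>))) * (1 + (2 ^ j * norm (p z)) powr b k'))"
        for j z
      proof -
        have "norm (X k j is z) = c j ^ L * ((1 / c j) ^ length is * norm (cv (dderivs (map ax is) S') (c j) (v k') z))"
          unfolding X_def Some using c(1)[of j] by (simp add: V_def vjet_def norm_mult norm_power norm_divide)
        also have "\<dots> \<le> c j ^ L * ((1 / c j) ^ length is * (D * (norm (p z) powr b k' + c j powr b k')))"
          using c[of j] by (intro mult_left_mono D) auto
        also have "norm (p z) powr b k' + c j powr b k' = c j powr b k' * (1 + (2 ^ j * norm (p z)) powr b k')"
        proof -
          have eq: "c j * (2 ^ j * norm (p z)) = norm (p z)" unfolding c_def by (simp add: power_one_over)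
          have "(c j * (2 ^ j * norm (p z))) powr b k' = c j powr b k' * (2 ^ j * norm (p z)) powr b k'"
            by (rule powr_mult)
          from this[unfolded eq] show ?thesis by (simp add: distrib_left)
        qed
        also have "c j ^ L * ((1 / c j) ^ length is * (D * (c j powr b k' * (1 + (2 ^ j * norm (p z)) powr b k'))))
           = D * ((c j ^ L * (1 / c j) ^ length is * c j powr b k') * (1 + (2 ^ j * norm (p z)) powr b k'))" by (simp add: mult_ac)
        also have "c j ^ L * (1 / c j) ^ length is * c j powr b k' = c j powr (b k' + real L - real (length is))"
          using c(1)[of j] by (simp add: powr_add powr_diff powr_realpow power_one_over)
        also have "\<dots> = 2 powr (real j * (real (length is) - (real (nat (\<delta> k)) - \<epsilon>)))"
          unfolding half_powr K c_def by simp
        finally show ?thesis .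
      qed
      then show "\<exists>C. 0 \<le> C \<and> (\<forall>j. \<forall>z\<in>cyl r. norm (X k j is z) \<le> C * (2 powr (real j * (real (length is) - (real (nat (\<delta> k)) - \<epsilon>))) * (1 + (2 ^ j * norm (p z)) powr b k')))"
        using D(1) by blast
    qed (use eps in auto)
  qed
  define K where "K = insert None (Some ` I)"
  have "\<forall>k. \<exists>R Y. k \<in> K \<longrightarrow> ok k R Y" using key[folded K_def] by blast
  then obtain R Y where "\<And>k. k \<in> K \<Longrightarrow> ok k (R k) (Y k)" by metis
  note RY = this[unfolded ok_def K_def]
  define P where "P k z = (\<Sum>n<nat (\<delta> k). (1 / fact n) *\<^sub>R ct (p z) (Y k) n [] (proj z))" for k z
  have \<delta>0: "0 < \<delta> k" for k using L unfolding \<delta>_def by linarith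
  have Pp: "polc (\<delta> k) (P k)" if k: "k \<in> insert None (Some ` I)" for k
    unfolding P_def[abs_def] scaleR_conv_of_real
  proof (intro polc_sum polc_cmult)
    fix n assume n: "n \<in> {..<nat (\<delta> k)}"
    have "polc (int n + 1) (\<lambda>z. ct (p z) (Y k) n [] (proj z))" using RY[OF k] by (intro polc_ct) blast
    then show "polc (\<delta> k) (\<lambda>z. ct (p z) (Y k) n [] (proj z))" by (rule polc_mono) (use n \<delta>0[of k] in simp)
  qed
  have half: "cyl (r / 2) \<subseteq> cyl r" unfolding cyl_def using r by auto
  have sumsI: "(\<lambda>j. LINT z|lborel. X k j [] z * \<xi> z) sums (LINT z|lborel. (R k z + P k z) * \<xi> z)"
    if k: "k \<in> insert None (Some ` I)" and xi: "test_fun (cyl (r / 2)) \<xi>" for k \<xi>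
  proof -
    obtain M where M: "summable M" "\<And>j z. z \<in> cyl (r / 2) \<Longrightarrow> norm (X k j [] z) \<le> M j" using RY[OF k] by blast
    have q: "qjet (X k j)" for j using k Vjet Hjet unfolding X_def by auto
    show ?thesis
      by (rule sums_integral_test[OF cont[OF q, of _ "[]"] xi _ M]) (use RY[OF k] in \<open>auto simp: P_def\<close>)
  qed
  have final: "(\<lambda>j. of_real (c j ^ L) * t (\<lambda>z. \<sigma> (c j *\<^sub>R p z) * fourier \<psi> z)) sums
        (\<Sum>k\<in>insert None (Some ` I). (-1) ^ length (case_option [] l k) *
            (LINT z|lborel. (R k z + P k z) * dderivs (map e (case_option [] l k)) \<psi> z))"
    if psi: "test_fun (cyl (r / 2)) \<psi>" for \<psi>
  proof -
    have e1: "of_real (c j ^ L) * t (\<lambda>z. \<sigma> (c j *\<^sub>R p z) * fourier \<psi> z) =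
       (\<Sum>k\<in>insert None (Some ` I). (-1) ^ length (case_option [] l k) * (LINT z|lborel. X k j [] z * dderivs (map e (case_option [] l k)) \<psi> z))" for j
    proof -
      have "(\<Sum>k\<in>Some ` I. (-1) ^ length (case_option [] l k) * (LINT z|lborel. X k j [] z * dderivs (map e (case_option [] l k)) \<psi> z)) =
         (\<Sum>k\<in>I. (-1) ^ length (l k) * (LINT z|lborel. V k j [] z * dderivs (map e (l k)) \<psi> z))"
        by (subst sum.reindex) (auto simp: X_def)
      moreover have "None \<notin> Some ` I" "finite (Some ` I)" using I by auto
      ultimately show ?thesis unfolding main[OF test_fun_mono[OF psi half]] by (simp add: X_def)
    qed
    show ?thesis unfolding e1
      by (intro sums_sum sums_mult sumsI test_fun_dderivs psi)
  qed
  show ?thesis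
  proof (rule exI[of _ "r / 2"], rule exI[of _ R], rule exI[of _ P], intro conjI ballI allI impI)
    show "0 < r / 2" using r by simp
    fix k assume k: "k \<in> insert None (Some ` I)"
    have e: "real (nat (\<delta> k)) - \<epsilon> = real_of_int d - \<epsilon> + real L + real (length (case_option [] l k))"
      using \<delta>0[of k] unfolding \<delta>_def by simp
    show "continuous_on (cyl (r / 2)) (R k)" using RY[OF k] by blast
    show "\<exists>C. \<forall>z\<in>cyl (r / 2). norm (R k z) \<le> C * norm (p z) powr (real_of_int d - \<epsilon> + real L + real (length (case_option [] l k)))"
      using RY[OF k] unfolding e by blast
    show "polc (d + int L + int (length (case_option [] l k))) (P k)" using Pp[OF k] unfolding \<delta>_def .
  next
    fix \<psi> assume "test_fun (cyl (r / 2)) \<psi>"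
    from final[OF this] show "(\<lambda>j. of_real (((1/2) ^ j) ^ L) * t (\<lambda>z. \<sigma> (((1/2) ^ j) *\<^sub>R p z) * fourier \<psi> z)) sums
        (\<Sum>k\<in>insert None (Some ` I). (-1) ^ length (case_option [] l k) *
            (LINT z|lborel. (R k z + P k z) * dderivs (map e (case_option [] l k)) \<psi> z))"
      unfolding c_def .
  qed
qed

end

section \<open>Splitting functions\<close>

lemma count_mi_list: "count_list (mi_list \<alpha>) i = \<alpha> (i :: 'n::finite)"
proof -
  obtain xs where "mset xs = Abs_multiset \<alpha>" using ex_mset by blast
  then have "count_list xs i = \<alpha> i" for i
    by (metis count_Abs_multiset count_mset finite)
  then have "\<exists>xs. \<forall>i. count_list xs i = \<alpha> i" by blast
  from someI_ex[OF this] show ?thesis unfolding mi_list_def by blast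
qed

lemma length_eq_mi_abs: "length l = mi_abs (count_list (l :: 'n::finite list))"
  unfolding mi_abs_def by (rule sum_count_set[symmetric]) auto

lemma length_mi_list: "length (mi_list \<alpha>) = mi_abs (\<alpha> :: 'n::finite \<Rightarrow> nat)"
  using length_eq_mi_abs[of "mi_list \<alpha>"] by (simp add: mi_abs_def count_mi_list)

lemma dderivs_mi_list:
  assumes "smooth f"
  shows "dderivs (map g (mi_list (count_list l))) f = dderivs (map g (l :: 'n::finite list)) f"
proof (rule dderivs_perm[OF assms])
  have "mset (mi_list (count_list l)) = mset l"
    by (rule multiset_eqI) (simp add: count_mset count_mi_list)
  then show "mset (map g (mi_list (count_list l))) = mset (map g l)" by simp
qed

section \<open>Smoothness and dilations of splitting functions\<close>

lemma dderiv_scale_direction: "smooth f \<Longrightarrow> dderiv (c *\<^sub>R v) f = (\<lambda>x. c *\<^sub>R dderiv v f x)"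
  using linear_scale[OF linear_dderiv] by (intro ext) blast

lemma dderivs_scale_directions:
  assumes "smooth f" shows "dderivs (map ((*\<^sub>R) c) vs) f = (\<lambda>x. c ^ length vs *\<^sub>R dderivs vs f x)"
proof (induction vs)
  case (Cons v vs)
  then show ?case
    by (simp add: dderiv_blin[OF bounded_linear_scaleR_right smooth_dderivs[OF assms]]
        dderiv_scale_direction[OF smooth_dderivs[OF assms]] mult.commute[of c])
qed simp

text \<open>The quotients \<open>a / D ^ k\<close> with \<open>a\<close> vanishing near the origin
  are closed under differentiation, the quotient rule raising \<open>k\<close> by one. The zero of
  \<open>D\<close> at the origin is harmless because the numerator vanishes on a whole ball.\<close>

lemma smooth_divide:
  fixes a D :: "'a::real_normed_vector \<Rightarrow> complex"
  assumes D: "smooth D" "\<And>y. y \<noteq> 0 \<Longrightarrow> D y \<noteq> 0" and r: "0 < r"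
    and a: "smooth a" "\<And>y. norm y < r \<Longrightarrow> a y = 0"
  shows "smooth (\<lambda>y. a y / D y)"
proof -
  define P where "P f \<longleftrightarrow> (\<exists>a k. smooth a \<and> (\<forall>y. norm y < r \<longrightarrow> a y = 0) \<and> f = (\<lambda>y. a y / D y ^ k))" for f :: "'a \<Rightarrow> complex"
  show ?thesis
  proof (rule smooth_coinduct[where P=P])
    show "P (\<lambda>y. a y / D y)" unfolding P_def
      by (intro exI[of _ a] exI[of _ "1::nat"]) (use a in simp)
    fix f assume "P f"
    then obtain a k where a: "smooth a" "\<And>y. norm y < r \<Longrightarrow> a y = 0" and f: "f = (\<lambda>y. a y / D y ^ k)"
      unfolding P_def by blast
    define b where "b v y = dderiv v a y * D y + (- of_nat k) * (a y * dderiv v D y)" for v y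
    have a0: "dderiv v a y = 0" if "norm y < r" for v y
    proof -
      have "dderivs [v] a y = dderivs [v] (\<lambda>_. 0) y"
        by (rule dderivs_local[OF a(1) smooth_const open_ball[of 0 r]]) (use a(2) that in auto)
      then show ?thesis by (simp add: dderiv_const)
    qed
    have der: "(f has_derivative (\<lambda>v. b v y / D y ^ Suc k)) (at y)" for y
    proof (cases "norm y < r")
      case True
      have "(f has_derivative (\<lambda>v. 0)) (at y)"
        by (rule has_derivative_transform_within_open[OF has_derivative_const[of 0] open_ball[of 0 r]])
          (use True a(2) in \<open>auto simp: f\<close>)
      then show ?thesis using True a(2) a0 by (simp add: b_def)
    next
      case False
      then have "y \<noteq> 0" using r by auto
      then have nz: "D y \<noteq> 0" by (rule D(2))
      have "(f has_derivative (\<lambda>v. (dderiv v a y * D y ^ k - a y * (of_nat k * dderiv v D y * D y ^ (k - 1))) / (D y ^ k * D y ^ k))) (at y)"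
        unfolding f using nz
        by (intro has_derivative_divide' has_derivative_power smooth_has_derivative a D) auto
      moreover have "(dderiv v a y * D y ^ k - a y * (of_nat k * dderiv v D y * D y ^ (k - 1))) / (D y ^ k * D y ^ k) = b v y / D y ^ Suc k" for v
        using nz by (cases k) (simp_all add: b_def field_simps)
      ultimately show ?thesis by simp
    qed
    show "(\<forall>x. f differentiable (at x)) \<and> (\<forall>v. P (dderiv v f))"
    proof (intro conjI allI)
      show "f differentiable (at x)" for x using der differentiable_def by blast
      fix v
      have "dderiv v f = (\<lambda>y. b v y / D y ^ Suc k)" using dderiv_eq[OF der] by blast
      moreover have "smooth (b v)" unfolding b_def[abs_def]
        by (intro smooth_add smooth_mult smooth_const smooth_dderiv a D)
      moreover have "b v y = 0" if "norm y < r" for y using that a0 a(2) by (simp add: b_def)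
      ultimately show "P (dderiv v f)" unfolding P_def by blast
    qed
  qed
qed

definition bdd_smooth :: "('a::real_normed_vector \<Rightarrow> 'b::real_normed_vector) \<Rightarrow> bool" where
  "bdd_smooth g \<longleftrightarrow> smooth g \<and> (\<forall>vs. bounded (range (dderivs vs g)))"

lemma bdd_smooth_dderiv: "bdd_smooth g \<Longrightarrow> bdd_smooth (dderiv v g)"
  unfolding bdd_smooth_def by (metis dderivs.simps dderivs_append smooth_dderiv)

lemma bdd_smooth_of_real: "bdd_smooth g \<Longrightarrow> bdd_smooth (\<lambda>x. complex_of_real (g x))"
  unfolding bdd_smooth_def bounded_iff
  by (auto simp: smooth_blin[OF bounded_linear_of_real] dderivs_blin[OF bounded_linear_of_real])

text \<open>Differentiating \<open>\<Theta> (lam *\<^sub>R y) = \<Theta> y\<close> shows that derivatives of order \<open>m\<close> are homogeneous of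
  degree \<open>- m\<close> outside a ball.\<close>
lemma uv_splitting_bdd_smooth:
  fixes \<Theta> :: "real^'n::finite \<Rightarrow> real"
  assumes "uv_splitting \<Theta>" shows "bdd_smooth \<Theta>"
proof -
  have s: "smooth \<Theta>" using assms by (simp add: uv_splitting_def)
  obtain l where l: "0 < l" "\<And>lam y. 1 < lam \<Longrightarrow> l < norm y \<Longrightarrow> \<Theta> (lam *\<^sub>R y) = \<Theta> y"
    using assms unfolding uv_splitting_def by blast
  have "bounded (range (dderivs vs \<Theta>))" for vs
  proof -
    have "compact (dderivs vs \<Theta> ` cball 0 (l + 1))"
      by (intro compact_continuous_image smooth_continuous_on smooth_dderivs s compact_cball)
    from compact_imp_bounded[OF this] obtain M where "\<forall>w\<in>dderivs vs \<Theta> ` cball 0 (l + 1). norm w \<le> M"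
      unfolding bounded_iff by (rule exE)
    then have M: "norm (dderivs vs \<Theta> y) \<le> M" if "norm y \<le> l + 1" for y using that by simp
    have "norm (dderivs vs \<Theta> y) \<le> M" for y
    proof (cases "norm y \<le> l + 1")
      case False
      \<comment> \<open>Points are pulled back radially to the sphere of radius
        \<open>l + 1\<close>. The extra 1 places them in the open complement of the ball, where the
        scaling identity holds in a neighbourhood and may be differentiated.\<close>
      define lam where "lam = norm y / (l + 1)"
      have lam: "1 < lam" using False l(1) by (simp add: lam_def)
      define x where "x = (1 / lam) *\<^sub>R y"
      have x: "norm x = l + 1" "lam *\<^sub>R x = y" using lam l(1) False by (auto simp: x_def lam_def)
      have "dderivs vs \<Theta> x = dderivs vs (\<lambda>w. \<Theta> (lam *\<^sub>R w + 0)) x"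
      proof (rule dderivs_local[OF s smooth_affine[OF bounded_linear_scaleR_right s]])
        show "open (- cball 0 l :: (real^'n) set)" by (intro open_Compl closed_cball)
      qed (use l(2) lam x in auto)
      also have "\<dots> = lam ^ length vs *\<^sub>R dderivs vs \<Theta> y"
        unfolding dderivs_affine[OF bounded_linear_scaleR_right s] using dderivs_scale_directions[OF s, of lam vs] x by simp
      finally have "norm (dderivs vs \<Theta> x) = lam ^ length vs * norm (dderivs vs \<Theta> y)" using lam by (simp add: abs_mult)
      moreover have "1 * norm (dderivs vs \<Theta> y) \<le> lam ^ length vs * norm (dderivs vs \<Theta> y)"
        using lam by (intro mult_right_mono) (auto intro: one_le_power)
      ultimately show ?thesis using M[of x] x(1) by simp
    qed (use M in simp)
    then show ?thesis unfolding bounded_iff by blast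
  qed
  then show ?thesis using s unfolding bdd_smooth_def by blast
qed

text \<open>The dilated \<open>g\<close> vanishes unless \<open>norm (p z)\<close> is at least
  \<open>r * 2 ^ n\<close>, and there one more power of the Schwartz weight of \<open>\<psi>\<close>
  is worth a factor \<open>(1/2) ^ n\<close>. Derivatives of the dilated function only add powers of
  \<open>(1/2) ^ n\<close>, which \<open>m\<close> counts in the class \<open>B\<close>.\<close>

lemma (in split_space) dilation_family:
  assumes g: "bdd_smooth g" "0 < r" "\<And>y. norm y < r \<Longrightarrow> g y = 0" and psi: "schwartz \<psi>"
  shows "sfam UNIV (\<lambda>n. (1/2) ^ n) (\<lambda>n z. g ((1/2) ^ n *\<^sub>R p z) * \<psi> z)"
proof -
  define B :: "(nat \<Rightarrow> 'a \<Rightarrow> complex) \<Rightarrow> bool" where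
    "B f \<longleftrightarrow> (\<exists>m g \<psi>. bdd_smooth g \<and> (\<forall>y. norm y < r \<longrightarrow> g y = 0) \<and> schwartz \<psi> \<and>
       f = (\<lambda>n z. of_real (((1/2) ^ n) ^ m) * (g ((1/2) ^ n *\<^sub>R p z) * \<psi> z)))" for f
  have BI: "B (\<lambda>n z. of_real (((1/2) ^ n) ^ m) * (g ((1/2) ^ n *\<^sub>R p z) * \<psi> z))"
    if "bdd_smooth g" "\<forall>y. norm y < r \<longrightarrow> g y = 0" "schwartz \<psi>" for m g \<psi> unfolding B_def using that by blast
  show ?thesis
  proof (rule sfam_sumcl[where B=B])
    show "sumcl UNIV B (\<lambda>n z. g ((1/2) ^ n *\<^sub>R p z) * \<psi> z)"
      by (rule sumcl.base[where f="\<lambda>n z. of_real (((1/2) ^ n) ^ 0) * (g ((1/2) ^ n *\<^sub>R p z) * \<psi> z)"], rule BI)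
        (use g psi in auto)
    fix f assume "B f"
    then obtain m g \<psi> where g: "bdd_smooth g" "\<forall>y. norm y < r \<longrightarrow> g y = 0" and psi: "schwartz \<psi>"
      and f: "f = (\<lambda>n z. of_real (((1/2) ^ n) ^ m) * (g ((1/2) ^ n *\<^sub>R p z) * \<psi> z))"
      unfolding B_def by blast
    have sg: "smooth g" using g(1) by (simp add: bdd_smooth_def)
    have bl: "bounded_linear (\<lambda>z. (1/2) ^ n *\<^sub>R p z)" for n
      by (rule bounded_linear_compose[OF bounded_linear_scaleR_right bl_p])
    have sgn: "smooth (\<lambda>z. g ((1/2) ^ n *\<^sub>R p z))" for n using smooth_affine[OF bl sg, of n 0] by simp
    have dg: "dderiv v (\<lambda>z. g ((1/2) ^ n *\<^sub>R p z)) = (\<lambda>z. of_real ((1/2) ^ n) * dderiv (p v) g ((1/2) ^ n *\<^sub>R p z))" for n v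
      using dderiv_affine[OF bl sg, of v n 0] dderiv_scale_direction[OF sg, of "(1/2) ^ n" "p v"]
      by (simp add: scaleR_conv_of_real)
    have sf: "smooth (f n)" for n unfolding f by (intro smooth_mult smooth_const sgn schwartz_smooth psi)
    have diff: "f n differentiable (at z)" for n z by (rule smooth_differentiable[OF sf])
    have bd: "fbd UNIV (\<lambda>n. (1/2) ^ n) f" unfolding fbd_def
    proof
      fix k
      obtain M where M: "\<And>y. norm (g y) \<le> M" using g(1) unfolding bdd_smooth_def bounded_iff by (metis dderivs.simps(1) rangeI)
      have M0: "0 \<le> M" using M[of 0] norm_ge_zero[of "g 0"] by linarith
      obtain C where C: "0 \<le> C" "\<And>z. (1 + norm z) ^ Suc k * norm (\<psi> z) \<le> C" using schwartz_weighted_bound[OF psi] by metis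
      have "(1 + norm z) ^ k * norm (f n z) \<le> (M * C / r) * (1/2) ^ n" for n z
      proof (cases "norm ((1/2) ^ n *\<^sub>R p z) < r")
        case True
        then show ?thesis using g(2) M0 C(1) \<open>0 < r\<close> by (simp add: f)
      next
        case False
        then have "r \<le> (1/2) ^ n * (1 + norm z)"
          using norm_p_le[of z] by (simp add: not_less) (smt (verit) mult_left_mono zero_le_power divide_nonneg_nonneg)
        then have le: "1 \<le> (1/2) ^ n * (1 + norm z) / r" using \<open>0 < r\<close> by simp
        have "norm (f n z) \<le> 1 * (M * norm (\<psi> z))"
          unfolding f norm_mult using M by (intro mult_mono mult_right_mono) (auto simp: norm_power power_le_one)
        then have "(1 + norm z) ^ k * norm (f n z) \<le> (1 + norm z) ^ k * (M * norm (\<psi> z))"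
          by (intro mult_left_mono) auto
        also have "\<dots> \<le> ((1 + norm z) ^ k * (M * norm (\<psi> z))) * ((1/2) ^ n * (1 + norm z) / r)"
          using mult_left_mono[OF le, of "(1 + norm z) ^ k * (M * norm (\<psi> z))"] M0 by simp
        also have "\<dots> = (M / r * (1/2) ^ n) * ((1 + norm z) ^ Suc k * norm (\<psi> z))" by simp
        also have "\<dots> \<le> (M / r * (1/2) ^ n) * C" using M0 \<open>0 < r\<close> by (intro mult_left_mono C) auto
        finally show ?thesis by (simp add: mult_ac)
      qed
      then show "\<exists>C. \<forall>n\<in>UNIV. \<forall>z. (1 + norm z) ^ k * norm (f n z) \<le> C * (1/2) ^ n" by blast
    qed
    have der: "sumcl UNIV B (\<lambda>n. dderiv v (f n))" for v
    proof -
      have dg0: "\<forall>y::'q. norm y < r \<longrightarrow> dderiv (p v) g y = 0"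
      proof (intro allI impI)
        fix y :: 'q assume "norm y < r"
        then have "dderivs [p v] g y = dderivs [p v] (\<lambda>_. 0) y"
          by (intro dderivs_local[OF sg smooth_const open_ball[of 0 r]]) (use g(2) in auto)
        then show "dderiv (p v) g y = 0" by (simp add: dderiv_const)
      qed
      have b1: "B (\<lambda>n z. of_real (((1/2) ^ n) ^ m) * (g ((1/2) ^ n *\<^sub>R p z) * dderiv v \<psi> z))"
        by (rule BI[OF g schwartz_dderiv[OF psi]])
      have b2: "B (\<lambda>n z. of_real (((1/2) ^ n) ^ Suc m) * (dderiv (p v) g ((1/2) ^ n *\<^sub>R p z) * \<psi> z))"
        by (rule BI[OF bdd_smooth_dderiv[OF g(1)] dg0 psi])
      have "dderiv v (f n) z = of_real (((1/2) ^ n) ^ m) * (g ((1/2) ^ n *\<^sub>R p z) * dderiv v \<psi> z) +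
        of_real (((1/2) ^ n) ^ Suc m) * (dderiv (p v) g ((1/2) ^ n *\<^sub>R p z) * \<psi> z)" for n z
        unfolding f dderiv_cmult[OF smooth_mult[OF sgn schwartz_smooth[OF psi]]] dderiv_mult[OF sgn schwartz_smooth[OF psi]] dg
        by (simp add: distrib_left mult_ac)
      then show ?thesis
        by (rule sumcl_bases[where B=B, OF b1 b2])
    qed
    show "(\<forall>n\<in>UNIV. \<forall>z. f n differentiable (at z)) \<and> fbd UNIV (\<lambda>n. (1/2) ^ n) f \<and> (\<forall>v. sumcl UNIV B (\<lambda>n. dderiv v (f n)))"
      using diff bd der by blast
  qed
qed

text \<open>The dilates of \<open>g\<close> tend to 0 in Schwartz space after multiplication by
  \<open>\<psi>\<close>, so the telescoping series converges once \<open>t\<close> has been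
  applied.\<close>

lemma (in split_space) dilation_telescope:
  assumes t: "tempered t" and g: "bdd_smooth g" "0 < r" "\<And>y. norm y < r \<Longrightarrow> g y = 0" and psi: "schwartz \<psi>"
  shows "(\<lambda>n. t (\<lambda>z. (g ((1/2) ^ n *\<^sub>R p z) - g ((1/2) *\<^sub>R (1/2) ^ n *\<^sub>R p z)) * \<psi> z)) sums t (\<lambda>z. g (p z) * \<psi> z)"
proof -
  define a where "a n = t (\<lambda>z. g ((1/2) ^ n *\<^sub>R p z) * \<psi> z)" for n
  note fam = dilation_family[OF g psi]
  obtain C where "\<And>n. norm (a n) \<le> C * (1/2) ^ n"
    using tempered_family[OF t fam] unfolding a_def by auto
  then have "a \<longlonglongrightarrow> 0"
    by (intro Lim_null_comparison[of a "\<lambda>n. C * (1/2) ^ n"] always_eventually allI tendsto_mult_right_zero LIMSEQ_power_zero) auto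
  then have "(\<lambda>n. a n - a (Suc n)) sums (a 0 - 0)" by (rule telescope_sums')
  moreover have "a n - a (Suc n) = t (\<lambda>z. (g ((1/2) ^ n *\<^sub>R p z) - g ((1/2) *\<^sub>R (1/2) ^ n *\<^sub>R p z)) * \<psi> z)" for n
  proof -
    have "a n - a (Suc n) = t (\<lambda>z. g ((1/2) ^ n *\<^sub>R p z) * \<psi> z - g ((1/2) ^ Suc n *\<^sub>R p z) * \<psi> z)"
      unfolding a_def by (rule tempered_diff[OF t sfam_schwartz[OF fam UNIV_I] sfam_schwartz[OF fam UNIV_I], symmetric])
    then show ?thesis by (simp add: left_diff_distrib)
  qed
  ultimately show ?thesis by (simp add: a_def)
qed

section \<open>Converting between \<open>Odist_gen\<close> and sums over direction lists\<close>

context split_n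
begin

text \<open>Contributions whose lists have the same counts are merged into one coefficient, and the
  sign in \<open>ua\<close> accounts for the convention of distributional derivatives. Strictly
  positive exponents make \<open>pw\<close> agree with \<open>powr\<close>.\<close>

lemma Odist_genI:
  assumes B: "finite B" and U: "open U" "0 \<in> U" and X: "\<And>b. b \<in> B \<Longrightarrow> continuous_on U (X b)"
    and bound: "\<And>b. b \<in> B \<Longrightarrow> \<exists>C. \<forall>z\<in>U. norm (X b z) \<le> C * norm (p z) powr (\<delta> + real (length (l b)))"
    and pos: "\<And>b. b \<in> B \<Longrightarrow> 0 < \<delta> + real (length (l b))"
    and rep: "\<And>\<psi>. test_fun U \<psi> \<Longrightarrow> u \<psi> = (\<Sum>b\<in>B. LINT z|lborel. X b z * dderivs (map e (l b)) \<psi> z)"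
  shows "Odist_gen (\<lambda>i. e i) p u \<delta>"
proof -
  define G where "G = (\<lambda>b. count_list (l b)) ` B"
  define Bs where "Bs \<gamma> = {b \<in> B. count_list (l b) = \<gamma>}" for \<gamma>
  define ua where "ua \<gamma> z = (-1) ^ mi_abs \<gamma> * (\<Sum>b\<in>Bs \<gamma>. X b z)" for \<gamma> z
  have len: "length (l b) = mi_abs \<gamma>" if "b \<in> Bs \<gamma>" for b \<gamma>
    using that length_eq_mi_abs[of "l b"] unfolding Bs_def by simp
  have BsB: "b \<in> B" if "b \<in> Bs \<gamma>" for b \<gamma> using that unfolding Bs_def by simp
  have empty: "Bs \<gamma> = {}" if "\<delta> + real (mi_abs \<gamma>) \<le> 0" for \<gamma>
  proof (rule ccontr)
    assume "Bs \<gamma> \<noteq> {}"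
    then obtain b where b: "b \<in> Bs \<gamma>" by blast
    from pos[OF BsB[OF b]] show False using that len[OF b] by simp
  qed
  let ?S = "{\<gamma>. \<exists>z\<in>U. ua \<gamma> z \<noteq> 0}"
  have SG: "?S \<subseteq> G"
  proof
    fix \<gamma> assume "\<gamma> \<in> ?S"
    then have "Bs \<gamma> \<noteq> {}" unfolding ua_def by auto
    then show "\<gamma> \<in> G" unfolding Bs_def G_def by auto
  qed
  have G: "finite G" unfolding G_def using B by simp
  have cua: "continuous_on U (ua \<gamma>)" for \<gamma>
    unfolding ua_def[abs_def] by (intro continuous_on_mult continuous_on_const continuous_on_sum X BsB)
  show ?thesis unfolding Odist_gen_def
  proof (rule exI[of _ U], rule exI[of _ ua], intro conjI allI impI ballI)
    show "open U" "0 \<in> U" by (fact U)+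
    show "finite ?S" by (rule finite_subset[OF SG G])
    show "continuous_on U (ua \<gamma>)" for \<gamma> by (rule cua)
    show "ua \<gamma> z = 0" if "\<delta> + real (mi_abs \<gamma>) < 0" for \<gamma> z using empty[of \<gamma>] that by (simp add: ua_def)
    show "\<exists>C. \<forall>z\<in>U. norm (ua \<gamma> z) \<le> C * pw (norm (p z)) (\<delta> + real (mi_abs \<gamma>))" for \<gamma>
    proof (cases "\<delta> + real (mi_abs \<gamma>) \<le> 0")
      case True
      then show ?thesis using empty[of \<gamma>] by (intro exI[of _ 0]) (simp add: ua_def)
    next
      case False
      have "\<forall>b\<in>Bs \<gamma>. \<exists>C. \<forall>z\<in>U. norm (X b z) \<le> C * norm (p z) powr (\<delta> + real (mi_abs \<gamma>))"
        using bound[OF BsB] len by metis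
      then obtain C where C: "\<And>b z. b \<in> Bs \<gamma> \<Longrightarrow> z \<in> U \<Longrightarrow> norm (X b z) \<le> C b * norm (p z) powr (\<delta> + real (mi_abs \<gamma>))"
        by metis
      have "norm (ua \<gamma> z) \<le> (\<Sum>b\<in>Bs \<gamma>. C b) * pw (norm (p z)) (\<delta> + real (mi_abs \<gamma>))" if z: "z \<in> U" for z
        using False sum_norm_le[of "Bs \<gamma>" "\<lambda>b. X b z" "\<lambda>b. C b * norm (p z) powr (\<delta> + real (mi_abs \<gamma>))"] C[OF _ z]
        by (simp add: ua_def norm_mult norm_power pw_def sum_distrib_right)
      then show ?thesis by blast
    qed
    fix \<psi> assume psi: "test_fun U \<psi>"
    have int: "integrable lborel (\<lambda>z. X b z * dderivs vs \<psi> z)" if "b \<in> B" for b vs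
      by (rule compact_support_integrable[OF U(1) X[OF that] test_fun_dderivs[OF psi]])
    have sm: "smooth \<psi>" using psi by (simp add: test_fun_def)
    have "u \<psi> = (\<Sum>\<gamma>\<in>G. \<Sum>b\<in>Bs \<gamma>. LINT z|lborel. X b z * dderivs (map e (l b)) \<psi> z)"
      unfolding rep[OF psi] G_def Bs_def by (rule sum.image_gen[OF B])
    also have "\<dots> = (\<Sum>\<gamma>\<in>G. (-1) ^ mi_abs \<gamma> * (LINT z|lborel. ua \<gamma> z * dderivs (map e (mi_list \<gamma>)) \<psi> z))"
    proof (rule sum.cong[OF refl])
      fix \<gamma>
      let ?D = "dderivs (map e (mi_list \<gamma>)) \<psi>"
      have "(\<Sum>b\<in>Bs \<gamma>. LINT z|lborel. X b z * dderivs (map e (l b)) \<psi> z) = (\<Sum>b\<in>Bs \<gamma>. LINT z|lborel. X b z * ?D z)"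
        by (rule sum.cong[OF refl]) (use dderivs_mi_list[OF sm, of e] in \<open>auto simp: Bs_def\<close>)
      also have "\<dots> = (LINT z|lborel. (\<Sum>b\<in>Bs \<gamma>. X b z * ?D z))"
        by (rule Bochner_Integration.integral_sum[symmetric]) (rule int[OF BsB])
      also have "\<dots> = (LINT z|lborel. (-1) ^ mi_abs \<gamma> * (ua \<gamma> z * ?D z))"
        by (simp add: ua_def sum_distrib_right power_mult_distrib[symmetric] mult.assoc[symmetric])
      also have "\<dots> = (-1) ^ mi_abs \<gamma> * (LINT z|lborel. ua \<gamma> z * ?D z)" by simp
      finally show "(\<Sum>b\<in>Bs \<gamma>. LINT z|lborel. X b z * dderivs (map e (l b)) \<psi> z) = (-1) ^ mi_abs \<gamma> * (LINT z|lborel. ua \<gamma> z * ?D z)" .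
    qed
    also have "\<dots> = (\<Sum>\<gamma>\<in>?S. (-1) ^ mi_abs \<gamma> * (LINT z|lborel. ua \<gamma> z * dderivs (map e (mi_list \<gamma>)) \<psi> z))"
    proof (rule sum.mono_neutral_right[OF G SG], rule ballI)
      fix \<gamma> assume "\<gamma> \<in> G - ?S"
      then have u0: "ua \<gamma> z = 0" if "z \<in> U" for z using that by blast
      \<comment> \<open>A coefficient that vanishes on \<open>U\<close> may be nonzero elsewhere, so
        the support of the test function in \<open>U\<close> is needed to discard its
        integral.\<close>
      obtain K where K: "compact K" "K \<subseteq> U" "\<And>z. z \<notin> K \<Longrightarrow> dderivs (map e (mi_list \<gamma>)) \<psi> z = 0"
          "smooth (dderivs (map e (mi_list \<gamma>)) \<psi>)"
        using test_fun_dderivs[OF psi, of "map e (mi_list \<gamma>)"] by (rule test_funE) (rule that)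
      have eq: "ua \<gamma> z * dderivs (map e (mi_list \<gamma>)) \<psi> z = 0" for z
        using u0 K(2,3) by (cases "z \<in> U") auto
      show "(-1) ^ mi_abs \<gamma> * (LINT z|lborel. ua \<gamma> z * dderivs (map e (mi_list \<gamma>)) \<psi> z) = 0" unfolding eq by simp
    qed
    finally show "u \<psi> = (\<Sum>\<gamma>\<in>?S. (-1) ^ mi_abs \<gamma> * (LINT z|lborel. ua \<gamma> z * dderivs (map e (mi_list \<gamma>)) \<psi> z))" .
  qed
qed

text \<open>As \<open>\<delta>\<close> plus a natural number is never 0, the exceptional case of
  \<open>pw\<close> does not arise, and every coefficient that is nonzero somewhere on
  \<open>U\<close> has a strictly positive exponent.\<close>

lemma Odist_genE:
  assumes u: "Odist_gen (\<lambda>i. e i) p u \<delta>" and \<delta>: "\<And>k::nat. \<delta> + real k \<noteq> 0"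
  obtains U I X where "open U" "0 \<in> U" "finite I" "\<And>\<alpha>. \<alpha> \<in> I \<Longrightarrow> continuous_on U (X \<alpha>)"
    "\<And>\<alpha>. \<alpha> \<in> I \<Longrightarrow> \<exists>C. \<forall>z\<in>U. norm (X \<alpha> z) \<le> C * norm (p z) powr (\<delta> + real (length (mi_list \<alpha>)))"
    "\<And>\<alpha>. \<alpha> \<in> I \<Longrightarrow> 0 < \<delta> + real (length (mi_list \<alpha>))"
    "\<And>\<psi>. test_fun U \<psi> \<Longrightarrow> u \<psi> = (\<Sum>\<alpha>\<in>I. (-1) ^ length (mi_list \<alpha>) * (LINT z|lborel. X \<alpha> z * dderivs (map e (mi_list \<alpha>)) \<psi> z))"
proof -
  obtain U ua where U: "open U" "0 \<in> U" and fin: "finite {\<alpha>. \<exists>z\<in>U. ua \<alpha> z \<noteq> 0}"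
    and c: "\<forall>\<alpha>. continuous_on U (ua \<alpha>)"
    and z: "\<forall>\<alpha>. \<delta> + real (mi_abs \<alpha>) < 0 \<longrightarrow> (\<forall>z\<in>U. ua \<alpha> z = 0)"
    and b: "\<forall>\<alpha>. \<exists>C. \<forall>z\<in>U. norm (ua \<alpha> z) \<le> C * pw (norm (p z)) (\<delta> + real (mi_abs \<alpha>))"
    and r: "\<forall>f. test_fun U f \<longrightarrow> u f = (\<Sum>\<alpha>\<in>{\<alpha>. \<exists>z\<in>U. ua \<alpha> z \<noteq> 0}.
        (-1) ^ mi_abs \<alpha> * (LINT z|lborel. ua \<alpha> z * dderivs (map e (mi_list \<alpha>)) f z))"
    using u unfolding Odist_gen_def by (elim exE conjE) (rule that)
  show thesis
  proof (rule that[OF U fin])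
    fix \<alpha>
    show "\<exists>C. \<forall>z\<in>U. norm (ua \<alpha> z) \<le> C * norm (p z) powr (\<delta> + real (length (mi_list \<alpha>)))"
      using b[rule_format, of \<alpha>] \<delta>[of "mi_abs \<alpha>"] by (simp add: pw_def length_mi_list)
    show "0 < \<delta> + real (length (mi_list \<alpha>))" if "\<alpha> \<in> {\<alpha>. \<exists>z\<in>U. ua \<alpha> z \<noteq> 0}"
      using that z[rule_format, of \<alpha>] \<delta>[of "mi_abs \<alpha>"] by (force simp: length_mi_list)
  qed (use c r in \<open>simp_all add: length_mi_list\<close>)
qed

text \<open>All derivatives are moved onto the polynomial, each lowering its degree bound.
  \<open>P'\<close> is found before the test function is chosen, so it is a density valid for all of
  them.\<close>

lemma polc_ibp:
  "polc D P \<Longrightarrow> \<exists>P'. polc (D - int (length l)) P' \<and> (\<forall>U \<psi>. test_fun U \<psi> \<longrightarrow>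
     (LINT z|lborel. P z * dderivs (map e l) \<psi> z) = (LINT z|lborel. P' z * \<psi> z))"
proof (induction l arbitrary: D P)
  case Nil
  then show ?case by (intro exI[of _ P]) simp
next
  case (Cons i l)
  obtain P1 where P1: "polc (D - 1) P1" "hdd (e i) P P1" using polc_hdd[OF Cons.prems] by blast
  obtain P' where P': "polc (D - 1 - int (length l)) P'"
    "\<And>U \<psi>. test_fun U \<psi> \<Longrightarrow> (LINT z|lborel. P1 z * dderivs (map e l) \<psi> z) = (LINT z|lborel. P' z * \<psi> z)"
    using Cons.IH[OF P1(1)] by blast
  have "(LINT z|lborel. P z * dderivs (map e (i # l)) \<psi> z) = (LINT z|lborel. (-1) * P' z * \<psi> z)" if "test_fun U \<psi>" for U \<psi>
    using hdd_ibp_test[OF P1(2) polc_continuous[OF Cons.prems] polc_continuous[OF P1(1)] test_fun_dderivs[OF that, of "map e l"]]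
      P'(2)[OF that] by simp
  moreover have "polc (D - int (length (i # l))) (\<lambda>z. (-1) * P' z)"
    using polc_cmult[OF P'(1), of "-1"] by (simp add: algebra_simps)
  ultimately show ?case by blast
qed

end

context split_n
begin

lemma zero_in_cyl: "0 < r \<Longrightarrow> 0 \<in> cyl r"
  using linear_0[OF lin_p] linear_0[OF lin_J] by (simp add: cyl_def proj_def)

text \<open>The even exponent makes \<open>D y = \<Sum>i. (y $ i) ^ L\<close> vanish only at the origin, so it can be divided
  out of the dyadic pieces; under the Fourier transform it turns into derivatives of order \<open>L\<close>.\<close>
theorem splitting:
  fixes \<Theta> :: "real^'n \<Rightarrow> real" and t s :: "('a \<Rightarrow> complex) \<Rightarrow> complex" and f :: "'a \<Rightarrow> complex" and d :: int
  assumes eps: "0 < \<epsilon>" "\<epsilon> < 1" and uv: "uv_splitting \<Theta>" and t: "tempered t" and s: "tempered s" and f: "qschw f"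
    and ts: "\<And>\<phi>. schwartz \<phi> \<Longrightarrow> t \<phi> = s (\<lambda>z. f z * \<phi> z)"
    and O: "Odist_gen (\<lambda>i. e i) p (fourier_dist t) (real_of_int d - \<epsilon>)"
  shows "\<exists>c. (\<forall>\<gamma>. continuous_on UNIV (c \<gamma>)) \<and>
     Odist_gen (\<lambda>i. e i) p (\<lambda>\<phi>. fourier_dist (\<lambda>\<psi>. t (\<lambda>z. complex_of_real (\<Theta> (p z)) * \<psi> z)) \<phi>
       - (LINT z|lborel. (\<Sum>\<gamma>\<in>{\<gamma>. int (mi_abs \<gamma>) < d}. c \<gamma> (proj z) * complex_of_real (mi_mono \<gamma> (p z))) * \<phi> z))
       (real_of_int d - \<epsilon>)"
proof -
  \<comment> \<open>Even, and large enough that \<open>d + L \<ge> 2\<close>, whence all orders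
    \<open>d - \<epsilon> + L + length (ll k)\<close> are positive whatever the sign of
    \<open>d\<close>.\<close>
  define L where "L = 2 * (nat \<bar>d\<bar> + 1)"
  have L: "2 \<le> L" "2 \<le> d + int L" "even L" unfolding L_def by auto
  have nz: "real_of_int d - \<epsilon> + real k \<noteq> 0" for k :: nat
  proof
    assume "real_of_int d - \<epsilon> + real k = 0"
    then have "\<epsilon> = of_int (d + int k)" by simp
    with eps have "0 < d + int k" "d + int k < 1" by (metis of_int_0_less_iff) (metis \<open>\<epsilon> = _\<close> eps(2) of_int_less_1_iff)
    then show False by simp
  qed
  obtain U I X where U: "open U" "0 \<in> U" "finite I" "\<And>\<alpha>. \<alpha> \<in> I \<Longrightarrow> continuous_on U (X \<alpha>)"
    and X: "\<And>\<alpha>. \<alpha> \<in> I \<Longrightarrow> \<exists>C. \<forall>z\<in>U. norm (X \<alpha> z) \<le> C * norm (p z) powr (real_of_int d - \<epsilon> + real (length (mi_list \<alpha>)))"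
    "\<And>\<alpha>. \<alpha> \<in> I \<Longrightarrow> 0 < real_of_int d - \<epsilon> + real (length (mi_list \<alpha>))"
    "\<And>\<psi>. test_fun U \<psi> \<Longrightarrow> fourier_dist t \<psi> = (\<Sum>\<alpha>\<in>I. (-1) ^ length (mi_list \<alpha>) * (LINT z|lborel. X \<alpha> z * dderivs (map e (mi_list \<alpha>)) \<psi> z))"
    by (rule Odist_genE[OF O nz]) (rule that)

  obtain r0 l0 where r0: "0 < r0" "\<And>y. norm y < r0 \<Longrightarrow> \<Theta> y = 0"
    and l0: "0 < l0" "\<And>lam y. 1 < lam \<Longrightarrow> l0 < norm y \<Longrightarrow> \<Theta> (lam *\<^sub>R y) = \<Theta> y"
    using uv unfolding uv_splitting_def by blast
  define g where "g y = complex_of_real (\<Theta> y)" for y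
  have g: "bdd_smooth g" unfolding g_def[abs_def] by (intro bdd_smooth_of_real uv_splitting_bdd_smooth uv)
  have g0: "g y = 0" if "norm y < r0" for y using r0(2)[OF that] by (simp add: g_def)
  have sg: "smooth g" using g by (simp add: bdd_smooth_def)
  \<comment> \<open>It vanishes near the origin because \<open>\<Theta>\<close> does, and beyond
    radius \<open>2 * l0\<close> because \<open>\<Theta>\<close> takes equal values at
    \<open>y\<close> and \<open>y / 2\<close> there. Hence dividing by \<open>D\<close> gives a
    smooth function of compact support.\<close>
  define \<rho> where "\<rho> y = g y - g ((1/2) *\<^sub>R y)" for y
  define D where "D y = complex_of_real (\<Sum>i\<in>UNIV. (y $ i) ^ L)" for y :: "real^'n"
  define \<sigma> where "\<sigma> y = \<rho> y / D y" for y
  have s\<rho>: "smooth \<rho>" unfolding \<rho>_def[abs_def]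
    using smooth_diff[OF sg smooth_affine[OF bounded_linear_scaleR_right[of "1/2"] sg, of 0]] by simp
  have \<rho>0: "\<rho> y = 0" if "norm y < r0" for y
  proof -
    have "norm y < r0 * 2" using that r0(1) by linarith
    then show ?thesis using that g0[of y] g0[of "(1/2) *\<^sub>R y"] unfolding \<rho>_def by simp
  qed
  have \<rho>1: "\<rho> y = 0" if "y \<notin> cball 0 (2 * l0)" for y
    using l0(2)[of 2 "(1/2) *\<^sub>R y"] that by (simp add: \<rho>_def g_def)
  have Dnz: "D y \<noteq> 0" if "y \<noteq> 0" for y
  proof -
    obtain i where "y $ i \<noteq> 0" using \<open>y \<noteq> 0\<close> by (metis vec_eq_iff zero_index)
    then have "0 < (y $ i) ^ L" using L(3) by (simp add: zero_less_power_eq)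
    moreover have "(y $ i) ^ L \<le> (\<Sum>i\<in>UNIV. (y $ i) ^ L)"
      by (rule member_le_sum) (use L(3) in \<open>auto simp: zero_le_even_power\<close>)
    ultimately show ?thesis unfolding D_def of_real_eq_0_iff by linarith
  qed
  have sD: "smooth D" unfolding D_def[abs_def] of_real_sum of_real_power
    by (intro smooth_sum smooth_power smooth_blin[OF bounded_linear_of_real] smooth_linear bounded_linear_vec_nth)
  have sig: "schwartz \<sigma>"
  proof (rule schwartzI_compact)
    show "smooth \<sigma>" unfolding \<sigma>_def[abs_def] by (rule smooth_divide[OF sD Dnz r0(1) s\<rho> \<rho>0])
    show "\<sigma> y = 0" if "y \<notin> cball 0 (2 * l0)" for y unfolding \<sigma>_def \<rho>1[OF that] by simp
  qed simp
  have \<rho>\<sigma>: "\<rho> y = \<sigma> y * D y" for y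
    using \<rho>0[of 0] r0(1) Dnz[of y] by (cases "y = 0") (auto simp: \<sigma>_def)

  note loc = X(3)[unfolded fourier_dist_def]
  \<comment> \<open>\<open>None\<close> stands for the far part, which carries no outer derivatives,
    and \<open>Some \<alpha>\<close> for the part stemming from the coefficient with multi-index
    \<open>\<alpha>\<close>.\<close>
  define ll where "ll k = case_option [] mi_list k" for k :: "('n \<Rightarrow> nat) option"
  define K where "K = insert None (Some ` I)"
  have K: "finite K" using U(3) by (simp add: K_def)
  have "\<exists>r R P. 0 < r \<and> (\<forall>k\<in>K. continuous_on (cyl r) (R k) \<and>
       (\<exists>C. \<forall>z\<in>cyl r. norm (R k z) \<le> C * norm (p z) powr (real_of_int d - \<epsilon> + real L + real (length (ll k)))) \<and>
       polc (d + int L + int (length (ll k))) (P k)) \<and>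
     (\<forall>\<psi>. test_fun (cyl r) \<psi> \<longrightarrow>
        (\<lambda>j. of_real (((1/2) ^ j) ^ L) * t (\<lambda>z. \<sigma> (((1/2) ^ j) *\<^sub>R p z) * fourier \<psi> z)) sums
        (\<Sum>k\<in>K. (-1) ^ length (ll k) * (LINT z|lborel. (R k z + P k z) * dderivs (map e (ll k)) \<psi> z)))"
    unfolding ll_def K_def by (rule dyadic_core[OF t s f ts U X(1,2) loc eps L(1,2) sig])
  then obtain r R P where r: "0 < r" and RP: "\<forall>k\<in>K. continuous_on (cyl r) (R k) \<and>
       (\<exists>C. \<forall>z\<in>cyl r. norm (R k z) \<le> C * norm (p z) powr (real_of_int d - \<epsilon> + real L + real (length (ll k)))) \<and>
       polc (d + int L + int (length (ll k))) (P k)"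
    and S: "\<forall>\<psi>. test_fun (cyl r) \<psi> \<longrightarrow>
        (\<lambda>j. of_real (((1/2) ^ j) ^ L) * t (\<lambda>z. \<sigma> (((1/2) ^ j) *\<^sub>R p z) * fourier \<psi> z)) sums
        (\<Sum>k\<in>K. (-1) ^ length (ll k) * (LINT z|lborel. (R k z + P k z) * dderivs (map e (ll k)) \<psi> z))"
    by (elim exE conjE) (rule that)

  define T where "T \<phi> = t (\<lambda>z. g (p z) * fourier \<phi> z)" for \<phi>
  \<comment> \<open>The outer derivatives followed by the \<open>L\<close> derivatives in one
    direction that replace the factor \<open>(y $ i) ^ L\<close>; the constant
    \<open>\<i> ^ L\<close> in \<open>a\<close> comes from \<open>fourier_power_eq\<close>.\<close>
  define lb where "lb b = ll (snd b) @ replicate L (fst b)" for b :: "'n \<times> ('n \<Rightarrow> nat) option"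
  define a where "a b = \<i> ^ L * (-1) ^ length (ll (snd b))" for b :: "'n \<times> ('n \<Rightarrow> nat) option"
  define B where "B = (UNIV :: 'n set) \<times> K"
  have B: "finite B" using K by (simp add: B_def)
  have T: "T \<phi> = (\<Sum>b\<in>B. a b * (LINT z|lborel. (R (snd b) z + P (snd b) z) * dderivs (map e (lb b)) \<phi> z))"
    if phi: "test_fun (cyl r) \<phi>" for \<phi>
  proof -
    note sp = test_fun_schwartz[OF phi]
    define \<psi> where "\<psi> i = dderivs (replicate L (e i)) \<phi>" for i
    have sps: "schwartz (\<psi> i)" for i unfolding \<psi>_def by (rule schwartz_dderivs[OF sp])
    \<comment> \<open>The factor \<open>D (c *\<^sub>R p z)\<close> is \<open>c ^ L\<close> times
      the sum of the powers \<open>(p z $ i) ^ L\<close>, and multiplying a Fourier transform by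
      such a power differentiates the test function.\<close>
    have piece: "t (\<lambda>z. \<rho> (c *\<^sub>R p z) * fourier \<phi> z) =
        (\<Sum>i\<in>UNIV. \<i> ^ L * (of_real (c ^ L) * t (\<lambda>z. \<sigma> (c *\<^sub>R p z) * fourier (\<psi> i) z)))" if c: "0 < c" "c \<le> 1" for c
    proof -
      have sch: "schwartz (\<lambda>z. \<sigma> (c *\<^sub>R p z) * fourier (\<psi> i) z)" for i
        by (intro schwartz_mult schwartz_fourier sps slow_comp_linear[OF bl_p schwartz_slow[OF schwartz_scale[OF sig c]]])
      have "\<rho> (c *\<^sub>R p z) * fourier \<phi> z = (\<Sum>i\<in>UNIV. (\<i> ^ L * of_real (c ^ L)) * (\<sigma> (c *\<^sub>R p z) * fourier (\<psi> i) z))" for z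
      proof -
        have "\<i> ^ L * fourier (\<psi> i) z = of_real (p z $ i) ^ L * fourier \<phi> z" for i
        proof -
          have "z \<bullet> e i = p z $ i" unfolding inner_commute[of z] adj by (simp add: inner_axis')
          then show ?thesis using fourier_power_eq[OF sp, of z "e i" L] unfolding \<psi>_def by simp
        qed
        then have eq: "(\<i> ^ L * of_real (c ^ L)) * (\<sigma> (c *\<^sub>R p z) * fourier (\<psi> i) z) =
            \<sigma> (c *\<^sub>R p z) * of_real ((c * p z $ i) ^ L) * fourier \<phi> z" for i
          by (simp add: power_mult_distrib mult_ac)
        have "\<rho> (c *\<^sub>R p z) * fourier \<phi> z = (\<Sum>i\<in>UNIV. \<sigma> (c *\<^sub>R p z) * of_real ((c * p z $ i) ^ L) * fourier \<phi> z)"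
          unfolding \<rho>\<sigma> D_def by (simp add: sum_distrib_left sum_distrib_right)
        then show ?thesis unfolding eq .
      qed
      then have "t (\<lambda>z. \<rho> (c *\<^sub>R p z) * fourier \<phi> z) = t (\<lambda>z. \<Sum>i\<in>UNIV. (\<i> ^ L * of_real (c ^ L)) * (\<sigma> (c *\<^sub>R p z) * fourier (\<psi> i) z))"
        by simp
      also have "\<dots> = (\<Sum>i\<in>UNIV. t (\<lambda>z. (\<i> ^ L * of_real (c ^ L)) * (\<sigma> (c *\<^sub>R p z) * fourier (\<psi> i) z)))"
        by (rule tempered_sum[OF t]) (rule schwartz_cmult[OF sch])
      finally show ?thesis unfolding tempered_cmult[OF t sch] by (simp only: mult.assoc)
    qed
    have "(\<lambda>j. t (\<lambda>z. \<rho> ((1/2) ^ j *\<^sub>R p z) * fourier \<phi> z)) sums T \<phi>"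
      using dilation_telescope[OF t g r0(1) g0 schwartz_fourier[OF sp]] unfolding T_def \<rho>_def .
    moreover have "(\<lambda>j. t (\<lambda>z. \<rho> ((1/2) ^ j *\<^sub>R p z) * fourier \<phi> z)) sums
       (\<Sum>i\<in>UNIV. \<i> ^ L * (\<Sum>k\<in>K. (-1) ^ length (ll k) * (LINT z|lborel. (R k z + P k z) * dderivs (map e (ll k)) (\<psi> i) z)))"
    proof -
      have "(\<lambda>j. t (\<lambda>z. \<rho> ((1/2) ^ j *\<^sub>R p z) * fourier \<phi> z)) =
         (\<lambda>j. \<Sum>i\<in>UNIV. \<i> ^ L * (of_real (((1/2) ^ j) ^ L) * t (\<lambda>z. \<sigma> ((1/2) ^ j *\<^sub>R p z) * fourier (\<psi> i) z)))"
        by (rule ext, rule piece) (auto simp: power_le_one)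
      moreover have "test_fun (cyl r) (\<psi> i)" for i unfolding \<psi>_def by (rule test_fun_dderivs[OF phi])
      ultimately show ?thesis using S by (simp only:) (intro sums_sum sums_mult; blast)
    qed
    ultimately have "T \<phi> = (\<Sum>i\<in>UNIV. \<i> ^ L * (\<Sum>k\<in>K. (-1) ^ length (ll k) * (LINT z|lborel. (R k z + P k z) * dderivs (map e (ll k)) (\<psi> i) z)))"
      by (rule sums_unique2)
    also have "\<dots> = (\<Sum>i\<in>UNIV. \<Sum>k\<in>K. a (i, k) * (LINT z|lborel. (R k z + P k z) * dderivs (map e (lb (i, k))) \<phi> z))"
      by (simp add: sum_distrib_left a_def lb_def \<psi>_def dderivs_append mult.assoc)
    finally show ?thesis unfolding B_def sum.cartesian_product by (simp add: case_prod_beta)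
  qed

  \<comment> \<open>The degree bound \<open>d + L + length (ll k)\<close> meets exactly
    \<open>length (ll k) + L\<close> derivatives, which leaves \<open>d\<close>.\<close>
  have "\<forall>b\<in>B. \<exists>Q. polc d Q \<and> (\<forall>U \<psi>. test_fun U \<psi> \<longrightarrow> (LINT z|lborel. P (snd b) z * dderivs (map e (lb b)) \<psi> z) = (LINT z|lborel. Q z * \<psi> z))"
  proof
    fix b assume "b \<in> B"
    then have "snd b \<in> K" by (auto simp: B_def)
    from bspec[OF RP this] have "polc (d + int L + int (length (ll (snd b)))) (P (snd b))" by (elim conjE)
    from polc_ibp[OF this, of "lb b"] show "\<exists>Q. polc d Q \<and> (\<forall>U \<psi>. test_fun U \<psi> \<longrightarrow>
       (LINT z|lborel. P (snd b) z * dderivs (map e (lb b)) \<psi> z) = (LINT z|lborel. Q z * \<psi> z))"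
      by (simp add: lb_def)
  qed
  from bchoice[OF this] obtain Q where Q: "\<And>b. b \<in> B \<Longrightarrow> polc d (Q b)"
    "\<And>b U \<psi>. b \<in> B \<Longrightarrow> test_fun U \<psi> \<Longrightarrow> (LINT z|lborel. P (snd b) z * dderivs (map e (lb b)) \<psi> z) = (LINT z|lborel. Q b z * \<psi> z)"
    by blast
  have "polc d (\<lambda>z. \<Sum>b\<in>B. a b * Q b z)" by (intro polc_sum polc_cmult Q)
  from polc_normal_form[OF this] obtain c where c: "\<And>\<gamma>. continuous_on UNIV (c \<gamma>)"
    and cQ: "(\<lambda>z. \<Sum>b\<in>B. a b * Q b z) = (\<lambda>z. \<Sum>\<gamma>\<in>{\<gamma>. int (mi_abs \<gamma>) < d}. c \<gamma> (proj z) * complex_of_real (mi_mono \<gamma> (p z)))"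
    by blast
  have rep: "fourier_dist (\<lambda>\<psi>. t (\<lambda>z. complex_of_real (\<Theta> (p z)) * \<psi> z)) \<phi>
       - (LINT z|lborel. (\<Sum>\<gamma>\<in>{\<gamma>. int (mi_abs \<gamma>) < d}. c \<gamma> (proj z) * complex_of_real (mi_mono \<gamma> (p z))) * \<phi> z)
     = (\<Sum>b\<in>B. LINT z|lborel. (a b * R (snd b) z) * dderivs (map e (lb b)) \<phi> z)" if phi: "test_fun (cyl r) \<phi>" for \<phi>
  proof -
    have iR: "integrable lborel (\<lambda>z. R (snd b) z * dderivs (map e (lb b)) \<phi> z)" if "b \<in> B" for b
      by (rule compact_support_integrable[OF open_cyl _ test_fun_dderivs[OF phi]]) (use that RP in \<open>auto simp: B_def\<close>)
    have iP: "integrable lborel (\<lambda>z. P (snd b) z * dderivs (map e (lb b)) \<phi> z)" if "b \<in> B" for b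
    proof -
      have "snd b \<in> K" using that by (auto simp: B_def)
      from bspec[OF RP this] have "polc (d + int L + int (length (ll (snd b)))) (P (snd b))" by (elim conjE)
      from continuous_on_subset[OF polc_continuous[OF this]] show ?thesis
        by (rule compact_support_integrable[OF open_cyl _ test_fun_dderivs[OF phi]]) simp
    qed
    have iQ: "integrable lborel (\<lambda>z. Q b z * \<phi> z)" if "b \<in> B" for b
      by (rule compact_support_integrable[OF open_cyl continuous_on_subset[OF polc_continuous[OF Q(1)[OF that]]] phi]) simp
    have "T \<phi> = (\<Sum>b\<in>B. (LINT z|lborel. (a b * R (snd b) z) * dderivs (map e (lb b)) \<phi> z) + (LINT z|lborel. a b * Q b z * \<phi> z))"
      unfolding T[OF phi]
    proof (rule sum.cong[OF refl])
      fix b assume b: "b \<in> B"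
      have "(LINT z|lborel. (R (snd b) z + P (snd b) z) * dderivs (map e (lb b)) \<phi> z) =
          (LINT z|lborel. R (snd b) z * dderivs (map e (lb b)) \<phi> z) + (LINT z|lborel. Q b z * \<phi> z)"
        unfolding distrib_right Bochner_Integration.integral_add[OF iR[OF b] iP[OF b]] Q(2)[OF b phi] ..
      then show "a b * (LINT z|lborel. (R (snd b) z + P (snd b) z) * dderivs (map e (lb b)) \<phi> z) =
          (LINT z|lborel. (a b * R (snd b) z) * dderivs (map e (lb b)) \<phi> z) + (LINT z|lborel. a b * Q b z * \<phi> z)"
        by (simp add: distrib_left mult.assoc)
    qed
    also have "\<dots> = (\<Sum>b\<in>B. LINT z|lborel. (a b * R (snd b) z) * dderivs (map e (lb b)) \<phi> z) + (LINT z|lborel. (\<Sum>b\<in>B. a b * Q b z) * \<phi> z)"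
    proof -
      have "(LINT z|lborel. (\<Sum>b\<in>B. a b * Q b z * \<phi> z)) = (\<Sum>b\<in>B. LINT z|lborel. a b * Q b z * \<phi> z)"
        by (rule Bochner_Integration.integral_sum) (use iQ in \<open>simp add: mult.assoc\<close>)
      then show ?thesis by (simp add: sum.distrib sum_distrib_right)
    qed
    finally show ?thesis unfolding cQ[THEN fun_cong] fourier_dist_def T_def g_def by simp
  qed
  show ?thesis
  proof (intro exI[of _ c] conjI allI c)
    show "Odist_gen (\<lambda>i. e i) p (\<lambda>\<phi>. fourier_dist (\<lambda>\<psi>. t (\<lambda>z. complex_of_real (\<Theta> (p z)) * \<psi> z)) \<phi>
       - (LINT z|lborel. (\<Sum>\<gamma>\<in>{\<gamma>. int (mi_abs \<gamma>) < d}. c \<gamma> (proj z) * complex_of_real (mi_mono \<gamma> (p z))) * \<phi> z))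
       (real_of_int d - \<epsilon>)"
    proof (rule Odist_genI[OF B open_cyl zero_in_cyl[OF r] _ _ _ rep])
      fix b assume b: "b \<in> B"
      then have k: "snd b \<in> K" by (auto simp: B_def)
      have len: "real_of_int d - \<epsilon> + real L + real (length (ll (snd b))) = real_of_int d - \<epsilon> + real (length (lb b))"
        by (simp add: lb_def)
      have "continuous_on (cyl r) (R (snd b))" using RP k by blast
      then show "continuous_on (cyl r) (\<lambda>z. a b * R (snd b) z)" by (intro continuous_intros)
      have "2 \<le> real_of_int d + real L" using L(2) by linarith
      then show "0 < real_of_int d - \<epsilon> + real (length (lb b))" using eps by (simp add: lb_def)
      obtain C where C: "\<And>z. z \<in> cyl r \<Longrightarrow> norm (R (snd b) z) \<le> C * norm (p z) powr (real_of_int d - \<epsilon> + real (length (lb b)))"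
        using bspec[OF RP k] unfolding len by blast
      have "norm (a b * R (snd b) z) \<le> C * norm (p z) powr (real_of_int d - \<epsilon> + real (length (lb b)))" if "z \<in> cyl r" for z
        using C[OF that] by (simp add: a_def norm_mult norm_power)
      then show "\<exists>C. \<forall>z\<in>cyl r. norm (a b * R (snd b) z) \<le> C * norm (p z) powr (real_of_int d - \<epsilon> + real (length (lb b)))"
        by blast
    qed
  qed
qed

end

section \<open>The cases with and without \<open>x\<close>-variables\<close>

lemma split_n_fst: "split_n (fst :: (real^'n) \<times> 'b::euclidean_space \<Rightarrow> real^'n) (\<lambda>v. (v, 0))"
  by (intro split_n.intro split_space.intro linear_fst linearI) (auto simp: inner_prod_def)

lemma split_n_id: "split_n (id :: real^'n \<Rightarrow> real^'n) id"
  by (intro split_n.intro split_space.intro linear_id) auto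

theorem theorem3p8:
  fixes \<Theta> :: "real^'n \<Rightarrow> real" and d :: int and \<epsilon> :: real
  assumes "CARD('n) \<ge> 2" and "0 < \<epsilon>" and "\<epsilon> < 1" and "uv_splitting \<Theta>"
  shows
   "(\<forall>t :: ((real^'n) \<times> (real^'m) \<Rightarrow> complex) \<Rightarrow> complex.
      tempered t \<and>
      (\<exists>s f. tempered s \<and> schwartz (f :: real^'m \<Rightarrow> complex) \<and>
             (\<forall>\<phi>. schwartz \<phi> \<longrightarrow> t \<phi> = s (\<lambda>z. f (snd z) * \<phi> z))) \<and>
      Odist (fourier_dist t) (real_of_int d - \<epsilon>)
      \<longrightarrow> (\<exists>c :: ('n \<Rightarrow> nat) \<Rightarrow> real^'m \<Rightarrow> complex.
             (\<forall>\<gamma>. continuous_on UNIV (c \<gamma>)) \<and>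
             Odist (\<lambda>\<phi>. fourier_dist (\<lambda>\<psi>. t (\<lambda>z. complex_of_real (\<Theta> (fst z)) * \<psi> z)) \<phi>
                        - (LINT z|lborel. (\<Sum>\<gamma>\<in>{\<gamma>. int (mi_abs \<gamma>) < d}.
                               c \<gamma> (snd z) * complex_of_real (mi_mono \<gamma> (fst z))) * \<phi> z))
                   (real_of_int d - \<epsilon>)))
    \<and>
    (\<forall>t :: (real^'n \<Rightarrow> complex) \<Rightarrow> complex.
      tempered t \<and> Odist0 (fourier_dist t) (real_of_int d - \<epsilon>)
      \<longrightarrow> (\<exists>c :: ('n \<Rightarrow> nat) \<Rightarrow> complex.
             Odist0 (\<lambda>\<phi>. fourier_dist (\<lambda>\<psi>. t (\<lambda>y. complex_of_real (\<Theta> y) * \<psi> y)) \<phi>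
                        - (LINT y|lborel. (\<Sum>\<gamma>\<in>{\<gamma>. int (mi_abs \<gamma>) < d}.
                               c \<gamma> * complex_of_real (mi_mono \<gamma> y)) * \<phi> y))
                   (real_of_int d - \<epsilon>)))"
proof (intro conjI allI impI; (elim conjE exE)?)
  fix t s :: "((real^'n) \<times> (real^'m) \<Rightarrow> complex) \<Rightarrow> complex" and f :: "real^'m \<Rightarrow> complex"
  assume t: "tempered t" and s: "tempered s" and f: "schwartz f"
    and ts: "\<forall>\<phi>. schwartz \<phi> \<longrightarrow> t \<phi> = s (\<lambda>z. f (snd z) * \<phi> z)"
    and O: "Odist (fourier_dist t) (real_of_int d - \<epsilon>)"
  interpret split_n "fst :: (real^'n) \<times> (real^'m) \<Rightarrow> real^'n" "\<lambda>v. (v, 0)" by (rule split_n_fst)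
  have proj: "proj z = (0, snd z)" for z by (cases z) (simp add: proj_def)
  have sm: "smooth (\<lambda>z :: (real^'n) \<times> (real^'m). f (snd z))"
    using smooth_affine[OF bounded_linear_snd schwartz_smooth[OF f], of 0] by simp
  have dd: "dderivs vs (\<lambda>z :: (real^'n) \<times> (real^'m). f (snd z)) = (\<lambda>z. dderivs (map snd vs) f (snd z))" for vs
    using dderivs_affine[OF bounded_linear_snd schwartz_smooth[OF f], of vs 0] by simp
  have q: "qschw (\<lambda>z. f (snd z))" unfolding qschw_def dd proj norm_Pair
    using sm schwartz_bound[OF f] by simp metis
  obtain c where c: "\<And>\<gamma>. continuous_on UNIV (c \<gamma>)" and
    Oc: "Odist_gen (\<lambda>i. (axis i 1, 0)) fst (\<lambda>\<phi>. fourier_dist (\<lambda>\<psi>. t (\<lambda>z. complex_of_real (\<Theta> (fst z)) * \<psi> z)) \<phi>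
       - (LINT z|lborel. (\<Sum>\<gamma>\<in>{\<gamma>. int (mi_abs \<gamma>) < d}. c \<gamma> (proj z) * complex_of_real (mi_mono \<gamma> (fst z))) * \<phi> z))
       (real_of_int d - \<epsilon>)"
    using splitting[OF assms(2-4) t s q _ O[unfolded Odist_def]] ts by blast
  \<comment> \<open>The coefficients of the locale live on the full space but are evaluated only at
    \<open>proj z = (0, snd z)\<close>; restricting them gives functions of
    \<open>x\<close>.\<close>
  show "\<exists>c :: ('n \<Rightarrow> nat) \<Rightarrow> real^'m \<Rightarrow> complex. (\<forall>\<gamma>. continuous_on UNIV (c \<gamma>)) \<and>
             Odist (\<lambda>\<phi>. fourier_dist (\<lambda>\<psi>. t (\<lambda>z. complex_of_real (\<Theta> (fst z)) * \<psi> z)) \<phi>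
                        - (LINT z|lborel. (\<Sum>\<gamma>\<in>{\<gamma>. int (mi_abs \<gamma>) < d}.
                               c \<gamma> (snd z) * complex_of_real (mi_mono \<gamma> (fst z))) * \<phi> z))
                   (real_of_int d - \<epsilon>)"
  proof (intro exI[of _ "\<lambda>\<gamma> x. c \<gamma> (0, x)"] conjI allI)
    show "continuous_on UNIV (\<lambda>x. c \<gamma> (0, x))" for \<gamma>
      by (rule continuous_on_compose2[OF c]) (auto intro!: continuous_intros)
  qed (use Oc in \<open>simp add: Odist_def proj\<close>)
next
  fix t :: "(real^'n \<Rightarrow> complex) \<Rightarrow> complex"
  assume t: "tempered t" and O: "Odist0 (fourier_dist t) (real_of_int d - \<epsilon>)"
  interpret split_n "id :: real^'n \<Rightarrow> real^'n" id by (rule split_n_id)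
  have proj: "proj z = 0" for z by (simp add: proj_def)
  \<comment> \<open>Without \<open>x\<close>-variables \<open>t\<close> itself serves as
    \<open>s\<close>, with the constant 1 as \<open>f\<close>: decay is measured in
    \<open>proj z = 0\<close>, so boundedness of derivatives is enough. The coefficients become the
    constants \<open>c \<gamma> 0\<close>.\<close>
  have "bounded (range (dderivs vs (\<lambda>z::real^'n. 1 :: complex)))" for vs
    by (cases vs rule: rev_cases) (auto simp: bounded_iff dderivs_append dderiv_const dderivs_zero)
  then have q: "qschw (\<lambda>z. 1)" unfolding qschw_def proj bounded_iff by (auto simp: smooth_const)
  obtain c where "Odist_gen (\<lambda>i. id (axis i 1)) id (\<lambda>\<phi>. fourier_dist (\<lambda>\<psi>. t (\<lambda>z. complex_of_real (\<Theta> (id z)) * \<psi> z)) \<phi>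
       - (LINT z|lborel. (\<Sum>\<gamma>\<in>{\<gamma>. int (mi_abs \<gamma>) < d}. c \<gamma> (proj z) * complex_of_real (mi_mono \<gamma> (id z))) * \<phi> z))
       (real_of_int d - \<epsilon>)"
    using splitting[OF assms(2-4) t t q] O unfolding Odist0_def by auto
  then show "\<exists>c :: ('n \<Rightarrow> nat) \<Rightarrow> complex.
             Odist0 (\<lambda>\<phi>. fourier_dist (\<lambda>\<psi>. t (\<lambda>y. complex_of_real (\<Theta> y) * \<psi> y)) \<phi>
                        - (LINT y|lborel. (\<Sum>\<gamma>\<in>{\<gamma>. int (mi_abs \<gamma>) < d}.
                               c \<gamma> * complex_of_real (mi_mono \<gamma> y)) * \<phi> y))
                   (real_of_int d - \<epsilon>)"
    by (intro exI[of _ "\<lambda>\<gamma>. c \<gamma> 0"]) (simp add: Odist0_def proj)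
qed

end
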